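(* Let $s_1>-\frac98$ and $s_2\ge 0$. Then the Cauchy problem $$u_t+\partial_x^5u+\partial_x^{-1}\partial_y^2u+\tfrac12\partial_x(u^2)=0,\qquad u(x,y,0)=u_0(x,y),\qquad (x,y)\in\mathbb R^2,$$ is locally well-posed in $H^{s_1,s_2}(\mathbb R^2)$ for initial data $u_0\in H^{s_1,s_2}(\mathbb R^2)$ satisfying $|\xi|^{-1}\mathscr F_{xy}u_0(\xi,\mu)\in\mathscr S'(\mathbb R^2)$. Precisely: for $0<\epsilon\ll1$ there is $T=T(\|u_0\|_{H^{s_1,s_2}})>0$ and a solution $u\in X^{s_1,s_2}_{\frac12+\epsilon}([0,T])$ of the Duhamel (integral) formulation of the problem on $[0,T]$; this solution is unique in that space, and it depends continuously on the initial data.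
   Context: Notation: $\langle a\rangle=1+|a|$. $\mathscr F_{xy}$ denotes the Fourier transform in $(x,y)$ with dual variables $(\xi,\mu)$, and $\mathscr F$ the space-time Fourier transform with dual variables $(\xi,\mu,\tau)$. The anisotropic Sobolev space $H^{s_1,s_2}(\mathbb R^2)$ consists of $f\in\mathscr S'(\mathbb R^2)$ with $\|f\|_{H^{s_1,s_2}}=\|\langle\xi\rangle^{s_1}\langle\mu\rangle^{s_2}\mathscr F_{xy}f(\xi,\mu)\|_{L^2_{\xi\mu}}<\infty$. The phase is $\phi(\xi,\mu)=\xi^5+\mu^2/\xi$, and $\sigma=\tau+\phi(\xi,\mu)$. The Bourgain space $X^{s_1,s_2}_b$ is the set of $u\in\mathscr S'(\mathbb R^3)$ with $\|u\|_{X^{s_1,s_2}_b}=\|\langle\xi\rangle^{s_1}\langle\mu\rangle^{s_2}\langle\sigma\rangle^{b}\mathscr Fu(\xi,\mu,\tau)\|_{L^2_{\tau\xi\mu}}<\infty$, and $X^{s_1,s_2}_b([0,T])$ is its restriction to the time interval $[0,T]$ with norm $\inf\{\|g\|_{X^{s_1,s_2}_b}: g=u \text{ on } [0,T]\}$. The linear group $W(t)$ is the Fourier multiplier solving the linear part of the equation, and the Duhamel formulation is $u(t)=W(t)u_0-\frac12\int_0^tW(t-t')\partial_x(u^2)(t')\,dt'$. *)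

theory Defs
  imports "HOL-Analysis.Analysis"
begin

text \<open>Everything is expressed on the Fourier side. A tempered distribution u0 on R^2 with
  Fourier transform in a weighted L^2 space is represented by its Fourier transform
  u0hat :: (real * real) => complex, a function of (xi, mu). A space-time distribution g
  is represented by its space-time Fourier transform G :: ((real * real) * real) => complex,
  a function of ((xi, mu), tau). Fourier convention: F f (k) = integral of exp(-i x.k) f(x) dx.\<close>

definition jb :: "real \<Rightarrow> real" where
  "jb a = 1 + \<bar>a\<bar>"

definition phase :: "real \<times> real \<Rightarrow> real" where
  "phase p = fst p ^ 5 + snd p ^ 2 / fst p"

definition hweight :: "real \<Rightarrow> real \<Rightarrow> real \<times> real \<Rightarrow> real" where
  "hweight s1 s2 p = jb (fst p) powr s1 * jb (snd p) powr s2"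

definition inH :: "real \<Rightarrow> real \<Rightarrow> (real \<times> real \<Rightarrow> complex) \<Rightarrow> bool" where
  "inH s1 s2 f \<longleftrightarrow> f \<in> borel_measurable lborel \<and>
     integrable lborel (\<lambda>p. (hweight s1 s2 p)\<^sup>2 * (cmod (f p))\<^sup>2)"

definition hnorm :: "real \<Rightarrow> real \<Rightarrow> (real \<times> real \<Rightarrow> complex) \<Rightarrow> real" where
  "hnorm s1 s2 f = sqrt (integral\<^sup>L lborel (\<lambda>p. (hweight s1 s2 p)\<^sup>2 * (cmod (f p))\<^sup>2))"

text \<open>A function g on R^2 defines a tempered distribution (convention: measurable,
  and integrable against some inverse polynomial weight).\<close>
definition tempered_fun :: "(real \<times> real \<Rightarrow> complex) \<Rightarrow> bool" where
  "tempered_fun g \<longleftrightarrow> g \<in> borel_measurable lborel \<and>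
     (\<exists>N::nat. integrable lborel (\<lambda>p. cmod (g p) / (1 + norm p) ^ N))"

definition admissible :: "real \<Rightarrow> real \<Rightarrow> (real \<times> real \<Rightarrow> complex) \<Rightarrow> bool" where
  "admissible s1 s2 u0 \<longleftrightarrow> inH s1 s2 u0 \<and>
     tempered_fun (\<lambda>p. u0 p / complex_of_real \<bar>fst p\<bar>)"

definition xweight :: "real \<Rightarrow> real \<Rightarrow> real \<Rightarrow> (real \<times> real) \<times> real \<Rightarrow> real" where
  "xweight s1 s2 b z = hweight s1 s2 (fst z) * jb (snd z + phase (fst z)) powr b"

definition inX :: "real \<Rightarrow> real \<Rightarrow> real \<Rightarrow> ((real \<times> real) \<times> real \<Rightarrow> complex) \<Rightarrow> bool" where
  "inX s1 s2 b G \<longleftrightarrow> G \<in> borel_measurable lborel \<and>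
     integrable lborel (\<lambda>z. (xweight s1 s2 b z)\<^sup>2 * (cmod (G z))\<^sup>2)"

definition xnorm :: "real \<Rightarrow> real \<Rightarrow> real \<Rightarrow> ((real \<times> real) \<times> real \<Rightarrow> complex) \<Rightarrow> real" where
  "xnorm s1 s2 b G = sqrt (integral\<^sup>L lborel (\<lambda>z. (xweight s1 s2 b z)\<^sup>2 * (cmod (G z))\<^sup>2))"

text \<open>Partial Fourier transform in (x,y) at time t of the function whose space-time
  Fourier transform is G (inverse Fourier transform in tau).\<close>
definition time_repr :: "((real \<times> real) \<times> real \<Rightarrow> complex) \<Rightarrow> real \<times> real \<Rightarrow> real \<Rightarrow> complex" where
  "time_repr G p t = integral\<^sup>L lborel (\<lambda>\<tau>. exp (\<i> * complex_of_real (t * \<tau>)) * G (p, \<tau>))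
                      / complex_of_real (2 * pi)"

definition same_on :: "real \<Rightarrow> ((real \<times> real) \<times> real \<Rightarrow> complex) \<Rightarrow> ((real \<times> real) \<times> real \<Rightarrow> complex) \<Rightarrow> bool" where
  "same_on T G H \<longleftrightarrow> (\<forall>t\<in>{0..T}. AE p in lborel. time_repr G p t = time_repr H p t)"

definition restr_norm :: "real \<Rightarrow> real \<Rightarrow> real \<Rightarrow> real \<Rightarrow> ((real \<times> real) \<times> real \<Rightarrow> complex) \<Rightarrow> real" where
  "restr_norm s1 s2 b T G = Inf {xnorm s1 s2 b K | K. inX s1 s2 b K \<and> same_on T K G}"

text \<open>Space-time Fourier transform of d_x(g^2): i xi (2 pi)^{-3} (G * G)\<close>
definition nonlin :: "((real \<times> real) \<times> real \<Rightarrow> complex) \<Rightarrow> (real \<times> real) \<times> real \<Rightarrow> complex" where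
  "nonlin G z = \<i> * complex_of_real (fst (fst z)) *
      integral\<^sup>L lborel (\<lambda>w. G w * G (z - w)) / complex_of_real ((2 * pi) ^ 3)"

text \<open>integral_0^t exp(i t' sigma) dt'\<close>
definition tker :: "real \<Rightarrow> real \<Rightarrow> complex" where
  "tker t \<sigma> = (if \<sigma> = 0 then complex_of_real t
               else (exp (\<i> * complex_of_real (t * \<sigma>)) - 1) / (\<i> * complex_of_real \<sigma>))"

text \<open>G (space-time Fourier transform of an element g of X_b) gives a solution on [0,T] of
  u(t) = W(t)u0 - 1/2 int_0^t W(t-t') d_x(u^2)(t') dt', written on the Fourier side:
  F_xy u(t) = e^{-it phi} (F u0 - 1/2 (2 pi)^{-1} int N(.,tau) (e^{it sigma}-1)/(i sigma) dtau).
  All integrals are required to converge absolutely.\<close>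
definition duhamel_sol :: "real \<Rightarrow> real \<Rightarrow> real \<Rightarrow> real \<Rightarrow> (real \<times> real \<Rightarrow> complex)
    \<Rightarrow> ((real \<times> real) \<times> real \<Rightarrow> complex) \<Rightarrow> bool" where
  "duhamel_sol s1 s2 b T u0 G \<longleftrightarrow> inX s1 s2 b G \<and>
     (AE z in lborel. integrable lborel (\<lambda>w. G w * G (z - w))) \<and>
     (\<forall>t\<in>{0..T}. AE p in lborel.
        integrable lborel (\<lambda>\<tau>. nonlin G (p, \<tau>) * tker t (\<tau> + phase p)) \<and>
        time_repr G p t = exp (- \<i> * complex_of_real (t * phase p)) *
          (u0 p - (1/2) * integral\<^sup>L lborel (\<lambda>\<tau>. nonlin G (p, \<tau>) * tker t (\<tau> + phase p))
                          / complex_of_real (2 * pi)))"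

end

theory Submission
  imports Defs "HOL-Probability.Probability"
begin

text \<open>The bound for the Duhamel term with a product of two elements of \<open>X\<^sub>b\<close> is reduced by duality to
  trilinear forms in nonnegative functions of space-time frequency. If one modulation
  \<open>\<sigma>\<close> dominates the resonance function, the form follows from bilinear Strichartz-type bounds, obtained
  by Cauchy--Schwarz; otherwise the three characteristic surfaces are transversal
  and a nonlinear Loomis--Whitney inequality applies. The cut-off in time uses an explicit kernel
  whose inverse Fourier transform equals \<open>1\<close> on \<open>[0,T]\<close>, which gains a power of \<open>T\<close> and makes the
  Duhamel map a contraction. Uniqueness holds for arbitrary extensions because the Duhamel term on \<open>[0,t]\<close> depends only on the
  restriction of the factors to \<open>[0,t]\<close>; iterating the linear equation for the difference
  of two solutions then shows that it vanishes on short intervals, and translation in time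
  (a modulation on the Fourier side) covers \<open>[0,T]\<close>.\<close>

section \<open>Bounded trilinear forms\<close>

text \<open>The threshold -9/8 comes from two frequencies of size N producing one of size k at most
  N. The multiplier is then k <k>^s <N>^(-2s). If the largest modulation is of order k N^4 or more,
  it is worth (k N^4)^(1/2) = k^(1/2) N^2, and the bilinear Strichartz bound for the other two
  functions adds k^(1/4) N^(1/4). The total k^(3/4) N^(9/4) beats N^(-2s) for s > -9/8. The
  transversal region gains k^(1/2) N^(5/2), which is no worse. For very small k these gains
  degenerate; below <N>^(-4/3) a third kernel exploits the short range of k and ignores the
  resonance. The product is estimated with modulation exponent -1/2 + 2 \<epsilon>, although b - 1 =
  -1/2 + \<epsilon> would be natural; the surplus becomes the factor T^(2 \<epsilon>) for squared
  norms. Norms are kept squared in \<open>ennreal\<close>, so that no estimate carries integrability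
  hypotheses. The price is a triangle inequality with factor 2, which explains the generous
  constants of the iteration.\<close>

lemma nn_integral_lborel_translate:
  fixes f :: "'a::euclidean_space \<Rightarrow> ennreal"
  assumes [measurable]: "f \<in> borel_measurable borel"
  shows "(\<integral>\<^sup>+x. f (c + x) \<partial>lborel) = (\<integral>\<^sup>+x. f x \<partial>lborel)"
  by (subst (2) lborel_distr_plus[symmetric, of c]) (simp add: nn_integral_distr)

lemma lborel_distr_uminus_euclidean:
  "distr lborel borel uminus = (lborel :: 'a::euclidean_space measure)"
  by (subst lborel_affine[of "-1" 0]) (auto simp: density_1)

lemma nn_integral_lborel_uminus:
  fixes f :: "'a::euclidean_space \<Rightarrow> ennreal"
  assumes [measurable]: "f \<in> borel_measurable borel"
  shows "(\<integral>\<^sup>+x. f (- x) \<partial>lborel) = (\<integral>\<^sup>+x. f x \<partial>lborel)"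
  by (subst (2) lborel_distr_uminus_euclidean[symmetric]) (simp add: nn_integral_distr)

lemma nn_integral_lborel_reflect:
  fixes f :: "'a::euclidean_space \<Rightarrow> ennreal"
  assumes [measurable]: "f \<in> borel_measurable borel"
  shows "(\<integral>\<^sup>+x. f (c - x) \<partial>lborel) = (\<integral>\<^sup>+x. f x \<partial>lborel)"
proof -
  have "(\<integral>\<^sup>+x. f (c - x) \<partial>lborel) = (\<integral>\<^sup>+x. (\<lambda>y. f (c + y)) (- x) \<partial>lborel)" by simp
  also have "\<dots> = (\<integral>\<^sup>+x. f (c + x) \<partial>lborel)" by (rule nn_integral_lborel_uminus) measurable
  finally show ?thesis by (simp add: nn_integral_lborel_translate)
qed

lemma nn_integral_lborel_swap:
  fixes f :: "'a::euclidean_space \<Rightarrow> 'b::euclidean_space \<Rightarrow> ennreal"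
  assumes "(\<lambda>(x, y). f x y) \<in> borel_measurable (borel \<Otimes>\<^sub>M borel)"
  shows "(\<integral>\<^sup>+x. \<integral>\<^sup>+y. f x y \<partial>lborel \<partial>lborel) = (\<integral>\<^sup>+y. \<integral>\<^sup>+x. f x y \<partial>lborel \<partial>lborel)"
  using assms by (intro lborel_pair.Fubini'[symmetric]) simp

lemma nn_integral_lborel_pair:
  fixes f :: "'a::euclidean_space \<times> 'b::euclidean_space \<Rightarrow> ennreal"
  assumes [measurable]: "f \<in> borel_measurable borel"
  shows "(\<integral>\<^sup>+z. f z \<partial>lborel) = (\<integral>\<^sup>+x. \<integral>\<^sup>+y. f (x, y) \<partial>lborel \<partial>lborel)"
  unfolding lborel_prod[symmetric]
  by (subst lborel.nn_integral_fst[symmetric]) (use assms in \<open>simp_all add: lborel_prod\<close>)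

lemma ennreal_two_mult_le_sum_squares:
  fixes x y :: ennreal shows "2 * (x * y) \<le> x\<^sup>2 + y\<^sup>2"
proof (cases x; cases y)
  fix a b assume *: "x = ennreal a" "y = ennreal b" "0 \<le> a" "0 \<le> b"
  have "2 * (a * b) \<le> a\<^sup>2 + b\<^sup>2" using sum_squares_bound[of a b] by (simp add: mult.assoc)
  then have "ennreal (2 * (a * b)) \<le> ennreal (a\<^sup>2 + b\<^sup>2)" by (rule ennreal_leI)
  then show ?thesis using * by (simp add: ennreal_mult ennreal_power)
qed (auto simp: power2_eq_square top_add ennreal_mult_eq_top_iff)

lemma ennreal_square_sum_le:
  fixes x y :: ennreal shows "(x + y)\<^sup>2 \<le> 2 * (x\<^sup>2 + y\<^sup>2)"
proof -
  have "(x + y)\<^sup>2 = x\<^sup>2 + y\<^sup>2 + 2 * (x * y)" by (simp add: power2_sum ac_simps)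
  also have "\<dots> \<le> x\<^sup>2 + y\<^sup>2 + (x\<^sup>2 + y\<^sup>2)" by (intro add_left_mono ennreal_two_mult_le_sum_squares)
  finally show ?thesis by (simp add: mult_2 ac_simps)
qed

section \<open>Square-integrable bounds for trilinear kernels and their symmetries\<close>

definition sqint :: "('a::euclidean_space \<Rightarrow> ennreal) \<Rightarrow> ennreal" where
  "sqint f = (\<integral>\<^sup>+x. (f x)\<^sup>2 \<partial>lborel)"

definition triform :: "('a::euclidean_space \<Rightarrow> 'a \<Rightarrow> ennreal) \<Rightarrow> ('a \<Rightarrow> ennreal) \<Rightarrow> ('a \<Rightarrow> ennreal) \<Rightarrow> ('a \<Rightarrow> ennreal) \<Rightarrow> ennreal" where
  "triform K f g h = (\<integral>\<^sup>+x. \<integral>\<^sup>+y. K x y * f x * g y * h (x + y) \<partial>lborel \<partial>lborel)"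

text \<open>Both sides are squared, so no roots are taken in \<open>ennreal\<close>. Measurability
  of the kernel is part of the notion because every closure property below rests on Tonelli.\<close>

definition tri_bounded :: "('a::euclidean_space \<Rightarrow> 'a \<Rightarrow> ennreal) \<Rightarrow> bool" where
  "tri_bounded K \<longleftrightarrow> case_prod K \<in> borel_measurable (borel \<Otimes>\<^sub>M borel) \<and>
    (\<exists>C<\<top>. \<forall>f\<in>borel_measurable borel. \<forall>g\<in>borel_measurable borel. \<forall>h\<in>borel_measurable borel.
       (triform K f g h)\<^sup>2 \<le> C * (sqint f * sqint g * sqint h))"

lemma sqint_uminus:
  "f \<in> borel_measurable borel \<Longrightarrow> sqint (\<lambda>x. f (- x)) = sqint f"
  unfolding sqint_def by (rule nn_integral_lborel_uminus[where f="\<lambda>x. (f x)\<^sup>2"]) measurable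

lemma tri_boundedD:
  assumes "tri_bounded K"
  obtains C where "C < \<top>" "\<And>f g h. f \<in> borel_measurable borel \<Longrightarrow> g \<in> borel_measurable borel \<Longrightarrow>
    h \<in> borel_measurable borel \<Longrightarrow> (triform K f g h)\<^sup>2 \<le> C * (sqint f * sqint g * sqint h)"
  using assms unfolding tri_bounded_def by blast

lemma tri_bounded_measurable:
  "tri_bounded K \<Longrightarrow> case_prod K \<in> borel_measurable (borel \<Otimes>\<^sub>M borel)"
  unfolding tri_bounded_def by blast

lemma tri_boundedI:
  assumes "case_prod K \<in> borel_measurable (borel \<Otimes>\<^sub>M borel)" "C < \<top>"
   "\<And>f g h. f \<in> borel_measurable borel \<Longrightarrow> g \<in> borel_measurable borel \<Longrightarrow>
    h \<in> borel_measurable borel \<Longrightarrow> (triform K f g h)\<^sup>2 \<le> C * (sqint f * sqint g * sqint h)"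
  shows "tri_bounded K"
  using assms unfolding tri_bounded_def by blast

lemma tri_bounded_mono:
  assumes "tri_bounded K" and m: "case_prod L \<in> borel_measurable (borel \<Otimes>\<^sub>M borel)"
    and le: "\<And>x y. L x y \<le> K x y"
  shows "tri_bounded L"
proof -
  obtain C where C: "C < \<top>" "\<And>f g h. f \<in> borel_measurable borel \<Longrightarrow> g \<in> borel_measurable borel \<Longrightarrow>
    h \<in> borel_measurable borel \<Longrightarrow> (triform K f g h)\<^sup>2 \<le> C * (sqint f * sqint g * sqint h)"
    using assms(1) by (rule tri_boundedD) blast
  show ?thesis
  proof (rule tri_boundedI[OF m C(1)])
    fix f g h :: "'a \<Rightarrow> ennreal"
    assume *: "f \<in> borel_measurable borel" "g \<in> borel_measurable borel" "h \<in> borel_measurable borel"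
    have "triform L f g h \<le> triform K f g h"
      unfolding triform_def by (intro nn_integral_mono mult_right_mono le) auto
    then have "(triform L f g h)\<^sup>2 \<le> (triform K f g h)\<^sup>2" by (rule power_mono) simp
    also note C(2)[OF *]
    finally show "(triform L f g h)\<^sup>2 \<le> C * (sqint f * sqint g * sqint h)" .
  qed
qed

lemma tri_bounded_add:
  assumes K: "tri_bounded K" and L: "tri_bounded L"
  shows "tri_bounded (\<lambda>x y. K x y + L x y)"
proof -
  obtain C where C: "C < \<top>" "\<And>f g h. f \<in> borel_measurable borel \<Longrightarrow> g \<in> borel_measurable borel \<Longrightarrow>
    h \<in> borel_measurable borel \<Longrightarrow> (triform K f g h)\<^sup>2 \<le> C * (sqint f * sqint g * sqint h)"
    using K by (rule tri_boundedD) blast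
  obtain D where D: "D < \<top>" "\<And>f g h. f \<in> borel_measurable borel \<Longrightarrow> g \<in> borel_measurable borel \<Longrightarrow>
    h \<in> borel_measurable borel \<Longrightarrow> (triform L f g h)\<^sup>2 \<le> D * (sqint f * sqint g * sqint h)"
    using L by (rule tri_boundedD) blast
  note [measurable] = tri_bounded_measurable[OF K] tri_bounded_measurable[OF L]
  show ?thesis
  proof (rule tri_boundedI[where C="2 * (C + D)"])
    fix f g h :: "'a \<Rightarrow> ennreal"
    assume [measurable]: "f \<in> borel_measurable borel" "g \<in> borel_measurable borel" "h \<in> borel_measurable borel"
    have "triform (\<lambda>x y. K x y + L x y) f g h = triform K f g h + triform L f g h"
      unfolding triform_def
      by (simp add: distrib_right nn_integral_add)
    then have "(triform (\<lambda>x y. K x y + L x y) f g h)\<^sup>2 \<le> 2 * ((triform K f g h)\<^sup>2 + (triform L f g h)\<^sup>2)"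
      using ennreal_square_sum_le by metis
    also have "\<dots> \<le> 2 * (C * (sqint f * sqint g * sqint h) + D * (sqint f * sqint g * sqint h))"
      by (intro mult_left_mono add_mono C D) auto
    finally show "(triform (\<lambda>x y. K x y + L x y) f g h)\<^sup>2 \<le> 2 * (C + D) * (sqint f * sqint g * sqint h)"
      by (simp add: distrib_right distrib_left mult.assoc)
  qed (use C D in \<open>auto simp: ennreal_mult_less_top\<close>)
qed

lemma tri_bounded_swap:
  assumes K: "tri_bounded K"
  shows "tri_bounded (\<lambda>x y. K y x)"
proof -
  obtain C where C: "C < \<top>" "\<And>f g h. f \<in> borel_measurable borel \<Longrightarrow> g \<in> borel_measurable borel \<Longrightarrow>
    h \<in> borel_measurable borel \<Longrightarrow> (triform K f g h)\<^sup>2 \<le> C * (sqint f * sqint g * sqint h)"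
    using K by (rule tri_boundedD) blast
  note [measurable] = tri_bounded_measurable[OF K]
  show ?thesis
  proof (rule tri_boundedI[OF _ C(1)])
    fix f g h :: "'a \<Rightarrow> ennreal"
    assume [measurable]: "f \<in> borel_measurable borel" "g \<in> borel_measurable borel" "h \<in> borel_measurable borel"
    have "triform (\<lambda>x y. K y x) f g h = triform K g f h"
      unfolding triform_def
      by (subst nn_integral_lborel_swap) (auto simp: ac_simps)
    then show "(triform (\<lambda>x y. K y x) f g h)\<^sup>2 \<le> C * (sqint f * sqint g * sqint h)"
      using C(2)[of g f h] by (simp add: ac_simps)
  qed measurable
qed

text \<open>Under duality the output function stands on the same footing as the two inputs:
  translating \<open>y\<close> and reflecting \<open>x\<close> moves \<open>h\<close> into the
  second slot and \<open>g\<close> into the output. Together with \<open>tri_bounded_swap\<close>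
  this generates all permutations of the three functions.\<close>

lemma tri_bounded_rotate:
  assumes K: "tri_bounded K"
  shows "tri_bounded (\<lambda>x y. K (- x) (x + y))"
proof -
  obtain C where C: "C < \<top>" "\<And>f g h. f \<in> borel_measurable borel \<Longrightarrow> g \<in> borel_measurable borel \<Longrightarrow>
    h \<in> borel_measurable borel \<Longrightarrow> (triform K f g h)\<^sup>2 \<le> C * (sqint f * sqint g * sqint h)"
    using K by (rule tri_boundedD) blast
  note [measurable] = tri_bounded_measurable[OF K]
  show ?thesis
  proof (rule tri_boundedI[OF _ C(1)])
    fix f g h :: "'a \<Rightarrow> ennreal"
    assume [measurable]: "f \<in> borel_measurable borel" "g \<in> borel_measurable borel" "h \<in> borel_measurable borel"
    have "triform (\<lambda>x y. K (- x) (x + y)) f g h =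
       (\<integral>\<^sup>+x. \<integral>\<^sup>+y. (\<lambda>y. K (- x) y * f x * g (y - x) * h y) (x + y) \<partial>lborel \<partial>lborel)"
      unfolding triform_def by simp
    also have "\<dots> = (\<integral>\<^sup>+x. \<integral>\<^sup>+y. K (- x) y * f x * g (y - x) * h y \<partial>lborel \<partial>lborel)"
      by (subst nn_integral_lborel_translate) auto
    also have "\<dots> = (\<integral>\<^sup>+x. (\<lambda>x. \<integral>\<^sup>+y. K x y * f (- x) * g (x + y) * h y \<partial>lborel) (- x) \<partial>lborel)"
      by simp
    also have "\<dots> = (\<integral>\<^sup>+x. \<integral>\<^sup>+y. K x y * f (- x) * g (x + y) * h y \<partial>lborel \<partial>lborel)"
      by (rule nn_integral_lborel_uminus) measurable
    also have "\<dots> = triform K (\<lambda>x. f (- x)) h g" unfolding triform_def by (simp add: ac_simps)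
    finally show "(triform (\<lambda>x y. K (- x) (x + y)) f g h)\<^sup>2 \<le> C * (sqint f * sqint g * sqint h)"
      using C(2)[of "\<lambda>x. f (- x)" h g] by (simp add: ac_simps sqint_uminus)
  qed measurable
qed

lemma tri_bounded_uminus:
  assumes K: "tri_bounded K"
  shows "tri_bounded (\<lambda>x y. K (- x) (- y))"
proof -
  obtain C where C: "C < \<top>" "\<And>f g h. f \<in> borel_measurable borel \<Longrightarrow> g \<in> borel_measurable borel \<Longrightarrow>
    h \<in> borel_measurable borel \<Longrightarrow> (triform K f g h)\<^sup>2 \<le> C * (sqint f * sqint g * sqint h)"
    using K by (rule tri_boundedD) blast
  note [measurable] = tri_bounded_measurable[OF K]
  show ?thesis
  proof (rule tri_boundedI[OF _ C(1)])
    fix f g h :: "'a \<Rightarrow> ennreal"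
    assume [measurable]: "f \<in> borel_measurable borel" "g \<in> borel_measurable borel" "h \<in> borel_measurable borel"
    have "triform (\<lambda>x y. K (- x) (- y)) f g h =
       (\<integral>\<^sup>+x. \<integral>\<^sup>+y. (\<lambda>y. K (- x) y * f x * g (- y) * h (x - y)) (- y) \<partial>lborel \<partial>lborel)"
      unfolding triform_def by simp
    also have "\<dots> = (\<integral>\<^sup>+x. \<integral>\<^sup>+y. K (- x) y * f x * g (- y) * h (x - y) \<partial>lborel \<partial>lborel)"
      by (subst nn_integral_lborel_uminus) auto
    also have "\<dots> = (\<integral>\<^sup>+x. (\<lambda>x. \<integral>\<^sup>+y. K x y * f (- x) * g (- y) * h (- (x + y)) \<partial>lborel) (- x) \<partial>lborel)"
      by simp
    also have "\<dots> = (\<integral>\<^sup>+x. \<integral>\<^sup>+y. K x y * f (- x) * g (- y) * h (- (x + y)) \<partial>lborel \<partial>lborel)"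
      by (rule nn_integral_lborel_uminus) measurable
    also have "\<dots> = triform K (\<lambda>x. f (- x)) (\<lambda>x. g (- x)) (\<lambda>x. h (- x))" unfolding triform_def by (simp add: ac_simps)
    finally show "(triform (\<lambda>x y. K (- x) (- y)) f g h)\<^sup>2 \<le> C * (sqint f * sqint g * sqint h)"
      using C(2)[of "\<lambda>x. f (- x)" "\<lambda>x. g (- x)" "\<lambda>x. h (- x)"] by (simp add: ac_simps sqint_uminus)
  qed measurable
qed

section \<open>Dual bilinear operators and criteria for boundedness\<close>

definition trisum :: "('a::euclidean_space \<Rightarrow> 'a \<Rightarrow> ennreal) \<Rightarrow> ('a \<Rightarrow> ennreal) \<Rightarrow> ('a \<Rightarrow> ennreal) \<Rightarrow> 'a \<Rightarrow> ennreal" where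
  "trisum K f g z = (\<integral>\<^sup>+x. K x (z - x) * f x * g (z - x) \<partial>lborel)"

lemma trisum_measurable:
  assumes [measurable]: "case_prod K \<in> borel_measurable (borel \<Otimes>\<^sub>M borel)"
    "f \<in> borel_measurable borel" "g \<in> borel_measurable borel"
  shows "trisum K f g \<in> borel_measurable borel"
  unfolding trisum_def by measurable

lemma triform_eq_trisum:
  assumes [measurable]: "case_prod K \<in> borel_measurable (borel \<Otimes>\<^sub>M borel)"
    "f \<in> borel_measurable borel" "g \<in> borel_measurable borel" "h \<in> borel_measurable borel"
  shows "triform K f g h = (\<integral>\<^sup>+z. trisum K f g z * h z \<partial>lborel)"
proof -
  have "triform K f g h = (\<integral>\<^sup>+x. \<integral>\<^sup>+y. (\<lambda>z. K x (z - x) * f x * g (z - x) * h z) (x + y) \<partial>lborel \<partial>lborel)"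
    unfolding triform_def by simp
  also have "\<dots> = (\<integral>\<^sup>+x. \<integral>\<^sup>+z. K x (z - x) * f x * g (z - x) * h z \<partial>lborel \<partial>lborel)"
    by (subst nn_integral_lborel_translate) auto
  also have "\<dots> = (\<integral>\<^sup>+z. \<integral>\<^sup>+x. K x (z - x) * f x * g (z - x) * h z \<partial>lborel \<partial>lborel)"
    by (rule nn_integral_lborel_swap) measurable
  also have "\<dots> = (\<integral>\<^sup>+z. trisum K f g z * h z \<partial>lborel)"
    unfolding trisum_def by (subst nn_integral_multc[symmetric]) auto
  finally show ?thesis .
qed

lemma tri_bounded_if_trisum:
  assumes m: "case_prod K \<in> borel_measurable (borel \<Otimes>\<^sub>M borel)" and C: "C < \<top>"
    and le: "\<And>f g. f \<in> borel_measurable borel \<Longrightarrow> g \<in> borel_measurable borel \<Longrightarrow>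
      sqint (trisum K f g) \<le> C * (sqint f * sqint g)"
  shows "tri_bounded K"
proof (rule tri_boundedI[OF m C])
  note [measurable] = m
  fix f g h :: "'a \<Rightarrow> ennreal"
  assume [measurable]: "f \<in> borel_measurable borel" "g \<in> borel_measurable borel" "h \<in> borel_measurable borel"
  have [measurable]: "trisum K f g \<in> borel_measurable borel" by (rule trisum_measurable) measurable
  have "(triform K f g h)\<^sup>2 \<le> sqint (trisum K f g) * sqint h"
    unfolding sqint_def by (subst triform_eq_trisum) (auto intro!: Cauchy_Schwarz_nn_integral)
  also have "\<dots> \<le> C * (sqint f * sqint g) * sqint h"
    by (intro mult_right_mono le) auto
  finally show "(triform K f g h)\<^sup>2 \<le> C * (sqint f * sqint g * sqint h)" by (simp add: ac_simps)
qed

text \<open>Duality: test against truncations of the bilinear expression itself.\<close>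
lemma tri_bounded_trisum:
  assumes K: "tri_bounded K"
  obtains C where "C < \<top>" "\<And>f g. f \<in> borel_measurable borel \<Longrightarrow> g \<in> borel_measurable borel \<Longrightarrow>
      sqint (trisum K f g) \<le> C * (sqint f * sqint g)"
proof -
  obtain C where C: "C < \<top>" "\<And>f g h. f \<in> borel_measurable borel \<Longrightarrow> g \<in> borel_measurable borel \<Longrightarrow>
    h \<in> borel_measurable borel \<Longrightarrow> (triform K f g h)\<^sup>2 \<le> C * (sqint f * sqint g * sqint h)"
    using K by (rule tri_boundedD) blast
  note [measurable] = tri_bounded_measurable[OF K]
  show ?thesis
  proof (rule that[OF C(1)])
    fix f g :: "'a \<Rightarrow> ennreal"
    assume [measurable]: "f \<in> borel_measurable borel" "g \<in> borel_measurable borel"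
    have [measurable]: "trisum K f g \<in> borel_measurable borel" by (rule trisum_measurable) measurable
    define h where "h n z = min (trisum K f g z) (of_nat n) * indicator (cball 0 (real n)) z" for n :: nat and z
    have [measurable]: "h n \<in> borel_measurable borel" for n
    proof -
      have [measurable]: "cball (0::'a) (real n) \<in> sets borel" by simp
      show ?thesis unfolding h_def by measurable
    qed
    have hle: "h n z \<le> trisum K f g z" for n z
      unfolding h_def by (auto split: split_indicator)
    have fin: "sqint (h n) < \<top>" for n
    proof -
      have [measurable]: "cball (0::'a) (real n) \<in> sets borel" by simp
      have "sqint (h n) \<le> (\<integral>\<^sup>+z. (of_nat n)\<^sup>2 * indicator (cball (0::'a) (real n)) z \<partial>lborel)"
        unfolding sqint_def h_def
        by (intro nn_integral_mono) (auto split: split_indicator intro!: power_mono)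
      also have "\<dots> = (of_nat n)\<^sup>2 * emeasure lborel (cball (0::'a) (real n))"
        by (simp add: nn_integral_cmult)
      also have "\<dots> < \<top>"
        using emeasure_lborel_cball_finite[of "0::'a" "real n"]
        by (auto simp: ennreal_mult_less_top power2_eq_square of_nat_less_top)
      finally show ?thesis .
    qed
    have hb: "sqint (h n) \<le> C * (sqint f * sqint g)" for n
    proof (cases "sqint (h n) = 0")
      case False
      have "sqint (h n) \<le> (\<integral>\<^sup>+z. trisum K f g z * h n z \<partial>lborel)"
        unfolding sqint_def power2_eq_square by (intro nn_integral_mono mult_right_mono hle) auto
      also have "\<dots> = triform K f g (h n)" by (rule triform_eq_trisum[symmetric]) measurable
      finally have "(sqint (h n))\<^sup>2 \<le> (triform K f g (h n))\<^sup>2" by (rule power_mono) simp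
      also have "\<dots> \<le> C * (sqint f * sqint g * sqint (h n))" by (rule C(2)) measurable
      finally have "sqint (h n) * sqint (h n) \<le> C * (sqint f * sqint g) * sqint (h n)"
        by (simp add: power2_eq_square ac_simps)
      \<comment> \<open>Truncation made \<open>sqint (h n)\<close> finite, and it is nonzero in this
        case, so it can be cancelled in \<open>ennreal\<close>.\<close>
      then show ?thesis
        using False fin[of n] by (simp add: ennreal_mult_le_mult_iff mult.commute)
    qed simp
    have "incseq (\<lambda>n z. (h n z)\<^sup>2)"
      unfolding h_def mono_def le_fun_def
      by (auto intro!: power_mono mult_mono min.mono split: split_indicator)
    moreover have "(SUP n. (h n z)\<^sup>2) = (trisum K f g z)\<^sup>2" for z
    proof -
      obtain n0 where n0: "norm z \<le> real n0" using real_arch_simple by blast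
      have ev: "\<forall>\<^sub>F n in sequentially. h n z = min (trisum K f g z) (of_nat n)"
        unfolding h_def eventually_sequentially using n0 by (intro exI[of _ n0]) (auto split: split_indicator)
      have lim: "(\<lambda>n. min (trisum K f g z) (of_nat n)) \<longlonglongrightarrow> trisum K f g z"
      proof -
        have "(\<lambda>n. min (trisum K f g z) (of_nat n)) \<longlonglongrightarrow> min (trisum K f g z) top"
          by (intro tendsto_min tendsto_const of_nat_tendsto_top_ennreal)
        then show ?thesis by (simp add: min_absorb1)
      qed
      have "(\<lambda>n. h n z) \<longlonglongrightarrow> trisum K f g z"
        by (rule Lim_transform_eventually[OF lim]) (use ev in \<open>auto elim: eventually_mono\<close>)
      moreover have "incseq (\<lambda>n. h n z)"
        unfolding h_def mono_def by (auto intro!: mult_mono min.mono intro: min.coboundedI2 split: split_indicator)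
      ultimately have s: "(SUP n. h n z) = trisum K f g z" using LIMSEQ_SUP LIMSEQ_unique by blast
      have "(SUP n. (h n z)\<^sup>2) = (SUP n. h n z) * (SUP n. h n z)"
        unfolding power2_eq_square using \<open>incseq (\<lambda>n. h n z)\<close>
        by (subst SUP_mult_left_ennreal, subst SUP_mult_right_ennreal)
           (auto intro!: antisym SUP_least intro: SUP_upper2 simp: SUP_upper,
            meson SUP_upper2 UNIV_I linear mult_mono' incseq_def zero_le mult_right_mono mult_left_mono)
      then show ?thesis by (simp add: s power2_eq_square)
    qed
    ultimately have "sqint (trisum K f g) = (SUP n. sqint (h n))"
      unfolding sqint_def by (subst nn_integral_monotone_convergence_SUP[symmetric]) auto
    also have "\<dots> \<le> C * (sqint f * sqint g)" by (rule SUP_least) (rule hb)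
    finally show "sqint (trisum K f g) \<le> C * (sqint f * sqint g)" .
  qed
qed

text \<open>Cauchy-Schwarz on each fibre \<open>x + y = z\<close>, with the whole kernel in one
  factor. What remains is the convolution of the squares of \<open>f\<close> and \<open>g\<close>,
  whose integral is a product.\<close>

lemma tri_bounded_CS:
  assumes [measurable]: "case_prod K \<in> borel_measurable (borel \<Otimes>\<^sub>M borel)" and C: "C < \<top>"
    and le: "\<And>z. (\<integral>\<^sup>+x. (K x (z - x))\<^sup>2 \<partial>lborel) \<le> C"
  shows "tri_bounded K"
proof (rule tri_bounded_if_trisum[OF _ C])
  fix f g :: "'a \<Rightarrow> ennreal"
  assume [measurable]: "f \<in> borel_measurable borel" "g \<in> borel_measurable borel"
  have "(trisum K f g z)\<^sup>2 \<le> C * (\<integral>\<^sup>+x. (f x * g (z - x))\<^sup>2 \<partial>lborel)" for z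
  proof -
    have "(trisum K f g z)\<^sup>2 \<le> (\<integral>\<^sup>+x. (K x (z - x))\<^sup>2 \<partial>lborel) * (\<integral>\<^sup>+x. (f x * g (z - x))\<^sup>2 \<partial>lborel)"
      unfolding trisum_def mult.assoc by (rule Cauchy_Schwarz_nn_integral) measurable
    also have "\<dots> \<le> C * (\<integral>\<^sup>+x. (f x * g (z - x))\<^sup>2 \<partial>lborel)" by (intro mult_right_mono le) auto
    finally show ?thesis .
  qed
  then have "sqint (trisum K f g) \<le> (\<integral>\<^sup>+z. C * (\<integral>\<^sup>+x. (f x * g (z - x))\<^sup>2 \<partial>lborel) \<partial>lborel)"
    unfolding sqint_def by (rule nn_integral_mono)
  also have "\<dots> = C * (\<integral>\<^sup>+z. \<integral>\<^sup>+x. (f x * g (z - x))\<^sup>2 \<partial>lborel \<partial>lborel)"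
    by (rule nn_integral_cmult) measurable
  also have "(\<integral>\<^sup>+z. \<integral>\<^sup>+x. (f x * g (z - x))\<^sup>2 \<partial>lborel \<partial>lborel) = (\<integral>\<^sup>+x. \<integral>\<^sup>+z. (f x * g (z - x))\<^sup>2 \<partial>lborel \<partial>lborel)"
    by (rule nn_integral_lborel_swap) measurable
  also have "\<dots> = (\<integral>\<^sup>+x. (f x)\<^sup>2 * sqint g \<partial>lborel)"
  proof (rule nn_integral_cong)
    fix x
    have "(\<integral>\<^sup>+z. (f x * g (z - x))\<^sup>2 \<partial>lborel) = (f x)\<^sup>2 * (\<integral>\<^sup>+z. (\<lambda>y. (g y)\<^sup>2) (- x + z) \<partial>lborel)"
      by (subst nn_integral_cmult[symmetric]) (auto simp: power_mult_distrib)
    also have "(\<integral>\<^sup>+z. (\<lambda>y. (g y)\<^sup>2) (- x + z) \<partial>lborel) = sqint g"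
      unfolding sqint_def by (rule nn_integral_lborel_translate) measurable
    finally show "(\<integral>\<^sup>+z. (f x * g (z - x))\<^sup>2 \<partial>lborel) = (f x)\<^sup>2 * sqint g" .
  qed
  also have "\<dots> = sqint f * sqint g" unfolding sqint_def by (rule nn_integral_multc) measurable
  finally show "sqint (trisum K f g) \<le> C * (sqint f * sqint g)" .
qed measurable

text \<open>The square of the bilinear expression is a fourfold product; pairing the first factor of one
  copy with the second factor of the other copy is what exploits transversality of three surfaces
  (a nonlinear Loomis--Whitney inequality).\<close>
lemma tri_bounded_TTstar:
  fixes a b :: "'a::euclidean_space \<Rightarrow> 'a \<Rightarrow> ennreal"
  assumes [measurable]: "case_prod a \<in> borel_measurable (borel \<Otimes>\<^sub>M borel)" "case_prod b \<in> borel_measurable (borel \<Otimes>\<^sub>M borel)"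
    and C: "C < \<top>"
    and le: "\<And>x y. (\<integral>\<^sup>+z. (a x (z - x))\<^sup>2 * (b (z - y) y)\<^sup>2 \<partial>lborel) \<le> C"
  shows "tri_bounded (\<lambda>x y. a x y * b x y)"
proof (rule tri_bounded_if_trisum[OF _ C])
  fix f g :: "'a \<Rightarrow> ennreal"
  assume [measurable]: "f \<in> borel_measurable borel" "g \<in> borel_measurable borel"
  define Q where "Q z x x' = (a x (z - x))\<^sup>2 * (b x' (z - x'))\<^sup>2 * ((f x)\<^sup>2 * (g (z - x'))\<^sup>2)" for z x x'
  have [measurable]: "(\<lambda>(z, x, x'). Q z x x') \<in> borel_measurable (borel \<Otimes>\<^sub>M borel \<Otimes>\<^sub>M borel)"
    unfolding Q_def by measurable
  have sq: "(trisum (\<lambda>x y. a x y * b x y) f g z)\<^sup>2 \<le> (\<integral>\<^sup>+x. \<integral>\<^sup>+x'. Q z x x' \<partial>lborel \<partial>lborel)" for z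
  proof -
    define T where "T x = a x (z - x) * b x (z - x) * f x * g (z - x)" for x
    have [measurable]: "T \<in> borel_measurable borel" unfolding T_def by measurable
    have "(trisum (\<lambda>x y. a x y * b x y) f g z)\<^sup>2 = (\<integral>\<^sup>+x. T x \<partial>lborel) * (\<integral>\<^sup>+x. T x \<partial>lborel)"
      unfolding trisum_def T_def power2_eq_square by simp
    also have "\<dots> = (\<integral>\<^sup>+x. \<integral>\<^sup>+x'. T x * T x' \<partial>lborel \<partial>lborel)"
      by (simp add: nn_integral_cmult nn_integral_multc)
    finally have eq: "(trisum (\<lambda>x y. a x y * b x y) f g z)\<^sup>2 = (\<integral>\<^sup>+x. \<integral>\<^sup>+x'. T x * T x' \<partial>lborel \<partial>lborel)" .
    have "2 * (\<integral>\<^sup>+x. \<integral>\<^sup>+x'. T x * T x' \<partial>lborel \<partial>lborel) = (\<integral>\<^sup>+x. \<integral>\<^sup>+x'. 2 * (T x * T x') \<partial>lborel \<partial>lborel)"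
      by (simp add: nn_integral_cmult)
    also have "\<dots> \<le> (\<integral>\<^sup>+x. \<integral>\<^sup>+x'. Q z x x' + Q z x' x \<partial>lborel \<partial>lborel)"
    proof (intro nn_integral_mono)
      fix x x'
      \<comment> \<open>The factors are regrouped crosswise: \<open>f x\<close> goes with
        \<open>g (z - x')\<close>, and in each group \<open>a\<close> and \<open>b\<close> sit at
        different points.\<close>
      have "2 * (T x * T x') = 2 * ((a x (z - x) * b x' (z - x') * (f x * g (z - x'))) * (a x' (z - x') * b x (z - x) * (f x' * g (z - x))))"
        unfolding T_def by (simp add: ac_simps)
      also have "\<dots> \<le> (a x (z - x) * b x' (z - x') * (f x * g (z - x')))\<^sup>2 + (a x' (z - x') * b x (z - x) * (f x' * g (z - x)))\<^sup>2"
        by (rule ennreal_two_mult_le_sum_squares)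
      also have "\<dots> = Q z x x' + Q z x' x" unfolding Q_def by (simp add: power_mult_distrib)
      finally show "2 * (T x * T x') \<le> Q z x x' + Q z x' x" .
    qed
    also have "\<dots> = (\<integral>\<^sup>+x. \<integral>\<^sup>+x'. Q z x x' \<partial>lborel \<partial>lborel) + (\<integral>\<^sup>+x. \<integral>\<^sup>+x'. Q z x' x \<partial>lborel \<partial>lborel)"
      by (simp add: nn_integral_add)
    also have "(\<integral>\<^sup>+x. \<integral>\<^sup>+x'. Q z x' x \<partial>lborel \<partial>lborel) = (\<integral>\<^sup>+x. \<integral>\<^sup>+x'. Q z x x' \<partial>lborel \<partial>lborel)"
      by (rule nn_integral_lborel_swap) measurable
    finally show ?thesis
      unfolding eq mult_2[symmetric] by (subst (asm) ennreal_mult_le_mult_iff) auto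
  qed
  have "sqint (trisum (\<lambda>x y. a x y * b x y) f g) \<le> (\<integral>\<^sup>+z. \<integral>\<^sup>+x. \<integral>\<^sup>+x'. Q z x x' \<partial>lborel \<partial>lborel \<partial>lborel)"
    unfolding sqint_def by (rule nn_integral_mono) (rule sq)
  \<comment> \<open>Setting \<open>x' = z - y\<close> turns \<open>g (z - x')\<close> into
    \<open>g y\<close>. Then \<open>z\<close> can be integrated first with \<open>x\<close> and
    \<open>y\<close> fixed, as in the hypothesis \<open>le\<close>.\<close>
  also have "\<dots> = (\<integral>\<^sup>+z. \<integral>\<^sup>+x. \<integral>\<^sup>+y. Q z x (z - y) \<partial>lborel \<partial>lborel \<partial>lborel)"
    by (intro nn_integral_cong nn_integral_lborel_reflect[symmetric]) measurable
  also have "\<dots> = (\<integral>\<^sup>+x. \<integral>\<^sup>+z. \<integral>\<^sup>+y. Q z x (z - y) \<partial>lborel \<partial>lborel \<partial>lborel)"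
    by (rule nn_integral_lborel_swap) (unfold Q_def, measurable)
  also have "\<dots> = (\<integral>\<^sup>+x. \<integral>\<^sup>+y. \<integral>\<^sup>+z. Q z x (z - y) \<partial>lborel \<partial>lborel \<partial>lborel)"
    by (intro nn_integral_cong nn_integral_lborel_swap) (unfold Q_def, measurable)
  also have "\<dots> \<le> (\<integral>\<^sup>+x. \<integral>\<^sup>+y. C * ((f x)\<^sup>2 * (g y)\<^sup>2) \<partial>lborel \<partial>lborel)"
  proof (intro nn_integral_mono)
    fix x y
    have "(\<integral>\<^sup>+z. Q z x (z - y) \<partial>lborel) = (\<integral>\<^sup>+z. (a x (z - x))\<^sup>2 * (b (z - y) y)\<^sup>2 \<partial>lborel) * ((f x)\<^sup>2 * (g y)\<^sup>2)"
      unfolding Q_def by (subst nn_integral_multc[symmetric]) auto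
    also have "\<dots> \<le> C * ((f x)\<^sup>2 * (g y)\<^sup>2)" by (intro mult_right_mono le) auto
    finally show "(\<integral>\<^sup>+z. Q z x (z - y) \<partial>lborel) \<le> C * ((f x)\<^sup>2 * (g y)\<^sup>2)" .
  qed
  also have "\<dots> = C * (sqint f * sqint g)"
    unfolding sqint_def by (simp add: nn_integral_cmult nn_integral_multc)
  finally show "sqint (trisum (\<lambda>x y. a x y * b x y) f g) \<le> C * (sqint f * sqint g)" .
qed measurable

text \<open>Expanding the square gives \<open>f x * f x' * g (z - x) * g (z - x')\<close>, and
  \<open>z\<close> to \<open>x + x' - z\<close> exchanges \<open>z - x\<close> with
  \<open>- (z - x')\<close>. On the Fourier side, conjugating one factor does not change the modulus
  of a product.\<close>

lemma sqint_trisum_reflect: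
  fixes f g :: "'a::euclidean_space \<Rightarrow> ennreal"
  assumes [measurable]: "f \<in> borel_measurable borel" "g \<in> borel_measurable borel"
  shows "sqint (trisum (\<lambda>_ _. 1) f (\<lambda>x. g (- x))) = sqint (trisum (\<lambda>_ _. 1) f g)"
proof -
  have expand: "sqint (trisum (\<lambda>_ _. 1) f h) =
      (\<integral>\<^sup>+x. \<integral>\<^sup>+x'. \<integral>\<^sup>+z. f x * f x' * h (z - x) * h (z - x') \<partial>lborel \<partial>lborel \<partial>lborel)"
    if [measurable]: "h \<in> borel_measurable borel" for h :: "'a \<Rightarrow> ennreal"
  proof -
    have "sqint (trisum (\<lambda>_ _. 1) f h) =
      (\<integral>\<^sup>+z. \<integral>\<^sup>+x. \<integral>\<^sup>+x'. (f x * h (z - x)) * (f x' * h (z - x')) \<partial>lborel \<partial>lborel \<partial>lborel)"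
      unfolding sqint_def trisum_def power2_eq_square
      by (simp add: nn_integral_cmult nn_integral_multc)
    also have "\<dots> = (\<integral>\<^sup>+x. \<integral>\<^sup>+z. \<integral>\<^sup>+x'. (f x * h (z - x)) * (f x' * h (z - x')) \<partial>lborel \<partial>lborel \<partial>lborel)"
      by (rule nn_integral_lborel_swap) measurable
    also have "\<dots> = (\<integral>\<^sup>+x. \<integral>\<^sup>+x'. \<integral>\<^sup>+z. (f x * h (z - x)) * (f x' * h (z - x')) \<partial>lborel \<partial>lborel \<partial>lborel)"
      by (intro nn_integral_cong nn_integral_lborel_swap) measurable
    finally show ?thesis by (simp add: ac_simps)
  qed
  have "(\<integral>\<^sup>+z. f x * f x' * g (- (z - x)) * g (- (z - x')) \<partial>lborel) =
        (\<integral>\<^sup>+z. f x * f x' * g (z - x) * g (z - x') \<partial>lborel)" for x x'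
  proof -
    have "(\<integral>\<^sup>+z. f x * f x' * g (- (z - x)) * g (- (z - x')) \<partial>lborel) =
      (\<integral>\<^sup>+z. (\<lambda>z. f x * f x' * g (z - x) * g (z - x')) ((x + x') - z) \<partial>lborel)"
      by (simp add: algebra_simps)
    also have "\<dots> = (\<integral>\<^sup>+z. f x * f x' * g (z - x) * g (z - x') \<partial>lborel)"
      by (rule nn_integral_lborel_reflect) measurable
    finally show ?thesis .
  qed
  then show ?thesis by (subst (1 2) expand) auto
qed

section \<open>One-dimensional integrals\<close>

lemma jb_ge_1: "1 \<le> jb x" and jb_pos: "0 < jb x" and jb_nonneg: "0 \<le> jb x"
  unfolding jb_def by auto

lemma jb_uminus [simp]: "jb (- x) = jb x" unfolding jb_def by simp

lemma jb_measurable [measurable]: "jb \<in> borel_measurable borel"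
  unfolding jb_def[abs_def] by measurable

lemma jb_add_le: "jb (x + y) \<le> jb x + jb y" unfolding jb_def by simp

lemma jb_add_le_mult: "jb (x + y) \<le> jb x * jb y"
proof -
  have "jb (x + y) \<le> 1 + \<bar>x\<bar> + \<bar>y\<bar> + \<bar>x\<bar> * \<bar>y\<bar>"
    unfolding jb_def using abs_triangle_ineq[of x y] mult_nonneg_nonneg[OF abs_ge_zero[of x] abs_ge_zero[of y]] by linarith
  also have "\<dots> = jb x * jb y" unfolding jb_def by (simp add: algebra_simps)
  finally show ?thesis .
qed

lemma nn_integral_jb_half:
  assumes p: "p > 1"
  shows "(\<integral>\<^sup>+x. ennreal (jb x powr - p) * indicator {0..} x \<partial>lborel) = ennreal (1 / (p - 1))"
proof -
  have "(\<integral>\<^sup>+x. ennreal (jb x powr - p) * indicator {0..} x \<partial>lborel) =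
    (\<integral>\<^sup>+x. ennreal ((1 + x) powr - p) * indicator {0..} x \<partial>lborel)"
    by (intro nn_integral_cong) (auto simp: jb_def split: split_indicator)
  also have "\<dots> = ennreal (0 - (1 / (1 - p)) * (1 + 0) powr (1 - p))"
  proof (rule nn_integral_FTC_atLeast)
    fix x :: real assume x: "0 \<le> x"
    have "((\<lambda>x. (1 / (1 - p)) * (1 + x) powr (1 - p)) has_real_derivative
       (1 / (1 - p)) * ((1 - p) * (1 + x) powr (1 - p - 1))) (at x)"
      using x by (intro DERIV_cmult) (auto intro!: derivative_eq_intros simp: field_simps)
    then show "((\<lambda>x. (1 / (1 - p)) * (1 + x) powr (1 - p)) has_real_derivative (1 + x) powr - p) (at x)"
      using p by simp
  next
    have "((\<lambda>x. (1 + x) powr (1 - p)) \<longlongrightarrow> 0) at_top"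
      using p by (intro tendsto_neg_powr) (auto
          intro!: filterlim_tendsto_add_at_top filterlim_ident)
    then show "((\<lambda>x. (1 / (1 - p)) * (1 + x) powr (1 - p)) \<longlongrightarrow> 0) at_top"
      by (rule tendsto_mult_right_zero)
  qed auto
  also have "0 - (1 / (1 - p)) * (1 + 0) powr (1 - p) = 1 / (p - 1)"
    using p by (simp add: field_simps)
  finally show ?thesis .
qed

lemma nn_integral_jb_finite:
  assumes p: "p > 1"
  shows "(\<integral>\<^sup>+x. ennreal (jb x powr - p) \<partial>lborel) < \<top>"
proof -
  have "(\<integral>\<^sup>+x. ennreal (jb x powr - p) \<partial>lborel) \<le>
    (\<integral>\<^sup>+x. ennreal (jb x powr - p) * indicator {0..} x + ennreal (jb (-x) powr - p) * indicator {0..} (-x) \<partial>lborel)"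
    by (intro nn_integral_mono) (auto split: split_indicator)
  also have "\<dots> = (\<integral>\<^sup>+x. ennreal (jb x powr - p) * indicator {0..} x \<partial>lborel) +
     (\<integral>\<^sup>+x. (\<lambda>x. ennreal (jb x powr - p) * indicator {0..} x) (- x) \<partial>lborel)"
    by (subst nn_integral_add) auto
  also have "(\<integral>\<^sup>+x. (\<lambda>x. ennreal (jb x powr - p) * indicator {0..} x) (- x) \<partial>lborel) =
      (\<integral>\<^sup>+x. ennreal (jb x powr - p) * indicator {0..} x \<partial>lborel)"
    by (rule nn_integral_lborel_uminus) measurable
  also have "(\<integral>\<^sup>+x. ennreal (jb x powr - p) * indicator {0..} x \<partial>lborel) +
      (\<integral>\<^sup>+x. ennreal (jb x powr - p) * indicator {0..} x \<partial>lborel) < \<top>"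
    unfolding nn_integral_jb_half[OF p] by simp
  finally show ?thesis .
qed

definition jbint :: "real \<Rightarrow> ennreal" where
  "jbint p = (\<integral>\<^sup>+x. ennreal (jb x powr - p) \<partial>lborel)"

lemma jbint_finite: "p > 1 \<Longrightarrow> jbint p < \<top>"
  unfolding jbint_def by (rule nn_integral_jb_finite)

lemma nn_integral_jb_translate:
  "(\<integral>\<^sup>+x. ennreal (jb (c + x) powr - p) \<partial>lborel) = jbint p"
  unfolding jbint_def by (rule nn_integral_lborel_translate[where f="\<lambda>x. ennreal (jb x powr - p)"]) measurable

lemma nn_integral_jb_translate':
  "(\<integral>\<^sup>+x. ennreal (jb (x + c) powr - p) \<partial>lborel) = jbint p"
  "(\<integral>\<^sup>+x. ennreal (jb (x - c) powr - p) \<partial>lborel) = jbint p"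
  "(\<integral>\<^sup>+x. ennreal (jb (c - x) powr - p) \<partial>lborel) = jbint p"
proof -
  show 1: "(\<integral>\<^sup>+x. ennreal (jb (x + c) powr - p) \<partial>lborel) = jbint p" for c
    using nn_integral_jb_translate[of c p] by (simp add: add.commute)
  show 2: "(\<integral>\<^sup>+x. ennreal (jb (x - c) powr - p) \<partial>lborel) = jbint p"
    using 1[of "- c"] by simp
  have "jb (c - x) = jb (x - c)" for x using jb_uminus[of "x - c"] by simp
  then show "(\<integral>\<^sup>+x. ennreal (jb (c - x) powr - p) \<partial>lborel) = jbint p" using 2 by simp
qed

text \<open>The larger bracket is at least half of \<open>jb (x + y)\<close>: the power
  \<open>2 * \<kappa> - q\<close> of its decay is turned into decay in \<open>x + y\<close>, and the
  remaining \<open>q - \<kappa>\<close> is passed to the smaller bracket. Thus \<kappa> may lie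
  below 1 while the exponent \<open>q\<close>, which is integrated later, exceeds 1.\<close>

lemma jb_powr_prod_le:
  assumes "\<kappa> \<le> q" "q \<le> 2 * \<kappa>"
  shows "jb x powr - \<kappa> * jb y powr - \<kappa> \<le>
    2 powr (2 * \<kappa> - q) * ((jb x powr - q + jb y powr - q) * jb (x + y) powr - (2 * \<kappa> - q))"
proof -
  have *: "jb x powr - \<kappa> * jb y powr - \<kappa> \<le> 2 powr (2 * \<kappa> - q) * (jb x powr - q * jb (x + y) powr - (2 * \<kappa> - q))"
    if "jb x \<le> jb y" for x y
  proof -
    have h: "jb (x + y) / 2 \<le> jb y" using jb_add_le[of x y] that by simp
    have "jb y powr - \<kappa> = jb y powr - (q - \<kappa>) * jb y powr - (2 * \<kappa> - q)"
      by (simp add: powr_add[symmetric])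
    also have "\<dots> \<le> jb x powr - (q - \<kappa>) * (jb (x + y) / 2) powr - (2 * \<kappa> - q)"
      using that h assms jb_pos[of x] jb_pos[of "x+y"] by (intro mult_mono powr_mono2') auto
    also have "(jb (x + y) / 2) powr - (2 * \<kappa> - q) = 2 powr (2 * \<kappa> - q) * jb (x + y) powr - (2 * \<kappa> - q)"
    proof -
      have "(u / 2) powr - a = 2 powr a * u powr - a" if "u > 0" for u a :: real
        using that by (simp add: powr_divide powr_minus field_simps)
      then show ?thesis using jb_pos by blast
    qed
    finally have "jb x powr - \<kappa> * jb y powr - \<kappa> \<le>
      jb x powr - \<kappa> * (jb x powr - (q - \<kappa>) * (2 powr (2 * \<kappa> - q) * jb (x + y) powr - (2 * \<kappa> - q)))"
      by (rule mult_left_mono) auto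
    also have "\<dots> = 2 powr (2 * \<kappa> - q) * ((jb x powr - \<kappa> * jb x powr - (q - \<kappa>)) * jb (x + y) powr - (2 * \<kappa> - q))"
      by (simp only: ac_simps)
    also have "jb x powr - \<kappa> * jb x powr - (q - \<kappa>) = jb x powr - q" by (simp add: powr_add[symmetric])
    finally show ?thesis .
  qed
  show ?thesis
  proof (cases "jb x \<le> jb y")
    case True
    show ?thesis
      by (rule order_trans[OF *[OF True]]) (intro mult_left_mono mult_right_mono, auto)
  next
    case False
    then have "jb y \<le> jb x" by simp
    from *[OF this] have "jb x powr - \<kappa> * jb y powr - \<kappa> \<le> 2 powr (2 * \<kappa> - q) * (jb y powr - q * jb (x + y) powr - (2 * \<kappa> - q))"
      by (simp add: ac_simps)
    also have "\<dots> \<le> 2 powr (2 * \<kappa> - q) * ((jb x powr - q + jb y powr - q) * jb (x + y) powr - (2 * \<kappa> - q))"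
      by (intro mult_left_mono mult_right_mono) auto
    finally show ?thesis .
  qed
qed

lemma nn_integral_jb_conv_le:
  assumes "\<kappa> \<le> q" "q \<le> 2 * \<kappa>"
  shows "(\<integral>\<^sup>+x. ennreal (jb (x + c) powr - \<kappa> * jb (d - x) powr - \<kappa>) \<partial>lborel) \<le>
    ennreal (2 powr (2 * \<kappa> - q)) * (2 * jbint q) * ennreal (jb (c + d) powr - (2 * \<kappa> - q))"
proof -
  let ?E = "ennreal (2 powr (2 * \<kappa> - q)) * ennreal (jb (c + d) powr - (2 * \<kappa> - q))"
  have "(\<integral>\<^sup>+x. ennreal (jb (x + c) powr - \<kappa> * jb (d - x) powr - \<kappa>) \<partial>lborel) \<le>
    (\<integral>\<^sup>+x. ?E * (ennreal (jb (x + c) powr - q) + ennreal (jb (d - x) powr - q)) \<partial>lborel)"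
  proof (rule nn_integral_mono)
    fix x
    show "ennreal (jb (x + c) powr - \<kappa> * jb (d - x) powr - \<kappa>) \<le> ?E * (ennreal (jb (x + c) powr - q) + ennreal (jb (d - x) powr - q))"
      using jb_powr_prod_le[OF assms, of "x + c" "d - x"]
      by (simp add: ennreal_mult[symmetric] ennreal_plus[symmetric] ac_simps del: ennreal_plus)
  qed
  also have "\<dots> = ?E * (2 * jbint q)"
    by (simp add: nn_integral_cmult nn_integral_add nn_integral_jb_translate' mult_2[symmetric])
  finally show ?thesis by (simp only: mult.assoc mult.commute mult.left_commute)
qed

text \<open>For \<open>c < 0\<close> and \<open>k = 1\<close> the quadratic is
  \<open>(u - r) * (u + r)\<close>, at least the square of the distance to the nearer root;
  \<open>r = 0\<close> serves \<open>c \<ge> 0\<close>. Two translates of one integrand therefore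
  majorize it for every \<open>c\<close>, and scaling gives \<open>1 / sqrt k\<close>.\<close>

lemma nn_integral_jb_quadratic_le:
  assumes k: "k > 0" and p: "p \<ge> 0"
  shows "(\<integral>\<^sup>+u. ennreal (jb (k * (u - u0)\<^sup>2 + c) powr - p) \<partial>lborel) \<le>
     ennreal (1 / sqrt k) * (2 * (\<integral>\<^sup>+u. ennreal (jb (u\<^sup>2) powr - p) \<partial>lborel))" (is "_ \<le> _ * (2 * ?I)")
proof -
  define r where "r = sqrt (max 0 (- c))"
  have pt: "ennreal (jb (u\<^sup>2 + c) powr - p) \<le> ennreal (jb ((u - r)\<^sup>2) powr - p) + ennreal (jb ((u + r)\<^sup>2) powr - p)" for u
  proof -
    have "(u - r)\<^sup>2 \<le> \<bar>u\<^sup>2 + c\<bar> \<or> (u + r)\<^sup>2 \<le> \<bar>u\<^sup>2 + c\<bar>"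
    proof (cases "c \<ge> 0")
      case True then show ?thesis by (simp add: r_def)
    next
      case False
      then have c: "c = - r\<^sup>2" "r \<ge> 0" by (auto simp: r_def)
      have e: "\<bar>u\<^sup>2 + c\<bar> = \<bar>u - r\<bar> * \<bar>u + r\<bar>" unfolding c abs_mult[symmetric]
        by (simp add: power2_eq_square algebra_simps)
      show ?thesis
      proof (cases "u \<ge> 0")
        case True
        then have "\<bar>u - r\<bar> * \<bar>u - r\<bar> \<le> \<bar>u - r\<bar> * \<bar>u + r\<bar>" using c by (intro mult_left_mono) auto
        then show ?thesis unfolding e by (simp add: power2_eq_square abs_mult_self_eq)
      next
        case False
        then have "\<bar>u + r\<bar> * \<bar>u + r\<bar> \<le> \<bar>u - r\<bar> * \<bar>u + r\<bar>" using c by (intro mult_right_mono) auto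
        then show ?thesis unfolding e by (simp add: power2_eq_square abs_mult_self_eq)
      qed
    qed
    then have "jb ((u - r)\<^sup>2) \<le> jb (u\<^sup>2 + c) \<or> jb ((u + r)\<^sup>2) \<le> jb (u\<^sup>2 + c)"
      unfolding jb_def by auto
    then have "jb (u\<^sup>2 + c) powr - p \<le> jb ((u - r)\<^sup>2) powr - p \<or> jb (u\<^sup>2 + c) powr - p \<le> jb ((u + r)\<^sup>2) powr - p"
      using p jb_pos by (auto intro!: powr_mono2')
    then have "jb (u\<^sup>2 + c) powr - p \<le> jb ((u - r)\<^sup>2) powr - p + jb ((u + r)\<^sup>2) powr - p"
      using powr_ge_zero[of "jb ((u - r)\<^sup>2)" "-p"] powr_ge_zero[of "jb ((u + r)\<^sup>2)" "-p"] by linarith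
    then show ?thesis by (simp add: ennreal_plus[symmetric] del: ennreal_plus)
  qed
  have tr: "(\<integral>\<^sup>+u. ennreal (jb ((u + t)\<^sup>2) powr - p) \<partial>lborel) = ?I" for t
    using nn_integral_lborel_translate[where f="\<lambda>u. ennreal (jb (u\<^sup>2) powr - p)" and c=t]
    by (simp add: add.commute)
  have tr': "(\<integral>\<^sup>+u. ennreal (jb ((u - t)\<^sup>2) powr - p) \<partial>lborel) = ?I" for t
    using tr[of "-t"] by simp
  have base: "(\<integral>\<^sup>+u. ennreal (jb (u\<^sup>2 + c) powr - p) \<partial>lborel) \<le> 2 * ?I"
  proof -
    have "(\<integral>\<^sup>+u. ennreal (jb (u\<^sup>2 + c) powr - p) \<partial>lborel) \<le>
      (\<integral>\<^sup>+u. ennreal (jb ((u - r)\<^sup>2) powr - p) + ennreal (jb ((u + r)\<^sup>2) powr - p) \<partial>lborel)"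
      by (rule nn_integral_mono) (rule pt)
    also have "\<dots> = 2 * ?I" by (simp add: nn_integral_add tr tr' mult_2)
    finally show ?thesis .
  qed
  have "(\<integral>\<^sup>+u. ennreal (jb (u\<^sup>2 + c) powr - p) \<partial>lborel) =
    ennreal (sqrt k) * (\<integral>\<^sup>+u. ennreal (jb (k * (u - u0)\<^sup>2 + c) powr - p) \<partial>lborel)"
  proof -
    have "(- sqrt k * u0 + sqrt k * u)\<^sup>2 = k * (u - u0)\<^sup>2" for u
    proof -
      have "- sqrt k * u0 + sqrt k * u = sqrt k * (u - u0)" by (simp add: right_diff_distrib)
      then show ?thesis using k by (simp add: power_mult_distrib)
    qed
    then show ?thesis
      using k nn_integral_real_affine[where f="\<lambda>u. ennreal (jb (u\<^sup>2 + c) powr - p)" and c="sqrt k" and t="- sqrt k * u0"]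
      by simp
  qed
  then have "ennreal (1 / sqrt k) * (ennreal (sqrt k) * (\<integral>\<^sup>+u. ennreal (jb (k * (u - u0)\<^sup>2 + c) powr - p) \<partial>lborel))
     \<le> ennreal (1 / sqrt k) * (2 * ?I)"
    using base by (intro mult_left_mono) auto
  moreover have "ennreal (1 / sqrt k) * ennreal (sqrt k) = 1"
    using k by (simp add: ennreal_mult[symmetric])
  ultimately show ?thesis by (simp add: mult.assoc[symmetric])
qed

lemma nn_integral_jb_square_finite:
  assumes p: "p > 1/2"
  shows "(\<integral>\<^sup>+u. ennreal (jb (u\<^sup>2) powr - p) \<partial>lborel) < \<top>"
proof -
  have "(\<integral>\<^sup>+u. ennreal (jb (u\<^sup>2) powr - p) \<partial>lborel) \<le> (\<integral>\<^sup>+u. ennreal (2 powr p) * ennreal (jb u powr - (2 * p)) \<partial>lborel)"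
  proof (rule nn_integral_mono)
    fix u :: real
    have "(jb u)\<^sup>2 \<le> 2 * jb (u\<^sup>2)"
      using sum_squares_bound[of 1 "\<bar>u\<bar>"] unfolding jb_def by (simp add: power2_sum)
    then have "(2 * jb (u\<^sup>2)) powr - p \<le> ((jb u)\<^sup>2) powr - p"
      using p jb_pos[of u] by (intro powr_mono2') auto
    moreover have "((jb u)\<^sup>2) powr - p = jb u powr - (2 * p)"
      using jb_pos[of u] by (simp add: powr_powr flip: powr_numeral)
    moreover have "(2 * jb (u\<^sup>2)) powr - p = jb (u\<^sup>2) powr - p / 2 powr p"
      using jb_pos[of "u\<^sup>2"] by (simp add: powr_mult powr_minus field_simps)
    ultimately have "jb (u\<^sup>2) powr - p \<le> 2 powr p * jb u powr - (2 * p)" by (simp add: field_simps)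
    then show "ennreal (jb (u\<^sup>2) powr - p) \<le> ennreal (2 powr p) * ennreal (jb u powr - (2 * p))"
      by (simp add: ennreal_mult[symmetric])
  qed
  also have "\<dots> = ennreal (2 powr p) * jbint (2 * p)" unfolding jbint_def by (simp add: nn_integral_cmult)
  also have "\<dots> < \<top>" using jbint_finite[of "2 * p"] p by (simp add: ennreal_mult_less_top)
  finally show ?thesis .
qed

text \<open>Only an inequality is wanted, so \<open>g\<close> may be constant on subintervals and
  its range need not be known. On compact subintervals the substitution is exact, and
  \<open>S\<close> is exhausted from inside.\<close>

lemma nn_integral_substitution_le:
  fixes f :: "real \<Rightarrow> ennreal" and g g' :: "real \<Rightarrow> real"
  assumes f [measurable]: "f \<in> borel_measurable borel"
    and S: "open S" "is_interval S"
    and deriv: "\<And>x. x \<in> S \<Longrightarrow> (g has_real_derivative g' x) (at x)"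
    and cont: "continuous_on S g'"
    and sgn: "(\<forall>x\<in>S. 0 \<le> g' x) \<or> (\<forall>x\<in>S. g' x \<le> 0)"
  shows "(\<integral>\<^sup>+x. f (g x) * ennreal \<bar>g' x\<bar> * indicator S x \<partial>lborel) \<le> (\<integral>\<^sup>+x. f x \<partial>lborel)"
proof -
  have compact_case: "(\<integral>\<^sup>+x. f (g x) * ennreal \<bar>g' x\<bar> * indicator {a..b} x \<partial>lborel) \<le> (\<integral>\<^sup>+x. f x \<partial>lborel)"
    if ab: "a < b" "{a..b} \<subseteq> S" for a b
    using sgn
  proof
    assume pos: "\<forall>x\<in>S. 0 \<le> g' x"
    have "(\<integral>\<^sup>+x. f (g x) * ennreal \<bar>g' x\<bar> * indicator {a..b} x \<partial>lborel) =
      (\<integral>\<^sup>+x. f (g x) * ennreal (g' x) * indicator {a..b} x \<partial>lborel)"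
      using pos ab by (intro nn_integral_cong) (auto split: split_indicator)
    also have "\<dots> = (\<integral>\<^sup>+x. f x * indicator {g a..g b} x \<partial>lborel)"
      by (rule nn_integral_substitution_aux[symmetric]) (use ab pos deriv cont in \<open>auto intro: continuous_on_subset\<close>)
    also have "\<dots> \<le> (\<integral>\<^sup>+x. f x \<partial>lborel)" by (intro nn_integral_mono) (auto split: split_indicator)
    finally show ?thesis .
  next
    assume neg: "\<forall>x\<in>S. g' x \<le> 0"
    have "(\<integral>\<^sup>+x. f (g x) * ennreal \<bar>g' x\<bar> * indicator {a..b} x \<partial>lborel) =
      (\<integral>\<^sup>+x. f (- (- g x)) * ennreal (- g' x) * indicator {a..b} x \<partial>lborel)"
      using neg ab by (intro nn_integral_cong) (auto split: split_indicator)
    also have "\<dots> = (\<integral>\<^sup>+x. f (- x) * indicator {- g a..- g b} x \<partial>lborel)"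
      by (rule nn_integral_substitution_aux[symmetric, where g="\<lambda>x. - g x" and g'="\<lambda>x. - g' x" and f="\<lambda>x. f (- x)"])
         (use ab neg deriv cont in \<open>auto intro!: continuous_on_minus derivative_intros intro: continuous_on_subset\<close>)
    also have "\<dots> \<le> (\<integral>\<^sup>+x. f (- x) \<partial>lborel)" by (intro nn_integral_mono) (auto split: split_indicator)
    also have "\<dots> = (\<integral>\<^sup>+x. f x \<partial>lborel)" by (rule nn_integral_lborel_uminus) measurable
    finally show ?thesis .
  qed
  define h where "h x = f (g x) * ennreal \<bar>g' x\<bar> * indicator S x" for x
  have Sm [measurable]: "S \<in> sets borel" using S by simp
  have contg: "continuous_on S g"
    using deriv by (auto intro!: continuous_at_imp_continuous_on DERIV_isCont)
  have hm: "h \<in> borel_measurable borel"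
  proof -
    have [measurable]: "(\<lambda>x. indicator S x *\<^sub>R g x) \<in> borel_measurable borel"
      "(\<lambda>x. indicator S x *\<^sub>R g' x) \<in> borel_measurable borel"
      by (rule borel_measurable_continuous_on_indicator[OF Sm contg], rule borel_measurable_continuous_on_indicator[OF Sm cont])
    have heq: "h = (\<lambda>x. f (indicator S x *\<^sub>R g x) * ennreal \<bar>indicator S x *\<^sub>R g' x\<bar> * indicator S x)"
      unfolding h_def by (auto simp: fun_eq_iff split: split_indicator)
    show ?thesis unfolding heq by measurable
  qed
  \<comment> \<open>Points with room \<open>inverse (real (Suc n))\<close> inside \<open>S\<close>
    on both sides. The margin lets each \<open>A n\<close> fit into a compact interval contained in
    \<open>S\<close>, whose ends come from points of \<open>A n\<close> close to its infimum and
    supremum.\<close>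
  define A where "A n = {x. x - inverse (real (Suc n)) \<in> S \<and> x + inverse (real (Suc n)) \<in> S \<and> \<bar>x\<bar> \<le> real n}" for n
  have inS: "t \<in> S" if "x \<in> S" "y \<in> S" "x \<le> t" "t \<le> y" for x y t
    using S(2) that unfolding is_interval_1 by blast
  have An: "(\<integral>\<^sup>+x. h x * indicator (A n) x \<partial>lborel) \<le> (\<integral>\<^sup>+x. f x \<partial>lborel)" for n
  proof (cases "A n = {}")
    case False
    let ?e = "inverse (real (Suc n))"
    have bb: "bdd_below (A n)" "bdd_above (A n)"
      by (rule bdd_belowI[of _ "- real n"], force simp: A_def) (rule bdd_aboveI[of _ "real n"], force simp: A_def)
    have e: "?e > 0" by simp
    obtain x where x: "x \<in> A n" "x < Inf (A n) + ?e" using False bb e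
      by (meson cInf_less_iff less_add_same_cancel1)
    obtain y where y: "y \<in> A n" "Sup (A n) - ?e < y" using False bb e
      by (meson diff_less_eq less_add_same_cancel1 less_cSup_iff)
    have sub: "{x - ?e..y + ?e} \<subseteq> S"
      using x y inS[of "x - ?e" "y + ?e"] by (auto simp: A_def)
    have sub2: "A n \<subseteq> {x - ?e..y + ?e}"
    proof
      fix t assume "t \<in> A n"
      then have "Inf (A n) \<le> t" "t \<le> Sup (A n)" using bb by (auto intro: cInf_lower cSup_upper)
      then show "t \<in> {x - ?e..y + ?e}" using x y by auto
    qed
    have "x - ?e < y + ?e" using x(1) sub2 y(2) x(2) e
      by (smt (verit) atLeastAtMost_iff subsetD)
    have "(\<integral>\<^sup>+x. h x * indicator (A n) x \<partial>lborel) \<le>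
       (\<integral>\<^sup>+t. f (g t) * ennreal \<bar>g' t\<bar> * indicator {x - ?e..y + ?e} t \<partial>lborel)"
      unfolding h_def using sub2 by (intro nn_integral_mono) (auto split: split_indicator)
    also have "\<dots> \<le> (\<integral>\<^sup>+x. f x \<partial>lborel)"
      by (rule compact_case) fact+
    finally show ?thesis .
  qed simp
  have Am [measurable]: "A n \<in> sets borel" for n
    unfolding A_def by measurable
  have incA: "A m \<subseteq> A n" if "m \<le> n" for m n
  proof
    fix x assume x: "x \<in> A m"
    define e d where "e = inverse (real (Suc n))" and "d = inverse (real (Suc m))"
    have ed: "0 < e" "e \<le> d" unfolding e_def d_def using that by (auto simp: field_simps)
    have x': "x - d \<in> S" "x + d \<in> S" "\<bar>x\<bar> \<le> real m" using x by (auto simp: A_def d_def)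
    have "x - e \<in> S" "x + e \<in> S"
      using ed by (auto intro!: inS[OF x'(1,2)])
    then show "x \<in> A n" using x'(3) that by (auto simp: A_def e_def)
  qed
  have sup: "(SUP n. h x * indicator (A n) x) = h x" for x
  proof (cases "x \<in> S")
    case True
    then obtain e where e: "e > 0" "ball x e \<subseteq> S" using S(1) open_contains_ball by blast
    obtain n1 where n1: "inverse (real (Suc n1)) < e" using reals_Archimedean[OF e(1)] by blast
    obtain n2 where n2: "\<bar>x\<bar> \<le> real n2" using real_arch_simple by blast
    define n where "n = max n1 n2"
    have "inverse (real (Suc n)) \<le> inverse (real (Suc n1))" by (simp add: n_def field_simps)
    from this n1 have "inverse (real (Suc n)) < e" by (rule le_less_trans)
    moreover have "0 < inverse (real (Suc n))" by simp
    ultimately have "x - inverse (real (Suc n)) \<in> ball x e" "x + inverse (real (Suc n)) \<in> ball x e"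
      by (auto simp: dist_real_def)
    moreover have "\<bar>x\<bar> \<le> real n" using n2 by (simp add: n_def)
    ultimately have "x \<in> A n" using e(2) by (auto simp: A_def)
    then have "h x \<le> (SUP n. h x * indicator (A n) x)" by (intro SUP_upper2[of n]) auto
    moreover have "(SUP n. h x * indicator (A n) x) \<le> h x" by (intro SUP_least) (auto split: split_indicator)
    ultimately show ?thesis by (rule antisym[rotated])
  next
    case False
    then show ?thesis by (simp add: h_def)
  qed
  have "(\<integral>\<^sup>+x. h x \<partial>lborel) = (\<integral>\<^sup>+x. (SUP n. h x * indicator (A n) x) \<partial>lborel)" by (simp add: sup)
  also have "\<dots> = (SUP n. \<integral>\<^sup>+x. h x * indicator (A n) x \<partial>lborel)"
    by (rule nn_integral_monotone_convergence_SUP)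
       (use hm incA in \<open>auto simp: mono_def le_fun_def intro!: mult_left_mono split: split_indicator\<close>)
  also have "\<dots> \<le> (\<integral>\<^sup>+x. f x \<partial>lborel)" by (rule SUP_least) (rule An)
  finally show ?thesis unfolding h_def .
qed

section \<open>Strichartz-type kernels\<close>

type_synonym freq = "(real \<times> real) \<times> real"

abbreviation xi :: "freq \<Rightarrow> real" where "xi z \<equiv> fst (fst z)"

definition sg :: "freq \<Rightarrow> real" where "sg z = snd z + phase (fst z)"

lemma phase_measurable [measurable]: "phase \<in> borel_measurable borel"
  unfolding phase_def[abs_def] borel_prod[symmetric] by measurable

lemma fst_borel_measurable [measurable]: "fst \<in> (borel :: ('a::second_countable_topology \<times> 'b::second_countable_topology) measure) \<rightarrow>\<^sub>M borel"
  and snd_borel_measurable [measurable]: "snd \<in> (borel :: ('a::second_countable_topology \<times> 'b::second_countable_topology) measure) \<rightarrow>\<^sub>M borel"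
  unfolding borel_prod[symmetric] by measurable

lemma Pair_borel_measurable [measurable (raw)]:
  fixes f :: "'c \<Rightarrow> 'a::second_countable_topology" and g :: "'c \<Rightarrow> 'b::second_countable_topology"
  shows "f \<in> M \<rightarrow>\<^sub>M borel \<Longrightarrow> g \<in> M \<rightarrow>\<^sub>M borel \<Longrightarrow> (\<lambda>x. (f x, g x)) \<in> M \<rightarrow>\<^sub>M borel"
  unfolding borel_prod[symmetric] by measurable

lemma sg_measurable [measurable]: "sg \<in> borel_measurable borel"
  unfolding sg_def[abs_def] by measurable

lemma phase_uminus [simp]: "phase (- p) = - phase p"
  unfolding phase_def by simp

lemma sg_uminus [simp]: "sg (- z) = - sg z"
  unfolding sg_def by simp

lemma nn_integral_freq:
  fixes f :: "freq \<Rightarrow> ennreal"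
  assumes [measurable]: "f \<in> borel_measurable borel"
  shows "(\<integral>\<^sup>+z. f z \<partial>lborel) = (\<integral>\<^sup>+x. \<integral>\<^sup>+m. \<integral>\<^sup>+t. f ((x, m), t) \<partial>lborel \<partial>lborel \<partial>lborel)"
  by (subst nn_integral_lborel_pair, measurable) (rule nn_integral_lborel_pair, measurable)

text \<open>Completing the square in \<open>m\<close>; the vertex \<open>x * M / X\<close> is where
  the slopes \<open>m / x\<close> and \<open>M / X\<close> agree.\<close>

lemma phase_sum:
  assumes "x \<noteq> 0" "X - x \<noteq> 0" "X \<noteq> 0"
  shows "phase (x, m) + phase (X - x, M - m) =
    X / (x * (X - x)) * (m - x * M / X)\<^sup>2 + (x ^ 5 + (X - x) ^ 5 + M\<^sup>2 / X)"
proof -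
  have "m\<^sup>2 / x + (M - m)\<^sup>2 / (X - x) = X / (x * (X - x)) * (m - x * M / X)\<^sup>2 + M\<^sup>2 / X"
  proof -
    define y where "y = X - x"
    have y: "y \<noteq> 0" "X = x + y" using assms by (auto simp: y_def)
    have "x + y \<noteq> 0" using assms y by simp
    then show ?thesis unfolding y_def[symmetric] y(2) using assms(1) y(1)
      by (simp add: divide_simps) (simp add: power2_eq_square algebra_simps)
  qed
  then show ?thesis unfolding phase_def by simp
qed

lemma nn_integral_jb_sg_conv_le:
  assumes "\<kappa> \<le> q" "q \<le> 2 * \<kappa>"
  shows "(\<integral>\<^sup>+t. ennreal (jb (sg (p, t)) powr - \<kappa> * jb (sg ((P, T) - (p, t))) powr - \<kappa>) \<partial>lborel) \<le>
    ennreal (2 powr (2 * \<kappa> - q)) * (2 * jbint q) * ennreal (jb (phase p + phase (P - p) + T) powr - (2 * \<kappa> - q))"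
proof -
  have "(\<integral>\<^sup>+t. ennreal (jb (sg (p, t)) powr - \<kappa> * jb (sg ((P, T) - (p, t))) powr - \<kappa>) \<partial>lborel) =
    (\<integral>\<^sup>+t. ennreal (jb (t + phase p) powr - \<kappa> * jb ((T + phase (P - p)) - t) powr - \<kappa>) \<partial>lborel)"
    unfolding sg_def by (simp add: algebra_simps)
  also note nn_integral_jb_conv_le[OF assms]
  finally show ?thesis by (simp add: algebra_simps)
qed

definition KT :: "freq \<Rightarrow> freq \<Rightarrow> ennreal" where
  "KT z w = (if xi z \<noteq> 0 \<and> \<bar>xi z\<bar> * jb (xi (z + w)) powr (4/3) \<le> 4 \<and> \<bar>xi z\<bar> \<le> \<bar>xi w\<bar> \<and> \<bar>xi z\<bar> \<le> \<bar>xi (z + w)\<bar>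
     then ennreal (jb (xi w) * (jb (sg z) powr - (15/32) * jb (sg w) powr - (15/32))) else 0)"

lemma tri_bounded_KT: "tri_bounded KT"
proof -
  define J where "J = (\<integral>\<^sup>+u. ennreal (jb (u\<^sup>2) powr - (3/4)) \<partial>lborel)"
  define C where "C = ennreal 256 * (ennreal (2 powr (3/4)) * (2 * jbint (9/8)) * (2 * J))"
  have Jfin: "J < \<top>" unfolding J_def by (rule nn_integral_jb_square_finite) simp
  have [measurable]: "case_prod KT \<in> borel_measurable (borel \<Otimes>\<^sub>M borel)"
    unfolding KT_def by measurable
  show ?thesis
  proof (rule tri_bounded_CS[where C=C])
    show "C < \<top>" unfolding C_def using Jfin jbint_finite[of "9/8"] by (simp add: ennreal_mult_less_top)
    fix z :: freq
    obtain X M T where z: "z = ((X, M), T)" by (metis prod.collapse)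
    let ?c = "\<lambda>x. x \<noteq> 0 \<and> \<bar>x\<bar> * jb X powr (4/3) \<le> 4 \<and> \<bar>x\<bar> \<le> \<bar>X - x\<bar> \<and> \<bar>x\<bar> \<le> \<bar>X\<bar>"
    define K1 where "K1 = ennreal (2 powr (3/4)) * (2 * jbint (9/8))"
    \<comment> \<open>The convolution in \<open>t\<close> with \<open>\<kappa> = 15/16\<close> and
      \<open>q = 9/8\<close> leaves decay \<open>2 * \<kappa> - q = 3/4\<close>, still above the 1/2
      that a quadratic argument needs.\<close>
    have step1: "(\<integral>\<^sup>+t. (KT ((x, m), t) (z - ((x, m), t)))\<^sup>2 \<partial>lborel) \<le>
       (if ?c x then ennreal ((jb (X - x))\<^sup>2) * (K1 * ennreal (jb (phase (x, m) + phase (X - x, M - m) + T) powr - (3/4))) else 0)" for x m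
    proof (cases "?c x")
      case True
      have sq: "(jb a powr - (15/32))\<^sup>2 = jb a powr - (15/16)" for a
        using jb_pos[of a] by (simp add: powr_powr flip: powr_numeral)
      have "(\<integral>\<^sup>+t. (KT ((x, m), t) (z - ((x, m), t)))\<^sup>2 \<partial>lborel) =
        (\<integral>\<^sup>+t. ennreal ((jb (X - x))\<^sup>2) * ennreal (jb (sg ((x, m), t)) powr - (15/16) * jb (sg (((X, M), T) - ((x, m), t))) powr - (15/16)) \<partial>lborel)"
        using True unfolding KT_def z
        by (intro nn_integral_cong) (simp add: ennreal_power ennreal_mult[symmetric] jb_nonneg power_mult_distrib sq)
      also have "\<dots> = ennreal ((jb (X - x))\<^sup>2) * (\<integral>\<^sup>+t. ennreal (jb (sg ((x, m), t)) powr - (15/16) * jb (sg (((X, M), T) - ((x, m), t))) powr - (15/16)) \<partial>lborel)"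
        by (rule nn_integral_cmult) measurable
      also have "\<dots> \<le> ennreal ((jb (X - x))\<^sup>2) * (K1 * ennreal (jb (phase (x, m) + phase ((X, M) - (x, m)) + T) powr - (3/4)))"
        using nn_integral_jb_sg_conv_le[of "15/16" "9/8" "(x, m)" "(X, M)" T] unfolding K1_def
        by (intro mult_left_mono) auto
      finally show ?thesis using True by simp
    next
      case False
      then have "KT ((x, m), t) (z - ((x, m), t)) = 0" for t unfolding KT_def z by auto
      then show ?thesis using False by auto
    qed
    \<comment> \<open>Integrating the quadratic in \<open>m\<close> gives
      \<open>1 / sqrt \<bar>k\<bar>\<close>, of order \<open>\<bar>x\<bar> powr (1/2)\<close> and
      hence at most of order \<open>jb X powr - (2/3)\<close>. With the factor
      \<open>jb X powr 2\<close> this leaves \<open>jb X powr (4/3)\<close>, which the length of the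
      interval of \<open>x\<close> cancels.\<close>
    have step2: "(\<integral>\<^sup>+m. \<integral>\<^sup>+t. (KT ((x, m), t) (z - ((x, m), t)))\<^sup>2 \<partial>lborel \<partial>lborel) \<le>
       (K1 * (2 * J)) * ennreal (32 * (jb X) powr (4/3)) * indicator {- 4 * jb X powr - (4/3)..4 * jb X powr - (4/3)} x" for x
    proof (cases "?c x")
      case True
      then have nz: "x \<noteq> 0" "X - x \<noteq> 0" "X \<noteq> 0" by auto
      define k where "k = X / (x * (X - x))"
      define c where "c = x ^ 5 + (X - x) ^ 5 + M\<^sup>2 / X + T"
      have ph: "phase (x, m) + phase (X - x, M - m) + T = k * (m - x * M / X)\<^sup>2 + c" for m
        unfolding phase_sum[OF nz] k_def c_def by simp
      have kp: "\<bar>k\<bar> > 0" using nz by (simp add: k_def)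
      have jbk: "jb (k * (m - x * M / X)\<^sup>2 + c) = jb (\<bar>k\<bar> * (m - x * M / X)\<^sup>2 + sgn k * c)" for m
        using kp unfolding jb_def by (cases "k > 0") (auto simp: abs_minus_commute)
      have "(\<integral>\<^sup>+m. \<integral>\<^sup>+t. (KT ((x, m), t) (z - ((x, m), t)))\<^sup>2 \<partial>lborel \<partial>lborel) \<le>
        (\<integral>\<^sup>+m. ennreal ((jb (X - x))\<^sup>2) * (K1 * ennreal (jb (\<bar>k\<bar> * (m - x * M / X)\<^sup>2 + sgn k * c) powr - (3/4))) \<partial>lborel)"
        using step1[of x] True by (intro nn_integral_mono) (simp add: ph jbk)
      also have "\<dots> = ennreal ((jb (X - x))\<^sup>2) * (K1 * (\<integral>\<^sup>+m. ennreal (jb (\<bar>k\<bar> * (m - x * M / X)\<^sup>2 + sgn k * c) powr - (3/4)) \<partial>lborel))"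
        by (simp add: nn_integral_cmult)
      also have "\<dots> \<le> ennreal ((jb (X - x))\<^sup>2) * (K1 * (ennreal (1 / sqrt \<bar>k\<bar>) * (2 * J)))"
        unfolding J_def by (intro mult_left_mono nn_integral_jb_quadratic_le kp) auto
      also have "\<dots> = (K1 * (2 * J)) * ennreal ((jb (X - x))\<^sup>2 * (1 / sqrt \<bar>k\<bar>))"
        by (subst ennreal_mult) (simp_all only: ac_simps, simp_all)
      also have "\<dots> \<le> (K1 * (2 * J)) * ennreal (32 * (jb X) powr (4/3))"
      proof (intro mult_left_mono ennreal_leI)
        have a: "jb (X - x) \<le> 2 * jb X" using True abs_triangle_ineq4[of X x] unfolding jb_def by auto
        have "(jb (X - x))\<^sup>2 \<le> (2 * jb X)\<^sup>2" by (intro power_mono a jb_nonneg)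
        then have 1: "(jb (X - x))\<^sup>2 \<le> 4 * jb X powr 2" using jb_pos[of X] by (simp add: power_mult_distrib)
        have "\<bar>X - x\<bar> \<le> 2 * \<bar>X\<bar>" using True abs_triangle_ineq4[of X x] by auto
        then have "\<bar>X - x\<bar> / \<bar>X\<bar> \<le> 2" using nz by (simp add: divide_le_eq)
        then have "\<bar>x\<bar> * (\<bar>X - x\<bar> / \<bar>X\<bar>) \<le> \<bar>x\<bar> * 2" by (intro mult_left_mono) auto
        then have "1 / \<bar>k\<bar> \<le> 2 * \<bar>x\<bar>" unfolding k_def by (simp add: abs_mult)
        also have "\<dots> \<le> 16 * jb X powr - (4/3)"
          using True jb_pos[of X] by (simp add: powr_minus field_simps)
        also have "\<dots> = (4 * jb X powr - (2/3))\<^sup>2"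
          using jb_pos[of X] by (simp add: power_mult_distrib powr_powr flip: powr_numeral)
        finally have "sqrt (1 / \<bar>k\<bar>) \<le> sqrt ((4 * jb X powr - (2/3))\<^sup>2)" by (rule real_sqrt_le_mono)
        then have 2: "1 / sqrt \<bar>k\<bar> \<le> 4 * jb X powr - (2/3)" by (simp only: real_sqrt_abs) (simp add: real_sqrt_divide)
        have "(jb (X - x))\<^sup>2 * (1 / sqrt \<bar>k\<bar>) \<le> (4 * jb X powr 2) * (4 * jb X powr - (2/3))"
          by (rule mult_mono[OF 1 2]) auto
        also have "\<dots> = 16 * jb X powr (4/3)" by (simp add: powr_add[symmetric])
        finally show "(jb (X - x))\<^sup>2 * (1 / sqrt \<bar>k\<bar>) \<le> 32 * (jb X) powr (4/3)" 
          using powr_ge_zero[of "jb X" "4/3"] by linarith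
      qed auto
      moreover have "x \<in> {- 4 * jb X powr - (4/3)..4 * jb X powr - (4/3)}"
      proof -
        have "\<bar>x\<bar> \<le> 4 * jb X powr - (4/3)" using True jb_pos[of X] by (simp add: powr_minus field_simps)
        then show ?thesis by auto
      qed
      ultimately show ?thesis by simp
    next
      case False
      have "(\<integral>\<^sup>+m. \<integral>\<^sup>+t. (KT ((x, m), t) (z - ((x, m), t)))\<^sup>2 \<partial>lborel \<partial>lborel) \<le> (\<integral>\<^sup>+m. 0 \<partial>(lborel :: real measure))"
        using step1[of x] False by (intro nn_integral_mono) auto
      then show ?thesis by simp
    qed
    have "(\<integral>\<^sup>+x. (KT x (z - x))\<^sup>2 \<partial>lborel) = (\<integral>\<^sup>+x. \<integral>\<^sup>+m. \<integral>\<^sup>+t. (KT ((x, m), t) (z - ((x, m), t)))\<^sup>2 \<partial>lborel \<partial>lborel \<partial>lborel)"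
      by (rule nn_integral_freq) measurable
    also have "\<dots> \<le> (\<integral>\<^sup>+x. (K1 * (2 * J)) * ennreal (32 * (jb X) powr (4/3)) * indicator {- 4 * jb X powr - (4/3)..4 * jb X powr - (4/3)} x \<partial>lborel)"
      by (rule nn_integral_mono) (rule step2)
    also have "\<dots> = (K1 * (2 * J)) * ennreal (32 * (jb X) powr (4/3)) * ennreal (8 * jb X powr - (4/3))"
      by (simp add: nn_integral_cmult)
    also have "\<dots> = (K1 * (2 * J)) * (ennreal (32 * (jb X) powr (4/3)) * ennreal (8 * jb X powr - (4/3)))"
      by (simp only: mult.assoc)
    also have "ennreal (32 * (jb X) powr (4/3)) * ennreal (8 * jb X powr - (4/3)) =
        ennreal (32 * (jb X) powr (4/3) * (8 * jb X powr - (4/3)))"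
      by (rule ennreal_mult[symmetric]) auto
    also have "32 * (jb X) powr (4/3) * (8 * jb X powr - (4/3)) = 256"
      using jb_pos[of X] by (simp add: powr_minus field_simps)
    also have "(K1 * (2 * J)) * ennreal 256 = C" unfolding C_def K1_def by (simp only: ac_simps)
    finally show "(\<integral>\<^sup>+x. (KT x (z - x))\<^sup>2 \<partial>lborel) \<le> C" by simp
  qed measurable
qed

section \<open>The bilinear Strichartz kernel, first for frequencies of equal sign\<close>

definition kS :: "real \<Rightarrow> freq \<Rightarrow> ennreal" where
  "kS b z = (if xi z > 0 then ennreal (xi z powr (1/4) * jb (sg z) powr - b) else 0)"

lemma kS_measurable [measurable]: "kS b \<in> borel_measurable borel"
  unfolding kS_def[abs_def] by measurable

text \<open>For frequencies of the same sign the form \<open>phase p + phase (P - p)\<close> is, after completing the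
  square in the second variable, a sum of two squares in suitable coordinates; the substitution
  \<open>\<alpha> = \<beta> t\<close> then reduces the integral to a one-dimensional one without logarithmic loss.\<close>
lemma nn_integral_same_sign_le:
  assumes X: "X > 0" and p: "p > 1"
  shows "(\<integral>\<^sup>+x. \<integral>\<^sup>+m. (if 0 < x \<and> x < X then ennreal (sqrt (x * (X - x)) * jb (phase (x, m) + phase (X - x, M - m) + T) powr - p) else 0) \<partial>lborel \<partial>lborel)
    \<le> jbint p * (\<integral>\<^sup>+t. ennreal (jb (t\<^sup>2) powr - 1) \<partial>lborel)"
proof -
  \<comment> \<open>The polynomial \<open>x ^ 5 + (X - x) ^ 5\<close> is even about the midpoint:
    with \<open>u = x - X/2\<close> it equals \<open>g u + X ^ 5 / 16\<close>.\<close>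
  define g where "g u = 5/2 * X ^ 3 * u\<^sup>2 + 5 * X * u ^ 4" for u
  define g' where "g' u = 5 * X ^ 3 * u + 20 * X * u ^ 3" for u
  define c where "c = X ^ 5 / 16 + M\<^sup>2 / X + T"
  define h where "h x = x - X/2" for x
  have gpos: "g u > 0" if "u \<noteq> 0" for u
    using X that unfolding g_def by (intro add_pos_pos mult_pos_pos) auto
  have gnn: "g u \<ge> 0" for u using X unfolding g_def by (intro add_nonneg_nonneg mult_nonneg_nonneg) auto
  have [measurable]: "g \<in> borel_measurable borel" "h \<in> borel_measurable borel"
    unfolding g_def[abs_def] h_def[abs_def] by measurable
  have inner: "(\<integral>\<^sup>+m. (if 0 < x \<and> x < X then ennreal (sqrt (x * (X - x)) * jb (phase (x, m) + phase (X - x, M - m) + T) powr - p) else 0) \<partial>lborel)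
    \<le> (\<integral>\<^sup>+t. (if 0 < x \<and> x < X then ennreal (X powr (3/2) / 4 * sqrt (g (h x)) * jb (g (h x) * (1 + t\<^sup>2) + c) powr - p) else 0) \<partial>lborel)"
    if xh: "x \<noteq> X / 2" for x
  proof (cases "0 < x \<and> x < X")
    case True
    then have nz: "x \<noteq> 0" "X - x \<noteq> 0" "X \<noteq> 0" using X by auto
    define k where "k = X / (x * (X - x))"
    have k: "k > 0" using True X by (simp add: k_def)
    define \<beta> where "\<beta> = sqrt (g (h x))"
    have \<beta>: "\<beta> > 0" unfolding \<beta>_def using gpos[of "h x"] xh by (simp add: h_def)
    have \<beta>2: "\<beta>\<^sup>2 = g (h x)" unfolding \<beta>_def using gnn by simp
    have five: "x ^ 5 + (X - x) ^ 5 = g (h x) + X ^ 5 / 16"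
      unfolding g_def h_def by (simp add: field_simps power2_eq_square) (simp add: eval_nat_numeral algebra_simps)
    have ph: "phase (x, m) + phase (X - x, M - m) + T = k * (m - x * M / X)\<^sup>2 + (g (h x) + c)" for m
      unfolding phase_sum[OF nz] five c_def k_def by simp
    \<comment> \<open>Measuring \<open>m\<close> from the vertex in units of
      \<open>\<beta> / sqrt k\<close>, with \<open>\<beta>\<^sup>2 = g (h x)\<close>, makes the
      phase \<open>g (h x) * (1 + t\<^sup>2)\<close> plus a constant. For fixed \<open>t\<close>
      only a one-dimensional substitution in \<open>x\<close> is left.\<close>
    have sub: "k * ((x * M / X + \<beta> / sqrt k * t) - x * M / X)\<^sup>2 + (g (h x) + c) = g (h x) * (1 + t\<^sup>2) + c" for t
      using k by (simp add: power_mult_distrib power_divide \<beta>2 algebra_simps)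
    have "(\<integral>\<^sup>+m. ennreal (sqrt (x * (X - x)) * jb (k * (m - x * M / X)\<^sup>2 + (g (h x) + c)) powr - p) \<partial>lborel) =
       ennreal \<bar>\<beta> / sqrt k\<bar> * (\<integral>\<^sup>+t. ennreal (sqrt (x * (X - x)) * jb (k * ((x * M / X + \<beta> / sqrt k * t) - x * M / X)\<^sup>2 + (g (h x) + c)) powr - p) \<partial>lborel)"
      by (rule nn_integral_real_affine) (use \<beta> k in auto)
    also have "\<dots> = (\<integral>\<^sup>+t. ennreal (\<beta> / sqrt k) * ennreal (sqrt (x * (X - x)) * jb (g (h x) * (1 + t\<^sup>2) + c) powr - p) \<partial>lborel)"
      unfolding sub using \<beta> k by (subst nn_integral_cmult) auto
    also have "\<dots> = (\<integral>\<^sup>+t. ennreal (\<beta> * (sqrt (x * (X - x)) / sqrt k) * jb (g (h x) * (1 + t\<^sup>2) + c) powr - p) \<partial>lborel)"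
      using \<beta> k True by (intro nn_integral_cong) (simp add: ennreal_mult[symmetric] ac_simps)
    also have "\<dots> \<le> (\<integral>\<^sup>+t. ennreal (X powr (3/2) / 4 * \<beta> * jb (g (h x) * (1 + t\<^sup>2) + c) powr - p) \<partial>lborel)"
    proof (intro nn_integral_mono ennreal_leI mult_right_mono)
      have "x * (X - x) \<le> X\<^sup>2 / 4" using zero_le_power2[of "X/2 - x"] by (simp add: power2_eq_square algebra_simps)
      have "sqrt (x * (X - x)) / sqrt k = sqrt ((x * (X - x))\<^sup>2 / X)"
        unfolding k_def by (simp add: real_sqrt_divide[symmetric] power2_eq_square)
      also have "\<dots> = (x * (X - x)) / sqrt X" using True by (simp add: real_sqrt_divide)
      also have "\<dots> \<le> (X\<^sup>2 / 4) / sqrt X" by (intro divide_right_mono) (fact, use X in simp)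
      also have "\<dots> = X powr (3/2) / 4"
        using X by (simp add: powr_half_sqrt[symmetric] powr_diff[symmetric] flip: powr_numeral)
      finally have "\<beta> * (sqrt (x * (X - x)) / sqrt k) \<le> \<beta> * (X powr (3/2) / 4)"
        using \<beta> by (intro mult_left_mono) auto
      then show "\<beta> * (sqrt (x * (X - x)) / sqrt k) \<le> X powr (3/2) / 4 * \<beta>" by (simp add: ac_simps)
    qed auto
    finally show ?thesis using True unfolding ph \<beta>_def by simp
  qed auto
  have tint: "(\<integral>\<^sup>+x. (if 0 < x \<and> x < X then ennreal (X powr (3/2) / 4 * sqrt (g (h x)) * jb (g (h x) * (1 + t\<^sup>2) + c) powr - p) else 0) \<partial>lborel)
     \<le> jbint p * ennreal (jb (t\<^sup>2) powr - 1)" for t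
  proof -
    define f where "f y = ennreal (jb (y + c) powr - p)" for y
    have [measurable]: "f \<in> borel_measurable borel" unfolding f_def[abs_def] by measurable
    define G where "G u = g u * (1 + t\<^sup>2)" for u
    define G' where "G' u = g' u * (1 + t\<^sup>2)" for u
    have t1: "1 + t\<^sup>2 > 0" by (simp add: add_pos_nonneg)
    have dG: "(G has_real_derivative G' u) (at u)" for u
      unfolding G_def G'_def g_def g'_def
      by (auto intro!: derivative_eq_intros simp: algebra_simps)
    have cG: "continuous_on S G'" for S
      unfolding G'_def g'_def by (intro continuous_intros)
    have fi: "(\<integral>\<^sup>+y. f y \<partial>lborel) = jbint p" unfolding f_def by (rule nn_integral_jb_translate')
    \<comment> \<open>\<open>G\<close> is monotone on either side of 0 but not across it, hence two
      substitutions.\<close>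
    have I1: "(\<integral>\<^sup>+u. f (G u) * ennreal \<bar>G' u\<bar> * indicator {0<..<X} u \<partial>lborel) \<le> jbint p"
      unfolding fi[symmetric] using X t1
      by (intro nn_integral_substitution_le dG cG disjI1) (auto simp: G'_def g'_def is_interval_1)
    have I2: "(\<integral>\<^sup>+u. f (G u) * ennreal \<bar>G' u\<bar> * indicator {-X<..<0} u \<partial>lborel) \<le> jbint p"
    proof -
      have "g' u \<le> 0" if "u < 0" for u
      proof -
        have "u ^ 3 < 0" using that by (simp add: power_less_zero_eq)
        then have "X * u ^ 3 \<le> 0" "X ^ 3 * u \<le> 0" using that X by (auto simp: mult_le_0_iff)
        then show ?thesis unfolding g'_def by (simp add: mult.assoc)
      qed
      then show ?thesis
        unfolding fi[symmetric] using X t1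
        by (intro nn_integral_substitution_le dG cG disjI2) (auto simp: G'_def is_interval_1 mult_le_0_iff)
    qed
    \<comment> \<open>The derivative absorbs the weight: for \<open>\<bar>u\<bar> \<le> X/2\<close>
      the root \<open>sqrt (g u)\<close> is at most \<open>2 * X powr (3/2) * \<bar>u\<bar>\<close>,
      while \<open>\<bar>g' u\<bar> \<ge> X ^ 3 * \<bar>u\<bar>\<close>. The factor
      \<open>1 + t\<^sup>2\<close> of \<open>G'\<close> survives as the integrable
      \<open>jb (t\<^sup>2) powr - 1\<close>.\<close>
    have pt: "(if 0 < x \<and> x < X then ennreal (X powr (3/2) / 4 * sqrt (g (h x)) * jb (g (h x) * (1 + t\<^sup>2) + c) powr - p) else 0)
      \<le> (\<lambda>u. ennreal (1/2 * jb (t\<^sup>2) powr - 1) * (f (G u) * ennreal \<bar>G' u\<bar> * indicator {0<..<X} u + f (G u) * ennreal \<bar>G' u\<bar> * indicator {-X<..<0} u)) (- X/2 + x)" for x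
    proof (cases "0 < x \<and> x < X \<and> x \<noteq> X/2")
      case True
      define u where "u = h x"
      have u: "\<bar>u\<bar> \<le> X/2" "u \<noteq> 0" using True by (auto simp: u_def h_def abs_if)
      have hx: "- X / 2 + x = u" by (simp add: u_def h_def)
      have ind: "f (G u) * ennreal \<bar>G' u\<bar> * indicator {0<..<X} u + f (G u) * ennreal \<bar>G' u\<bar> * indicator {-X<..<0} u = f (G u) * ennreal \<bar>G' u\<bar>"
        using u X by (auto split: split_indicator simp: abs_if split: if_splits)
      have u2: "u\<^sup>2 \<le> X\<^sup>2 / 4" using u(1) abs_le_square_iff[of u "X/2"] X by (simp add: power_divide)
      have "g u = X * u\<^sup>2 * (5/2 * X\<^sup>2 + 5 * u\<^sup>2)" unfolding g_def by (simp add: power2_eq_square power3_eq_cube power4_eq_xxxx algebra_simps)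
      also have "\<dots> \<le> X * u\<^sup>2 * (4 * X\<^sup>2)"
      proof (rule mult_left_mono)
        show "5/2 * X\<^sup>2 + 5 * u\<^sup>2 \<le> 4 * X\<^sup>2" using u2 zero_le_power2[of X] by linarith
      qed (use X in auto)
      finally have "sqrt (g u) \<le> sqrt (X * u\<^sup>2 * (4 * X\<^sup>2))" by (rule real_sqrt_le_mono)
      also have "\<dots> = 2 * X * sqrt X * \<bar>u\<bar>" using X by (simp add: real_sqrt_mult)
      finally have "X powr (3/2) / 4 * sqrt (g u) \<le> X powr (3/2) / 4 * (2 * X * sqrt X * \<bar>u\<bar>)"
        by (intro mult_left_mono) auto
      also have "\<dots> = (X powr (3/2) * (X powr 1 * X powr (1/2))) * \<bar>u\<bar> / 2" using X by (simp add: powr_half_sqrt)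
      also have "X powr (3/2) * (X powr 1 * X powr (1/2)) = X ^ 3"
        unfolding powr_add[symmetric] using X by (simp flip: powr_numeral)
      also have "X ^ 3 * \<bar>u\<bar> / 2 \<le> 1/2 * \<bar>g' u\<bar>"
      proof -
        have "\<bar>g' u\<bar> = \<bar>u\<bar> * (5 * X ^ 3 + 20 * X * u\<^sup>2)"
        proof -
          have "g' u = u * (5 * X ^ 3 + 20 * X * u\<^sup>2)" unfolding g'_def by (simp add: power2_eq_square power3_eq_cube algebra_simps)
          moreover have "5 * X ^ 3 + 20 * X * u\<^sup>2 \<ge> 0" using X by simp
          ultimately show ?thesis by (simp add: abs_mult)
        qed
        also have "\<dots> \<ge> \<bar>u\<bar> * X ^ 3" using X by (intro mult_left_mono) auto
        finally show ?thesis by (simp add: ac_simps)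
      qed
      finally have le: "X powr (3/2) / 4 * sqrt (g u) \<le> 1/2 * \<bar>g' u\<bar>" .
      have j: "jb (t\<^sup>2) powr - 1 * (1 + t\<^sup>2) = 1"
        unfolding jb_def using t1 by (simp add: powr_minus powr_one)
      have "X powr (3/2) / 4 * sqrt (g u) * jb (g u * (1 + t\<^sup>2) + c) powr - p \<le> 1/2 * \<bar>g' u\<bar> * jb (G u + c) powr - p"
        unfolding G_def by (intro mult_right_mono le) auto
      also have "1/2 * \<bar>g' u\<bar> = (1/2 * jb (t\<^sup>2) powr - 1) * \<bar>G' u\<bar>"
      proof -
        have "(1/2 * jb (t\<^sup>2) powr - 1) * \<bar>G' u\<bar> = 1/2 * \<bar>g' u\<bar> * (jb (t\<^sup>2) powr - 1 * (1 + t\<^sup>2))"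
          unfolding G'_def using t1 by (simp only: abs_mult abs_of_pos ac_simps)
        then show ?thesis unfolding j by simp
      qed
      finally have "ennreal (X powr (3/2) / 4 * sqrt (g u) * jb (g u * (1 + t\<^sup>2) + c) powr - p) \<le>
        ennreal ((1/2 * jb (t\<^sup>2) powr - 1) * \<bar>G' u\<bar> * jb (G u + c) powr - p)" by (rule ennreal_leI)
      also have "\<dots> = ennreal (1/2 * jb (t\<^sup>2) powr - 1) * (f (G u) * ennreal \<bar>G' u\<bar>)"
        unfolding f_def by (subst ennreal_mult, simp, simp, subst ennreal_mult, simp, simp) (simp only: ac_simps)
      finally show ?thesis using True unfolding hx ind by (simp add: u_def)
    next
      case False
      have "g 0 = 0" unfolding g_def by simp
      then show ?thesis using False X by (auto simp: h_def)
    qed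
    have "(\<integral>\<^sup>+x. (if 0 < x \<and> x < X then ennreal (X powr (3/2) / 4 * sqrt (g (h x)) * jb (g (h x) * (1 + t\<^sup>2) + c) powr - p) else 0) \<partial>lborel)
      \<le> (\<integral>\<^sup>+x. (\<lambda>u. ennreal (1/2 * jb (t\<^sup>2) powr - 1) * (f (G u) * ennreal \<bar>G' u\<bar> * indicator {0<..<X} u + f (G u) * ennreal \<bar>G' u\<bar> * indicator {-X<..<0} u)) (- X/2 + x) \<partial>lborel)"
      by (rule nn_integral_mono) (rule pt)
    also have "\<dots> = (\<integral>\<^sup>+u. ennreal (1/2 * jb (t\<^sup>2) powr - 1) * (f (G u) * ennreal \<bar>G' u\<bar> * indicator {0<..<X} u + f (G u) * ennreal \<bar>G' u\<bar> * indicator {-X<..<0} u) \<partial>lborel)"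
      by (rule nn_integral_lborel_translate) (unfold G_def G'_def g'_def, measurable)
    also have "\<dots> = ennreal (1/2 * jb (t\<^sup>2) powr - 1) * ((\<integral>\<^sup>+u. f (G u) * ennreal \<bar>G' u\<bar> * indicator {0<..<X} u \<partial>lborel) + (\<integral>\<^sup>+u. f (G u) * ennreal \<bar>G' u\<bar> * indicator {-X<..<0} u \<partial>lborel))"
    proof -
      have [measurable]: "G \<in> borel_measurable borel" "G' \<in> borel_measurable borel"
        unfolding G_def[abs_def] G'_def[abs_def] g'_def by measurable
      show ?thesis by (subst nn_integral_cmult, measurable, subst nn_integral_add) auto
    qed
    also have "\<dots> \<le> ennreal (1/2 * jb (t\<^sup>2) powr - 1) * (jbint p + jbint p)"
      by (intro mult_left_mono add_mono I1 I2) auto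
    also have "\<dots> = ennreal (1/2 * jb (t\<^sup>2) powr - 1) * (ennreal 2 * jbint p)"
      by (simp add: mult_2[symmetric])
    also have "\<dots> = (ennreal (1/2 * jb (t\<^sup>2) powr - 1) * ennreal 2) * jbint p" by (simp only: mult.assoc)
    also have "ennreal (1/2 * jb (t\<^sup>2) powr - 1) * ennreal 2 = ennreal (jb (t\<^sup>2) powr - 1)"
      by (subst ennreal_mult[symmetric]) auto
    finally show ?thesis by (simp add: ac_simps)
  qed
  have "(\<integral>\<^sup>+x. \<integral>\<^sup>+m. (if 0 < x \<and> x < X then ennreal (sqrt (x * (X - x)) * jb (phase (x, m) + phase (X - x, M - m) + T) powr - p) else 0) \<partial>lborel \<partial>lborel)
    \<le> (\<integral>\<^sup>+x. \<integral>\<^sup>+t. (if 0 < x \<and> x < X then ennreal (X powr (3/2) / 4 * sqrt (g (h x)) * jb (g (h x) * (1 + t\<^sup>2) + c) powr - p) else 0) \<partial>lborel \<partial>lborel)"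
  proof (rule nn_integral_mono_AE)
    have "AE x in lborel. x \<noteq> X / 2" by (rule AE_lborel_singleton)
    then show "AE x in lborel. (\<integral>\<^sup>+m. (if 0 < x \<and> x < X then ennreal (sqrt (x * (X - x)) * jb (phase (x, m) + phase (X - x, M - m) + T) powr - p) else 0) \<partial>lborel)
    \<le> (\<integral>\<^sup>+t. (if 0 < x \<and> x < X then ennreal (X powr (3/2) / 4 * sqrt (g (h x)) * jb (g (h x) * (1 + t\<^sup>2) + c) powr - p) else 0) \<partial>lborel)"
      by eventually_elim (rule inner)
  qed
  also have "\<dots> = (\<integral>\<^sup>+t. \<integral>\<^sup>+x. (if 0 < x \<and> x < X then ennreal (X powr (3/2) / 4 * sqrt (g (h x)) * jb (g (h x) * (1 + t\<^sup>2) + c) powr - p) else 0) \<partial>lborel \<partial>lborel)"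
    by (rule nn_integral_lborel_swap) measurable
  also have "\<dots> \<le> (\<integral>\<^sup>+t. jbint p * ennreal (jb (t\<^sup>2) powr - 1) \<partial>lborel)"
    by (rule nn_integral_mono) (rule tint)
  also have "\<dots> = jbint p * (\<integral>\<^sup>+t. ennreal (jb (t\<^sup>2) powr - 1) \<partial>lborel)"
    by (rule nn_integral_cmult) measurable
  finally show ?thesis .
qed

lemma tri_bounded_kS_same_sign:
  assumes b: "b > 1/2"
  shows "tri_bounded (\<lambda>z w. kS b z * kS b w)"
proof -
  define J where "J = (\<integral>\<^sup>+u. ennreal (jb (u\<^sup>2) powr - 1) \<partial>lborel)"
  define K1 where "K1 = ennreal (2 powr (2 * b)) * (2 * jbint (2 * b))"
  have Jfin: "J < \<top>" unfolding J_def by (rule nn_integral_jb_square_finite) simp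
  show ?thesis
  proof (rule tri_bounded_CS[where C="K1 * (jbint (2 * b) * J)"])
    show "K1 * (jbint (2 * b) * J) < \<top>" unfolding K1_def using Jfin jbint_finite[of "2 * b"] b by (simp add: ennreal_mult_less_top)
    fix z :: freq
    obtain X M T where z: "z = ((X, M), T)" by (metis prod.collapse)
    have step1: "(\<integral>\<^sup>+t. (kS b ((x, m), t) * kS b (z - ((x, m), t)))\<^sup>2 \<partial>lborel) \<le>
       K1 * (if 0 < x \<and> x < X then ennreal (sqrt (x * (X - x)) * jb (phase (x, m) + phase (X - x, M - m) + T) powr - (2 * b)) else 0)" for x m
    proof (cases "0 < x \<and> x < X")
      case True
      have sq: "(jb a powr - b)\<^sup>2 = jb a powr - (2 * b)" for a
        using jb_pos[of a] by (simp add: powr_powr mult.commute flip: powr_numeral)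
      have sq4: "(a powr (1/4))\<^sup>2 = sqrt a" if "a > 0" for a :: real
        using that by (simp add: powr_powr powr_half_sqrt[symmetric] flip: powr_numeral)
      have "(\<integral>\<^sup>+t. (kS b ((x, m), t) * kS b (z - ((x, m), t)))\<^sup>2 \<partial>lborel) =
        (\<integral>\<^sup>+t. ennreal (sqrt (x * (X - x))) * ennreal (jb (sg ((x, m), t)) powr - (2*b) * jb (sg (((X, M), T) - ((x, m), t))) powr - (2*b)) \<partial>lborel)"
        using True unfolding kS_def z
        by (intro nn_integral_cong) (simp add: ennreal_power ennreal_mult[symmetric] jb_nonneg power_mult_distrib sq sq4 real_sqrt_mult ac_simps)
      also have "\<dots> = ennreal (sqrt (x * (X - x))) * (\<integral>\<^sup>+t. ennreal (jb (sg ((x, m), t)) powr - (2*b) * jb (sg (((X, M), T) - ((x, m), t))) powr - (2*b)) \<partial>lborel)"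
        by (rule nn_integral_cmult) measurable
      also have "\<dots> \<le> ennreal (sqrt (x * (X - x))) * (K1 * ennreal (jb (phase (x, m) + phase ((X, M) - (x, m)) + T) powr - (2*b)))"
        using nn_integral_jb_sg_conv_le[of "2*b" "2*b" "(x, m)" "(X, M)" T] b unfolding K1_def
        by (intro mult_left_mono) auto
      also have "\<dots> = K1 * ennreal (sqrt (x * (X - x)) * jb (phase (x, m) + phase (X - x, M - m) + T) powr - (2 * b))"
        using True by (subst ennreal_mult) (auto simp: ac_simps)
      finally show ?thesis using True by simp
    next
      case False
      then have "kS b ((x, m), t) * kS b (z - ((x, m), t)) = 0" for t unfolding kS_def z by auto
      then have "(\<integral>\<^sup>+t. (kS b ((x, m), t) * kS b (z - ((x, m), t)))\<^sup>2 \<partial>lborel) = 0" by (simp only:) simp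
      then show ?thesis by simp
    qed
    have "(\<integral>\<^sup>+x. (kS b x * kS b (z - x))\<^sup>2 \<partial>lborel) = (\<integral>\<^sup>+x. \<integral>\<^sup>+m. \<integral>\<^sup>+t. (kS b ((x, m), t) * kS b (z - ((x, m), t)))\<^sup>2 \<partial>lborel \<partial>lborel \<partial>lborel)"
      by (rule nn_integral_freq) measurable
    also have "\<dots> \<le> (\<integral>\<^sup>+x. \<integral>\<^sup>+m. K1 * (if 0 < x \<and> x < X then ennreal (sqrt (x * (X - x)) * jb (phase (x, m) + phase (X - x, M - m) + T) powr - (2 * b)) else 0) \<partial>lborel \<partial>lborel)"
      by (intro nn_integral_mono) (rule step1)
    also have "\<dots> = K1 * (\<integral>\<^sup>+x. \<integral>\<^sup>+m. (if 0 < x \<and> x < X then ennreal (sqrt (x * (X - x)) * jb (phase (x, m) + phase (X - x, M - m) + T) powr - (2 * b)) else 0) \<partial>lborel \<partial>lborel)"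
      by (subst nn_integral_cmult, measurable, subst nn_integral_cmult, measurable)
    also have "\<dots> \<le> K1 * (jbint (2 * b) * J)"
    proof (cases "X > 0")
      case True
      show ?thesis unfolding J_def using b by (intro mult_left_mono nn_integral_same_sign_le True) auto
    next
      case False
      then have "(0 < x \<and> x < X) = False" for x by auto
      then show ?thesis by (simp only: if_False) simp
    qed
    finally show "(\<integral>\<^sup>+x. (kS b x * kS b (z - x))\<^sup>2 \<partial>lborel) \<le> K1 * (jbint (2 * b) * J)" .
  qed measurable
qed

text \<open>For a product kernel \<open>k\<close> and \<open>l\<close> can be absorbed into
  \<open>f\<close> and \<open>g\<close>, and then \<open>sqint_trisum_reflect\<close> applies. This
  carries the bound for equal signs over to opposite signs, where the phase sum is a difference
  rather than a sum of two squares.\<close>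

lemma tri_bounded_reflect_second:
  assumes [measurable]: "k \<in> borel_measurable borel" "l \<in> borel_measurable borel"
    and K: "tri_bounded (\<lambda>x y. k x * l y)"
  shows "tri_bounded (\<lambda>x y. k x * l (- y))"
proof -
  obtain C where C: "C < \<top>" "\<And>f g. f \<in> borel_measurable borel \<Longrightarrow> g \<in> borel_measurable borel \<Longrightarrow>
      sqint (trisum (\<lambda>x y. k x * l y) f g) \<le> C * (sqint f * sqint g)"
    using K by (rule tri_bounded_trisum) blast
  show ?thesis
  proof (rule tri_bounded_if_trisum[OF _ C(1)])
    fix f g :: "'a \<Rightarrow> ennreal"
    assume [measurable]: "f \<in> borel_measurable borel" "g \<in> borel_measurable borel"
    let ?h = "\<lambda>y. l y * g (- y)"
    have "trisum (\<lambda>x y. k x * l (- y)) f g = trisum (\<lambda>_ _. 1) (\<lambda>x. k x * f x) (\<lambda>y. ?h (- y))"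
      unfolding trisum_def by (simp add: ac_simps)
    then have "sqint (trisum (\<lambda>x y. k x * l (- y)) f g) = sqint (trisum (\<lambda>_ _. 1) (\<lambda>x. k x * f x) ?h)"
      by (simp only:) (rule sqint_trisum_reflect, measurable)
    also have "trisum (\<lambda>_ _. 1) (\<lambda>x. k x * f x) ?h = trisum (\<lambda>x y. k x * l y) f (\<lambda>y. g (- y))"
      unfolding trisum_def by (simp add: ac_simps)
    also have "sqint \<dots> \<le> C * (sqint f * sqint (\<lambda>y. g (- y)))" by (rule C(2)) measurable
    finally show "sqint (trisum (\<lambda>x y. k x * l (- y)) f g) \<le> C * (sqint f * sqint g)"
      by (simp add: sqint_uminus)
  qed measurable
qed

text \<open>Kernel form of the L4 Strichartz estimate with a gain of a quarter derivative on each
  factor: by Plancherel it bounds the L2 norm of a product.\<close>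

definition KS :: "real \<Rightarrow> freq \<Rightarrow> freq \<Rightarrow> ennreal" where
  "KS b z w = ennreal ((\<bar>xi z\<bar> powr (1/4) * \<bar>xi w\<bar> powr (1/4)) * (jb (sg z) powr - b * jb (sg w) powr - b))"

lemma tri_bounded_KS:
  assumes b: "b > 1/2"
  shows "tri_bounded (KS b)"
proof -
  let ?k = "kS b"
  note pp = tri_bounded_kS_same_sign[OF b]
  have pm: "tri_bounded (\<lambda>z w. ?k z * ?k (- w))" by (rule tri_bounded_reflect_second[OF _ _ pp]) measurable
  have mp: "tri_bounded (\<lambda>z w. ?k (- z) * ?k w)"
    using tri_bounded_swap[OF pm] by (simp add: mult.commute)
  have mm: "tri_bounded (\<lambda>z w. ?k (- z) * ?k (- w))" using tri_bounded_uminus[OF pp] by simp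
  have "tri_bounded (\<lambda>z w. (?k z * ?k w + ?k z * ?k (- w)) + (?k (- z) * ?k w + ?k (- z) * ?k (- w)))"
    by (intro tri_bounded_add pp pm mp mm)
  moreover have "KS b z w = (?k z * ?k w + ?k z * ?k (- w)) + (?k (- z) * ?k w + ?k (- z) * ?k (- w))" for z w
    unfolding KS_def kS_def
    by (cases "xi z" "0::real" rule: linorder_cases; cases "xi w" "0::real" rule: linorder_cases)
       (auto simp: ennreal_mult[symmetric] ac_simps)
  ultimately show ?thesis by presburger
qed

section \<open>The transversal kernel\<close>

text \<open>The variables are slopes: \<alpha> is \<open>mu / xi\<close> for the input of frequency
  \<eta>, and \<open>a\<close> for the sum of frequency \<open>X\<close>. The resonance is then
  \<open>resf\<close>, which vanishes on \<open>(\<alpha> - a)\<^sup>2 = Ef \<eta> X\<close>.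
  \<open>Ed\<close> is the derivative of \<open>Ef\<close> in \<open>X\<close>, and
  \<open>Gf\<close> solves \<open>resf = r\<close> for the modulus of the slope difference.\<close>

definition Ef :: "real \<Rightarrow> real \<Rightarrow> real" where
  "Ef \<eta> X = 5 * (X - \<eta>)\<^sup>2 * (X\<^sup>2 - X * \<eta> + \<eta>\<^sup>2)"

definition Ed :: "real \<Rightarrow> real \<Rightarrow> real" where
  "Ed \<eta> X = 5 * (X - \<eta>) * (4 * X\<^sup>2 - 5 * X * \<eta> + 3 * \<eta>\<^sup>2)"

definition resf :: "real \<Rightarrow> real \<Rightarrow> real \<Rightarrow> real \<Rightarrow> real" where
  "resf \<eta> \<alpha> X a = ((\<alpha> - a)\<^sup>2 - Ef \<eta> X) / (1 / \<eta> - 1 / X)"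

definition Gf :: "real \<Rightarrow> real \<Rightarrow> real \<Rightarrow> real" where
  "Gf \<eta> r X = sqrt (Ef \<eta> X + r * (1 / \<eta> - 1 / X))"

lemma Ef_deriv: "(Ef \<eta> has_real_derivative Ed \<eta> X) (at X)"
  unfolding Ef_def Ed_def
  by (auto intro!: derivative_eq_intros simp: power2_eq_square algebra_simps)

lemma resonance_eq:
  assumes "\<eta> \<noteq> 0" "X \<noteq> 0" "X - \<eta> \<noteq> 0"
  shows "phase (\<eta>, \<eta> * \<alpha>) + phase (X - \<eta>, X * a - \<eta> * \<alpha>) - phase (X, X * a) = resf \<eta> \<alpha> X a"
proof -
  have d: "1 / \<eta> - 1 / X = (X - \<eta>) / (\<eta> * X)" using assms by (simp add: field_simps)
  have 1: "\<eta> * X * ((\<eta> * \<alpha> - \<eta> * (X * a) / X)\<^sup>2 / \<eta>\<^sup>2) / (X - \<eta>) = X / (\<eta> * (X - \<eta>)) * (\<eta> * \<alpha> - \<eta> * (X * a) / X)\<^sup>2"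
    using assms by (simp add: power2_eq_square)
  have 2: "(\<eta> * \<alpha> - \<eta> * (X * a) / X)\<^sup>2 / \<eta>\<^sup>2 = (\<alpha> - a)\<^sup>2"
  proof -
    have "\<eta> * \<alpha> - \<eta> * (X * a) / X = \<eta> * (\<alpha> - a)" using assms by (simp add: algebra_simps)
    then show ?thesis using assms by (simp add: power_mult_distrib)
  qed
  have 3: "\<eta> ^ 5 + (X - \<eta>) ^ 5 - X ^ 5 = - (\<eta> * X * Ef \<eta> X / (X - \<eta>))"
  proof -
    have "\<eta> * X * Ef \<eta> X / (X - \<eta>) = 5 * \<eta> * X * (X - \<eta>) * (X\<^sup>2 - X * \<eta> + \<eta>\<^sup>2)"
      unfolding Ef_def using assms by (simp add: power2_eq_square)
    then show ?thesis by (simp add: power2_eq_square eval_nat_numeral algebra_simps)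
  qed
  have "phase (\<eta>, \<eta> * \<alpha>) + phase (X - \<eta>, X * a - \<eta> * \<alpha>) - phase (X, X * a) =
    \<eta> * X * (\<alpha> - a)\<^sup>2 / (X - \<eta>) + (\<eta> ^ 5 + (X - \<eta>) ^ 5 - X ^ 5)"
    unfolding phase_sum[OF assms(1,3,2)] 1[symmetric] 2 by (simp add: phase_def)
  also have "\<dots> = \<eta> * X * ((\<alpha> - a)\<^sup>2 - Ef \<eta> X) / (X - \<eta>)"
    unfolding 3 by (simp add: right_diff_distrib diff_divide_distrib)
  also have "\<dots> = ((\<alpha> - a)\<^sup>2 - Ef \<eta> X) / ((X - \<eta>) / (\<eta> * X))"
    by (simp only: divide_divide_eq_right mult.commute)
  also have "\<dots> = ((\<alpha> - a)\<^sup>2 - Ef \<eta> X) / (1 / \<eta> - 1 / X)" unfolding d ..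
  finally show ?thesis unfolding resf_def .
qed

section \<open>Size and growth of the slope difference on a level set of the resonance\<close>

context
  fixes \<eta> X :: real
  assumes \<eta>: "0 < \<eta>" and X: "19/10 * \<eta> < X"
begin

text \<open>In the ordered region with positive frequencies the sum is at least twice the smaller
  one. The factor 19/10 keeps a margin, so that the conditions on \<open>X\<close> can be strict and
  define open sets.\<close>

lemma LW_Xpos: "0 < X" and LW_diff: "9/19 * X \<le> X - \<eta>" and LW_eta_le: "\<eta> \<le> 10/19 * X"
  using \<eta> X by auto

lemma LW_Ef_ge: "8/10 * X ^ 4 \<le> Ef \<eta> X" and LW_Ef_le: "Ef \<eta> X \<le> 5 * X ^ 4"
proof -
  have q: "3/4 * X\<^sup>2 \<le> X\<^sup>2 - X * \<eta> + \<eta>\<^sup>2"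
    using zero_le_power2[of "\<eta> - X/2"] by (simp add: power2_eq_square algebra_simps)
  have "(9/19 * X)\<^sup>2 \<le> (X - \<eta>)\<^sup>2" using LW_diff LW_Xpos by (intro power_mono) auto
  then have "(9/19 * X)\<^sup>2 * (3/4 * X\<^sup>2) \<le> (X - \<eta>)\<^sup>2 * (X\<^sup>2 - X * \<eta> + \<eta>\<^sup>2)"
    using q by (intro mult_mono) auto
  moreover have e: "(9/19 * X)\<^sup>2 * (3/4 * X\<^sup>2) = 243/1444 * X ^ 4" by (simp add: power2_eq_square power4_eq_xxxx)
  ultimately have "243/1444 * X ^ 4 \<le> (X - \<eta>)\<^sup>2 * (X\<^sup>2 - X * \<eta> + \<eta>\<^sup>2)" by (simp only: e)
  then show "8/10 * X ^ 4 \<le> Ef \<eta> X" unfolding Ef_def mult.assoc using zero_less_power[OF LW_Xpos, of 4]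
    by linarith
  have "\<eta>\<^sup>2 \<le> X * \<eta>" using \<eta> X by (simp add: power2_eq_square)
  then have "X\<^sup>2 - X * \<eta> + \<eta>\<^sup>2 \<le> X\<^sup>2" by simp
  moreover have "(X - \<eta>)\<^sup>2 \<le> X\<^sup>2" using \<eta> X by (intro power_mono) auto
  ultimately have "(X - \<eta>)\<^sup>2 * (X\<^sup>2 - X * \<eta> + \<eta>\<^sup>2) \<le> X\<^sup>2 * X\<^sup>2"
    using q zero_le_power2[of X] by (intro mult_mono) auto
  then show "Ef \<eta> X \<le> 5 * X ^ 4" unfolding Ef_def by (simp add: power2_eq_square power4_eq_xxxx mult.assoc)
qed

lemma LW_d: "0 < 1 / \<eta> - 1 / X" "1 / \<eta> - 1 / X < 1 / \<eta>"
  using \<eta> X by (auto simp: field_simps)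

text \<open>The second summand is reserved for absorbing \<open>r / X\<^sup>2\<close>, whose modulus
  is at most \<open>3/5 * \<eta> * X\<^sup>2\<close>.\<close>

lemma LW_Ed_ge: "4 * X ^ 3 + 6/10 * \<eta> * X\<^sup>2 \<le> Ed \<eta> X"
proof -
  have "(2 * X - 3 * \<eta>) * (X - \<eta>) \<ge> 0" using \<eta> X by (intro mult_nonneg_nonneg) auto
  then have "2 * X\<^sup>2 \<le> 4 * X\<^sup>2 - 5 * X * \<eta> + 3 * \<eta>\<^sup>2" by (simp add: power2_eq_square algebra_simps)
  then have "(9/19 * X) * (2 * X\<^sup>2) \<le> (X - \<eta>) * (4 * X\<^sup>2 - 5 * X * \<eta> + 3 * \<eta>\<^sup>2)"
    using LW_diff LW_Xpos by (intro mult_mono) auto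
  moreover have "(9/19 * X) * (2 * X\<^sup>2) = 18/19 * X ^ 3" by (simp add: power2_eq_square power3_eq_cube)
  ultimately have "90/19 * X ^ 3 \<le> Ed \<eta> X" unfolding Ed_def mult.assoc by linarith
  moreover have "\<eta> * X\<^sup>2 \<le> (10/19 * X) * X\<^sup>2" using LW_eta_le by (intro mult_right_mono) auto
  then have "\<eta> * X\<^sup>2 \<le> 10/19 * X ^ 3" by (simp add: power2_eq_square power3_eq_cube)
  moreover have "X ^ 3 > 0" using LW_Xpos by simp
  ultimately show ?thesis unfolding mult.assoc by linarith
qed

context
  fixes r :: real
  assumes r: "\<bar>r\<bar> < 3/5 * \<eta> * X ^ 4"
begin

text \<open>This explains the cut at \<open>3/5 * \<eta> * X ^ 4\<close>: the perturbation stays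
  below \<open>Ef \<eta> X \<ge> 8/10 * X ^ 4\<close>, so the radicand of \<open>Gf\<close> keeps
  the size of \<open>X ^ 4\<close>.\<close>

lemma LW_rd: "\<bar>r * (1 / \<eta> - 1 / X)\<bar> \<le> 3/5 * X ^ 4"
proof -
  have "\<bar>r * (1 / \<eta> - 1 / X)\<bar> = \<bar>r\<bar> * (1 / \<eta> - 1 / X)" using LW_d by (simp add: abs_mult)
  also have "\<dots> \<le> (3/5 * \<eta> * X ^ 4) * (1 / \<eta>)" using r LW_d \<eta> by (intro mult_mono) auto
  finally show ?thesis using \<eta> by simp
qed

lemma LW_U: "2/10 * X ^ 4 \<le> Ef \<eta> X + r * (1 / \<eta> - 1 / X)" "Ef \<eta> X + r * (1 / \<eta> - 1 / X) \<le> 6 * X ^ 4"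
  using LW_rd LW_Ef_ge LW_Ef_le zero_less_power[OF LW_Xpos, of 4] by linarith+

lemma LW_Upos: "0 < Ef \<eta> X + r * (1 / \<eta> - 1 / X)"
  using LW_U zero_less_power[OF LW_Xpos, of 4] by linarith

lemma LW_G_sq: "(Gf \<eta> r X)\<^sup>2 = Ef \<eta> X + r * (1 / \<eta> - 1 / X)"
  unfolding Gf_def using LW_Upos by simp

lemma LW_Gpos: "0 < Gf \<eta> r X"
  unfolding Gf_def using LW_Upos by simp

lemma LW_G_ge: "2/5 * X\<^sup>2 \<le> Gf \<eta> r X"
proof (rule power2_le_imp_le)
  have "(2/5 * X\<^sup>2)\<^sup>2 = 4/25 * X ^ 4" by (simp add: power_mult_distrib power2_eq_square power4_eq_xxxx)
  then show "(2/5 * X\<^sup>2)\<^sup>2 \<le> (Gf \<eta> r X)\<^sup>2" unfolding LW_G_sq using LW_U zero_less_power[OF LW_Xpos, of 4]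
    by linarith
qed (use LW_Gpos in simp)

lemma LW_G_le: "Gf \<eta> r X \<le> 5/2 * X\<^sup>2"
proof (rule power2_le_imp_le)
  have "(5/2 * X\<^sup>2)\<^sup>2 = 25/4 * X ^ 4" by (simp add: power_mult_distrib power2_eq_square power4_eq_xxxx)
  then show "(Gf \<eta> r X)\<^sup>2 \<le> (5/2 * X\<^sup>2)\<^sup>2" unfolding LW_G_sq using LW_U zero_less_power[OF LW_Xpos, of 4]
    by linarith
qed simp

lemma LW_G_deriv:
  "((\<lambda>X. Gf \<eta> r X) has_real_derivative (Ed \<eta> X + r / X\<^sup>2) / (2 * Gf \<eta> r X)) (at X)"
proof -
  have "((\<lambda>X. Ef \<eta> X + r * (1 / \<eta> - 1 / X)) has_real_derivative Ed \<eta> X + r / X\<^sup>2) (at X)"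
    using LW_Xpos by (auto intro!: derivative_eq_intros Ef_deriv simp: power2_eq_square field_simps)
  from DERIV_chain2[OF DERIV_real_sqrt[OF LW_Upos] this] show ?thesis
    unfolding Gf_def by (simp add: field_simps)
qed

text \<open>Uniformly in \<open>r\<close>, the level set of the first resonance is tilted in the
  variable \<open>X\<close>; this is one of the transversality factors of the Jacobian in
  \<open>LW_outer\<close>.\<close>

lemma LW_Gd_ge: "4/5 * X \<le> (Ed \<eta> X + r / X\<^sup>2) / (2 * Gf \<eta> r X)"
proof -
  have "\<bar>r / X\<^sup>2\<bar> \<le> 3/5 * \<eta> * X\<^sup>2"
    using r LW_Xpos by (simp add: abs_divide field_simps power2_eq_square power4_eq_xxxx)
  then have 1: "4 * X ^ 3 \<le> Ed \<eta> X + r / X\<^sup>2" using LW_Ed_ge by linarith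
  have "4/5 * X * (2 * Gf \<eta> r X) \<le> 4/5 * X * (2 * (5/2 * X\<^sup>2))"
    using LW_G_le LW_Xpos by (intro mult_left_mono) auto
  also have "\<dots> = 4 * X ^ 3" by (simp add: power2_eq_square power3_eq_cube)
  also note 1
  finally show ?thesis using LW_Gpos by (subst pos_le_divide_eq) auto
qed

end
end

text \<open>Dropping the square bounds \<open>resf\<close> below by its value at equal slopes.
  Multiplied by \<open>X\<close>, the remainder factors as \<open>5 * (X - \<eta>') * ((2 * X -
  \<eta>') * (X\<^sup>2 + (X - \<eta>')\<^sup>2))\<close>. The sign makes the two parts of the
  derivative in \<open>LW_outer\<close> add up instead of cancelling.\<close>

lemma LW_sign:
  assumes \<eta>': "0 < \<eta>'" "\<eta>' < X"
  shows "0 \<le> Ed \<eta>' X + resf \<eta>' \<beta> X a / X\<^sup>2"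
proof -
  have Xp: "X > 0" using assms by simp
  have d: "1 / \<eta>' - 1 / X = (X - \<eta>') / (\<eta>' * X)" "0 < 1 / \<eta>' - 1 / X" using assms by (auto simp: field_simps)
  have "- Ef \<eta>' X / (1 / \<eta>' - 1 / X) \<le> resf \<eta>' \<beta> X a"
    unfolding resf_def using d(2) by (intro divide_right_mono) auto
  then have "- Ef \<eta>' X / (1 / \<eta>' - 1 / X) / X\<^sup>2 \<le> resf \<eta>' \<beta> X a / X\<^sup>2" by (intro divide_right_mono) auto
  moreover have "- Ef \<eta>' X / (1 / \<eta>' - 1 / X) / X\<^sup>2 = - (5 * (X - \<eta>') * (X\<^sup>2 - X * \<eta>' + \<eta>'\<^sup>2) * \<eta>' / X)"
    unfolding d(1) Ef_def using assms by (simp add: power2_eq_square)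
  moreover have "Ed \<eta>' X - 5 * (X - \<eta>') * (X\<^sup>2 - X * \<eta>' + \<eta>'\<^sup>2) * \<eta>' / X = 5 * (X - \<eta>') * ((2 * X - \<eta>') * (X\<^sup>2 + (X - \<eta>')\<^sup>2)) / X"
  proof -
    have "X * Ed \<eta>' X - 5 * (X - \<eta>') * (X\<^sup>2 - X * \<eta>' + \<eta>'\<^sup>2) * \<eta>' = 5 * (X - \<eta>') * ((2 * X - \<eta>') * (X\<^sup>2 + (X - \<eta>')\<^sup>2))"
      unfolding Ed_def by (simp add: power2_eq_square algebra_simps)
    from this[symmetric] show ?thesis using Xp by (simp add: diff_divide_distrib)
  qed
  moreover have "5 * (X - \<eta>') * ((2 * X - \<eta>') * (X\<^sup>2 + (X - \<eta>')\<^sup>2)) / X \<ge> 0"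
    using assms by (intro divide_nonneg_pos mult_nonneg_nonneg add_nonneg_nonneg) auto
  ultimately show ?thesis by linarith
qed

text \<open>Here \<eta>' is the larger input frequency and \<open>k = X - \<eta>'\<close> the
  smaller. A small resonance keeps \<open>(a - \<beta>)\<^sup>2\<close> near
  \<open>Ef \<eta>' X\<close>, which is at least \<open>15/4 * k\<^sup>2 * X\<^sup>2\<close>; the
  error is at most \<open>19/15 * k\<^sup>2 * X\<^sup>2\<close>, and the difference exceeds
  \<open>9/4 * k\<^sup>2 * X\<^sup>2\<close>.\<close>

lemma LW_second_ge:
  assumes \<eta>': "\<eta>' < X" "19/10 * (X - \<eta>') < X" and R: "\<bar>resf \<eta>' \<beta> X a\<bar> < 3/5 * (X - \<eta>') * X ^ 4"
  shows "3/2 * (X - \<eta>') * X \<le> \<bar>a - \<beta>\<bar>"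
proof -
  have e: "9/19 * X < \<eta>'" "0 < \<eta>'" "0 < X" using \<eta>' by auto
  define k where "k = X - \<eta>'"
  have k: "0 < k" using \<eta>' by (simp add: k_def)
  have d: "1 / \<eta>' - 1 / X = k / (\<eta>' * X)" "0 < 1 / \<eta>' - 1 / X" using e \<eta>' by (auto simp: k_def field_simps)
  have "n = n / c * c" if "c \<noteq> 0" for n c :: real using that by simp
  then have "(\<beta> - a)\<^sup>2 - Ef \<eta>' X = resf \<eta>' \<beta> X a * (1 / \<eta>' - 1 / X)"
    unfolding resf_def using less_imp_neq[OF d(2)] by metis
  then have eq: "(a - \<beta>)\<^sup>2 = Ef \<eta>' X + resf \<eta>' \<beta> X a * (1 / \<eta>' - 1 / X)" by (simp add: power2_commute)
  have "3/4 * X\<^sup>2 \<le> X\<^sup>2 - X * \<eta>' + \<eta>'\<^sup>2"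
    using zero_le_power2[of "\<eta>' - X/2"] by (simp add: power2_eq_square algebra_simps)
  then have "5 * k\<^sup>2 * (3/4 * X\<^sup>2) \<le> Ef \<eta>' X" unfolding Ef_def k_def[symmetric] by (intro mult_left_mono) auto
  moreover have "\<bar>resf \<eta>' \<beta> X a * (1 / \<eta>' - 1 / X)\<bar> \<le> 3/5 * k * X ^ 4 * (19/9 * k / X\<^sup>2)"
  proof -
    have "k / (\<eta>' * X) \<le> k / (9/19 * X * X)" using e k by (intro divide_left_mono mult_right_mono mult_pos_pos) auto
    also have "\<dots> = 19/9 * k / X\<^sup>2" by (simp add: power2_eq_square)
    finally have "1 / \<eta>' - 1 / X \<le> 19/9 * k / X\<^sup>2" using d by simp
    then show ?thesis using R d k e unfolding abs_mult k_def[symmetric] by (intro mult_mono) auto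
  qed
  moreover have "3/5 * k * X ^ 4 * (19/9 * k / X\<^sup>2) = 19/15 * k\<^sup>2 * X\<^sup>2"
    using e by (simp add: power2_eq_square power4_eq_xxxx)
  ultimately have "(9/4) * (k\<^sup>2 * X\<^sup>2) \<le> (a - \<beta>)\<^sup>2"
    unfolding eq using mult_nonneg_nonneg[OF zero_le_power2[of k] zero_le_power2[of X]] by linarith
  then have "(3/2 * k * X)\<^sup>2 \<le> \<bar>a - \<beta>\<bar>\<^sup>2" by (simp add: power_mult_distrib power_divide)
  then show ?thesis unfolding k_def[symmetric] by (rule power2_le_imp_le) simp
qed


text \<open>Substitution \<open>r = resf \<eta> \<alpha> X a\<close> on the half-line where
  \<open>\<alpha> - a\<close> has sign \<open>s\<close>, inverted there by
  \<open>a = \<alpha> - s * Gf \<eta> r X\<close>. The Jacobian is at least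
  \<open>4/5 * \<eta> * X\<^sup>2\<close>, which pays for the drop from
  \<open>\<eta> * X ^ 6\<close> to \<open>2 * X ^ 4\<close>.\<close>

lemma LW_inner:
  fixes f :: "real \<Rightarrow> real" and P :: "real \<Rightarrow> bool"
  assumes \<eta>: "0 < \<eta>" and X: "19/10 * \<eta> < X" and s: "s = 1 \<or> s = (- 1 :: real)"
    and f: "\<And>a. 0 \<le> f a"
    and [measurable]: "f \<in> borel_measurable borel" "Measurable.pred borel P"
  shows "(\<integral>\<^sup>+a. (if 0 < s * (\<alpha> - a) \<and> \<bar>resf \<eta> \<alpha> X a\<bar> < 3/5 * \<eta> * X ^ 4 \<and> P a
       then ennreal (\<eta> * X ^ 6 * (jb (resf \<eta> \<alpha> X a - c) powr - q * f a)) else 0) \<partial>lborel)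
    \<le> (\<integral>\<^sup>+r. (if \<bar>r\<bar> < 3/5 * \<eta> * X ^ 4 \<and> P (\<alpha> - s * Gf \<eta> r X)
       then ennreal (2 * X ^ 4 * (jb (r - c) powr - q * f (\<alpha> - s * Gf \<eta> r X))) else 0) \<partial>lborel)"
  (is "(\<integral>\<^sup>+a. ?L a \<partial>lborel) \<le> (\<integral>\<^sup>+r. ?R r \<partial>lborel)")
proof -
  define d where "d = 1 / \<eta> - 1 / X"
  have d: "0 < d" "d < 1 / \<eta>" unfolding d_def using LW_d[OF \<eta> X] by auto
  have Xp: "X > 0" by (rule LW_Xpos[OF \<eta> X])
  define S where "S = {a. 0 < s * (\<alpha> - a)}"
  define r' where "r' a = - (2 * (\<alpha> - a)) / d" for a
  have [measurable]: "?R \<in> borel_measurable borel" unfolding Gf_def by measurable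
  have "(\<integral>\<^sup>+a. ?L a \<partial>lborel) \<le> (\<integral>\<^sup>+a. ?R (resf \<eta> \<alpha> X a) * ennreal \<bar>r' a\<bar> * indicator S a \<partial>lborel)"
  proof (rule nn_integral_mono)
    fix a
    show "?L a \<le> ?R (resf \<eta> \<alpha> X a) * ennreal \<bar>r' a\<bar> * indicator S a"
    proof (cases "0 < s * (\<alpha> - a) \<and> \<bar>resf \<eta> \<alpha> X a\<bar> < 3/5 * \<eta> * X ^ 4 \<and> P a")
      case True
      define r where "r = resf \<eta> \<alpha> X a"
      have r: "\<bar>r\<bar> < 3/5 * \<eta> * X ^ 4" using True by (simp add: r_def)
      have "Ef \<eta> X + r * d = (\<alpha> - a)\<^sup>2" unfolding r_def resf_def d_def[symmetric] using d by simp
      then have G0: "Gf \<eta> r X = \<bar>\<alpha> - a\<bar>" unfolding Gf_def d_def[symmetric] by simp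
      have "\<bar>\<alpha> - a\<bar> = s * (\<alpha> - a)" using True s by auto
      with G0 have G: "Gf \<eta> r X = s * (\<alpha> - a)" by simp
      then have a: "\<alpha> - s * Gf \<eta> r X = a" using s by auto
      have "\<bar>r' a\<bar> = 2 * Gf \<eta> r X / d" unfolding r'_def G0 using d by (simp only: abs_divide abs_minus_cancel abs_mult abs_of_pos abs_numeral)
      moreover have "2 * (2/5 * X\<^sup>2) / (1 / \<eta>) \<le> 2 * Gf \<eta> r X / d"
        using LW_G_ge[OF \<eta> X r] d LW_Gpos[OF \<eta> X r] by (intro frac_le) auto
      ultimately have "4/5 * \<eta> * X\<^sup>2 \<le> \<bar>r' a\<bar>" by (simp add: ac_simps)
      then have "2 * X ^ 4 * (4/5 * \<eta> * X\<^sup>2) \<le> 2 * X ^ 4 * \<bar>r' a\<bar>" using Xp by (intro mult_left_mono) auto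
      moreover have "2 * X ^ 4 * (4/5 * \<eta> * X\<^sup>2) = 8/5 * (\<eta> * X ^ 6)" by (simp add: eval_nat_numeral)
      moreover have "\<eta> * X ^ 6 > 0" using \<eta> Xp by simp
      ultimately have "\<eta> * X ^ 6 \<le> 2 * X ^ 4 * \<bar>r' a\<bar>" by linarith
      then have "\<eta> * X ^ 6 * (jb (r - c) powr - q * f a) \<le> 2 * X ^ 4 * \<bar>r' a\<bar> * (jb (r - c) powr - q * f a)"
        using f by (intro mult_right_mono) auto
      also have "\<dots> = 2 * X ^ 4 * (jb (r - c) powr - q * f a) * \<bar>r' a\<bar>" by (simp only: ac_simps)
      finally have "ennreal (\<eta> * X ^ 6 * (jb (r - c) powr - q * f a)) \<le> ennreal (2 * X ^ 4 * (jb (r - c) powr - q * f a) * \<bar>r' a\<bar>)"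
        by (rule ennreal_leI)
      also have "\<dots> = ennreal (2 * X ^ 4 * (jb (r - c) powr - q * f a)) * ennreal \<bar>r' a\<bar>"
        using f Xp by (intro ennreal_mult) auto
      finally show ?thesis using True r a unfolding r_def[symmetric] by (simp add: S_def)
    next
      case False
      then show ?thesis by auto
    qed
  qed
  also have "\<dots> \<le> (\<integral>\<^sup>+r. ?R r \<partial>lborel)"
  proof (rule nn_integral_substitution_le)
    have "S = (if s = 1 then {..<\<alpha>} else {\<alpha><..})" using s unfolding S_def by auto
    then show "open S" "is_interval S" by auto
    show "(resf \<eta> \<alpha> X has_real_derivative r' a) (at a)" for a
      unfolding resf_def[abs_def] r'_def d_def[symmetric] using d
      by (auto intro!: derivative_eq_intros)
    show "continuous_on S r'" unfolding r'_def using d by (intro continuous_intros) auto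
    show "(\<forall>a\<in>S. 0 \<le> r' a) \<or> (\<forall>a\<in>S. r' a \<le> 0)"
      using s d unfolding S_def r'_def by (auto simp: divide_le_0_iff zero_le_divide_iff)
  qed measurable
  finally show ?thesis .
qed

text \<open>With \<open>r\<close> fixed, one moves along the level set of the first resonance and
  takes the second resonance \<psi> as the new variable in place of \<open>X\<close>. Its derivative
  consists of a product of transversality factors and a term of the same sign, so in modulus it is
  at least \<open>X ^ 4\<close>, exactly the weight left by \<open>LW_inner\<close>.\<close>

lemma LW_outer:
  fixes r :: real
  assumes \<eta>: "0 < \<eta>" and s: "s = 1 \<or> s = (- 1 :: real)"
  shows "(\<integral>\<^sup>+X. (if 19/10 * \<eta> < X \<and> \<bar>r\<bar> < 3/5 * \<eta> * X ^ 4 \<and> \<eta>' < X \<and> 19/10 * (X - \<eta>') < X \<and>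
         0 < s * (\<alpha> - s * Gf \<eta> r X - \<beta>) \<and> \<bar>resf \<eta>' \<beta> X (\<alpha> - s * Gf \<eta> r X)\<bar> < 3/5 * (X - \<eta>') * X ^ 4
       then ennreal (X ^ 4 * jb (resf \<eta>' \<beta> X (\<alpha> - s * Gf \<eta> r X) - c) powr - q) else 0) \<partial>lborel) \<le> jbint q"
  (is "(\<integral>\<^sup>+X. (if ?c X then ?v X else 0) \<partial>lborel) \<le> _")
proof -
  define S0 where "S0 = {X. 19/10 * \<eta> < X \<and> \<bar>r\<bar> < 3/5 * \<eta> * X ^ 4 \<and> \<eta>' < X \<and> 19/10 * (X - \<eta>') < X}"
  \<comment> \<open>The cut expresses that \<open>a - \<beta>\<close> has sign \<open>s\<close>.
    \<open>Gf\<close> increases on \<open>S0\<close>, so what remains is still an interval.\<close>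
  define S where "S = S0 \<inter> (\<lambda>X. Gf \<eta> r X) -` {..<s * (\<alpha> - \<beta>)}"
  define Gd where "Gd X = (Ed \<eta> X + r / X\<^sup>2) / (2 * Gf \<eta> r X)" for X
  define \<psi> where "\<psi> X = resf \<eta>' \<beta> X (\<alpha> - s * Gf \<eta> r X)" for X
  define \<psi>' where "\<psi>' X = - (2 * (s * (\<alpha> - \<beta>) - Gf \<eta> r X) * Gd X + (Ed \<eta>' X + \<psi> X / X\<^sup>2)) / (1 / \<eta>' - 1 / X)" for X
  have S0: "19/10 * \<eta> < X" "\<bar>r\<bar> < 3/5 * \<eta> * X ^ 4" "\<eta>' < X" "19/10 * (X - \<eta>') < X" "0 < \<eta>'" "0 < X" if "X \<in> S0" for X
    using that \<eta> by (auto simp: S0_def)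
  have ss: "s * s = 1" using s by auto
  have Gder: "((\<lambda>X. Gf \<eta> r X) has_real_derivative Gd X) (at X)" "4/5 * X \<le> Gd X" "0 < Gf \<eta> r X" if "X \<in> S0" for X
    using LW_G_deriv[OF \<eta> S0(1,2)[OF that]] LW_Gd_ge[OF \<eta> S0(1,2)[OF that]] LW_Gpos[OF \<eta> S0(1,2)[OF that]]
    unfolding Gd_def by auto
  have contG: "continuous_on S0 (\<lambda>X. Gf \<eta> r X)"
    using Gder by (auto intro!: continuous_at_imp_continuous_on DERIV_isCont)
  have openS0: "open S0" unfolding S0_def
    by (intro open_Collect_conj open_Collect_less continuous_intros)
  have intS0: "t \<in> S0" if "x \<in> S0" "y \<in> S0" "x \<le> t" "t \<le> y" for x y t
  proof -
    have "x ^ 4 \<le> t ^ 4" using S0(6)[OF that(1)] that(3) by (intro power_mono) auto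
    then have "3/5 * \<eta> * x ^ 4 \<le> 3/5 * \<eta> * t ^ 4" using \<eta> by (intro mult_left_mono) auto
    then show ?thesis using S0[OF that(1)] S0[OF that(2)] that unfolding S0_def by auto
  qed
  have openS: "open S" unfolding S_def
    by (rule continuous_open_preimage[OF contG openS0]) simp
  have Gmono: "Gf \<eta> r x \<le> Gf \<eta> r y" if "x \<in> S0" "y \<in> S0" "x \<le> y" for x y
  proof (rule DERIV_nonneg_imp_nondecreasing[OF that(3)])
    fix t assume "x \<le> t" "t \<le> y"
    then have "t \<in> S0" using intS0 that by blast
    then show "\<exists>y. ((\<lambda>X. Gf \<eta> r X) has_real_derivative y) (at t) \<and> 0 \<le> y"
      using Gder[of t] S0(6)[of t] by (intro exI[of _ "Gd t"]) auto
  qed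
  have intS: "is_interval S" unfolding is_interval_1
  proof (intro ballI allI impI)
    fix x y t assume *: "x \<in> S" "y \<in> S" "x \<le> t \<and> t \<le> y"
    then have "t \<in> S0" using intS0 unfolding S_def by blast
    then show "t \<in> S" using * Gmono[of t y] unfolding S_def by auto
  qed
  have psider: "(\<psi> has_real_derivative \<psi>' X) (at X)" if "X \<in> S" for X
  proof -
    have X0: "X \<in> S0" using that by (simp add: S_def)
    have d: "1 / \<eta>' - 1 / X \<noteq> 0" using S0[OF X0] by (simp add: field_simps)
    have num: "((\<lambda>X. (\<beta> - (\<alpha> - s * Gf \<eta> r X))\<^sup>2 - Ef \<eta>' X) has_real_derivative
       2 * (\<beta> - (\<alpha> - s * Gf \<eta> r X)) * (s * Gd X) - Ed \<eta>' X) (at X)"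
      by (rule derivative_eq_intros Ef_deriv Gder(1)[OF X0] refl | simp)+
    have den: "((\<lambda>X. 1 / \<eta>' - 1 / X) has_real_derivative 1 / X\<^sup>2) (at X)"
      using S0[OF X0] by (auto intro!: derivative_eq_intros simp: power2_eq_square)
    have "(\<psi> has_real_derivative ((2 * (\<beta> - (\<alpha> - s * Gf \<eta> r X)) * (s * Gd X) - Ed \<eta>' X) * (1 / \<eta>' - 1 / X) -
        ((\<beta> - (\<alpha> - s * Gf \<eta> r X))\<^sup>2 - Ef \<eta>' X) * (1 / X\<^sup>2)) / ((1 / \<eta>' - 1 / X) * (1 / \<eta>' - 1 / X))) (at X)"
      unfolding \<psi>_def[abs_def] resf_def by (rule DERIV_divide[OF num den d])
    also have "((2 * (\<beta> - (\<alpha> - s * Gf \<eta> r X)) * (s * Gd X) - Ed \<eta>' X) * (1 / \<eta>' - 1 / X) -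
        ((\<beta> - (\<alpha> - s * Gf \<eta> r X))\<^sup>2 - Ef \<eta>' X) * (1 / X\<^sup>2)) / ((1 / \<eta>' - 1 / X) * (1 / \<eta>' - 1 / X)) =
        ((2 * (\<beta> - (\<alpha> - s * Gf \<eta> r X)) * (s * Gd X) - Ed \<eta>' X) - \<psi> X / X\<^sup>2) / (1 / \<eta>' - 1 / X)"
    proof -
      have "(A * D - B * (1 / e)) / (D * D) = (A - B / D / e) / D" if "D \<noteq> 0" for A B D e :: real
      proof -
        have "(A * D - B * (1 / e)) / (D * D) = A * D / (D * D) - B * (1 / e) / (D * D)" by (rule diff_divide_distrib)
        then show ?thesis using that by (simp add: diff_divide_distrib ac_simps)
      qed
      from this[OF d] show ?thesis unfolding \<psi>_def resf_def .
    qed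
    also have "2 * (\<beta> - (\<alpha> - s * Gf \<eta> r X)) * (s * Gd X) = - (2 * (s * (\<alpha> - \<beta>) - Gf \<eta> r X) * Gd X)"
    proof -
      have "2 * (\<beta> - (\<alpha> - s * Gf \<eta> r X)) * (s * Gd X) = - (2 * (s * (\<alpha> - \<beta>) - (s * s) * Gf \<eta> r X) * Gd X)"
        by (simp add: algebra_simps)
      then show ?thesis unfolding ss by simp
    qed
    finally show ?thesis unfolding \<psi>'_def by (simp add: algebra_simps)
  qed
  have dpos: "0 < 1 / \<eta>' - 1 / X" if "X \<in> S0" for X using S0[OF that] by (simp add: field_simps)
  have psineg: "\<psi>' X \<le> 0" "2 * (s * (\<alpha> - \<beta>) - Gf \<eta> r X) * Gd X / (1 / \<eta>' - 1 / X) \<le> \<bar>\<psi>' X\<bar>" if "X \<in> S" for X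
  proof -
    have X0: "X \<in> S0" using that by (simp add: S_def)
    have 1: "0 \<le> Ed \<eta>' X + \<psi> X / X\<^sup>2" unfolding \<psi>_def by (rule LW_sign) (use S0[OF X0] in auto)
    have 2: "0 \<le> 2 * (s * (\<alpha> - \<beta>) - Gf \<eta> r X) * Gd X"
      using that Gder[OF X0] S0[OF X0] by (intro mult_nonneg_nonneg) (auto simp: S_def)
    have abs: "\<bar>\<psi>' X\<bar> = (2 * (s * (\<alpha> - \<beta>) - Gf \<eta> r X) * Gd X + (Ed \<eta>' X + \<psi> X / X\<^sup>2)) / (1 / \<eta>' - 1 / X)"
      unfolding \<psi>'_def using 1 2 dpos[OF X0] by (simp add: abs_divide)
    show "\<psi>' X \<le> 0" unfolding \<psi>'_def using 1 2 dpos[OF X0] by (intro divide_nonpos_pos) auto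
    show "2 * (s * (\<alpha> - \<beta>) - Gf \<eta> r X) * Gd X / (1 / \<eta>' - 1 / X) \<le> \<bar>\<psi>' X\<bar>"
      unfolding abs using 1 dpos[OF X0] by (intro divide_right_mono) auto
  qed
  have cont: "continuous_on S \<psi>'"
  proof -
    have SS: "S \<subseteq> S0" by (auto simp: S_def)
    have cG: "continuous_on S (\<lambda>X. Gf \<eta> r X)" using contG SS continuous_on_subset by blast
    have c\<psi>: "continuous_on S \<psi>" using psider by (auto intro!: continuous_at_imp_continuous_on DERIV_isCont)
    have nz: "X \<noteq> 0" "1 / \<eta>' - 1 / X \<noteq> 0" "Gf \<eta> r X \<noteq> 0" if "X \<in> S" for X
      using S0(6) Gder(3) dpos that SS by (fastforce)+
    show ?thesis unfolding \<psi>'_def Gd_def Ed_def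
      by (intro continuous_intros cG c\<psi>) (use nz in auto)
  qed
  have "(\<integral>\<^sup>+X. (if ?c X then ?v X else 0) \<partial>lborel) \<le> (\<integral>\<^sup>+X. ennreal (jb (\<psi> X - c) powr - q) * ennreal \<bar>\<psi>' X\<bar> * indicator S X \<partial>lborel)"
  proof (rule nn_integral_mono)
    fix X
    show "(if ?c X then ?v X else 0) \<le> ennreal (jb (\<psi> X - c) powr - q) * ennreal \<bar>\<psi>' X\<bar> * indicator S X"
    proof (cases "?c X")
      case True
      have "s * (\<alpha> - s * Gf \<eta> r X - \<beta>) = s * (\<alpha> - \<beta>) - (s * s) * Gf \<eta> r X" by (simp add: algebra_simps)
      then have sa: "s * (\<alpha> - s * Gf \<eta> r X - \<beta>) = s * (\<alpha> - \<beta>) - Gf \<eta> r X" unfolding ss by simp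
      have X0: "X \<in> S0" using True by (simp add: S0_def)
      have XS: "X \<in> S" using True X0 sa by (simp add: S_def)
      define k where "k = X - \<eta>'"
      have k: "k > 0" using S0[OF X0] by (simp add: k_def)
      have "3/2 * (X - \<eta>') * X \<le> \<bar>(\<alpha> - s * Gf \<eta> r X) - \<beta>\<bar>"
        by (rule LW_second_ge) (use True in auto)
      also have "\<bar>(\<alpha> - s * Gf \<eta> r X) - \<beta>\<bar> = s * (\<alpha> - \<beta>) - Gf \<eta> r X"
        unfolding sa[symmetric] using True s by auto
      finally have 1: "3/2 * k * X \<le> s * (\<alpha> - \<beta>) - Gf \<eta> r X" unfolding k_def .
      have 0: "0 \<le> s * (\<alpha> - \<beta>) - Gf \<eta> r X" using XS by (simp add: S_def)
      \<comment> \<open>The slope separation \<open>3/2 * k * X\<close>, the growth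
        \<open>4/5 * X\<close> of \<open>Gf\<close> and the divisor
        \<open>1 / \<eta>' - 1 / X\<close> of size \<open>k / X\<^sup>2\<close> combine to
        \<open>108/95 * X ^ 4\<close>: the possibly small \<open>k\<close> cancels.\<close>
      have "2 * (3/2 * k * X) * (4/5 * X) \<le> 2 * (s * (\<alpha> - \<beta>) - Gf \<eta> r X) * Gd X"
        using 0 1 k S0[OF X0] Gder(2)[OF X0] by (intro mult_mono) auto
      moreover have ynn: "0 \<le> 2 * (s * (\<alpha> - \<beta>) - Gf \<eta> r X) * Gd X"
        using 0 S0(6)[OF X0] Gder(2)[OF X0] by (intro mult_nonneg_nonneg) auto
      moreover have "1 / \<eta>' - 1 / X \<le> 19/9 * k / X\<^sup>2"
      proof -
        have e: "9/19 * X < \<eta>'" using S0[OF X0] by auto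
        have "1 / \<eta>' - 1 / X = k / (\<eta>' * X)" using S0[OF X0] by (simp add: k_def field_simps)
        also have "\<dots> \<le> k / (9/19 * X * X)" using e k S0[OF X0] by (intro divide_left_mono mult_right_mono mult_pos_pos) auto
        also have "\<dots> = 19/9 * k / X\<^sup>2" by (simp add: power2_eq_square)
        finally show ?thesis .
      qed
      ultimately have "(2 * (3/2 * k * X) * (4/5 * X)) / (19/9 * k / X\<^sup>2) \<le> 2 * (s * (\<alpha> - \<beta>) - Gf \<eta> r X) * Gd X / (1 / \<eta>' - 1 / X)"
        by (intro frac_le ynn dpos[OF X0])
      moreover have "(2 * (3/2 * k * X) * (4/5 * X)) / (19/9 * k / X\<^sup>2) = 108/95 * X ^ 4"
        using k S0[OF X0] by (simp add: power2_eq_square power4_eq_xxxx)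
      moreover have "X ^ 4 > 0" using S0[OF X0] by simp
      ultimately have le: "X ^ 4 \<le> \<bar>\<psi>' X\<bar>" using psineg(2)[OF XS] by linarith
      have "?v X \<le> ennreal (\<bar>\<psi>' X\<bar> * jb (\<psi> X - c) powr - q)"
        unfolding \<psi>_def by (intro ennreal_leI mult_right_mono le) auto
      also have "\<dots> = ennreal (jb (\<psi> X - c) powr - q) * ennreal \<bar>\<psi>' X\<bar>"
        by (subst mult.commute, rule ennreal_mult) auto
      finally show ?thesis using True XS by simp
    qed auto
  qed
  also have "\<dots> \<le> (\<integral>\<^sup>+y. ennreal (jb (y - c) powr - q) \<partial>lborel)"
    by (rule nn_integral_substitution_le[where f="\<lambda>y. ennreal (jb (y - c) powr - q)"])
       (use openS intS psider cont psineg(1) in auto)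
  also have "\<dots> = jbint q" by (rule nn_integral_jb_translate')
  finally show ?thesis .
qed

section \<open>From slopes back to the space-time kernel\<close>

abbreviation mu :: "freq \<Rightarrow> real" where "mu z \<equiv> snd (fst z)"

lemma jb_sg_powr_measurable [measurable]: "(\<lambda>z. jb (sg z) powr c) \<in> borel_measurable borel"
  by measurable

text \<open>\<open>z\<close> carries the smaller frequency. Both sign conditions share one
  \<open>s\<close>: for positive frequencies the slope of the sum is a weighted mean of the input
  slopes, which therefore lie on opposite sides of it.\<close>

definition regL :: "real \<Rightarrow> freq \<Rightarrow> freq \<Rightarrow> bool" where
  "regL s z w \<longleftrightarrow> 0 < xi z \<and> 19/10 * xi z < xi (z + w) \<and>
     0 < s * (mu z / xi z - mu (z + w) / xi (z + w)) \<and> 0 < s * (mu (z + w) / xi (z + w) - mu w / xi w) \<and>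
     \<bar>phase (fst z) + phase (fst w) - phase (fst (z + w))\<bar> < 3/5 * xi z * xi (z + w) ^ 4"

lemma regL_measurable [measurable]: "Measurable.pred (borel \<Otimes>\<^sub>M borel) (\<lambda>(z, w). regL s z w)"
  unfolding regL_def by measurable

lemma resf_measurable [measurable (raw)]:
  assumes [measurable]: "f \<in> borel_measurable M" "g \<in> borel_measurable M"
  shows "(\<lambda>x. resf \<eta> \<alpha> (f x) (g x)) \<in> borel_measurable M"
  unfolding resf_def Ef_def by measurable

lemma Gf_measurable [measurable (raw)]:
  assumes [measurable]: "f \<in> borel_measurable M" "g \<in> borel_measurable M"
  shows "(\<lambda>x. Gf \<eta> (f x) (g x)) \<in> borel_measurable M"
  unfolding Gf_def Ef_def by measurable

text \<open>Factors tailored to \<open>tri_bounded_TTstar\<close>, where the first argument is held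
  fixed in \<open>aL\<close> and the second in \<open>bL\<close>: each omits the modulation of its
  fixed argument. The modulation of the sum is shared equally, and the two squared powers 5/4 of the
  sum frequency multiply to its fifth power.\<close>

definition aL :: "real \<Rightarrow> real \<Rightarrow> freq \<Rightarrow> freq \<Rightarrow> ennreal" where
  "aL b s z w = (if regL s z w then ennreal (xi z powr (1/2) * xi (z + w) powr (5/4) * (jb (sg w) powr - b * jb (sg (z + w)) powr - (b/2))) else 0)"

definition bL :: "real \<Rightarrow> real \<Rightarrow> freq \<Rightarrow> freq \<Rightarrow> ennreal" where
  "bL b s z w = (if regL s z w then ennreal (xi (z + w) powr (5/4) * (jb (sg z) powr - b * jb (sg (z + w)) powr - (b/2))) else 0)"

lemma LW_integral_le:
  assumes \<eta>: "0 < \<eta>" and s: "s = 1 \<or> s = (- 1 :: real)"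
  shows "(\<integral>\<^sup>+X. \<integral>\<^sup>+M. (if 19/10 * \<eta> < X \<and> 0 < s * (\<alpha> - M / X) \<and> \<bar>resf \<eta> \<alpha> X (M / X)\<bar> < 3/5 * \<eta> * X ^ 4 \<and>
        (\<eta>' < X \<and> 19/10 * (X - \<eta>') < X \<and> 0 < s * (M / X - \<beta>) \<and> \<bar>resf \<eta>' \<beta> X (M / X)\<bar> < 3/5 * (X - \<eta>') * X ^ 4)
      then ennreal (\<eta> * X ^ 5 * (jb (resf \<eta> \<alpha> X (M / X) - c) powr - q * jb (resf \<eta>' \<beta> X (M / X) - c') powr - q)) else 0) \<partial>lborel \<partial>lborel)
     \<le> 2 * (jbint q * jbint q)"
  (is "(\<integral>\<^sup>+X. \<integral>\<^sup>+M. ?F X (M / X) \<partial>lborel \<partial>lborel) \<le> _")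
proof -
  let ?P = "\<lambda>X a. \<eta>' < X \<and> 19/10 * (X - \<eta>') < X \<and> 0 < s * (a - \<beta>) \<and> \<bar>resf \<eta>' \<beta> X a\<bar> < 3/5 * (X - \<eta>') * X ^ 4"
  let ?W = "\<lambda>X r. if 19/10 * \<eta> < X \<and> \<bar>r\<bar> < 3/5 * \<eta> * X ^ 4 \<and> ?P X (\<alpha> - s * Gf \<eta> r X)
       then ennreal (2 * X ^ 4 * (jb (r - c) powr - q * jb (resf \<eta>' \<beta> X (\<alpha> - s * Gf \<eta> r X) - c') powr - q)) else 0"
  have m: "(\<lambda>(X, a). ?F X a) \<in> borel_measurable (borel \<Otimes>\<^sub>M borel)"
    by measurable
  note [measurable] = m
  have "(\<integral>\<^sup>+M. ?F X (M / X) \<partial>lborel) \<le> (\<integral>\<^sup>+r. ?W X r \<partial>lborel)" for X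
  proof (cases "19/10 * \<eta> < X")
    case True
    have Xp: "X > 0" using True \<eta> by simp
    have "(\<integral>\<^sup>+M. ?F X (M / X) \<partial>lborel) = ennreal \<bar>X\<bar> * (\<integral>\<^sup>+a. ?F X ((0 + X * a) / X) \<partial>lborel)"
      using Xp by (intro nn_integral_real_affine) auto
    \<comment> \<open>Passing from \<open>M\<close> to the slope \<open>a = M / X\<close> has
      Jacobian \<open>X\<close>, which raises \<open>\<eta> * X ^ 5\<close> to the weight
      \<open>\<eta> * X ^ 6\<close> of \<open>LW_inner\<close>.\<close>
    also have "\<dots> = ennreal X * (\<integral>\<^sup>+a. ?F X a \<partial>lborel)"
    proof -
      have "(0 + X * a) / X = a" for a using Xp by simp
      then show ?thesis using Xp by (simp only: abs_of_pos)
    qed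
    also have "\<dots> = (\<integral>\<^sup>+a. ennreal X * ?F X a \<partial>lborel)"
      by (rule nn_integral_cmult[symmetric]) measurable
    also have "\<dots> = (\<integral>\<^sup>+a. (if 0 < s * (\<alpha> - a) \<and> \<bar>resf \<eta> \<alpha> X a\<bar> < 3/5 * \<eta> * X ^ 4 \<and> ?P X a
       then ennreal (\<eta> * X ^ 6 * (jb (resf \<eta> \<alpha> X a - c) powr - q * jb (resf \<eta>' \<beta> X a - c') powr - q)) else 0) \<partial>lborel)"
    proof (rule nn_integral_cong)
      fix a
      have "ennreal X * ennreal (\<eta> * X ^ 5 * v) = ennreal (\<eta> * X ^ 6 * v)" for v
      proof -
        have "X * (\<eta> * X ^ 5 * v) = \<eta> * X ^ 6 * v" by (simp add: eval_nat_numeral)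
        then show ?thesis using Xp by (simp only: ennreal_mult'[symmetric] less_imp_le)
      qed
      then show "ennreal X * ?F X a = (if 0 < s * (\<alpha> - a) \<and> \<bar>resf \<eta> \<alpha> X a\<bar> < 3/5 * \<eta> * X ^ 4 \<and> ?P X a
       then ennreal (\<eta> * X ^ 6 * (jb (resf \<eta> \<alpha> X a - c) powr - q * jb (resf \<eta>' \<beta> X a - c') powr - q)) else 0)"
        using True by simp
    qed
    also have "\<dots> \<le> (\<integral>\<^sup>+r. (if \<bar>r\<bar> < 3/5 * \<eta> * X ^ 4 \<and> ?P X (\<alpha> - s * Gf \<eta> r X)
       then ennreal (2 * X ^ 4 * (jb (r - c) powr - q * jb (resf \<eta>' \<beta> X (\<alpha> - s * Gf \<eta> r X) - c') powr - q)) else 0) \<partial>lborel)"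
      by (rule LW_inner[OF \<eta> True s]) auto
    finally show ?thesis using True by simp
  qed simp
  then have "(\<integral>\<^sup>+X. \<integral>\<^sup>+M. ?F X (M / X) \<partial>lborel \<partial>lborel) \<le> (\<integral>\<^sup>+X. \<integral>\<^sup>+r. ?W X r \<partial>lborel \<partial>lborel)"
    by (rule nn_integral_mono)
  also have "\<dots> = (\<integral>\<^sup>+r. \<integral>\<^sup>+X. ?W X r \<partial>lborel \<partial>lborel)"
    by (rule nn_integral_lborel_swap) measurable
  also have "\<dots> \<le> (\<integral>\<^sup>+r. (2 * ennreal (jb (r - c) powr - q)) * jbint q \<partial>lborel)"
  proof (rule nn_integral_mono)
    fix r
    let ?V = "\<lambda>X. if 19/10 * \<eta> < X \<and> \<bar>r\<bar> < 3/5 * \<eta> * X ^ 4 \<and> ?P X (\<alpha> - s * Gf \<eta> r X)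
       then ennreal (X ^ 4 * jb (resf \<eta>' \<beta> X (\<alpha> - s * Gf \<eta> r X) - c') powr - q) else 0"
    have "(\<integral>\<^sup>+X. ?W X r \<partial>lborel) = (\<integral>\<^sup>+X. (2 * ennreal (jb (r - c) powr - q)) * ?V X \<partial>lborel)"
    proof (rule nn_integral_cong)
      fix X
      have "ennreal (2 * X ^ 4 * (u * v)) = (2 * ennreal u) * ennreal (X ^ 4 * v)" if "u \<ge> 0" "v \<ge> 0" for u v
      proof -
        have "2 * X ^ 4 * (u * v) = (2 * u) * (X ^ 4 * v)" by simp
        then show ?thesis using that by (simp only: ennreal_mult) (simp add: ennreal_mult)
      qed
      then show "?W X r = (2 * ennreal (jb (r - c) powr - q)) * ?V X" by simp
    qed
    also have "\<dots> = (2 * ennreal (jb (r - c) powr - q)) * (\<integral>\<^sup>+X. ?V X \<partial>lborel)"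
      by (rule nn_integral_cmult) measurable
    also have "\<dots> \<le> (2 * ennreal (jb (r - c) powr - q)) * jbint q"
      by (intro mult_left_mono LW_outer[OF \<eta> s]) auto
    finally show "(\<integral>\<^sup>+X. ?W X r \<partial>lborel) \<le> (2 * ennreal (jb (r - c) powr - q)) * jbint q" .
  qed
  also have "\<dots> = 2 * (jbint q * jbint q)"
    by (simp add: nn_integral_multc nn_integral_cmult nn_integral_jb_translate' mult.assoc)
  finally show ?thesis .
qed

lemma tri_bounded_LW:
  assumes s: "s = 1 \<or> s = (- 1 :: real)" and b: "b > 1/2"
  shows "tri_bounded (\<lambda>z w. aL b s z w * bL b s z w)"
proof -
  define q where "q = 2 * b"
  have q: "q > 1" using b by (simp add: q_def)
  define C where "C = jbint q * (2 * (jbint q * jbint q))"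
  have [measurable]: "case_prod (aL b s) \<in> borel_measurable (borel \<Otimes>\<^sub>M borel)" "case_prod (bL b s) \<in> borel_measurable (borel \<Otimes>\<^sub>M borel)"
    unfolding aL_def bL_def by measurable
  show ?thesis
  proof (rule tri_bounded_TTstar[where C=C])
    show "C < \<top>" unfolding C_def using jbint_finite[OF q] by (simp add: ennreal_mult_less_top)
    fix x y :: freq
    obtain \<eta> m1 t1 where x: "x = ((\<eta>, m1), t1)" by (metis prod.collapse)
    obtain \<eta>' m2 t2 where y: "y = ((\<eta>', m2), t2)" by (metis prod.collapse)
    show "(\<integral>\<^sup>+z. (aL b s x (z - x))\<^sup>2 * (bL b s (z - y) y)\<^sup>2 \<partial>lborel) \<le> C"
    proof (cases "\<eta> > 0")
      case False
      then have "aL b s x w = 0" for w unfolding aL_def regL_def x by simp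
      then show ?thesis by simp
    next
      case True
      define \<alpha> \<beta> where "\<alpha> = m1 / \<eta>" and "\<beta> = m2 / \<eta>'"
      let ?c = "\<lambda>X a. 19/10 * \<eta> < X \<and> 0 < s * (\<alpha> - a) \<and> \<bar>resf \<eta> \<alpha> X a\<bar> < 3/5 * \<eta> * X ^ 4 \<and>
        (\<eta>' < X \<and> 19/10 * (X - \<eta>') < X \<and> 0 < s * (a - \<beta>) \<and> \<bar>resf \<eta>' \<beta> X a\<bar> < 3/5 * (X - \<eta>') * X ^ 4)"
      let ?F = "\<lambda>\<sigma> X a. if ?c X a then ennreal (\<eta> * X ^ 5 * (jb (resf \<eta> \<alpha> X a - (sg x - \<sigma>)) powr - q * jb (resf \<eta>' \<beta> X a - (sg y - \<sigma>)) powr - q)) else 0"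
      have pt: "(aL b s x (z - x))\<^sup>2 * (bL b s (z - y) y)\<^sup>2 \<le> ennreal (jb \<sigma> powr - q) * ?F \<sigma> X (M / X)"
        if z: "z = ((X, M), - phase (X, M) + \<sigma>)" for z X M \<sigma>
      proof (cases "regL s x (z - x) \<and> regL s (z - y) y")
        case False
        then show ?thesis unfolding aL_def bL_def by auto
      next
        case True
        then have r1: "regL s x (z - x)" and r2: "regL s (z - y) y" by auto
        have a1: "0 < \<eta>" "19/10 * \<eta> < X" "0 < s * (\<alpha> - M / X)" "\<bar>phase (\<eta>, m1) + phase (X - \<eta>, M - m1) - phase (X, M)\<bar> < 3/5 * \<eta> * X ^ 4"
          using r1 unfolding regL_def x z \<alpha>_def by auto
        have a2: "0 < X - \<eta>'" "19/10 * (X - \<eta>') < X" "0 < s * (M / X - \<beta>)" "\<bar>phase (X - \<eta>', M - m2) + phase (\<eta>', m2) - phase (X, M)\<bar> < 3/5 * (X - \<eta>') * X ^ 4"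
          using r2 unfolding regL_def y z \<beta>_def by auto
        have Xp: "X > 0" and ep: "\<eta>' > 0" using a1 a2 by auto
        have m: "\<eta> * \<alpha> = m1" "\<eta>' * \<beta> = m2" "X * (M / X) = M" using a1 ep Xp by (auto simp: \<alpha>_def \<beta>_def)
        have R1: "phase (\<eta>, m1) + phase (X - \<eta>, M - m1) - phase (X, M) = resf \<eta> \<alpha> X (M / X)"
          using resonance_eq[of \<eta> X \<alpha> "M / X"] a1 Xp unfolding m by auto
        have R2: "phase (X - \<eta>', M - m2) + phase (\<eta>', m2) - phase (X, M) = resf \<eta>' \<beta> X (M / X)"
          using resonance_eq[of \<eta>' X \<beta> "M / X"] a2 ep Xp unfolding m by auto
        have c: "?c X (M / X)" using a1 a2 unfolding R1 R2 by auto
        \<comment> \<open>For fixed \<open>x\<close> the modulation of \<open>z - x\<close> is the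
          first resonance up to a shift, and for fixed \<open>y\<close> that of \<open>z - y\<close>
          is the second. With \<sigma>, the modulation of \<open>z\<close>, these are the three
          coordinates in which the integral is bounded.\<close>
        have s1: "sg (z - x) = resf \<eta> \<alpha> X (M / X) - (sg x - \<sigma>)"
          unfolding R1[symmetric] by (simp add: sg_def z x)
        have s2: "sg (z - y) = resf \<eta>' \<beta> X (M / X) - (sg y - \<sigma>)"
          unfolding R2[symmetric] by (simp add: sg_def z y)
        have s3: "sg z = \<sigma>" by (simp add: sg_def z)
        have sq: "(jb u powr - b)\<^sup>2 = jb u powr - q" for u
          unfolding q_def using jb_pos[of u] by (simp add: powr_powr mult.commute flip: powr_numeral)
        have sqh: "(jb u powr - (b / 2))\<^sup>2 = jb u powr - b" for u
          using jb_pos[of u] by (simp add: powr_powr mult.commute flip: powr_numeral)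
        have sqh2: "jb u powr - b * jb u powr - b = jb u powr - q" for u
          unfolding q_def by (simp add: powr_add[symmetric])
        have X5: "(X powr (5/4))\<^sup>2 * (X powr (5/4))\<^sup>2 = X ^ 5"
        proof -
          have "(X powr (5/4))\<^sup>2 = X powr (5/2)" using Xp by (simp add: powr_powr flip: powr_numeral)
          moreover have "X powr (5/2) * X powr (5/2) = X powr 5" unfolding powr_add[symmetric] by simp
          ultimately show ?thesis using Xp by (simp flip: powr_numeral)
        qed
        have e2: "(\<eta> powr (1/2))\<^sup>2 = \<eta>" using a1 by (simp add: powr_powr flip: powr_numeral)
        have xs: "xi x = \<eta>" "xi z = X" by (simp_all add: x z)
        have "aL b s x (z - x) = ennreal (\<eta> powr (1/2) * X powr (5/4) * (jb (sg (z - x)) powr - b * jb \<sigma> powr - (b/2)))"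
          using r1 unfolding aL_def by (simp add: s3 xs)
        moreover have "bL b s (z - y) y = ennreal (X powr (5/4) * (jb (sg (z - y)) powr - b * jb \<sigma> powr - (b/2)))"
          using r2 unfolding bL_def by (simp add: s3 xs)
        ultimately have "(aL b s x (z - x))\<^sup>2 * (bL b s (z - y) y)\<^sup>2 =
          ennreal ((\<eta> powr (1/2) * X powr (5/4) * (jb (sg (z - x)) powr - b * jb \<sigma> powr - (b/2)))\<^sup>2 *
             (X powr (5/4) * (jb (sg (z - y)) powr - b * jb \<sigma> powr - (b/2)))\<^sup>2)"
          by (simp only: ennreal_power ennreal_mult[symmetric] zero_le_power2 powr_ge_zero mult_nonneg_nonneg)
        also have "(\<eta> powr (1/2) * X powr (5/4) * (jb (sg (z - x)) powr - b * jb \<sigma> powr - (b/2)))\<^sup>2 *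
             (X powr (5/4) * (jb (sg (z - y)) powr - b * jb \<sigma> powr - (b/2)))\<^sup>2 =
           (jb \<sigma> powr - b * jb \<sigma> powr - b) * (\<eta> * ((X powr (5/4))\<^sup>2 * (X powr (5/4))\<^sup>2) * (jb (sg (z - x)) powr - q * jb (sg (z - y)) powr - q))"
          unfolding power_mult_distrib sq sqh e2 by (simp only: ac_simps)
        also have "\<dots> = jb \<sigma> powr - q * (\<eta> * X ^ 5 * (jb (sg (z - x)) powr - q * jb (sg (z - y)) powr - q))"
          unfolding X5 sqh2 ..
        also have "ennreal \<dots> = ennreal (jb \<sigma> powr - q) * ?F \<sigma> X (M / X)"
          unfolding s1 s2 using c a1 Xp by (subst ennreal_mult) auto
        finally show ?thesis by simp
      qed
      have [measurable]: "(\<lambda>(\<sigma>, X, a). ?F \<sigma> X a) \<in> borel_measurable (borel \<Otimes>\<^sub>M borel \<Otimes>\<^sub>M borel)"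
        by measurable
      have "(\<integral>\<^sup>+z. (aL b s x (z - x))\<^sup>2 * (bL b s (z - y) y)\<^sup>2 \<partial>lborel) =
        (\<integral>\<^sup>+X. \<integral>\<^sup>+M. \<integral>\<^sup>+T. (aL b s x (((X, M), T) - x))\<^sup>2 * (bL b s (((X, M), T) - y) y)\<^sup>2 \<partial>lborel \<partial>lborel \<partial>lborel)"
        by (rule nn_integral_freq) measurable
      also have "\<dots> = (\<integral>\<^sup>+X. \<integral>\<^sup>+M. \<integral>\<^sup>+\<sigma>. (aL b s x (((X, M), - phase (X, M) + \<sigma>) - x))\<^sup>2 * (bL b s (((X, M), - phase (X, M) + \<sigma>) - y) y)\<^sup>2 \<partial>lborel \<partial>lborel \<partial>lborel)"
        by (intro nn_integral_cong nn_integral_lborel_translate[symmetric]) measurable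
      also have "\<dots> \<le> (\<integral>\<^sup>+X. \<integral>\<^sup>+M. \<integral>\<^sup>+\<sigma>. ennreal (jb \<sigma> powr - q) * ?F \<sigma> X (M / X) \<partial>lborel \<partial>lborel \<partial>lborel)"
        by (intro nn_integral_mono pt refl)
      also have "\<dots> = (\<integral>\<^sup>+X. \<integral>\<^sup>+\<sigma>. \<integral>\<^sup>+M. ennreal (jb \<sigma> powr - q) * ?F \<sigma> X (M / X) \<partial>lborel \<partial>lborel \<partial>lborel)"
        by (intro nn_integral_cong nn_integral_lborel_swap) measurable
      also have "\<dots> = (\<integral>\<^sup>+\<sigma>. \<integral>\<^sup>+X. \<integral>\<^sup>+M. ennreal (jb \<sigma> powr - q) * ?F \<sigma> X (M / X) \<partial>lborel \<partial>lborel \<partial>lborel)"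
        by (intro nn_integral_lborel_swap) measurable
      also have "\<dots> = (\<integral>\<^sup>+\<sigma>. ennreal (jb \<sigma> powr - q) * (\<integral>\<^sup>+X. \<integral>\<^sup>+M. ?F \<sigma> X (M / X) \<partial>lborel \<partial>lborel) \<partial>lborel)"
      proof (rule nn_integral_cong)
        fix \<sigma>
        show "(\<integral>\<^sup>+X. \<integral>\<^sup>+M. ennreal (jb \<sigma> powr - q) * ?F \<sigma> X (M / X) \<partial>lborel \<partial>lborel) =
          ennreal (jb \<sigma> powr - q) * (\<integral>\<^sup>+X. \<integral>\<^sup>+M. ?F \<sigma> X (M / X) \<partial>lborel \<partial>lborel)"
          by (subst nn_integral_cmult[symmetric], measurable, intro nn_integral_cong nn_integral_cmult)
             measurable
      qed
      also have "\<dots> \<le> (\<integral>\<^sup>+\<sigma>. ennreal (jb \<sigma> powr - q) * (2 * (jbint q * jbint q)) \<partial>lborel)"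
        by (intro nn_integral_mono mult_left_mono LW_integral_le[OF \<open>0 < \<eta>\<close> s]) auto
      also have "\<dots> = C" unfolding C_def jbint_def by (rule nn_integral_multc) measurable
      finally show ?thesis .
    qed
  qed measurable
qed

section \<open>The transversal kernel on the full low-resonance region\<close>

definition regK :: "freq \<Rightarrow> freq \<Rightarrow> bool" where
  "regK z w \<longleftrightarrow> 0 < \<bar>xi z\<bar> \<and> \<bar>xi z\<bar> \<le> \<bar>xi w\<bar> \<and> \<bar>xi w\<bar> \<le> \<bar>xi (z + w)\<bar> \<and>
    \<bar>phase (fst z) + phase (fst w) - phase (fst (z + w))\<bar> < 3/5 * \<bar>xi z\<bar> * xi (z + w) ^ 4"

text \<open>The powers are those supplied by \<open>aL\<close> and \<open>bL\<close> together. As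
  \<open>\<bar>xi z\<bar> \<le> \<bar>xi (z + w)\<bar>\<close>, they dominate the powers 3/4 and 9/4
  that \<open>AB_big\<close> asks for.\<close>

definition KL :: "real \<Rightarrow> freq \<Rightarrow> freq \<Rightarrow> ennreal" where
  "KL b z w = (if regK z w
    then ennreal (\<bar>xi z\<bar> powr (1/2) * \<bar>xi (z + w)\<bar> powr (5/2) * (jb (sg z) powr - b * jb (sg w) powr - b * jb (sg (z + w)) powr - b)) else 0)"

lemma regK_measurable [measurable]: "Measurable.pred (borel \<Otimes>\<^sub>M borel) (\<lambda>(z, w). regK z w)"
  unfolding regK_def by measurable

lemma KL_measurable: "case_prod (KL b) \<in> borel_measurable (borel \<Otimes>\<^sub>M borel)"
proof -
  have v [measurable]: "(\<lambda>(z, w). ennreal (\<bar>xi z\<bar> powr (1/2) * \<bar>xi (z + w)\<bar> powr (5/2) *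
      (jb (sg z) powr - b * jb (sg w) powr - b * jb (sg (z + w)) powr - b))) \<in> borel_measurable (borel \<Otimes>\<^sub>M borel)" (is "case_prod ?v \<in> _")
    by measurable
  have "case_prod (KL b) = (\<lambda>p. if (case p of (z, w) \<Rightarrow> regK z w) then (case_prod ?v) p else 0)"
    by (rule ext) (simp only: split_beta KL_def)
  then show ?thesis by simp
qed

lemma KL_le_pos:
  assumes pos: "0 < xi (z + w)"
  shows "KL b z w \<le> aL b 1 z w * bL b 1 z w + aL b (-1) z w * bL b (-1) z w"
proof (cases "regK z w")
  case regK: True
  note True = regK[unfolded regK_def]
  define \<eta> \<eta>' X where "\<eta> = xi z" and "\<eta>' = xi w" and "X = xi (z + w)"
  have XX: "X = \<eta> + \<eta>'" by (simp add: X_def \<eta>_def \<eta>'_def)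
  have o: "0 < \<eta>" "\<eta> \<le> \<eta>'" "X > 0"
    using True pos unfolding \<eta>_def[symmetric] \<eta>'_def[symmetric] X_def[symmetric] XX by (auto simp: abs_if split: if_splits)
  define \<alpha> a \<beta> where "\<alpha> = mu z / \<eta>" and "a = mu (z + w) / X" and "\<beta> = mu w / \<eta>'"
  have m: "\<eta> * \<alpha> = mu z" "\<eta>' * \<beta> = mu w" "X * a = mu (z + w)" using o by (auto simp: \<alpha>_def \<beta>_def a_def)
  have fz: "fst z = (\<eta>, \<eta> * \<alpha>)" "fst w = (X - \<eta>, X * a - \<eta> * \<alpha>)" "fst (z + w) = (X, X * a)"
  proof -
    have "fst z = (\<eta>, mu z)" "fst w = (X - \<eta>, mu (z + w) - mu z)" "fst (z + w) = (X, mu (z + w))"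
      by (auto simp: prod_eq_iff \<eta>_def X_def)
    then show "fst z = (\<eta>, \<eta> * \<alpha>)" "fst w = (X - \<eta>, X * a - \<eta> * \<alpha>)" "fst (z + w) = (X, X * a)" unfolding m .
  qed
  have R: "phase (fst z) + phase (fst w) - phase (fst (z + w)) = resf \<eta> \<alpha> X a"
    unfolding fz by (rule resonance_eq) (use o XX in auto)
  have Rs: "\<bar>resf \<eta> \<alpha> X a\<bar> < 3/5 * \<eta> * X ^ 4"
    using True o unfolding R \<eta>_def[symmetric] X_def[symmetric] by simp
  have X19: "19/10 * \<eta> < X" using o XX by auto
  \<comment> \<open>Equal slopes would make the resonance too large for \<open>regK\<close>, so
    \<open>\<alpha> - a\<close> has a definite sign.\<close>
  have ne: "\<alpha> \<noteq> a"
  proof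
    assume "\<alpha> = a"
    then have "resf \<eta> \<alpha> X a * (1 / \<eta> - 1 / X) = - Ef \<eta> X"
      unfolding resf_def using less_imp_neq[OF LW_d(1)[OF o(1) X19]] by simp
    then have "\<bar>resf \<eta> \<alpha> X a * (1 / \<eta> - 1 / X)\<bar> \<ge> 8/10 * X ^ 4" using LW_Ef_ge[OF o(1) X19] by linarith
    moreover have "\<bar>resf \<eta> \<alpha> X a * (1 / \<eta> - 1 / X)\<bar> \<le> 3/5 * X ^ 4" by (rule LW_rd[OF o(1) X19 Rs])
    moreover have "X ^ 4 > 0" using o by simp
    ultimately show False by linarith
  qed
  \<comment> \<open>The slope of the sum is the mean of the input slopes with weights \<eta> and
    \<eta>', so the two differences have the same sign.\<close>
  have rel: "\<eta> * (\<alpha> - a) = \<eta>' * (a - \<beta>)"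
  proof -
    have "mu (z + w) = mu z + mu w" by simp
    then have "X * a = \<eta> * \<alpha> + \<eta>' * \<beta>" unfolding m .
    then show ?thesis unfolding XX by (simp add: algebra_simps)
  qed
  define s :: real where "s = (if a < \<alpha> then 1 else - 1)"
  have s1: "0 < s * (\<alpha> - a)" using ne by (auto simp: s_def)
  then have "0 < \<eta> * (s * (\<alpha> - a))" using o by simp
  also have "\<eta> * (s * (\<alpha> - a)) = s * (\<eta>' * (a - \<beta>))" unfolding rel[symmetric] by simp
  also have "\<dots> = \<eta>' * (s * (a - \<beta>))" by simp
  finally have s2: "0 < s * (a - \<beta>)" using o by (simp add: zero_less_mult_iff)
  have reg: "regL s z w"
    unfolding regL_def R \<eta>_def[symmetric] X_def[symmetric] \<eta>'_def[symmetric] \<alpha>_def[symmetric] a_def[symmetric] \<beta>_def[symmetric]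
    using o X19 s1 s2 Rs by auto
  have "KL b z w = ennreal (\<eta> powr (1/2) * X powr (5/2) * (jb (sg z) powr - b * jb (sg w) powr - b * jb (sg (z + w)) powr - b))"
    using regK o unfolding KL_def \<eta>_def[symmetric] X_def[symmetric] by simp
  also have "\<dots> = aL b s z w * bL b s z w"
  proof -
    have h: "jb u powr - (b/2) * jb u powr - (b/2) = jb u powr - b" for u unfolding powr_add[symmetric] by simp
    have x: "X powr (5/4) * X powr (5/4) = X powr (5/2)" unfolding powr_add[symmetric] by simp
    have "aL b s z w * bL b s z w = ennreal ((\<eta> powr (1/2) * X powr (5/4) * (jb (sg w) powr - b * jb (sg (z + w)) powr - (b/2))) *
       (X powr (5/4) * (jb (sg z) powr - b * jb (sg (z + w)) powr - (b/2))))"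
      using reg unfolding aL_def bL_def \<eta>_def[symmetric] X_def[symmetric] by (simp add: ennreal_mult)
    also have "(\<eta> powr (1/2) * X powr (5/4) * (jb (sg w) powr - b * jb (sg (z + w)) powr - (b/2))) *
       (X powr (5/4) * (jb (sg z) powr - b * jb (sg (z + w)) powr - (b/2))) =
       \<eta> powr (1/2) * (X powr (5/4) * X powr (5/4)) * (jb (sg z) powr - b * jb (sg w) powr - b * (jb (sg (z + w)) powr - (b/2) * jb (sg (z + w)) powr - (b/2)))"
      by (simp only: ac_simps)
    finally show ?thesis unfolding h x by simp
  qed
  also have "\<dots> \<le> aL b 1 z w * bL b 1 z w + aL b (-1) z w * bL b (-1) z w"
    unfolding s_def by auto
  finally show ?thesis .
qed (auto simp: KL_def)

lemma tri_bounded_KL: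
  assumes b: "b > 1/2"
  shows "tri_bounded (KL b)"
proof -
  let ?A = "\<lambda>z w. aL b 1 z w * bL b 1 z w + aL b (-1) z w * bL b (-1) z w"
  have A1: "tri_bounded (\<lambda>z w. aL b 1 z w * bL b 1 z w)" by (rule tri_bounded_LW[OF _ b]) simp
  have A2: "tri_bounded (\<lambda>z w. aL b (-1) z w * bL b (-1) z w)" by (rule tri_bounded_LW[OF _ b]) simp
  have A: "tri_bounded ?A" by (rule tri_bounded_add[OF A1 A2])
  have 1: "tri_bounded (\<lambda>z w. ?A z w + ?A (- z) (- w))"
    by (rule tri_bounded_add[OF A tri_bounded_uminus[OF A]])
  note 2 = KL_measurable[of b]
  have 3: "KL b z w \<le> ?A z w + ?A (- z) (- w)" for z w
  proof (cases "xi (z + w)" "0::real" rule: linorder_cases)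
    case greater
    then have "KL b z w \<le> ?A z w" by (rule KL_le_pos)
    then show ?thesis by (rule add_increasing2[rotated]) simp
  next
    case less
    have e: "- z + - w = - (z + w)" by simp
    have "KL b (- z) (- w) = KL b z w" 
    proof -
      have "\<bar>phase (fst (- z)) + phase (fst (- w)) - phase (fst (- z + - w))\<bar> = \<bar>phase (fst z) + phase (fst w) - phase (fst (z + w))\<bar>"
        unfolding e fst_uminus phase_uminus by simp
      moreover have "xi (- z + - w) ^ 4 = xi (z + w) ^ 4" unfolding e by (simp only: fst_uminus) (rule power_minus_even, simp)
      moreover have "jb (sg (- z + - w)) = jb (sg (z + w))" unfolding e sg_uminus by simp
      moreover have "\<bar>xi (- z + - w)\<bar> = \<bar>xi (z + w)\<bar>" unfolding e by (simp only: fst_uminus abs_minus_cancel)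
      moreover have "\<bar>xi (- z)\<bar> = \<bar>xi z\<bar>" "\<bar>xi (- w)\<bar> = \<bar>xi w\<bar>" "jb (sg (- z)) = jb (sg z)" "jb (sg (- w)) = jb (sg w)" by simp_all
      ultimately show ?thesis unfolding KL_def regK_def by (simp only:)
    qed
    moreover have "KL b (- z) (- w) \<le> ?A (- z) (- w)" by (rule KL_le_pos) (use less in simp)
    ultimately show ?thesis by (simp add: add_increasing)
  next
    case equal
    then have "KL b z w = 0" unfolding KL_def regK_def by auto
    then show ?thesis by simp
  qed
  show ?thesis by (rule tri_bounded_mono[OF 1 2 3])
qed

section \<open>The bilinear estimate\<close>

lemma jb_powr_mono: "0 \<le> x \<Longrightarrow> x \<le> y \<Longrightarrow> 0 \<le> p \<Longrightarrow> jb x powr p \<le> jb y powr p"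
  by (intro powr_mono2) (auto simp: jb_def)

lemma jb_powr_le_1: "p \<le> 0 \<Longrightarrow> jb x powr p \<le> 1"
  using powr_mono[of p 0 "jb x"] jb_ge_1[of x] by simp

lemma jb_powr_expo_mono: "p \<le> q \<Longrightarrow> jb x powr p \<le> jb x powr q"
  using jb_ge_1[of x] by (intro powr_mono) auto

text \<open>Majorant for frequencies ordered \<open>k \<le> m \<le> N\<close>, where
  \<open>m\<close> is comparable to \<open>N\<close> and need not appear. The first term is the
  interaction of two high frequencies with low output, which forces the threshold for
  \<open>s\<close>; the second covers a high output.\<close>

definition AB :: "real \<Rightarrow> real \<Rightarrow> real \<Rightarrow> real" where
  "AB s k N = k * jb k powr s * jb N powr (- 2 * s) + 4 * N * jb k powr - s"

definition freqw :: "real \<Rightarrow> real \<Rightarrow> real \<Rightarrow> real \<Rightarrow> real" where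
  "freqw s x y z = z * jb z powr s * (jb x powr - s * jb y powr - s)"

lemma freqw_commute: "freqw s x y z = freqw s y x z"
  unfolding freqw_def by (simp add: ac_simps)

lemma freqw_le_AB:
  assumes k: "0 < k" "k \<le> m" "m \<le> N" "N \<le> k + m" and s: "- 9/8 < s" "s \<le> -1"
  shows "freqw s k m N \<le> AB s k N" "freqw s k N m \<le> AB s k N" "freqw s m N k \<le> AB s k N"
proof -
  have nn: "0 \<le> k * jb k powr s * jb N powr (- 2 * s)" "0 \<le> 4 * N * jb k powr - s"
    using k by auto
  have cancel: "jb N powr s * jb N powr - s = 1" for N using jb_pos[of N] by (simp add: powr_add[symmetric])
  have mN: "jb m powr - s \<le> jb N powr - s" using k s by (intro jb_powr_mono) auto
  have "jb N powr s * (jb k powr - s * jb m powr - s) \<le> jb N powr s * (jb k powr - s * jb N powr - s)"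
    using mN by (intro mult_left_mono) auto
  also have "\<dots> = jb k powr - s" using cancel[of N] by (simp add: ac_simps)
  finally have "N * (jb N powr s * (jb k powr - s * jb m powr - s)) \<le> N * jb k powr - s" using k by (intro mult_left_mono) auto
  moreover have "N * jb k powr - s \<le> 4 * N * jb k powr - s" using k by (intro mult_right_mono) auto
  ultimately show "freqw s k m N \<le> AB s k N" using nn unfolding AB_def freqw_def by (simp add: mult.assoc)
  have "jb N \<le> 2 * jb m" using k by (simp add: jb_def)
  then have "jb N powr - s \<le> (2 * jb m) powr - s" using s jb_nonneg[of N] by (intro powr_mono2) auto
  also have "\<dots> = 2 powr - s * jb m powr - s" using jb_nonneg[of m] by (simp add: powr_mult)
  also have "\<dots> \<le> 4 * jb m powr - s"
  proof (intro mult_right_mono)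
    have "(2::real) powr - s \<le> 2 powr 2" using s by (intro powr_mono) auto
    then show "(2::real) powr - s \<le> 4" by simp
  qed auto
  finally have "jb m powr s * (jb k powr - s * jb N powr - s) \<le> jb m powr s * (jb k powr - s * (4 * jb m powr - s))"
    by (intro mult_left_mono) auto
  also have "\<dots> = 4 * jb k powr - s" using cancel[of m] by (simp add: ac_simps)
  finally have m4: "jb m powr s * (jb k powr - s * jb N powr - s) \<le> 4 * jb k powr - s" .
  have "m * (jb m powr s * (jb k powr - s * jb N powr - s)) \<le> N * (4 * jb k powr - s)"
    by (rule mult_mono[OF k(3) m4]) (use k in auto)
  then show "freqw s k N m \<le> AB s k N" using nn unfolding AB_def freqw_def by (simp add: ac_simps)
  have "jb m powr - s * jb N powr - s \<le> jb N powr - s * jb N powr - s" using mN by (intro mult_right_mono) auto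
  also have "\<dots> = jb N powr (- 2 * s)" by (simp add: powr_add[symmetric])
  finally have "k * jb k powr s * (jb m powr - s * jb N powr - s) \<le> k * jb k powr s * jb N powr (- 2 * s)"
    using k by (intro mult_left_mono) auto
  then show "freqw s m N k \<le> AB s k N" using nn unfolding AB_def freqw_def by linarith
qed

text \<open>\<open>k \<le> jb N powr - (4/3)\<close> brings the first term down to the power
  \<open>9/4 - 4/3 = 11/12\<close> of \<open>jb N\<close>, and it bounds \<open>jb k\<close> in the
  second.\<close>

lemma AB_tiny:
  assumes k: "0 < k" "k \<le> N" and s: "- 9/8 < s" "s \<le> -1" and t: "k * jb N powr (4/3) \<le> 1"
  shows "AB s k N \<le> 17 * jb N"
proof -
  have kt: "k \<le> jb N powr - (4/3)" using t jb_pos[of N] by (simp add: powr_minus field_simps)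
  have "k * jb k powr s * jb N powr (- 2 * s) \<le> jb N powr - (4/3) * 1 * jb N powr (9/4)"
    using kt k s jb_powr_le_1[of s k] by (intro mult_mono jb_powr_expo_mono) auto
  also have "\<dots> = jb N powr (11/12)" by (simp add: powr_add[symmetric])
  also have "\<dots> \<le> jb N powr 1" by (intro jb_powr_expo_mono) auto
  finally have 1: "k * jb k powr s * jb N powr (- 2 * s) \<le> jb N" using jb_pos[of N] by simp
  have "jb N powr - (4/3) \<le> 1" by (rule jb_powr_le_1) simp
  then have "jb k \<le> 2" using kt k by (simp add: jb_def)
  then have "jb k powr - s \<le> 2 powr - s" using s jb_nonneg[of k] by (intro powr_mono2) auto
  also have "(2::real) powr - s \<le> 2 powr 2" using s by (intro powr_mono) auto
  finally have "4 * N * jb k powr - s \<le> 4 * N * 4" using k by (intro mult_left_mono) auto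
  also have "\<dots> \<le> 16 * jb N" using k by (simp add: jb_def)
  finally show ?thesis using 1 unfolding AB_def by linarith
qed

text \<open>With \<open>k \<le> N\<close> the hypothesis \<open>t\<close> excludes small
  \<open>N\<close>. From here on brackets of \<open>N\<close> may be replaced by powers of
  \<open>N\<close>, and the size \<open>k * N ^ 4\<close> of the resonance is bounded below.\<close>

lemma nontiny_N:
  assumes k: "0 < k" "k \<le> N" and t: "1 < k * jb N powr (4/3)"
  shows "1/3 \<le> N" "jb N \<le> 4 * N" "1/216 \<le> k * N ^ 4"
proof -
  show N: "1/3 \<le> N"
  proof (rule ccontr)
    assume "\<not> 1/3 \<le> N"
    then have N: "N < 1/3" "jb N \<le> 4/3" using k by (auto simp: jb_def)
    have "jb N powr (4/3) \<le> jb N powr 2" by (intro jb_powr_expo_mono) auto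
    also have "\<dots> = (jb N)\<^sup>2" using jb_pos[of N] by simp
    also have "\<dots> \<le> (4/3)\<^sup>2" using N jb_nonneg by (intro power_mono) auto
    finally have "k * jb N powr (4/3) \<le> 1/3 * (4/3)\<^sup>2" using N k by (intro mult_mono) auto
    then show False using t by (simp add: power2_eq_square)
  qed
  then show jN: "jb N \<le> 4 * N" by (simp add: jb_def)
  have "jb N powr (4/3) \<le> jb N powr 2" by (intro jb_powr_expo_mono) auto
  also have "\<dots> = (jb N)\<^sup>2" using jb_pos[of N] by simp
  also have "\<dots> \<le> (4 * N)\<^sup>2" using jN jb_nonneg by (intro power_mono) auto
  finally have "jb N powr (4/3) \<le> 16 * N\<^sup>2" by (simp add: power_mult_distrib)
  then have "k * jb N powr (4/3) \<le> k * (16 * N\<^sup>2)" using k by (intro mult_left_mono) auto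
  then have "1 \<le> 16 * (k * N\<^sup>2)" using t by linarith
  then have "1/16 \<le> k * N\<^sup>2" by simp
  moreover have "(1/3)\<^sup>2 \<le> N\<^sup>2" using N by (intro power_mono) auto
  ultimately have "1/16 * (1/3)\<^sup>2 \<le> (k * N\<^sup>2) * N\<^sup>2" using k by (intro mult_mono) auto
  then show "1/216 \<le> k * N ^ 4" by (simp add: power2_eq_square power4_eq_xxxx mult.assoc)
qed

text \<open>The right side is the Strichartz gain \<open>k powr (1/4) * N powr (1/4)\<close> times
  the square root of \<open>k * N ^ 4\<close>; the extra \<open>3 * \<epsilon>\<close> on the left
  pays for the weaker modulation exponent of the output. In the first term this asks for
  \<open>- 2 * s + 12 * \<epsilon> \<le> 9/4\<close>, which is the second part of
  \<open>e\<close>.\<close>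

lemma AB_big:
  assumes k: "0 < k" "k \<le> N" and s: "- 9/8 < s" "s \<le> -1" and t: "1 < k * jb N powr (4/3)"
    and e: "0 < \<epsilon>" "6 * \<epsilon> \<le> s + 9/8"
  shows "AB s k N * (k * N ^ 4) powr (3 * \<epsilon>) \<le> 1000 * (k powr (3/4) * N powr (9/4))"
proof -
  note N = nontiny_N[OF k t]
  have Np: "N > 0" using N by simp
  have small: "\<epsilon> \<le> 1/48" using e s by linarith
  have pw: "(k * N ^ 4) powr (3 * \<epsilon>) = k powr (3 * \<epsilon>) * N powr (12 * \<epsilon>)"
    using k Np by (simp add: powr_mult powr_powr flip: powr_numeral)
  have Nneg: "N powr (- p) \<le> 3" if "0 \<le> p" "p \<le> 1" for p
  proof -
    have "N powr (- p) \<le> (1/3) powr (- p)" using N that by (intro powr_mono2') auto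
    also have "\<dots> = 3 powr p" by (simp add: powr_divide powr_minus field_simps)
    also have "\<dots> \<le> 3 powr 1" using that by (intro powr_mono) auto
    finally show ?thesis by simp
  qed
  have A: "k * jb k powr s * jb N powr (- 2 * s) * (k powr (3 * \<epsilon>) * N powr (12 * \<epsilon>)) \<le> 192 * (k powr (3/4) * N powr (9/4))"
  proof -
    have "jb N powr (- 2 * s) \<le> (4 * N) powr (- 2 * s)" using N s jb_nonneg by (intro powr_mono2) auto
    also have "\<dots> = 4 powr (- 2 * s) * N powr (- 2 * s)" using Np by (simp add: powr_mult)
    also have "\<dots> \<le> 64 * N powr (- 2 * s)"
    proof (intro mult_right_mono)
      have "(4::real) powr (- 2 * s) \<le> 4 powr 3" using s by (intro powr_mono) auto
      then show "(4::real) powr (- 2 * s) \<le> 64" by simp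
    qed auto
    finally have 1: "jb N powr (- 2 * s) * N powr (12 * \<epsilon>) \<le> 64 * N powr (- 2 * s) * N powr (12 * \<epsilon>)"
      by (intro mult_right_mono) auto
    have "N powr (- 2 * s) * N powr (12 * \<epsilon>) = N powr (9/4) * N powr - (2 * s + 9/4 - 12 * \<epsilon>)"
      by (simp add: powr_add[symmetric])
    also have "\<dots> \<le> N powr (9/4) * 3" using e s by (intro mult_left_mono Nneg) auto
    finally have 2: "jb N powr (- 2 * s) * N powr (12 * \<epsilon>) \<le> 192 * N powr (9/4)" using 1 by (simp add: mult.assoc)
    have "k powr (1/4 + 3 * \<epsilon>) \<le> jb k powr (1/4 + 3 * \<epsilon>)" using k e by (intro powr_mono2) (auto simp: jb_def)
    also have "\<dots> \<le> jb k powr - s" using s small by (intro jb_powr_expo_mono) auto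
    finally have "k powr (1/4 + 3 * \<epsilon>) * jb k powr s \<le> jb k powr - s * jb k powr s" by (intro mult_right_mono) auto
    also have "\<dots> = 1" using jb_pos[of k] by (simp add: powr_add[symmetric])
    finally have 3: "k powr (1/4 + 3 * \<epsilon>) * jb k powr s \<le> 1" .
    have "k * k powr (3 * \<epsilon>) = k powr (3/4) * k powr (1/4 + 3 * \<epsilon>)"
    proof -
      have "k * k powr (3 * \<epsilon>) = k powr 1 * k powr (3 * \<epsilon>)" using k by simp
      also have "\<dots> = k powr (3/4) * k powr (1/4 + 3 * \<epsilon>)" unfolding powr_add[symmetric] by simp
      finally show ?thesis .
    qed
    then have "k * jb k powr s * jb N powr (- 2 * s) * (k powr (3 * \<epsilon>) * N powr (12 * \<epsilon>)) =
       k powr (3/4) * ((k powr (1/4 + 3 * \<epsilon>) * jb k powr s) * (jb N powr (- 2 * s) * N powr (12 * \<epsilon>)))"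
      by (simp add: ac_simps)
    also have "\<dots> \<le> k powr (3/4) * (1 * (192 * N powr (9/4)))"
      by (intro mult_left_mono mult_mono[OF 3 2]) auto
    finally show ?thesis by (simp add: ac_simps)
  qed
  have B: "4 * N * jb k powr - s * (k powr (3 * \<epsilon>) * N powr (12 * \<epsilon>)) \<le> 200 * (k powr (3/4) * N powr (9/4))"
  proof -
    have NN: "N * N powr (12 * \<epsilon>) = N powr (9/4) * N powr (- 5/4 + 12 * \<epsilon>)"
    proof -
      have "N * N powr (12 * \<epsilon>) = N powr 1 * N powr (12 * \<epsilon>)" using Np by simp
      also have "\<dots> = N powr (9/4) * N powr (- 5/4 + 12 * \<epsilon>)" unfolding powr_add[symmetric] by simp
      finally show ?thesis .
    qed
    have kk: "k powr (3 * \<epsilon>) = k powr (3/4) * k powr - (3/4 - 3 * \<epsilon>)" by (simp add: powr_add[symmetric])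
    \<comment> \<open>For \<open>k \<ge> 1\<close> powers of \<open>k\<close> are traded for powers
      of \<open>N\<close>. For \<open>k < 1\<close> the bound
      \<open>k \<ge> jb N powr - (4/3)\<close> turns the negative power of \<open>k\<close> into at
      most one power of \<open>jb N\<close>, which leaves the exponent
      \<open>- 1/4 + 12 * \<epsilon> \<le> 0\<close>.\<close>
    have key: "jb k powr - s * k powr - (3/4 - 3 * \<epsilon>) * N powr (- 5/4 + 12 * \<epsilon>) \<le> 50"
    proof (cases "k \<ge> 1")
      case True
      have "jb k powr - s \<le> jb k powr (9/8)" using s by (intro jb_powr_expo_mono) auto
      also have "\<dots> \<le> (2 * k) powr (9/8)" using True by (intro powr_mono2) (auto simp: jb_def)
      also have "\<dots> = 2 powr (9/8) * k powr (9/8)" using k by (simp add: powr_mult)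
      also have "\<dots> \<le> 4 * k powr (9/8)"
      proof (intro mult_right_mono)
        have "(2::real) powr (9/8) \<le> 2 powr 2" by (intro powr_mono) auto
        then show "(2::real) powr (9/8) \<le> 4" by simp
      qed auto
      finally have "jb k powr - s * k powr - (3/4 - 3 * \<epsilon>) \<le> 4 * k powr (9/8) * k powr - (3/4 - 3 * \<epsilon>)"
        by (intro mult_right_mono) auto
      also have "\<dots> = 4 * k powr (3/8 + 3 * \<epsilon>)" by (simp add: powr_add[symmetric])
      also have "\<dots> \<le> 4 * N powr (3/8 + 3 * \<epsilon>)" using k e by (intro mult_left_mono powr_mono2) auto
      finally have "jb k powr - s * k powr - (3/4 - 3 * \<epsilon>) * N powr (- 5/4 + 12 * \<epsilon>) \<le> 4 * N powr (3/8 + 3 * \<epsilon>) * N powr (- 5/4 + 12 * \<epsilon>)"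
        by (intro mult_right_mono) auto
      also have "\<dots> = 4 * N powr (- 7/8 + 15 * \<epsilon>)" by (simp add: powr_add[symmetric])
      also have "\<dots> \<le> 4 * N powr 0" using True k small by (intro mult_left_mono powr_mono) auto
      finally show ?thesis using Np by simp
    next
      case False
      have "jb k powr - s \<le> 2 powr - s" using False k s by (intro powr_mono2) (auto simp: jb_def)
      also have "\<dots> \<le> 2 powr 2" using s by (intro powr_mono) auto
      finally have 1: "jb k powr - s \<le> 4" by simp
      have "jb N powr - (4/3) \<le> k" using t jb_pos[of N] by (simp add: powr_minus field_simps)
      then have "k powr - (3/4 - 3 * \<epsilon>) \<le> (jb N powr - (4/3)) powr - (3/4 - 3 * \<epsilon>)"
        using small jb_pos[of N] by (intro powr_mono2') auto
      also have "\<dots> = jb N powr (4/3 * (3/4 - 3 * \<epsilon>))"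
        unfolding powr_powr by (rule arg_cong[where f="\<lambda>x. jb N powr x"]) (simp add: algebra_simps)
      also have "\<dots> \<le> jb N powr 1" using e by (intro jb_powr_expo_mono) auto
      also have "\<dots> \<le> 4 * N" using N jb_pos[of N] by simp
      finally have "jb k powr - s * k powr - (3/4 - 3 * \<epsilon>) * N powr (- 5/4 + 12 * \<epsilon>) \<le> 4 * (4 * N) * N powr (- 5/4 + 12 * \<epsilon>)"
        using 1 by (intro mult_right_mono mult_mono) auto
      also have "\<dots> = 16 * (N powr 1 * N powr (- 5/4 + 12 * \<epsilon>))" using Np by simp
      also have "N powr 1 * N powr (- 5/4 + 12 * \<epsilon>) = N powr - (1/4 - 12 * \<epsilon>)" unfolding powr_add[symmetric] by simp
      also have "16 * N powr - (1/4 - 12 * \<epsilon>) \<le> 16 * 3" using small e by (intro mult_left_mono Nneg) auto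
      finally show ?thesis by simp
    qed
    have "4 * N * jb k powr - s * (k powr (3 * \<epsilon>) * N powr (12 * \<epsilon>)) = 4 * jb k powr - s * (k powr (3 * \<epsilon>) * (N * N powr (12 * \<epsilon>)))"
      by (simp only: ac_simps)
    also have "\<dots> = 4 * (k powr (3/4) * N powr (9/4)) * (jb k powr - s * k powr - (3/4 - 3 * \<epsilon>) * N powr (- 5/4 + 12 * \<epsilon>))"
      unfolding NN kk by (simp only: ac_simps)
    also have "\<dots> \<le> 4 * (k powr (3/4) * N powr (9/4)) * 50" using key by (intro mult_left_mono) auto
    finally show ?thesis by simp
  qed
  have "0 \<le> k powr (3/4) * N powr (9/4)" by simp
  then show ?thesis using A B unfolding AB_def pw distrib_right by linarith
qed

text \<open>One summand per regime, with \<open>xi z\<close> the smallest frequency: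
  \<open>KT\<close> when it is tiny; the three Strichartz kernels, each for the two functions that
  do not carry the largest modulation; and \<open>KL\<close> when all modulations are small.\<close>

definition KU :: "real \<Rightarrow> freq \<Rightarrow> freq \<Rightarrow> ennreal" where
  "KU b z w = KT z w + (KS b z w + (KS b z (z + w) + (KS b w (w + z) + KL b z w)))"

lemma KS_even: "KS b (- z) w = KS b z w" "KS b z (- w) = KS b z w"
  unfolding KS_def by simp_all

lemma tri_bounded_KU:
  assumes b: "b > 1/2"
  shows "tri_bounded (KU b)"
proof -
  note S = tri_bounded_KS[OF b]
  have S1: "tri_bounded (\<lambda>z w. KS b z (z + w))" using tri_bounded_rotate[OF S] unfolding KS_even .
  have S2: "tri_bounded (\<lambda>z w. KS b w (w + z))" by (rule tri_bounded_swap[OF S1])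
  show ?thesis unfolding KU_def[abs_def]
    by (rule tri_bounded_add[OF tri_bounded_KT tri_bounded_add[OF S tri_bounded_add[OF S1 tri_bounded_add[OF S2 tri_bounded_KL[OF b]]]]])
qed

text \<open>Sum over the six ways to distribute the smallest, middle and largest frequency over the
  two inputs and the output. Since \<open>- z\<close> and \<open>z + w\<close> add up to
  \<open>w\<close>, an input can take the place of the sum.\<close>

definition KV :: "real \<Rightarrow> freq \<Rightarrow> freq \<Rightarrow> ennreal" where
  "KV b z w = (KU b z w + KU b w z) + ((KU b (- z) (z + w) + KU b (- w) (w + z)) + (KU b (z + w) (- z) + KU b (w + z) (- w)))"

lemma tri_bounded_KV:
  assumes b: "b > 1/2"
  shows "tri_bounded (KV b)"
proof -
  note U = tri_bounded_KU[OF b]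
  note s = tri_bounded_swap[OF U]
  note r1 = tri_bounded_rotate[OF U]
  note r2 = tri_bounded_swap[OF r1]
  have t1: "tri_bounded (\<lambda>z w. KU b (z + w) (- z))" using tri_bounded_rotate[OF s] .
  note t2 = tri_bounded_swap[OF t1]
  show ?thesis unfolding KV_def[abs_def]
    by (rule tri_bounded_add[OF tri_bounded_add[OF U s] tri_bounded_add[OF tri_bounded_add[OF r1 r2] tri_bounded_add[OF t1 t2]]])
qed

text \<open>\<open>jm\<close> is the modulation of the true output, which is weighted with
  \<open>b - 3 * \<epsilon>\<close> instead of \<open>b\<close>. After the frequencies are permuted
  it may occupy any of the three places, hence the form of the hypothesis \<open>jm\<close>.\<close>

lemma kernel_le_KU:
  fixes z w :: freq
  assumes k: "0 < \<bar>xi z\<bar>" "\<bar>xi z\<bar> \<le> \<bar>xi w\<bar>" "\<bar>xi w\<bar> \<le> \<bar>xi (z + w)\<bar>"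
    and s: "- 9/8 < s" "s \<le> -1" and e: "0 < \<epsilon>" "6 * \<epsilon> \<le> s + 9/8" and e64: "64 * \<epsilon> \<le> 1" and b: "b = 1/2 + \<epsilon>"
    and M: "0 \<le> M" "M \<le> AB s \<bar>xi z\<bar> \<bar>xi (z + w)\<bar>"
    and jm: "jm \<in> {jb (sg z), jb (sg w), jb (sg (z + w))}"
  shows "ennreal (M * (jm powr (3 * \<epsilon>) * (jb (sg z) powr - b * jb (sg w) powr - b * jb (sg (z + w)) powr - b)))
     \<le> ennreal 30000000 * KU b z w"
proof -
  define k N where "k = \<bar>xi z\<bar>" and "N = \<bar>xi (z + w)\<bar>"
  define m where "m = \<bar>xi w\<bar>"
  define j1 j2 j3 where "j1 = jb (sg z)" and "j2 = jb (sg w)" and "j3 = jb (sg (z + w))"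
  have j: "1 \<le> j1" "1 \<le> j2" "1 \<le> j3" unfolding j1_def j2_def j3_def by (auto simp: jb_ge_1)
  have kN: "0 < k" "k \<le> m" "m \<le> N" "k \<le> N" "N \<le> k + m" "N > 0" "m > 0"
    using k abs_triangle_ineq[of "xi z" "xi w"] by (auto simp: k_def N_def m_def)
  have small: "\<epsilon> \<le> 1/48" using e s by linarith
  have jmc: "jm = j1 \<or> jm = j2 \<or> jm = j3" using jm by (auto simp: j1_def j2_def j3_def)
  define W where "W = jm powr (3 * \<epsilon>) * (j1 powr - b * j2 powr - b * j3 powr - b)"
  have W0: "0 \<le> W" unfolding W_def by auto
  have goal: "ennreal (M * W) \<le> ennreal 30000000 * KU b z w"
  proof (cases "k * jb N powr (4/3) \<le> 1")
    case True
    have M17: "M \<le> 17 * jb N" using AB_tiny[OF kN(1,4) s True] M unfolding k_def N_def by linarith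
    have jN: "jb N \<le> 2 * jb (xi w)" using kN by (simp add: jb_def m_def)
    \<comment> \<open>The bracket with the surplus keeps the exponent
      \<open>1/2 - 2 * \<epsilon> \<ge> 15/32\<close>; this is where
      \<open>64 * \<epsilon> \<le> 1\<close> enters.\<close>
    have red: "ja powr (3 * \<epsilon>) * ja powr - b \<le> ja powr - (15/32)" "ja powr - b \<le> ja powr - (15/32)" "ja powr (3 * \<epsilon>) * ja powr - b \<le> 1" "ja powr - b \<le> 1"
      if "1 \<le> ja" for ja
    proof -
      have "ja powr (3 * \<epsilon>) * ja powr - b = ja powr (3 * \<epsilon> - b)" by (simp add: powr_add[symmetric])
      moreover have "ja powr (3 * \<epsilon> - b) \<le> ja powr - (15/32)" by (rule powr_mono) (use that e64 e in \<open>auto simp: b\<close>)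
      moreover have "ja powr (3 * \<epsilon> - b) \<le> ja powr 0" by (rule powr_mono) (use that e64 e in \<open>auto simp: b\<close>)
      moreover have "ja powr - b \<le> ja powr - (15/32)" by (rule powr_mono) (use that e64 e in \<open>auto simp: b\<close>)
      moreover have "ja powr - b \<le> ja powr 0" by (rule powr_mono) (use that e64 e in \<open>auto simp: b\<close>)
      ultimately show "ja powr (3 * \<epsilon>) * ja powr - b \<le> ja powr - (15/32)" "ja powr - b \<le> ja powr - (15/32)" "ja powr (3 * \<epsilon>) * ja powr - b \<le> 1" "ja powr - b \<le> 1"
        using that by auto
    qed
    have Wle: "W \<le> j1 powr - (15/32) * j2 powr - (15/32)"
      using jmc
    proof (elim disjE)
      assume "jm = j1"
      then have "W = (j1 powr (3 * \<epsilon>) * j1 powr - b) * j2 powr - b * j3 powr - b" unfolding W_def by (simp add: ac_simps)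
      also have "\<dots> \<le> j1 powr - (15/32) * j2 powr - (15/32) * 1" using red[OF j(1)] red[OF j(2)] red[OF j(3)] by (intro mult_mono) auto
      finally show ?thesis by simp
    next
      assume "jm = j2"
      then have "W = j1 powr - b * (j2 powr (3 * \<epsilon>) * j2 powr - b) * j3 powr - b" unfolding W_def by (simp add: ac_simps)
      also have "\<dots> \<le> j1 powr - (15/32) * j2 powr - (15/32) * 1" using red[OF j(1)] red[OF j(2)] red[OF j(3)] by (intro mult_mono) auto
      finally show ?thesis by simp
    next
      assume "jm = j3"
      then have "W = j1 powr - b * j2 powr - b * (j3 powr (3 * \<epsilon>) * j3 powr - b)" unfolding W_def by (simp add: ac_simps)
      also have "\<dots> \<le> j1 powr - (15/32) * j2 powr - (15/32) * 1" using red[OF j(1)] red[OF j(2)] red[OF j(3)] by (intro mult_mono) auto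
      finally show ?thesis by simp
    qed
    have "M * W \<le> (17 * (2 * jb (xi w))) * (j1 powr - (15/32) * j2 powr - (15/32))"
      using M17 jN Wle W0 jb_nonneg[of "xi w"] by (intro mult_mono) auto
    also have "\<dots> \<le> 30000000 * (jb (xi w) * (j1 powr - (15/32) * j2 powr - (15/32)))"
      using jb_nonneg[of "xi w"] by (simp add: mult_nonneg_nonneg mult_right_mono)
    finally have "ennreal (M * W) \<le> ennreal 30000000 * ennreal (jb (xi w) * (j1 powr - (15/32) * j2 powr - (15/32)))"
      using jb_nonneg[of "xi w"] by (subst ennreal_mult[symmetric]) (auto intro!: ennreal_leI)
    also have "ennreal (jb (xi w) * (j1 powr - (15/32) * j2 powr - (15/32))) = KT z w"
    proof -
      have "jb (xi (z + w)) = jb N" unfolding N_def jb_def by simp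
      then show ?thesis using True kN unfolding KT_def j1_def j2_def k_def m_def N_def by simp
    qed
    finally show ?thesis unfolding KU_def by (rule order_trans) (intro mult_left_mono add_increasing2, auto)
  next
    case False
    then have t: "1 < k * jb N powr (4/3)" by simp
    note N3 = nontiny_N[OF kN(1,4) t]
    define P where "P = k * N ^ 4"
    have P: "1/216 \<le> P" "0 < P" using N3 by (auto simp: P_def)
    have M1: "M * P powr (3 * \<epsilon>) \<le> 1000 * (k powr (3/4) * N powr (9/4))"
      using mult_right_mono[OF M(2), of "P powr (3 * \<epsilon>)"] AB_big[OF kN(1,4) s t e] unfolding k_def N_def P_def by simp
    define J where "J = max j1 (max j2 j3)"
    have J: "1 \<le> J" "j1 \<le> J" "j2 \<le> J" "j3 \<le> J" "J = j1 \<or> J = j2 \<or> J = j3" using j by (auto simp: J_def max_def)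
    have jmJ: "jm powr (3 * \<epsilon>) \<le> J powr (3 * \<epsilon>)" using jmc J j e by (intro powr_mono2) auto
    show ?thesis
    \<comment> \<open>If the largest modulation \<open>J\<close> reaches the order of
      \<open>P\<close>, it is spent and the other two functions meet a Strichartz kernel. Otherwise
      the resonance, at most \<open>3 * J\<close>, is below \<open>3/5 * P\<close> and
      \<open>KL\<close> applies.\<close>
    proof (cases "P / 96 \<le> J")
      case True
      have WJ: "W \<le> J powr (3 * \<epsilon>) * (j1 powr - b * j2 powr - b * j3 powr - b)" unfolding W_def using jmJ by (intro mult_right_mono) auto
      \<comment> \<open>\<open>J powr (3 * \<epsilon> - b)\<close> is exchanged for a power of
        \<open>P\<close>. The losses 96, 1000 and 216 multiply to 20736000; the later factor 5/4
        stays within the claimed 30000000.\<close>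
      have MJ: "M * (J powr (3 * \<epsilon>) * J powr - b) \<le> 20736000 * (k powr (1/4) * N powr (1/4))"
      proof -
        have "J powr (3 * \<epsilon>) * J powr - b = J powr - (1/2 - 2 * \<epsilon>)" unfolding b by (simp add: powr_add[symmetric])
        also have "\<dots> \<le> (P / 96) powr - (1/2 - 2 * \<epsilon>)" using True P small by (intro powr_mono2') auto
        also have "\<dots> = P powr - (1/2 - 2 * \<epsilon>) * 96 powr (1/2 - 2 * \<epsilon>)" using P by (simp add: powr_divide powr_minus field_simps)
        also have "\<dots> \<le> P powr - (1/2 - 2 * \<epsilon>) * 96"
        proof (intro mult_left_mono)
          have "(96::real) powr (1/2 - 2 * \<epsilon>) \<le> 96 powr 1" using e by (intro powr_mono) auto
          then show "(96::real) powr (1/2 - 2 * \<epsilon>) \<le> 96" by simp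
        qed auto
        finally have "M * (J powr (3 * \<epsilon>) * J powr - b) \<le> M * (P powr - (1/2 - 2 * \<epsilon>) * 96)" using M by (intro mult_left_mono) auto
        also have "\<dots> = 96 * (M * P powr (3 * \<epsilon>)) * (P powr - \<epsilon> * P powr - (1/2))"
        proof -
          have "P powr (3 * \<epsilon>) * (P powr - \<epsilon> * P powr - (1/2)) = P powr - (1/2 - 2 * \<epsilon>)" by (simp add: powr_add[symmetric])
          then show ?thesis by (simp add: ac_simps)
        qed
        also have "\<dots> \<le> 96 * (1000 * (k powr (3/4) * N powr (9/4))) * (216 * P powr - (1/2))"
        proof -
          have "P powr - \<epsilon> \<le> (1/216) powr - \<epsilon>" using P e by (intro powr_mono2') auto
          also have "\<dots> = 216 powr \<epsilon>" by (simp add: powr_divide powr_minus field_simps)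
          also have "\<dots> \<le> 216 powr 1" using small by (intro powr_mono) auto
          finally have "P powr - \<epsilon> \<le> 216" by simp
          then have Pe: "P powr - \<epsilon> * P powr - (1/2) \<le> 216 * P powr - (1/2)" by (intro mult_right_mono) auto
          show ?thesis using mult_mono[OF mult_left_mono[OF M1, of 96] Pe] M by simp
        qed
        also have "\<dots> = 20736000 * ((k powr (3/4) * N powr (9/4)) * P powr - (1/2))" by (simp add: ac_simps)
        also have "(k powr (3/4) * N powr (9/4)) * P powr - (1/2) = k powr (1/4) * N powr (1/4)"
        proof -
          have "P powr - (1/2) = k powr - (1/2) * N powr - 2"
            unfolding P_def using kN by (simp add: powr_mult powr_powr flip: powr_numeral)
          then have "(k powr (3/4) * N powr (9/4)) * P powr - (1/2) = (k powr (3/4) * k powr - (1/2)) * (N powr (9/4) * N powr - 2)"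
            by (simp add: ac_simps)
          then show ?thesis by (simp add: powr_add[symmetric])
        qed
        finally show ?thesis .
      qed
      have N4: "N powr (1/4) \<le> 5/4 * m powr (1/4)"
      proof -
        have "N powr (1/4) \<le> (2 * m) powr (1/4)" using kN by (intro powr_mono2) auto
        also have "\<dots> = 2 powr (1/4) * m powr (1/4)" using kN by (simp add: powr_mult)
        also have "\<dots> \<le> 5/4 * m powr (1/4)"
        proof (intro mult_right_mono)
          have "(2::real) powr (1/4) \<le> ((5/4)^4) powr (1/4)" by (intro powr_mono2) (auto simp: power4_eq_xxxx)
          also have "\<dots> = 5/4" by (simp add: powr_powr flip: powr_numeral)
          finally show "(2::real) powr (1/4) \<le> 5/4" .
        qed auto
        finally show ?thesis .
      qed
      have fin: "ennreal (M * W) \<le> ennreal 30000000 * KS b u v"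
        if uv: "M * W \<le> (M * (J powr (3 * \<epsilon>) * J powr - b)) * (jb (sg u) powr - b * jb (sg v) powr - b)"
          "k powr (1/4) * m powr (1/4) \<le> \<bar>xi u\<bar> powr (1/4) * \<bar>xi v\<bar> powr (1/4)" for u v
      proof -
        have "k powr (1/4) * N powr (1/4) \<le> k powr (1/4) * (5/4 * m powr (1/4))" using N4 by (intro mult_left_mono) auto
        then have "k powr (1/4) * N powr (1/4) \<le> 5/4 * (\<bar>xi u\<bar> powr (1/4) * \<bar>xi v\<bar> powr (1/4))" using uv(2) by linarith
        then have "M * (J powr (3 * \<epsilon>) * J powr - b) \<le> 30000000 * (\<bar>xi u\<bar> powr (1/4) * \<bar>xi v\<bar> powr (1/4))"
          using MJ mult_nonneg_nonneg[OF powr_ge_zero[of "\<bar>xi u\<bar>" "1/4"] powr_ge_zero[of "\<bar>xi v\<bar>" "1/4"]] by linarith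
        then have "M * W \<le> 30000000 * (\<bar>xi u\<bar> powr (1/4) * \<bar>xi v\<bar> powr (1/4)) * (jb (sg u) powr - b * jb (sg v) powr - b)"
          by (intro order_trans[OF uv(1)] mult_right_mono) auto
        then show ?thesis unfolding KS_def
          by (subst ennreal_mult[symmetric]) (auto intro!: ennreal_leI simp: mult.assoc)
      qed
      have mN4: "m powr (1/4) \<le> N powr (1/4)" "k powr (1/4) \<le> m powr (1/4)" using kN by (auto intro!: powr_mono2)
      from J(5) show ?thesis
      proof (elim disjE)
        assume "J = j3"
        have "ennreal (M * W) \<le> ennreal 30000000 * KS b z w"
        proof (rule fin)
          show "M * W \<le> (M * (J powr (3 * \<epsilon>) * J powr - b)) * (jb (sg z) powr - b * jb (sg w) powr - b)"
            using mult_left_mono[OF WJ M(1)] \<open>J = j3\<close> unfolding j1_def j2_def by (simp add: ac_simps)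
        qed (auto simp: k_def m_def)
        also have "\<dots> \<le> ennreal 30000000 * KU b z w" unfolding KU_def by (intro mult_left_mono) (auto intro: add_increasing add_increasing2)
        finally show ?thesis .
      next
        assume "J = j2"
        have "ennreal (M * W) \<le> ennreal 30000000 * KS b z (z + w)"
        proof (rule fin)
          show "M * W \<le> (M * (J powr (3 * \<epsilon>) * J powr - b)) * (jb (sg z) powr - b * jb (sg (z + w)) powr - b)"
            using mult_left_mono[OF WJ M(1)] \<open>J = j2\<close> unfolding j1_def j3_def by (simp add: ac_simps)
          show "k powr (1/4) * m powr (1/4) \<le> \<bar>xi z\<bar> powr (1/4) * \<bar>xi (z + w)\<bar> powr (1/4)"
            unfolding k_def[symmetric] N_def[symmetric] using mN4 by (intro mult_left_mono) auto
        qed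
        also have "\<dots> \<le> ennreal 30000000 * KU b z w" unfolding KU_def by (intro mult_left_mono) (auto intro: add_increasing add_increasing2)
        finally show ?thesis .
      next
        assume "J = j1"
        have "ennreal (M * W) \<le> ennreal 30000000 * KS b w (w + z)"
        proof (rule fin)
          show "M * W \<le> (M * (J powr (3 * \<epsilon>) * J powr - b)) * (jb (sg w) powr - b * jb (sg (w + z)) powr - b)"
            using mult_left_mono[OF WJ M(1)] \<open>J = j1\<close> unfolding j2_def j3_def add.commute[of w z] by (simp add: ac_simps)
          show "k powr (1/4) * m powr (1/4) \<le> \<bar>xi w\<bar> powr (1/4) * \<bar>xi (w + z)\<bar> powr (1/4)"
            unfolding add.commute[of w z] m_def[symmetric] N_def[symmetric] using mN4 by (intro mult_mono) auto
        qed
        also have "\<dots> \<le> ennreal 30000000 * KU b z w" unfolding KU_def by (intro mult_left_mono) (auto intro: add_increasing add_increasing2)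
        finally show ?thesis .
      qed
    next
      case False
      have R: "regK z w"
      proof -
        have "phase (fst z) + phase (fst w) - phase (fst (z + w)) = sg z + sg w - sg (z + w)" by (simp add: sg_def)
        then have "\<bar>phase (fst z) + phase (fst w) - phase (fst (z + w))\<bar> \<le> 3 * J"
          using J unfolding j1_def j2_def j3_def jb_def by linarith
        also have "\<dots> < 3/5 * P" using False P by linarith
        also have "\<dots> = 3/5 * \<bar>xi z\<bar> * xi (z + w) ^ 4" unfolding P_def k_def N_def by simp
        finally show ?thesis unfolding regK_def using k by auto
      qed
      have "J powr (3 * \<epsilon>) \<le> P powr (3 * \<epsilon>)" using False P J e by (intro powr_mono2) auto
      then have "W \<le> P powr (3 * \<epsilon>) * (j1 powr - b * j2 powr - b * j3 powr - b)" unfolding W_def using jmJ by (intro mult_right_mono) auto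
      then have "M * W \<le> M * (P powr (3 * \<epsilon>) * (j1 powr - b * j2 powr - b * j3 powr - b))" using M by (intro mult_left_mono)
      also have "\<dots> = (M * P powr (3 * \<epsilon>)) * (j1 powr - b * j2 powr - b * j3 powr - b)" by (simp only: mult.assoc)
      also have "\<dots> \<le> (30000000 * (k powr (1/2) * N powr (5/2))) * (j1 powr - b * j2 powr - b * j3 powr - b)"
      proof (intro mult_right_mono)
        have "k powr (3/4) * N powr (9/4) = k powr (1/2) * (k powr (1/4) * N powr (9/4))"
          by (simp add: powr_add[symmetric] mult.assoc[symmetric])
        also have "\<dots> \<le> k powr (1/2) * (N powr (1/4) * N powr (9/4))"
          using kN by (intro mult_left_mono mult_right_mono powr_mono2) auto
        also have "\<dots> = k powr (1/2) * N powr (5/2)" by (simp add: powr_add[symmetric])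
        finally show "M * P powr (3 * \<epsilon>) \<le> 30000000 * (k powr (1/2) * N powr (5/2))"
          using M1 powr_ge_zero[of k "1/2"] powr_ge_zero[of N "5/2"] mult_nonneg_nonneg[of "k powr (1/2)" "N powr (5/2)"] by linarith
      qed auto
      finally have "ennreal (M * W) \<le> ennreal 30000000 * KL b z w"
        using R unfolding KL_def k_def N_def j1_def j2_def j3_def
        by (simp only: if_True) (subst ennreal_mult[symmetric], auto intro!: ennreal_leI simp: mult.assoc)
      also have "\<dots> \<le> ennreal 30000000 * KU b z w" unfolding KU_def by (intro mult_left_mono) (auto intro: add_increasing add_increasing2)
      finally show ?thesis .
    qed
  qed
  then show ?thesis unfolding W_def j1_def j2_def j3_def .
qed

section \<open>From ordered kernels to the weighted bilinear bound\<close>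

lemma AE_xi_neq: "AE z in lborel. xi z \<noteq> c"
proof -
  define u :: "freq \<Rightarrow> ennreal" where "u z = (if xi z = c then 1 else 0)" for z
  have [measurable]: "u \<in> borel_measurable borel" unfolding u_def[abs_def] by measurable
  have "(\<integral>\<^sup>+z. u z \<partial>lborel) = (\<integral>\<^sup>+x. \<integral>\<^sup>+m. \<integral>\<^sup>+t. u ((x, m), t) \<partial>lborel \<partial>lborel \<partial>lborel)"
    by (rule nn_integral_freq) measurable
  also have "\<dots> = (\<integral>\<^sup>+x. 0 \<partial>(lborel :: real measure))"
  proof (rule nn_integral_cong_AE)
    have "AE x in lborel. x \<noteq> c" by (rule AE_lborel_singleton)
    then show "AE x in lborel. (\<integral>\<^sup>+m. \<integral>\<^sup>+t. u ((x, m), t) \<partial>lborel \<partial>lborel) = 0"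
      by eventually_elim (simp add: u_def)
  qed
  finally have "(\<integral>\<^sup>+z. u z \<partial>lborel) = 0" by simp
  then have "AE z in lborel. u z = 0" by (subst (asm) nn_integral_0_iff_AE) auto
  then show ?thesis by eventually_elim (auto simp: u_def split: if_splits)
qed

lemma freq_kernel_le:
  assumes nz: "xi z \<noteq> 0" "xi w \<noteq> 0" "xi (z + w) \<noteq> 0"
    and s: "- 9/8 < s" "s \<le> -1" and e: "0 < \<epsilon>" "6 * \<epsilon> \<le> s + 9/8" "64 * \<epsilon> \<le> 1" and b: "b = 1/2 + \<epsilon>"
  shows "ennreal (freqw s \<bar>xi z\<bar> \<bar>xi w\<bar> \<bar>xi (z + w)\<bar> * (jb (sg z) powr - b * jb (sg w) powr - b * jb (sg (z + w)) powr - (1/2 - 2 * \<epsilon>)))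
    \<le> ennreal 30000000 * KV b z w"
proof -
  define x y v where "x = \<bar>xi z\<bar>" and "y = \<bar>xi w\<bar>" and "v = \<bar>xi (z + w)\<bar>"
  define jm where "jm = jb (sg (z + w))"
  define W where "W = jm powr (3 * \<epsilon>) * (jb (sg z) powr - b * jb (sg w) powr - b * jb (sg (z + w)) powr - b)"
  have "jb (sg (z + w)) powr - (1/2 - 2 * \<epsilon>) = jm powr (3 * \<epsilon>) * jb (sg (z + w)) powr - b"
    unfolding jm_def b by (simp add: powr_add[symmetric])
  then have eq: "jb (sg z) powr - b * jb (sg w) powr - b * jb (sg (z + w)) powr - (1/2 - 2 * \<epsilon>) = W"
    unfolding W_def by (simp add: ac_simps)
  have pos: "0 < x" "0 < y" "0 < v" using nz by (auto simp: x_def y_def v_def)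
  have tri: "v \<le> x + y" "x \<le> v + y" "y \<le> v + x" unfolding x_def y_def v_def by auto
  have M0: "0 \<le> freqw s x y v" unfolding freqw_def using pos by auto
  have g1: "KU b a c \<le> KV b z w" if "(a, c) \<in> {(z, w), (w, z), (- z, z + w), (- w, w + z), (z + w, - z), (w + z, - w)}" for a c
    using that unfolding KV_def by (auto intro: add_increasing add_increasing2)
  have main: "ennreal (freqw s x y v * W) \<le> ennreal 30000000 * KV b z w"
    if ac: "(a, c) \<in> {(z, w), (w, z), (- z, z + w), (- w, w + z), (z + w, - z), (w + z, - w)}"
      "\<bar>xi a\<bar> \<le> \<bar>xi c\<bar>" "\<bar>xi c\<bar> \<le> \<bar>xi (a + c)\<bar>" "freqw s x y v \<le> AB s \<bar>xi a\<bar> \<bar>xi (a + c)\<bar>" for a c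
  proof -
    have a0: "0 < \<bar>xi a\<bar>" using ac(1) nz by auto
    have jmin: "jm \<in> {jb (sg a), jb (sg c), jb (sg (a + c))}" using ac(1) unfolding jm_def by (auto simp: add.commute)
    have W': "W = jm powr (3 * \<epsilon>) * (jb (sg a) powr - b * jb (sg c) powr - b * jb (sg (a + c)) powr - b)"
      using ac(1) unfolding W_def by (auto simp: ac_simps)
    have "ennreal (freqw s x y v * W) \<le> ennreal 30000000 * KU b a c"
      unfolding W' by (rule kernel_le_KU[OF a0 ac(2,3) s e(1,2,3) b M0 ac(4) jmin])
    also have "\<dots> \<le> ennreal 30000000 * KV b z w" by (intro mult_left_mono g1 ac) auto
    finally show ?thesis .
  qed
  \<comment> \<open>Each ordering of the frequencies is matched with one summand of
    \<open>KV\<close>. As \<open>freqw\<close> is symmetric in the inputs, the three inequalities of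
    \<open>freqw_le_AB\<close> cover all six.\<close>
  consider "x \<le> y" "y \<le> v" | "y \<le> x" "x \<le> v" | "x \<le> v" "v \<le> y" | "y \<le> v" "v \<le> x" | "v \<le> x" "x \<le> y" | "v \<le> y" "y \<le> x"
    by linarith
  then have "ennreal (freqw s x y v * W) \<le> ennreal 30000000 * KV b z w"
  proof cases
    case 1
    show ?thesis by (rule main[of z w]) (use 1 freqw_le_AB(1)[OF pos(1) 1 tri(1) s] in \<open>auto simp: x_def y_def v_def\<close>)
  next
    case 2
    have t: "v \<le> y + x" using tri by simp
    show ?thesis by (rule main[of w z]) (use 2 freqw_le_AB(1)[OF pos(2) 2 t s] in \<open>auto simp: x_def y_def v_def freqw_commute add.commute\<close>)
  next
    case 3
    have t: "y \<le> x + v" using tri by simp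
    show ?thesis by (rule main[of "- z" "z + w"]) (use 3 freqw_le_AB(2)[OF pos(1) 3 t s] in \<open>auto simp: x_def y_def v_def\<close>)
  next
    case 4
    have t: "x \<le> y + v" using tri by simp
    show ?thesis by (rule main[of "- w" "w + z"]) (use 4 freqw_le_AB(2)[OF pos(2) 4 t s] freqw_commute[of s x y v] in \<open>auto simp: x_def y_def v_def add.commute\<close>)
  next
    case 5
    show ?thesis by (rule main[of "z + w" "- z"]) (use 5 freqw_le_AB(3)[OF pos(3) 5 tri(3) s] in \<open>auto simp: x_def y_def v_def\<close>)
  next
    case 6
    show ?thesis by (rule main[of "w + z" "- w"]) (use 6 freqw_le_AB(3)[OF pos(3) 6 tri(2) s] freqw_commute[of s x y v] in \<open>auto simp: x_def y_def v_def add.commute\<close>)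
  qed
  then show ?thesis unfolding eq x_def y_def v_def .
qed

lemma xweight_eq: "xweight s1 s2 b z = jb (xi z) powr s1 * jb (mu z) powr s2 * jb (sg z) powr b"
  unfolding xweight_def hweight_def sg_def ..

lemma xweight_pos: "0 < xweight s1 s2 b z"
proof -
  have "0 < jb u powr p" for u p using jb_pos[of u] by simp
  then show ?thesis unfolding xweight_eq by (intro mult_pos_pos)
qed

lemma xweight_measurable [measurable]: "xweight s1 s2 b \<in> borel_measurable borel"
  unfolding xweight_eq[abs_def] by measurable

lemma hweight_measurable [measurable]: "hweight s1 s2 \<in> borel_measurable borel"
  unfolding hweight_def[abs_def] by measurable

text \<open>The difference \<open>s1 - s\<close> is nonnegative and, like \<open>s2\<close>, is
  handled by submultiplicativity of the bracket. So only the regularity \<open>s\<close> reaches the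
  kernel estimate, and it can be taken as \<open>min s1 (- 1)\<close>.\<close>

lemma xweight_le:
  assumes s: "s \<le> s1" and s2: "0 \<le> s2"
  shows "\<bar>xi (z + w)\<bar> * xweight s1 s2 (- (1/2) + 2 * \<epsilon>) (z + w) \<le>
    (freqw s \<bar>xi z\<bar> \<bar>xi w\<bar> \<bar>xi (z + w)\<bar> * (jb (sg z) powr - b * jb (sg w) powr - b * jb (sg (z + w)) powr - (1/2 - 2 * \<epsilon>)))
     * (xweight s1 s2 b z * xweight s1 s2 b w)"
proof -
  have jbabs: "jb \<bar>x\<bar> = jb x" for x unfolding jb_def by simp
  have c: "jb u powr - p * jb u powr p = 1" for u p using jb_pos[of u] by (simp add: powr_add[symmetric])
  have prod: "jb (x + y) powr p \<le> jb x powr p * jb y powr p" if "0 \<le> p" for x y p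
  proof -
    have "jb (x + y) powr p \<le> (jb x * jb y) powr p" using jb_add_le_mult that jb_nonneg by (intro powr_mono2) auto
    then show ?thesis using jb_nonneg by (simp add: powr_mult)
  qed
  have "jb (xi (z + w)) powr s1 = jb (xi (z + w)) powr s * jb (xi z + xi w) powr (s1 - s)"
    by (simp add: powr_add[symmetric])
  also have "\<dots> \<le> jb (xi (z + w)) powr s * (jb (xi z) powr (s1 - s) * jb (xi w) powr (s1 - s))"
    using prod[of "s1 - s"] s by (intro mult_left_mono) auto
  also have "jb (xi z) powr (s1 - s) * jb (xi w) powr (s1 - s) = (jb (xi z) powr - s * jb (xi w) powr - s) * (jb (xi z) powr s1 * jb (xi w) powr s1)"
  proof -
    have "jb u powr (s1 - s) = jb u powr - s * jb u powr s1" for u by (simp add: powr_add[symmetric])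
    then show ?thesis by (simp add: ac_simps)
  qed
  finally have 1: "jb (xi (z + w)) powr s1 \<le> jb (xi (z + w)) powr s * ((jb (xi z) powr - s * jb (xi w) powr - s) * (jb (xi z) powr s1 * jb (xi w) powr s1))" .
  have 2: "jb (mu (z + w)) powr s2 \<le> jb (mu z) powr s2 * jb (mu w) powr s2" using prod[OF s2, of "mu z" "mu w"] by simp
  have "\<bar>xi (z + w)\<bar> * xweight s1 s2 (- (1/2) + 2 * \<epsilon>) (z + w) =
    \<bar>xi (z + w)\<bar> * (jb (xi (z + w)) powr s1 * jb (mu (z + w)) powr s2) * jb (sg (z + w)) powr - (1/2 - 2 * \<epsilon>)"
    unfolding xweight_eq by (simp add: algebra_simps)
  also have "\<dots> \<le> \<bar>xi (z + w)\<bar> * ((jb (xi (z + w)) powr s * ((jb (xi z) powr - s * jb (xi w) powr - s) * (jb (xi z) powr s1 * jb (xi w) powr s1))) *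
      (jb (mu z) powr s2 * jb (mu w) powr s2)) * jb (sg (z + w)) powr - (1/2 - 2 * \<epsilon>)"
    by (intro mult_right_mono mult_left_mono mult_mono[OF 1 2]) auto
  also have "\<dots> = \<bar>xi (z + w)\<bar> * ((jb (xi (z + w)) powr s * ((jb (xi z) powr - s * jb (xi w) powr - s) * (jb (xi z) powr s1 * jb (xi w) powr s1))) *
      (jb (mu z) powr s2 * jb (mu w) powr s2)) * jb (sg (z + w)) powr - (1/2 - 2 * \<epsilon>) *
      ((jb (sg z) powr - b * jb (sg z) powr b) * (jb (sg w) powr - b * jb (sg w) powr b))"
    unfolding c by simp
  also have "\<dots> = (freqw s \<bar>xi z\<bar> \<bar>xi w\<bar> \<bar>xi (z + w)\<bar> * (jb (sg z) powr - b * jb (sg w) powr - b * jb (sg (z + w)) powr - (1/2 - 2 * \<epsilon>)))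
     * (xweight s1 s2 b z * xweight s1 s2 b w)"
    unfolding freqw_def xweight_eq jbabs by (simp only: ac_simps)
  finally show ?thesis .
qed

text \<open>Stating it for nonnegative functions makes it usable before the convolution of the
  complex functions is known to converge.\<close>

theorem bilinear_estimate:
  assumes s1: "- 9/8 < s1" and s2: "0 \<le> s2"
    and e: "0 < \<epsilon>" "6 * \<epsilon> \<le> min s1 (- 1) + 9/8" "64 * \<epsilon> \<le> 1"
  obtains C where "C < \<top>" "\<And>f g. f \<in> borel_measurable borel \<Longrightarrow> g \<in> borel_measurable borel \<Longrightarrow>
    (\<integral>\<^sup>+z. (ennreal (\<bar>xi z\<bar> * xweight s1 s2 (- (1/2) + 2 * \<epsilon>) z) * (\<integral>\<^sup>+w. f w * g (z - w) \<partial>lborel))\<^sup>2 \<partial>lborel)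
    \<le> C * ((\<integral>\<^sup>+z. (ennreal (xweight s1 s2 (1/2 + \<epsilon>) z) * f z)\<^sup>2 \<partial>lborel) * (\<integral>\<^sup>+z. (ennreal (xweight s1 s2 (1/2 + \<epsilon>) z) * g z)\<^sup>2 \<partial>lborel))"
proof -
  define s b where "s = min s1 (- 1)" and "b = 1/2 + \<epsilon>"
  have s: "- 9/8 < s" "s \<le> - 1" "s \<le> s1" using s1 by (auto simp: s_def)
  have b: "b > 1/2" using e by (simp add: b_def)
  let ?X = "xweight s1 s2 b"
  let ?c = "ennreal 30000000"
  obtain C where C: "C < \<top>" "\<And>f g. f \<in> borel_measurable borel \<Longrightarrow> g \<in> borel_measurable borel \<Longrightarrow>
      sqint (trisum (KV b) f g) \<le> C * (sqint f * sqint g)"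
    using tri_bounded_KV[OF b] by (rule tri_bounded_trisum) blast
  note m = tri_bounded_measurable[OF tri_bounded_KV[OF b]]
  show ?thesis
  proof (rule that[of "?c\<^sup>2 * C"])
    show "?c\<^sup>2 * C < \<top>" using C by (simp add: ennreal_mult_less_top power2_eq_square)
    fix f g :: "freq \<Rightarrow> ennreal"
    assume [measurable]: "f \<in> borel_measurable borel" "g \<in> borel_measurable borel"
    define F G where "F z = ennreal (?X z) * f z" and "G z = ennreal (?X z) * g z" for z
    have [measurable]: "F \<in> borel_measurable borel" "G \<in> borel_measurable borel" unfolding F_def[abs_def] G_def[abs_def] by measurable
    have pt: "ennreal (\<bar>xi z\<bar> * xweight s1 s2 (- (1/2) + 2 * \<epsilon>) z) * (\<integral>\<^sup>+w. f w * g (z - w) \<partial>lborel) \<le> ?c * trisum (KV b) F G z" for z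
    proof (cases "xi z = 0")
      case False
      define A where "A = ennreal (\<bar>xi z\<bar> * xweight s1 s2 (- (1/2) + 2 * \<epsilon>) z)"
      have "A * (\<integral>\<^sup>+w. f w * g (z - w) \<partial>lborel) = (\<integral>\<^sup>+w. A * (f w * g (z - w)) \<partial>lborel)"
        by (rule nn_integral_cmult[symmetric]) measurable
      also have "\<dots> \<le> (\<integral>\<^sup>+w. ?c * (KV b w (z - w) * F w * G (z - w)) \<partial>lborel)"
      proof (rule nn_integral_mono_AE)
        show "AE w in lborel. A * (f w * g (z - w)) \<le> ?c * (KV b w (z - w) * F w * G (z - w))"
          using AE_xi_neq[of 0] AE_xi_neq[of "xi z"]
        proof eventually_elim
          case (elim w)
          define w' where "w' = z - w"
          have z: "z = w + w'" by (simp add: w'_def)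
          define Kf where "Kf = freqw s \<bar>xi w\<bar> \<bar>xi w'\<bar> \<bar>xi (w + w')\<bar> * (jb (sg w) powr - b * jb (sg w') powr - b * jb (sg (w + w')) powr - (1/2 - 2 * \<epsilon>))"
          have Kf0: "0 \<le> Kf" unfolding Kf_def freqw_def by simp
          have "A \<le> ennreal (Kf * (?X w * ?X w'))"
            unfolding A_def z Kf_def by (intro ennreal_leI xweight_le s s2)
          also have "\<dots> = ennreal Kf * (ennreal (?X w) * ennreal (?X w'))"
            using Kf0 xweight_pos[of s1 s2 b w] xweight_pos[of s1 s2 b w'] by (simp add: ennreal_mult less_imp_le)
          also have "ennreal Kf \<le> ?c * KV b w w'" unfolding Kf_def
            by (rule freq_kernel_le) (use elim False s e in \<open>auto simp: z b_def s_def[symmetric]\<close>)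
          finally have "A * (f w * g w') \<le> (?c * KV b w w' * (ennreal (?X w) * ennreal (?X w'))) * (f w * g w')"
            by (simp add: mult_right_mono)
          also have "\<dots> = ?c * (KV b w w' * F w * G w')" unfolding F_def G_def by (simp only: ac_simps)
          finally show ?case unfolding w'_def .
        qed
      qed
      also have "\<dots> = ?c * trisum (KV b) F G z" unfolding trisum_def using m by (subst nn_integral_cmult) auto
      finally show ?thesis unfolding A_def .
    qed simp
    have "(\<integral>\<^sup>+z. (ennreal (\<bar>xi z\<bar> * xweight s1 s2 (- (1/2) + 2 * \<epsilon>) z) * (\<integral>\<^sup>+w. f w * g (z - w) \<partial>lborel))\<^sup>2 \<partial>lborel)
      \<le> (\<integral>\<^sup>+z. (?c * trisum (KV b) F G z)\<^sup>2 \<partial>lborel)" by (intro nn_integral_mono power_mono pt) auto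
    also have "\<dots> = ?c\<^sup>2 * sqint (trisum (KV b) F G)"
      unfolding sqint_def power_mult_distrib using trisum_measurable[OF m, of F G] by (subst nn_integral_cmult) auto
    also have "\<dots> \<le> ?c\<^sup>2 * (C * (sqint F * sqint G))" by (intro mult_left_mono C) auto
    finally show "(\<integral>\<^sup>+z. (ennreal (\<bar>xi z\<bar> * xweight s1 s2 (- (1/2) + 2 * \<epsilon>) z) * (\<integral>\<^sup>+w. f w * g (z - w) \<partial>lborel))\<^sup>2 \<partial>lborel)
      \<le> ?c\<^sup>2 * C * ((\<integral>\<^sup>+z. (ennreal (xweight s1 s2 (1/2 + \<epsilon>) z) * f z)\<^sup>2 \<partial>lborel) * (\<integral>\<^sup>+z. (ennreal (xweight s1 s2 (1/2 + \<epsilon>) z) * g z)\<^sup>2 \<partial>lborel))"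
      unfolding sqint_def F_def G_def b_def by (simp only: mult.assoc)
  qed
qed

section \<open>Time cut-off\<close>

text \<open>Integration by parts leads to the sine integral:
  \<open>a * Si (a * x) - (1 - cos (a * x)) / x\<close> is an antiderivative, for
  \<open>a > 0\<close> with limits 0 and \<open>a * (pi / 2)\<close> at the ends of the positive
  half-line.\<close>

lemma has_bochner_integral_one_minus_cos:
  fixes a :: real
  shows "has_bochner_integral lborel (\<lambda>x. (1 - cos (a * x)) / x\<^sup>2) (pi * \<bar>a\<bar>)"
proof -
  have pos: "has_bochner_integral lborel (\<lambda>x. (1 - cos (a * x)) / x\<^sup>2) (pi * a)" if a: "a > 0" for a
  proof -
    define f where "f x = (1 - cos (a * x)) / x\<^sup>2" for x
    define F where "F x = a * Si (a * x) - (1 - cos (a * x)) / x" for x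
    have der: "(F has_real_derivative f x) (at x)" if "x > 0" for x
    proof -
      have "((\<lambda>x. Si (a * x)) has_real_derivative sinc (a * x) * a) (at x)"
        by (rule DERIV_chain'[where f="\<lambda>x. a * x", OF _ DERIV_Si, unfolded mult.commute[of _ a], THEN DERIV_cong])
           (auto intro!: derivative_eq_intros)
      then have "((\<lambda>x. a * Si (a * x)) has_real_derivative a * (sinc (a * x) * a)) (at x)" by (rule DERIV_cmult)
      moreover have "((\<lambda>x. (1 - cos (a * x)) / x) has_real_derivative (a * sin (a * x) * x - (1 - cos (a * x))) / x\<^sup>2) (at x)"
        using that by (auto intro!: derivative_eq_intros simp: power2_eq_square)
      ultimately have "(F has_real_derivative a * (sinc (a * x) * a) - (a * sin (a * x) * x - (1 - cos (a * x))) / x\<^sup>2) (at x)"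
        unfolding F_def[abs_def] by (rule DERIV_diff)
      moreover have "a * (sinc (a * x) * a) = a * sin (a * x) / x" using that a by simp
      ultimately show ?thesis unfolding f_def using that
        by (simp add: diff_divide_distrib power2_eq_square)
    qed
    have fnn: "0 \<le> f x" for x unfolding f_def by simp
    have lim0: "((F \<circ> real_of_ereal) \<longlongrightarrow> 0) (at_right (ereal 0))"
    proof -
      have "isCont (\<lambda>x. a * Si (a * x)) 0"
        by (intro continuous_intros isCont_o2[OF _ isCont_Si])
      then have 1: "((\<lambda>x. a * Si (a * x)) \<longlongrightarrow> 0) (at_right 0)"
        unfolding isCont_def by (auto simp: Si_def zero_ereal_def[symmetric] intro: tendsto_mono[OF at_le])
      have 2: "((\<lambda>x. (1 - cos (a * x)) / x) \<longlongrightarrow> 0) (at_right 0)"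
      proof -
        have "((\<lambda>x. 1 - cos (a * x)) has_real_derivative 0) (at 0)"
          by (auto intro!: derivative_eq_intros)
        then have "((\<lambda>x. (1 - cos (a * x)) / x) \<longlongrightarrow> 0) (at 0)" by (simp add: has_field_derivative_iff)
        then show ?thesis by (auto intro: tendsto_mono[OF at_le])
      qed
      have "(F \<longlongrightarrow> 0) (at_right 0)" unfolding F_def[abs_def] using tendsto_diff[OF 1 2] by simp
      then show ?thesis by (simp add: ereal_tendsto_simps)
    qed
    have liminf: "((F \<circ> real_of_ereal) \<longlongrightarrow> a * (pi / 2)) (at_left \<infinity>)"
    proof -
      have "((\<lambda>x. Si (a * x)) \<longlongrightarrow> pi / 2) at_top"
        using a by (intro filterlim_compose[OF Si_at_top] filterlim_tendsto_pos_mult_at_top[OF tendsto_const] filterlim_ident) auto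
      then have 1: "((\<lambda>x. a * Si (a * x)) \<longlongrightarrow> a * (pi / 2)) at_top" by (intro tendsto_intros)
      have 2: "((\<lambda>x. (1 - cos (a * x)) / x) \<longlongrightarrow> 0) at_top"
      proof (rule Lim_null_comparison)
        show "\<forall>\<^sub>F x in at_top. norm ((1 - cos (a * x)) / x) \<le> 2 / x"
          using eventually_gt_at_top[of "0::real"]
        proof eventually_elim
          case (elim x)
          have "\<bar>1 - cos (a * x)\<bar> \<le> 2" using cos_ge_minus_one[of "a * x"] cos_le_one[of "a * x"] by linarith
          then show ?case using elim by (simp add: divide_right_mono)
        qed
        show "((\<lambda>x::real. 2 / x) \<longlongrightarrow> 0) at_top" by real_asymp
      qed
      have "(F \<longlongrightarrow> a * (pi / 2)) at_top" unfolding F_def[abs_def] using tendsto_diff[OF 1 2] by simp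
      then show ?thesis by (simp add: ereal_tendsto_simps)
    qed
    have cont: "isCont f x" if "x > 0" for x
      unfolding f_def using that by (intro continuous_intros) auto
    note FTC = interval_integral_FTC_nonneg[of "ereal 0" \<infinity> F f 0 "a * (pi / 2)"]
    have "set_integrable lborel (einterval 0 \<infinity>) f" "(LBINT x=0..\<infinity>. f x) = a * (pi / 2) - 0"
      using FTC der cont fnn lim0 liminf by (auto simp: zero_ereal_def)
    moreover have "einterval 0 \<infinity> = {0<..}" by (auto simp: einterval_def zero_ereal_def)
    ultimately have "has_bochner_integral lborel (\<lambda>x. indicator {0<..} x *\<^sub>R f x) (a * (pi / 2))"
      by (simp add: has_bochner_integral_iff interval_lebesgue_integral_def set_integrable_def set_lebesgue_integral_def)
    then have "has_bochner_integral lborel (\<lambda>x. indicator {0..} x *\<^sub>R f x) (a * (pi / 2))"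
      by (rule has_bochner_integral_cong_AE[THEN iffD1, rotated -1])
         (auto intro!: AE_I[where N="{0}"] simp: f_def split: split_indicator)
    then have "has_bochner_integral lborel f (2 *\<^sub>R (a * (pi / 2)))"
      by (rule has_bochner_integral_even_function) (auto simp: f_def)
    then show ?thesis unfolding f_def by (simp add: mult.commute)
  qed
  show ?thesis
  proof (cases a "0::real" rule: linorder_cases)
    case less
    then show ?thesis using pos[of "- a"] by simp
  next
    case greater
    then show ?thesis using pos[of a] by simp
  next
    case equal
    then show ?thesis by (simp add: has_bochner_integral_zero)
  qed
qed

text \<open>Fourier transform of the trapezoid that is 1 on \<open>[-1,1]\<close>, vanishes outside
  \<open>[-2,2]\<close> and is linear in between, that is, of a convolution of two boxes. It is
  explicit and decays quadratically, which is enough because only modulation exponents slightly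
  above 1/2 occur.\<close>

definition fcut :: "real \<Rightarrow> real" where
  "fcut x = 3 * (sinc (3/2 * x) * sinc (x/2))"

lemma fcut_eq:
  assumes "x \<noteq> 0" shows "fcut x = 2 * (cos x - cos (2 * x)) / x\<^sup>2"
proof -
  have "cos x - cos (2 * x) = 2 * sin (3/2 * x) * sin (x/2)"
    using cos_diff_cos[of x "2 * x"] by (simp add: field_simps)
  then show ?thesis unfolding fcut_def using assms by (simp add: power2_eq_square field_simps)
qed

lemma fcut_measurable [measurable]: "fcut \<in> borel_measurable borel"
  unfolding fcut_def[abs_def] by measurable

lemma abs_sinc_le: "\<bar>sinc x\<bar> \<le> 2 / jb x"
proof (cases "x = 0")
  case False
  have "\<bar>sin x\<bar> * jb x \<le> 2 * \<bar>x\<bar>"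
  proof -
    have "\<bar>sin x\<bar> * jb x = \<bar>sin x\<bar> + \<bar>sin x\<bar> * \<bar>x\<bar>" unfolding jb_def by (simp add: algebra_simps)
    also have "\<dots> \<le> \<bar>x\<bar> + 1 * \<bar>x\<bar>" by (intro add_mono abs_sin_x_le_abs_x mult_right_mono abs_sin_le_one) auto
    finally show ?thesis by simp
  qed
  then show ?thesis using False jb_pos[of x] by (simp add: field_simps)
qed (simp add: jb_def)

text \<open>\<open>sinc x\<close> is the mean of \<open>cos (s * x)\<close> over
  \<open>0 \<le> s \<le> 1\<close>.\<close>

lemma sinc_lipschitz: "\<bar>sinc x - sinc y\<bar> \<le> \<bar>x - y\<bar>"
proof -
  have rep: "((\<lambda>s. cos (s * x)) has_integral sinc x) {0..1}" for x
  proof (cases "x = 0")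
    case True
    then show ?thesis using has_integral_const_real[of "1::real" 0 1] by simp
  next
    case False
    have "((\<lambda>s. cos (s * x)) has_integral (sin (1 * x) / x - sin (0 * x) / x)) {0..1}"
    proof (rule fundamental_theorem_of_calculus)
      fix s :: real
      show "((\<lambda>s. sin (s * x) / x) has_vector_derivative cos (s * x)) (at s within {0..1})"
        unfolding has_real_derivative_iff_has_vector_derivative[symmetric]
        using False by (auto intro!: derivative_eq_intros)
    qed simp
    then show ?thesis using False by simp
  qed
  have "((\<lambda>s. cos (s * x) - cos (s * y)) has_integral (sinc x - sinc y)) {0..1}"
    by (intro has_integral_diff rep)
  then have "norm (sinc x - sinc y) \<le> \<bar>x - y\<bar> * measure lborel (cbox 0 (1::real))"
    unfolding cbox_interval[symmetric]
  proof (rule has_integral_bound[rotated])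
    fix s :: real assume s: "s \<in> cbox 0 1"
    have "\<bar>cos (s * x) - cos (s * y)\<bar> \<le> \<bar>s * x - s * y\<bar>"
    proof -
      have "\<bar>cos u - cos v\<bar> \<le> \<bar>u - v\<bar>" for u v :: real
      proof -
        have "\<bar>cos u - cos v\<bar> = 2 * \<bar>sin ((u + v) / 2)\<bar> * \<bar>sin ((v - u) / 2)\<bar>"
          unfolding cos_diff_cos by (simp add: abs_mult)
        also have "\<dots> \<le> 2 * 1 * \<bar>(v - u) / 2\<bar>"
          by (intro mult_mono abs_sin_le_one abs_sin_x_le_abs_x) auto
        finally show ?thesis by simp
      qed
      then show ?thesis .
    qed
    also have "\<dots> = s * \<bar>x - y\<bar>" using s by (simp add: abs_mult[symmetric] right_diff_distrib[symmetric] abs_mult)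
    also have "\<dots> \<le> 1 * \<bar>x - y\<bar>" using s by (intro mult_right_mono) auto
    finally show "norm (cos (s * x) - cos (s * y)) \<le> \<bar>x - y\<bar>" by simp
  qed simp
  then show ?thesis by simp
qed

text \<open>From \<open>x * (sinc x - sinc y) = (sin x - sin y) + (y - x) * sinc y\<close>; adding
  the Lipschitz bound replaces \<open>\<bar>x\<bar>\<close> by the bracket.\<close>

lemma sinc_diff_le: "\<bar>sinc x - sinc y\<bar> \<le> 3 * \<bar>x - y\<bar> / jb x"
proof -
  have xs: "x * sinc x = sin x" for x by (simp)
  have "x * (sinc x - sinc y) = (sin x - sin y) + (y - x) * sinc y"
    using xs[of x] xs[of y] by (simp add: algebra_simps)
  then have "\<bar>x\<bar> * \<bar>sinc x - sinc y\<bar> \<le> \<bar>sin x - sin y\<bar> + \<bar>y - x\<bar> * \<bar>sinc y\<bar>"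
    using abs_triangle_ineq[of "sin x - sin y" "(y - x) * sinc y"] unfolding abs_mult[symmetric] by (simp only:)
  also have "\<dots> \<le> \<bar>x - y\<bar> + \<bar>x - y\<bar> * 1"
  proof (intro add_mono mult_mono)
    have "\<bar>sin x - sin y\<bar> = 2 * \<bar>sin ((x - y) / 2)\<bar> * \<bar>cos ((x + y) / 2)\<bar>"
      unfolding sin_diff_sin by (simp add: abs_mult)
    also have "\<dots> \<le> 2 * \<bar>(x - y) / 2\<bar> * 1" by (intro mult_mono abs_sin_x_le_abs_x abs_cos_le_one) auto
    finally show "\<bar>sin x - sin y\<bar> \<le> \<bar>x - y\<bar>" by simp
    show "\<bar>sinc y\<bar> \<le> 1" using abs_sin_x_le_abs_x[of y] by (simp add: divide_le_eq)
  qed auto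
  finally have "\<bar>x\<bar> * \<bar>sinc x - sinc y\<bar> \<le> 2 * \<bar>x - y\<bar>" by simp
  moreover have "(1 + u) * A \<le> 3 * v" if "u * A \<le> 2 * v" "A \<le> v" for u A v :: real
    using that by (simp add: distrib_right)
  ultimately have "jb x * \<bar>sinc x - sinc y\<bar> \<le> 3 * \<bar>x - y\<bar>"
    unfolding jb_def using sinc_lipschitz[of x y] by blast
  then show ?thesis using jb_pos[of x] by (simp add: field_simps)
qed

lemma jb_scale: "jb x \<le> jb (3/2 * x)" "jb x \<le> 2 * jb (x/2)"
  unfolding jb_def by auto

lemma inverse_jb_le: "1 / jb (3/2 * x) \<le> 1 / jb x" "1 / jb (x/2) \<le> 2 / jb x"
proof -
  show "1 / jb (3/2 * x) \<le> 1 / jb x" using jb_scale(1)[of x] jb_pos[of x] by (intro divide_left_mono) auto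
  show "1 / jb (x/2) \<le> 2 / jb x" using jb_scale(2)[of x] jb_pos[of x] jb_pos[of "x/2"] by (simp add: field_simps)
qed

lemma abs_cut_le: "\<bar>fcut x\<bar> \<le> 24 / (jb x)\<^sup>2"
proof -
  have "\<bar>fcut x\<bar> = 3 * (\<bar>sinc (3/2 * x)\<bar> * \<bar>sinc (x/2)\<bar>)" unfolding fcut_def abs_mult by simp
  also have "\<dots> \<le> 3 * ((2 / jb (3/2 * x)) * (2 / jb (x/2)))"
    using jb_pos[of "3/2*x"] by (intro mult_left_mono mult_mono abs_sinc_le) auto
  also have "\<dots> = 12 * ((1 / jb (3/2 * x)) * (1 / jb (x/2)))" by simp
  also have "\<dots> \<le> 12 * ((1 / jb x) * (2 / jb x))"
    using jb_pos[of x] jb_pos[of "x/2"] by (intro mult_left_mono mult_mono inverse_jb_le) auto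
  finally show ?thesis by (simp add: power2_eq_square)
qed

text \<open>Smallness in \<open>x - y\<close> together with full quadratic decay is what compensates
  the division by \<sigma> in the Duhamel kernel.\<close>

lemma fcut_diff_le:
  assumes "\<bar>x - y\<bar> \<le> 1"
  shows "\<bar>fcut y - fcut x\<bar> \<le> 100 * \<bar>x - y\<bar> / (jb x)\<^sup>2"
proof -
  let ?d = "\<bar>x - y\<bar>" and ?j = "1 / jb x"
  have j0: "0 \<le> ?j" using jb_pos[of x] by simp
  have "jb x \<le> 2 * jb y" using assms abs_triangle_ineq[of "x - y" y] unfolding jb_def by simp
  then have jy: "1 / jb y \<le> 2 * ?j" using jb_pos[of x] jb_pos[of y] by (simp add: field_simps)
  have a: "\<bar>sinc (3/2 * x) - sinc (3/2 * y)\<bar> \<le> 9/2 * ?d * ?j"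
  proof -
    have "\<bar>sinc (3/2 * x) - sinc (3/2 * y)\<bar> \<le> 3 * \<bar>3/2 * x - 3/2 * y\<bar> / jb (3/2 * x)" by (rule sinc_diff_le)
    also have "\<bar>3/2 * x - 3/2 * y\<bar> = 3/2 * ?d" unfolding right_diff_distrib[symmetric] abs_mult by simp
    also have "3 * (3/2 * ?d) / jb (3/2 * x) = 9/2 * ?d * (1 / jb (3/2 * x))" by simp
    also have "\<dots> \<le> 9/2 * ?d * ?j" by (intro mult_left_mono inverse_jb_le) auto
    finally show ?thesis .
  qed
  have b: "\<bar>sinc (x/2) - sinc (y/2)\<bar> \<le> 3 * ?d * ?j"
  proof -
    have "\<bar>sinc (x/2) - sinc (y/2)\<bar> \<le> 3 * \<bar>x/2 - y/2\<bar> / jb (x/2)" by (rule sinc_diff_le)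
    also have "\<dots> = 3/2 * ?d * (1 / jb (x/2))" by (simp add: diff_divide_distrib[symmetric])
    also have "\<dots> \<le> 3/2 * ?d * (2 / jb x)" by (intro mult_left_mono inverse_jb_le) auto
    finally show ?thesis by simp
  qed
  have c: "\<bar>sinc (x/2)\<bar> \<le> 4 * ?j" using abs_sinc_le[of "x/2"] inverse_jb_le(2)[of x] by simp
  have d: "\<bar>sinc (3/2 * y)\<bar> \<le> 4 * ?j" using abs_sinc_le[of "3/2 * y"] inverse_jb_le(1)[of y] jy by simp
  have "fcut x - fcut y = 3 * ((sinc (3/2 * x) - sinc (3/2 * y)) * sinc (x/2) + sinc (3/2 * y) * (sinc (x/2) - sinc (y/2)))"
    unfolding fcut_def by (simp add: algebra_simps)
  moreover have "\<bar>3 * (p * q + r * w)\<bar> \<le> 3 * (\<bar>p\<bar> * \<bar>q\<bar> + \<bar>r\<bar> * \<bar>w\<bar>)" for p q r w :: real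
  proof -
    have "3 * \<bar>p * q + r * w\<bar> \<le> 3 * (\<bar>p\<bar> * \<bar>q\<bar> + \<bar>r\<bar> * \<bar>w\<bar>)"
      using abs_triangle_ineq[of "p * q" "r * w"] unfolding abs_mult by (rule mult_left_mono) simp
    then show ?thesis by (simp only: abs_mult abs_numeral)
  qed
  ultimately have "\<bar>fcut x - fcut y\<bar> \<le> 3 * (\<bar>sinc (3/2 * x) - sinc (3/2 * y)\<bar> * \<bar>sinc (x/2)\<bar> + \<bar>sinc (3/2 * y)\<bar> * \<bar>sinc (x/2) - sinc (y/2)\<bar>)"
    by (simp only:)
  also have "\<dots> \<le> 3 * ((9/2 * ?d * ?j) * (4 * ?j) + (4 * ?j) * (3 * ?d * ?j))"
    using j0 by (intro mult_left_mono add_mono mult_mono a b c d) auto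
  also have "\<dots> = 90 * ?d * ?j\<^sup>2" by (simp add: power2_eq_square)
  also have "\<dots> \<le> 100 * ?d * ?j\<^sup>2" by (intro mult_right_mono) auto
  finally show ?thesis by (simp add: power_divide abs_minus_commute)
qed


lemma integrable_cut: "integrable lborel fcut"
proof (rule integrableI_bounded)
  have "(\<integral>\<^sup>+x. ennreal (norm (fcut x)) \<partial>lborel) \<le> (\<integral>\<^sup>+x. ennreal 24 * ennreal (jb x powr - 2) \<partial>lborel)"
  proof (intro nn_integral_mono)
    fix x :: real
    have "norm (fcut x) \<le> 24 * jb x powr - 2" using abs_cut_le[of x] jb_pos[of x] by (simp add: powr_minus field_simps)
    then show "ennreal (norm (fcut x)) \<le> ennreal 24 * ennreal (jb x powr - 2)" by (subst ennreal_mult[symmetric]) (auto intro: ennreal_leI)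
  qed
  also have "\<dots> = ennreal 24 * jbint 2" unfolding jbint_def by (rule nn_integral_cmult) measurable
  also have "\<dots> < \<infinity>" using jbint_finite[of 2] by (simp add: ennreal_mult_less_top)
  finally show "(\<integral>\<^sup>+x. ennreal (norm (fcut x)) \<partial>lborel) < \<infinity>" .
qed simp

text \<open>Product formulas turn the integrand into four terms
  \<open>(1 - cos (a * x)) / x\<^sup>2\<close> with \<open>a\<close> equal to \<open>t + 2\<close>,
  \<open>t - 2\<close>, \<open>t + 1\<close> and \<open>t - 1\<close>. The resulting combination of
  the four \<open>\<bar>a\<bar>\<close> is twice the trapezoid, and constant for
  \<open>\<bar>t\<bar> \<le> 1\<close>.\<close>

lemma integral_cos_cut:
  assumes t: "\<bar>t\<bar> \<le> 1"
  shows "(\<integral>x. cos (t * x) * fcut x \<partial>lborel) = 2 * pi"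
proof -
  let ?f = "\<lambda>a x. (1 - cos (a * x)) / x\<^sup>2 :: real"
  have hb: "has_bochner_integral lborel (\<lambda>x. ?f (t + 2) x + ?f (t - 2) x - ?f (t + 1) x - ?f (t - 1) x)
     (pi * \<bar>t + 2\<bar> + pi * \<bar>t - 2\<bar> - pi * \<bar>t + 1\<bar> - pi * \<bar>t - 1\<bar>)"
    by (intro has_bochner_integral_diff has_bochner_integral_add has_bochner_integral_one_minus_cos)
  have "pi * \<bar>t + 2\<bar> + pi * \<bar>t - 2\<bar> - pi * \<bar>t + 1\<bar> - pi * \<bar>t - 1\<bar> = pi * (\<bar>t + 2\<bar> + \<bar>t - 2\<bar> - \<bar>t + 1\<bar> - \<bar>t - 1\<bar>)"
    by (simp add: algebra_simps)
  also have "\<bar>t + 2\<bar> + \<bar>t - 2\<bar> - \<bar>t + 1\<bar> - \<bar>t - 1\<bar> = 2" using t by (simp add: abs_if split: if_splits)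
  finally have v: "pi * \<bar>t + 2\<bar> + pi * \<bar>t - 2\<bar> - pi * \<bar>t + 1\<bar> - pi * \<bar>t - 1\<bar> = 2 * pi" by simp
  have eq: "cos (t * x) * fcut x = ?f (t + 2) x + ?f (t - 2) x - ?f (t + 1) x - ?f (t - 1) x" if "x \<noteq> 0" for x
  proof -
    have p: "2 * (cos (t * x) * cos (c * x)) = cos ((t + c) * x) + cos ((t - c) * x)" for c
      by (simp add: cos_add cos_diff distrib_right left_diff_distrib)
    have "cos (t * x) * fcut x = (2 * (cos (t * x) * cos (1 * x)) - 2 * (cos (t * x) * cos (2 * x))) / x\<^sup>2"
      unfolding fcut_eq[OF that] by (simp add: right_diff_distrib)
    also have "\<dots> = (cos ((t + 1) * x) + cos ((t - 1) * x) - (cos ((t + 2) * x) + cos ((t - 2) * x))) / x\<^sup>2"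
      unfolding p ..
    also have "\<dots> = ?f (t + 2) x + ?f (t - 2) x - ?f (t + 1) x - ?f (t - 1) x"
      by (simp add: add_divide_distrib[symmetric] diff_divide_distrib[symmetric])
    finally show ?thesis .
  qed
  have "(\<integral>x. cos (t * x) * fcut x \<partial>lborel) = (\<integral>x. ?f (t + 2) x + ?f (t - 2) x - ?f (t + 1) x - ?f (t - 1) x \<partial>lborel)"
  proof (rule integral_cong_AE)
    have "AE x in lborel. x \<noteq> (0::real)" by (rule AE_lborel_singleton)
    then show "AE x in lborel. cos (t * x) * fcut x = ?f (t + 2) x + ?f (t - 2) x - ?f (t + 1) x - ?f (t - 1) x"
      by eventually_elim (rule eq)
  qed measurable
  also have "\<dots> = 2 * pi" using has_bochner_integral_integral_eq[OF hb] v by simp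
  finally show ?thesis .
qed

section \<open>Inverse transforms of the cut-off kernels\<close>

lemma integrable_exp_mult:
  fixes f :: "real \<Rightarrow> complex"
  assumes "integrable lborel f"
  shows "integrable lborel (\<lambda>x. exp (\<i> * complex_of_real (t * x)) * f x)"
proof (rule Bochner_Integration.integrable_bound[OF assms])
  have [measurable]: "f \<in> borel_measurable borel" using assms by auto
  show "(\<lambda>x. exp (\<i> * complex_of_real (t * x)) * f x) \<in> borel_measurable lborel" by measurable
qed (simp add: norm_mult)

lemma integral_exp_cut:
  assumes t: "\<bar>t\<bar> \<le> 1"
  shows "(\<integral>x. exp (\<i> * complex_of_real (t * x)) * complex_of_real (fcut x) \<partial>lborel) = complex_of_real (2 * pi)"
proof -
  have ic: "integrable lborel (\<lambda>x. cos (t * x) * fcut x)" and isn: "integrable lborel (\<lambda>x. sin (t * x) * fcut x)"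
    by (rule Bochner_Integration.integrable_bound[OF integrable_cut]; simp add: abs_mult mult_left_le_one_le)+
  have cutm: "fcut (- x) = fcut x" for x by (cases "x = 0") (auto simp: fcut_eq)
  have "(\<integral>x. sin (t * x) * fcut x \<partial>lborel) = (\<integral>x. sin (t * (0 + -1 * x)) * fcut (0 + -1 * x) \<partial>lborel)"
    by (subst lborel_integral_real_affine[where c="-1" and t=0]) auto
  also have "\<dots> = - (\<integral>x. sin (t * x) * fcut x \<partial>lborel)" by (simp add: cutm)
  finally have s0: "(\<integral>x. sin (t * x) * fcut x \<partial>lborel) = 0" by simp
  have "(\<lambda>x. exp (\<i> * complex_of_real (t * x)) * complex_of_real (fcut x)) =
     (\<lambda>x. complex_of_real (cos (t * x) * fcut x) + \<i> * complex_of_real (sin (t * x) * fcut x))"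
  proof (rule ext)
    fix x
    have "exp (\<i> * complex_of_real (t * x)) = complex_of_real (cos (t * x)) + \<i> * complex_of_real (sin (t * x))"
      unfolding cis_conv_exp[symmetric] by (simp add: complex_eq_iff)
    then show "exp (\<i> * complex_of_real (t * x)) * complex_of_real (fcut x) = complex_of_real (cos (t * x) * fcut x) + \<i> * complex_of_real (sin (t * x) * fcut x)"
      by (simp add: distrib_right mult.assoc)
  qed
  then have "(\<integral>x. exp (\<i> * complex_of_real (t * x)) * complex_of_real (fcut x) \<partial>lborel) =
     (\<integral>x. complex_of_real (cos (t * x) * fcut x) + \<i> * complex_of_real (sin (t * x) * fcut x) \<partial>lborel)" by simp
  also have "\<dots> = (\<integral>x. complex_of_real (cos (t * x) * fcut x) \<partial>lborel) + (\<integral>x. \<i> * complex_of_real (sin (t * x) * fcut x) \<partial>lborel)"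
    by (rule Bochner_Integration.integral_add[OF integrable_of_real[OF ic] integrable_mult_right[OF integrable_of_real[OF isn]]])
  also have "\<dots> = complex_of_real (\<integral>x. cos (t * x) * fcut x \<partial>lborel) + \<i> * complex_of_real (\<integral>x. sin (t * x) * fcut x \<partial>lborel)"
    by (simp only: integral_mult_right_zero integral_complex_of_real)
  finally show ?thesis using s0 integral_cos_cut[OF t] by simp
qed

text \<open>The inverse transform is the trapezoid dilated to the plateau
  \<open>[-T,T]\<close>.\<close>

definition cutT :: "real \<Rightarrow> real \<Rightarrow> real" where
  "cutT T x = T * fcut (T * x)"

lemma cutT_measurable [measurable]: "cutT T \<in> borel_measurable borel"
  unfolding cutT_def[abs_def] by measurable

lemma integrable_cutT: "T > 0 \<Longrightarrow> integrable lborel (\<lambda>x. complex_of_real (cutT T (x - c)))"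
  unfolding cutT_def
  using lborel_integrable_real_affine[OF integrable_cut, of T "- T * c"]
  by (auto simp: algebra_simps)

lemma integral_exp_cutT:
  assumes T: "T > 0" and t: "\<bar>t\<bar> \<le> T"
  shows "(\<integral>x. exp (\<i> * complex_of_real (t * x)) * complex_of_real (cutT T (x - c)) \<partial>lborel) =
    exp (\<i> * complex_of_real (t * c)) * complex_of_real (2 * pi)"
proof -
  have tT: "\<bar>t / T\<bar> \<le> 1" using assms by simp
  let ?F = "\<lambda>y. exp (\<i> * complex_of_real (t / T * y)) * complex_of_real (fcut y)"
  have "complex_of_real (2 * pi) = (\<integral>y. ?F y \<partial>lborel)" using integral_exp_cut[OF tT] by simp
  also have "\<dots> = \<bar>T\<bar> *\<^sub>R (\<integral>x. ?F (- T * c + T * x) \<partial>lborel)"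
    using T by (intro lborel_integral_real_affine) auto
  also have "\<dots> = (\<integral>x. \<bar>T\<bar> *\<^sub>R ?F (- T * c + T * x) \<partial>lborel)" by simp
  also have "\<dots> = (\<integral>x. exp (- (\<i> * complex_of_real (t * c))) * (exp (\<i> * complex_of_real (t * x)) * complex_of_real (cutT T (x - c))) \<partial>lborel)"
  proof (rule Bochner_Integration.integral_cong[OF refl])
    fix x
    have "t / T * (- T * c + T * x) = - (t * c) + t * x" using T by (simp add: field_simps)
    moreover have "- T * c + T * x = T * (x - c)" by (simp add: algebra_simps)
    ultimately have "\<bar>T\<bar> *\<^sub>R ?F (- T * c + T * x) = \<bar>T\<bar> *\<^sub>R (exp (\<i> * complex_of_real (- (t * c) + t * x)) * complex_of_real (fcut (T * (x - c))))"
      by (simp only:)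
    also have "exp (\<i> * complex_of_real (- (t * c) + t * x)) = exp (- (\<i> * complex_of_real (t * c))) * exp (\<i> * complex_of_real (t * x))"
      unfolding exp_add[symmetric] by (simp only: of_real_add of_real_minus distrib_left mult_minus_right)
    finally show "\<bar>T\<bar> *\<^sub>R ?F (- T * c + T * x) = exp (- (\<i> * complex_of_real (t * c))) * (exp (\<i> * complex_of_real (t * x)) * complex_of_real (cutT T (x - c)))"
      using T unfolding cutT_def scaleR_conv_of_real of_real_mult by (simp only: abs_of_pos ac_simps)
  qed
  also have "\<dots> = exp (- (\<i> * complex_of_real (t * c))) * (\<integral>x. exp (\<i> * complex_of_real (t * x)) * complex_of_real (cutT T (x - c)) \<partial>lborel)"
    by simp
  finally have "exp (\<i> * complex_of_real (t * c)) * complex_of_real (2 * pi) =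
    exp (\<i> * complex_of_real (t * c)) * (exp (- (\<i> * complex_of_real (t * c))) * (\<integral>x. exp (\<i> * complex_of_real (t * x)) * complex_of_real (cutT T (x - c)) \<partial>lborel))"
    by simp
  then show ?thesis by (simp add: mult.assoc[symmetric] exp_add[symmetric])
qed

text \<open>For \<open>0 \<le> t \<le> T\<close> the inverse Fourier transform in \<open>\<tau>\<close> of this kernel is the Duhamel kernel
  \<open>\<integral>\<^sub>0\<^sup>t e\<^sup>i\<^sup>t\<^sup>'\<^sup>\<sigma> dt'\<close>; for other \<open>t\<close> it is cut off at time scale \<open>T\<close>.\<close>
definition kT :: "real \<Rightarrow> real \<Rightarrow> real \<Rightarrow> complex" where
  "kT T \<tau> \<sigma> = complex_of_real (cutT T (\<tau> - \<sigma>) - cutT T \<tau>) / (\<i> * complex_of_real \<sigma>)"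

lemma kT_measurable [measurable (raw)]:
  assumes [measurable]: "f \<in> borel_measurable M" "g \<in> borel_measurable M"
  shows "(\<lambda>x. kT T (f x) (g x)) \<in> borel_measurable M"
  unfolding kT_def by measurable

lemma integral_exp_kT:
  assumes T: "T > 0" and t: "0 \<le> t" "t \<le> T" and \<sigma>: "\<sigma> \<noteq> 0"
  shows "(\<integral>\<tau>. exp (\<i> * complex_of_real (t * \<tau>)) * kT T \<tau> \<sigma> \<partial>lborel) = complex_of_real (2 * pi) * tker t \<sigma>"
proof -
  let ?e = "\<lambda>\<tau>. exp (\<i> * complex_of_real (t * \<tau>))"
  have tT: "\<bar>t\<bar> \<le> T" using t by simp
  have "(\<integral>\<tau>. ?e \<tau> * kT T \<tau> \<sigma> \<partial>lborel) = (\<integral>\<tau>. (?e \<tau> * complex_of_real (cutT T (\<tau> - \<sigma>)) - ?e \<tau> * complex_of_real (cutT T (\<tau> - 0))) / (\<i> * complex_of_real \<sigma>) \<partial>lborel)"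
    unfolding kT_def by (simp add: right_diff_distrib)
  also have "\<dots> = (\<integral>\<tau>. ?e \<tau> * complex_of_real (cutT T (\<tau> - \<sigma>)) - ?e \<tau> * complex_of_real (cutT T (\<tau> - 0)) \<partial>lborel) / (\<i> * complex_of_real \<sigma>)"
    by simp
  also have "(\<integral>\<tau>. ?e \<tau> * complex_of_real (cutT T (\<tau> - \<sigma>)) - ?e \<tau> * complex_of_real (cutT T (\<tau> - 0)) \<partial>lborel) =
     (\<integral>\<tau>. ?e \<tau> * complex_of_real (cutT T (\<tau> - \<sigma>)) \<partial>lborel) - (\<integral>\<tau>. ?e \<tau> * complex_of_real (cutT T (\<tau> - 0)) \<partial>lborel)"
    using integrable_exp_mult[OF integrable_cutT[OF T, of \<sigma>]] integrable_exp_mult[OF integrable_cutT[OF T, of 0]]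
    by (rule Bochner_Integration.integral_diff)
  also have "\<dots> = exp (\<i> * complex_of_real (t * \<sigma>)) * complex_of_real (2 * pi) - exp (\<i> * complex_of_real (t * 0)) * complex_of_real (2 * pi)"
    unfolding integral_exp_cutT[OF T tT] ..
  finally show ?thesis using \<sigma> by (simp add: tker_def right_diff_distrib mult.commute)
qed

text \<open>For \<open>\<bar>T * \<sigma>\<bar> \<le> 1\<close> the difference bound of
  \<open>fcut\<close> cancels the division by \<sigma>; beyond that the two terms are estimated
  separately. One factor \<open>T\<close> comes from \<open>cutT\<close>, the other from writing
  \<open>1 / \<sigma>\<close> as \<open>T / (T * \<sigma>)\<close>.\<close>

lemma norm_kT_le:
  assumes T: "T > 0"
  shows "norm (kT T \<tau> \<sigma>) \<le> 200 * T\<^sup>2 * ((1 / (jb (T * (\<tau> - \<sigma>)))\<^sup>2 + 1 / (jb (T * \<tau>))\<^sup>2) / jb (T * \<sigma>))"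
proof (cases "\<sigma> = 0")
  case True
  then show ?thesis by (simp add: kT_def jb_nonneg)
next
  case False
  define x s where "x = T * \<tau>" and "s = T * \<sigma>"
  have s0: "s \<noteq> 0" using False T by (simp add: s_def)
  let ?R = "(1 / (jb (x - s))\<^sup>2 + 1 / (jb x)\<^sup>2) / jb s"
  have key: "\<bar>fcut (x - s) - fcut x\<bar> / \<bar>s\<bar> \<le> 200 * ?R"
  proof (cases "\<bar>s\<bar> \<le> 1")
    case True
    have "\<bar>fcut (x - s) - fcut x\<bar> \<le> 100 * \<bar>s\<bar> / (jb x)\<^sup>2"
      using fcut_diff_le[of x "x - s"] True by simp
    then have "\<bar>fcut (x - s) - fcut x\<bar> / \<bar>s\<bar> \<le> 100 * (1 / (jb x)\<^sup>2)" using s0 by (simp add: field_simps)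
    also have "\<dots> \<le> 200 * (1 / (jb x)\<^sup>2 / jb s)"
    proof -
      have "jb s \<le> 2" using True by (simp add: jb_def)
      then have "1 \<le> 2 / jb s" using jb_pos[of s] by simp
      then have "(1 / (jb x)\<^sup>2) * 1 \<le> (1 / (jb x)\<^sup>2) * (2 / jb s)" by (intro mult_left_mono) auto
      then show ?thesis by simp
    qed
    also have "\<dots> \<le> 200 * ?R" using jb_pos[of s] by (intro mult_left_mono divide_right_mono) auto
    finally show ?thesis .
  next
    case False
    have "\<bar>fcut (x - s) - fcut x\<bar> \<le> 24 * (1 / (jb (x - s))\<^sup>2 + 1 / (jb x)\<^sup>2)"
      using abs_cut_le[of "x - s"] abs_cut_le[of x] by (simp add: distrib_left)
    moreover have "1 / \<bar>s\<bar> \<le> 2 / jb s" using False s0 jb_pos[of s] by (simp add: jb_def field_simps)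
    ultimately have "\<bar>fcut (x - s) - fcut x\<bar> * (1 / \<bar>s\<bar>) \<le> (24 * (1 / (jb (x - s))\<^sup>2 + 1 / (jb x)\<^sup>2)) * (2 / jb s)"
      by (intro mult_mono) auto
    also have "\<dots> = 48 * ?R" by simp
    also have "\<dots> \<le> 200 * ?R" using jb_pos[of s] by (intro mult_right_mono divide_nonneg_pos) auto
    finally show ?thesis by simp
  qed
  have xs: "T * (\<tau> - \<sigma>) = x - s" by (simp add: x_def s_def right_diff_distrib)
  have "norm (kT T \<tau> \<sigma>) = T\<^sup>2 * (\<bar>fcut (x - s) - fcut x\<bar> / \<bar>s\<bar>)"
  proof -
    have "norm (kT T \<tau> \<sigma>) = \<bar>cutT T (\<tau> - \<sigma>) - cutT T \<tau>\<bar> / \<bar>\<sigma>\<bar>"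
      unfolding kT_def norm_divide norm_mult norm_of_real by simp
    also have "cutT T (\<tau> - \<sigma>) - cutT T \<tau> = T * (fcut (x - s) - fcut x)"
      unfolding cutT_def xs x_def[symmetric] by (simp add: right_diff_distrib)
    also have "\<bar>T * (fcut (x - s) - fcut x)\<bar> / \<bar>\<sigma>\<bar> = T\<^sup>2 * (\<bar>fcut (x - s) - fcut x\<bar> / \<bar>s\<bar>)"
      unfolding s_def using T False by (simp add: abs_mult power2_eq_square)
    finally show ?thesis .
  qed
  also have "\<dots> \<le> T\<^sup>2 * (200 * ?R)" by (intro mult_left_mono key) auto
  finally show ?thesis unfolding xs x_def[symmetric] s_def[symmetric] by (simp only: ac_simps)
qed

section \<open>Square-integrable bound of the cut-off Duhamel operator\<close>

lemma nn_integral_jb_scale: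
  assumes T: "T > 0"
  shows "(\<integral>\<^sup>+x. ennreal (jb (T * (x - c)) powr - p) \<partial>lborel) = ennreal (1 / T) * jbint p"
proof -
  have "jbint p = ennreal \<bar>T\<bar> * (\<integral>\<^sup>+x. ennreal (jb (- T * c + T * x) powr - p) \<partial>lborel)"
    unfolding jbint_def using T by (intro nn_integral_real_affine) auto
  also have "(\<lambda>x. - T * c + T * x) = (\<lambda>x. T * (x - c))" by (rule ext) (simp add: algebra_simps)
  then have "(\<lambda>x. ennreal (jb (- T * c + T * x) powr - p)) = (\<lambda>x. ennreal (jb (T * (x - c)) powr - p))" by metis
  finally have "ennreal (1 / T) * jbint p = (ennreal (1 / T) * ennreal T) * (\<integral>\<^sup>+x. ennreal (jb (T * (x - c)) powr - p) \<partial>lborel)"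
    using T by (simp add: mult.assoc)
  also have "ennreal (1 / T) * ennreal T = 1" using T by (simp add: ennreal_mult[symmetric])
  finally show ?thesis by simp
qed

text \<open>The kernel brings \<open>T\<close> to the power 2, and rescaling the brackets of \<tau>
  and \<sigma> costs \<open>1/2 + \<epsilon>\<close> and \<open>1/2 - 2 * \<epsilon>\<close>, so
  \<open>1 + \<epsilon>\<close> remains. On the right stand a convolution kernel and a product
  kernel; the differences with 0 match \<open>nn_integral_jb_scale\<close>.\<close>

lemma duhamel_kernel_pointwise:
  assumes e: "0 < \<epsilon>" "64 * \<epsilon> \<le> 1" and T: "0 < T" "T \<le> 1"
  shows "jb \<tau> powr (1/2 + \<epsilon>) * (norm (kT T \<tau> \<sigma>) * jb \<sigma> powr (1/2 - 2 * \<epsilon>)) \<le>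
    200 * T powr (1 + \<epsilon>) * (jb (T * (\<tau> - \<sigma>)) powr - (3/2 - \<epsilon>) + jb (T * (\<tau> - 0)) powr - (3/2 - \<epsilon>) * jb (T * (\<sigma> - 0)) powr - (1/2 + 2 * \<epsilon>))"
proof -
  define x s d where "x = jb (T * \<tau>)" and "s = jb (T * \<sigma>)" and "d = jb (T * (\<tau> - \<sigma>))"
  have pos: "1 \<le> x" "1 \<le> s" "1 \<le> d" unfolding x_def s_def d_def by (auto simp: jb_ge_1)
  have sc: "jb u \<le> jb (T * u) / T" for u
    using T by (simp add: jb_def abs_mult field_simps)
  have scp: "jb u powr p \<le> T powr - p * jb (T * u) powr p" if "0 \<le> p" for u p
  proof -
    have "jb u powr p \<le> (jb (T * u) / T) powr p" using sc jb_nonneg that by (intro powr_mono2) auto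
    also have "\<dots> = T powr - p * jb (T * u) powr p" using T jb_nonneg[of "T * u"] by (simp add: powr_divide powr_minus field_simps)
    finally show ?thesis .
  qed
  have sq: "1 / y\<^sup>2 = y powr - 2" if "1 \<le> y" for y :: real using that by (simp add: powr_minus field_simps)
  have one: "1 / y = y powr - 1" if "1 \<le> y" for y :: real using that by (simp add: powr_minus field_simps)
  have xsd: "x powr p \<le> s powr p * d powr p" if "0 \<le> p" for p
  proof -
    have "x \<le> s * d" unfolding x_def s_def d_def using jb_add_le_mult[of "T * \<sigma>" "T * (\<tau> - \<sigma>)"] by (simp add: algebra_simps)
    then have "x powr p \<le> (s * d) powr p" using that pos by (intro powr_mono2) auto
    then show ?thesis using pos by (simp add: powr_mult)
  qed
  have "jb \<tau> powr (1/2 + \<epsilon>) * (norm (kT T \<tau> \<sigma>) * jb \<sigma> powr (1/2 - 2 * \<epsilon>)) \<le>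
    (T powr - (1/2 + \<epsilon>) * x powr (1/2 + \<epsilon>)) * ((200 * T\<^sup>2 * ((d powr - 2 + x powr - 2) * s powr - 1)) * (T powr - (1/2 - 2 * \<epsilon>) * s powr (1/2 - 2 * \<epsilon>)))"
  proof (intro mult_mono)
    show "jb \<tau> powr (1/2 + \<epsilon>) \<le> T powr - (1/2 + \<epsilon>) * x powr (1/2 + \<epsilon>)" unfolding x_def by (rule scp) (use e in simp)
    show "jb \<sigma> powr (1/2 - 2 * \<epsilon>) \<le> T powr - (1/2 - 2 * \<epsilon>) * s powr (1/2 - 2 * \<epsilon>)" unfolding s_def by (rule scp) (use e in simp)
    have "norm (kT T \<tau> \<sigma>) \<le> 200 * T\<^sup>2 * ((1 / d\<^sup>2 + 1 / x\<^sup>2) / s)" unfolding d_def x_def s_def by (rule norm_kT_le[OF T(1)])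
    also have "(1 / d\<^sup>2 + 1 / x\<^sup>2) / s = (d powr - 2 + x powr - 2) * s powr - 1"
      unfolding sq[OF pos(3)] sq[OF pos(1)] one[OF pos(2), symmetric] by simp
    finally show "norm (kT T \<tau> \<sigma>) \<le> 200 * T\<^sup>2 * ((d powr - 2 + x powr - 2) * s powr - 1)" .
  qed auto
  also have "\<dots> = 200 * (T powr 2 * T powr - (1/2 + \<epsilon>) * T powr - (1/2 - 2 * \<epsilon>)) * (x powr (1/2 + \<epsilon>) * (d powr - 2 + x powr - 2) * (s powr - 1 * s powr (1/2 - 2 * \<epsilon>)))"
    using T by (simp only: powr_numeral ac_simps)
  also have "T powr 2 * T powr - (1/2 + \<epsilon>) * T powr - (1/2 - 2 * \<epsilon>) = T powr (1 + \<epsilon>)" unfolding powr_add[symmetric] by (simp add: add.commute)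
  also have "s powr - 1 * s powr (1/2 - 2 * \<epsilon>) = s powr - (1/2 + 2 * \<epsilon>)" unfolding powr_add[symmetric] by simp
  also have "x powr (1/2 + \<epsilon>) * (d powr - 2 + x powr - 2) * s powr - (1/2 + 2 * \<epsilon>) \<le> d powr - (3/2 - \<epsilon>) + x powr - (3/2 - \<epsilon>) * s powr - (1/2 + 2 * \<epsilon>)"
  proof -
    have "x powr (1/2 + \<epsilon>) * d powr - 2 * s powr - (1/2 + 2 * \<epsilon>) \<le> (s powr (1/2 + \<epsilon>) * d powr (1/2 + \<epsilon>)) * d powr - 2 * s powr - (1/2 + 2 * \<epsilon>)"
      using xsd[of "1/2 + \<epsilon>"] e by (intro mult_right_mono) auto
    also have "\<dots> = (d powr (1/2 + \<epsilon>) * d powr - 2) * (s powr (1/2 + \<epsilon>) * s powr - (1/2 + 2 * \<epsilon>))" by (simp only: ac_simps)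
    also have "d powr (1/2 + \<epsilon>) * d powr - 2 = d powr - (3/2 - \<epsilon>)" unfolding powr_add[symmetric] by simp
    also have "s powr (1/2 + \<epsilon>) * s powr - (1/2 + 2 * \<epsilon>) = s powr - \<epsilon>" unfolding powr_add[symmetric] by simp
    also have "d powr - (3/2 - \<epsilon>) * s powr - \<epsilon> \<le> d powr - (3/2 - \<epsilon>) * s powr 0"
      using pos e by (intro mult_left_mono powr_mono) auto
    finally have 1: "x powr (1/2 + \<epsilon>) * d powr - 2 * s powr - (1/2 + 2 * \<epsilon>) \<le> d powr - (3/2 - \<epsilon>)" using pos by simp
    have 2: "x powr (1/2 + \<epsilon>) * x powr - 2 = x powr - (3/2 - \<epsilon>)" unfolding powr_add[symmetric] by simp
    show ?thesis using 1 unfolding distrib_left distrib_right 2 by simp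
  qed
  finally show ?thesis unfolding x_def s_def d_def using T by (simp add: mult_left_mono)
qed

text \<open>The convolution kernel is treated by Young's inequality and the product kernel by
  Cauchy-Schwarz. Each loses one power of \<open>T\<close>, since its profiles live at scale
  \<open>1 / T\<close>, so \<open>T powr \<epsilon>\<close> survives before squaring. The product
  kernel is square integrable in \<sigma> because \<open>1 + 4 * \<epsilon> > 1\<close>.\<close>

theorem duhamel_L2:
  assumes e: "0 < \<epsilon>" "64 * \<epsilon> \<le> 1"
  obtains C where "C < \<top>" "\<And>T n. 0 < T \<Longrightarrow> T \<le> 1 \<Longrightarrow> n \<in> borel_measurable borel \<Longrightarrow>
    (\<integral>\<^sup>+\<tau>. (ennreal (jb \<tau> powr (1/2 + \<epsilon>)) * (\<integral>\<^sup>+\<sigma>. n \<sigma> * ennreal (norm (kT T \<tau> \<sigma>)) \<partial>lborel))\<^sup>2 \<partial>lborel)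
     \<le> C * ennreal (T powr (2 * \<epsilon>)) * (\<integral>\<^sup>+\<sigma>. (ennreal (jb \<sigma> powr (- (1/2) + 2 * \<epsilon>)) * n \<sigma>)\<^sup>2 \<partial>lborel)"
proof -
  define P Q R where "P = jbint (3/2 - \<epsilon>)" and "Q = jbint (3 - 2 * \<epsilon>)" and "R = jbint (1 + 4 * \<epsilon>)"
  have fin: "P < \<top>" "Q < \<top>" "R < \<top>" unfolding P_def Q_def R_def using e by (auto intro!: jbint_finite)
  show ?thesis
  proof (rule that[of "ennreal 40000 * (2 * (P\<^sup>2 + Q * R))"])
    show "ennreal 40000 * (2 * (P\<^sup>2 + Q * R)) < \<top>" using fin by (simp add: ennreal_mult_less_top power2_eq_square)
    fix T :: real and n :: "real \<Rightarrow> ennreal"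
    assume T: "0 < T" "T \<le> 1" and [measurable]: "n \<in> borel_measurable borel"
    define f where "f \<sigma> = ennreal (jb \<sigma> powr (- (1/2) + 2 * \<epsilon>)) * n \<sigma>" for \<sigma>
    have [measurable]: "f \<in> borel_measurable borel" unfolding f_def[abs_def] by measurable
    define F where "F = (\<integral>\<^sup>+\<sigma>. (f \<sigma>)\<^sup>2 \<partial>lborel)"
    have nf: "n \<sigma> = ennreal (jb \<sigma> powr (1/2 - 2 * \<epsilon>)) * f \<sigma>" for \<sigma>
    proof -
      have "ennreal (jb \<sigma> powr (1/2 - 2 * \<epsilon>)) * f \<sigma> = ennreal (jb \<sigma> powr (1/2 - 2 * \<epsilon>) * jb \<sigma> powr (- (1/2) + 2 * \<epsilon>)) * n \<sigma>"
        unfolding f_def by (simp add: ennreal_mult mult.assoc)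
      also have "jb \<sigma> powr (1/2 - 2 * \<epsilon>) * jb \<sigma> powr (- (1/2) + 2 * \<epsilon>) = 1" using jb_pos[of \<sigma>] by (simp add: powr_add[symmetric])
      finally show ?thesis by simp
    qed
    define k where "k u = ennreal (jb (T * u) powr - (3/2 - \<epsilon>))" for u
    define l where "l u = ennreal (jb (T * u) powr - (1/2 + 2 * \<epsilon>))" for u
    have [measurable]: "k \<in> borel_measurable borel" "l \<in> borel_measurable borel" unfolding k_def[abs_def] l_def[abs_def] by measurable
    define A where "A = ennreal (200 * T powr (1 + \<epsilon>))"
    define g1 g2 where "g1 \<tau> = (\<integral>\<^sup>+\<sigma>. k (\<tau> - \<sigma>) * f \<sigma> \<partial>lborel)" and "g2 \<tau> = k (\<tau> - 0) * (\<integral>\<^sup>+\<sigma>. l (\<sigma> - 0) * f \<sigma> \<partial>lborel)" for \<tau>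
    have [measurable]: "g1 \<in> borel_measurable borel" "g2 \<in> borel_measurable borel" unfolding g1_def[abs_def] g2_def[abs_def] by measurable
    have pt: "ennreal (jb \<tau> powr (1/2 + \<epsilon>)) * (\<integral>\<^sup>+\<sigma>. n \<sigma> * ennreal (norm (kT T \<tau> \<sigma>)) \<partial>lborel) \<le> A * (g1 \<tau> + g2 \<tau>)" for \<tau>
    proof -
      have "ennreal (jb \<tau> powr (1/2 + \<epsilon>)) * (\<integral>\<^sup>+\<sigma>. n \<sigma> * ennreal (norm (kT T \<tau> \<sigma>)) \<partial>lborel) =
        (\<integral>\<^sup>+\<sigma>. ennreal (jb \<tau> powr (1/2 + \<epsilon>)) * (n \<sigma> * ennreal (norm (kT T \<tau> \<sigma>))) \<partial>lborel)"
        by (rule nn_integral_cmult[symmetric]) measurable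
      also have "\<dots> \<le> (\<integral>\<^sup>+\<sigma>. A * (k (\<tau> - \<sigma>) * f \<sigma> + k (\<tau> - 0) * (l (\<sigma> - 0) * f \<sigma>)) \<partial>lborel)"
      proof (rule nn_integral_mono)
        fix \<sigma>
        have "ennreal (jb \<tau> powr (1/2 + \<epsilon>)) * (n \<sigma> * ennreal (norm (kT T \<tau> \<sigma>))) =
          ennreal (jb \<tau> powr (1/2 + \<epsilon>) * (norm (kT T \<tau> \<sigma>) * jb \<sigma> powr (1/2 - 2 * \<epsilon>))) * f \<sigma>"
          unfolding nf by (simp add: ennreal_mult ac_simps)
        also have "\<dots> \<le> ennreal (200 * T powr (1 + \<epsilon>) * (jb (T * (\<tau> - \<sigma>)) powr - (3/2 - \<epsilon>) + jb (T * (\<tau> - 0)) powr - (3/2 - \<epsilon>) * jb (T * (\<sigma> - 0)) powr - (1/2 + 2 * \<epsilon>))) * f \<sigma>"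
          by (intro mult_right_mono ennreal_leI duhamel_kernel_pointwise e T) auto
        also have "\<dots> = A * (k (\<tau> - \<sigma>) + k (\<tau> - 0) * l (\<sigma> - 0)) * f \<sigma>"
          unfolding A_def k_def l_def by (subst ennreal_mult, simp, simp, subst ennreal_plus, simp, simp, subst (2) ennreal_mult, simp, simp) (rule refl)
        also have "\<dots> = A * (k (\<tau> - \<sigma>) * f \<sigma> + k (\<tau> - 0) * (l (\<sigma> - 0) * f \<sigma>))" by (simp add: distrib_right distrib_left mult.assoc)
        finally show "ennreal (jb \<tau> powr (1/2 + \<epsilon>)) * (n \<sigma> * ennreal (norm (kT T \<tau> \<sigma>))) \<le> A * (k (\<tau> - \<sigma>) * f \<sigma> + k (\<tau> - 0) * (l (\<sigma> - 0) * f \<sigma>))" .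
      qed
      also have "\<dots> = A * (g1 \<tau> + g2 \<tau>)"
        unfolding g1_def g2_def by (simp add: nn_integral_cmult nn_integral_add)
      finally show ?thesis .
    qed
    have kint: "(\<integral>\<^sup>+\<sigma>. k (\<tau> - \<sigma>) \<partial>lborel) = ennreal (1 / T) * P" for \<tau>
    proof -
      have "k (\<tau> - \<sigma>) = k (\<sigma> - \<tau>)" for \<sigma>
        using jb_uminus[of "T * (\<tau> - \<sigma>)"] unfolding k_def by (simp add: algebra_simps)
      then show ?thesis unfolding P_def using nn_integral_jb_scale[OF T(1), of \<tau> "3/2 - \<epsilon>"] unfolding k_def by simp
    qed
    have kint': "(\<integral>\<^sup>+\<tau>. k (\<tau> - \<sigma>) \<partial>lborel) = ennreal (1 / T) * P" for \<sigma>
      unfolding P_def k_def by (rule nn_integral_jb_scale[OF T(1)])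
    have I1: "(\<integral>\<^sup>+\<tau>. (g1 \<tau>)\<^sup>2 \<partial>lborel) \<le> (ennreal (1 / T))\<^sup>2 * (P\<^sup>2 * F)"
    proof -
      \<comment> \<open>\<open>h\<close> is a square root of \<open>k\<close>; splitting the kernel
        symmetrically before Cauchy-Schwarz is the proof of Young's inequality.\<close>
      define h where "h u = ennreal (jb (T * u) powr - ((3/2 - \<epsilon>)/2))" for u
      have [measurable]: "h \<in> borel_measurable borel" unfolding h_def[abs_def] by measurable
      have hh: "h u * h u = k u" for u unfolding h_def k_def by (simp add: ennreal_mult[symmetric] powr_add[symmetric])
      have "(g1 \<tau>)\<^sup>2 \<le> ennreal (1 / T) * P * (\<integral>\<^sup>+\<sigma>. k (\<tau> - \<sigma>) * (f \<sigma>)\<^sup>2 \<partial>lborel)" for \<tau>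
      proof -
        have "g1 \<tau> = (\<integral>\<^sup>+\<sigma>. h (\<tau> - \<sigma>) * (h (\<tau> - \<sigma>) * f \<sigma>) \<partial>lborel)" unfolding g1_def by (simp add: mult.assoc[symmetric] hh)
        then have "(g1 \<tau>)\<^sup>2 \<le> (\<integral>\<^sup>+\<sigma>. (h (\<tau> - \<sigma>))\<^sup>2 \<partial>lborel) * (\<integral>\<^sup>+\<sigma>. (h (\<tau> - \<sigma>) * f \<sigma>)\<^sup>2 \<partial>lborel)"
          by (simp only:) (rule Cauchy_Schwarz_nn_integral, measurable)
        also have "\<dots> = (\<integral>\<^sup>+\<sigma>. k (\<tau> - \<sigma>) \<partial>lborel) * (\<integral>\<^sup>+\<sigma>. k (\<tau> - \<sigma>) * (f \<sigma>)\<^sup>2 \<partial>lborel)"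
        proof -
          have "(h u)\<^sup>2 = k u" "(h u * v)\<^sup>2 = k u * v\<^sup>2" for u v
            unfolding power_mult_distrib by (simp_all add: power2_eq_square hh)
          then show ?thesis by simp
        qed
        finally show ?thesis unfolding kint .
      qed
      then have "(\<integral>\<^sup>+\<tau>. (g1 \<tau>)\<^sup>2 \<partial>lborel) \<le> (\<integral>\<^sup>+\<tau>. ennreal (1 / T) * P * (\<integral>\<^sup>+\<sigma>. k (\<tau> - \<sigma>) * (f \<sigma>)\<^sup>2 \<partial>lborel) \<partial>lborel)"
        by (rule nn_integral_mono)
      also have "\<dots> = ennreal (1 / T) * P * (\<integral>\<^sup>+\<tau>. \<integral>\<^sup>+\<sigma>. k (\<tau> - \<sigma>) * (f \<sigma>)\<^sup>2 \<partial>lborel \<partial>lborel)"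
        by (rule nn_integral_cmult) measurable
      also have "(\<integral>\<^sup>+\<tau>. \<integral>\<^sup>+\<sigma>. k (\<tau> - \<sigma>) * (f \<sigma>)\<^sup>2 \<partial>lborel \<partial>lborel) = (\<integral>\<^sup>+\<sigma>. \<integral>\<^sup>+\<tau>. k (\<tau> - \<sigma>) * (f \<sigma>)\<^sup>2 \<partial>lborel \<partial>lborel)"
        by (rule nn_integral_lborel_swap) measurable
      also have "\<dots> = ennreal (1 / T) * P * F" unfolding F_def by (simp add: nn_integral_multc kint' nn_integral_cmult)
      finally show ?thesis by (simp add: power2_eq_square ac_simps)
    qed
    have I2: "(\<integral>\<^sup>+\<tau>. (g2 \<tau>)\<^sup>2 \<partial>lborel) \<le> (ennreal (1 / T))\<^sup>2 * (Q * R * F)"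
    proof -
      have k2: "(k (\<tau> - 0))\<^sup>2 = ennreal (jb (T * (\<tau> - 0)) powr - (3 - 2 * \<epsilon>))" for \<tau>
        unfolding k_def power2_eq_square by (simp add: ennreal_mult[symmetric] powr_add[symmetric])
      have l2: "(l (\<tau> - 0))\<^sup>2 = ennreal (jb (T * (\<tau> - 0)) powr - (1 + 4 * \<epsilon>))" for \<tau>
        unfolding l_def power2_eq_square by (simp add: ennreal_mult[symmetric] powr_add[symmetric])
      have "(\<integral>\<^sup>+\<tau>. (g2 \<tau>)\<^sup>2 \<partial>lborel) = (\<integral>\<^sup>+\<tau>. (k (\<tau> - 0))\<^sup>2 \<partial>lborel) * (\<integral>\<^sup>+\<sigma>. l (\<sigma> - 0) * f \<sigma> \<partial>lborel)\<^sup>2"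
        unfolding g2_def power_mult_distrib by (rule nn_integral_multc) measurable
      also have "\<dots> \<le> (\<integral>\<^sup>+\<tau>. (k (\<tau> - 0))\<^sup>2 \<partial>lborel) * ((\<integral>\<^sup>+\<sigma>. (l (\<sigma> - 0))\<^sup>2 \<partial>lborel) * F)"
        unfolding F_def by (intro mult_left_mono Cauchy_Schwarz_nn_integral) auto
      also have "\<dots> = (ennreal (1 / T) * Q) * ((ennreal (1 / T) * R) * F)"
        unfolding k2 l2 nn_integral_jb_scale[OF T(1)] Q_def R_def ..
      finally show ?thesis by (simp add: power2_eq_square ac_simps)
    qed
    have "(\<integral>\<^sup>+\<tau>. (ennreal (jb \<tau> powr (1/2 + \<epsilon>)) * (\<integral>\<^sup>+\<sigma>. n \<sigma> * ennreal (norm (kT T \<tau> \<sigma>)) \<partial>lborel))\<^sup>2 \<partial>lborel)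
      \<le> (\<integral>\<^sup>+\<tau>. A\<^sup>2 * (2 * ((g1 \<tau>)\<^sup>2 + (g2 \<tau>)\<^sup>2)) \<partial>lborel)"
    proof (rule nn_integral_mono)
      fix \<tau>
      have "(ennreal (jb \<tau> powr (1/2 + \<epsilon>)) * (\<integral>\<^sup>+\<sigma>. n \<sigma> * ennreal (norm (kT T \<tau> \<sigma>)) \<partial>lborel))\<^sup>2 \<le> (A * (g1 \<tau> + g2 \<tau>))\<^sup>2"
        by (intro power_mono pt) auto
      also have "\<dots> \<le> A\<^sup>2 * (2 * ((g1 \<tau>)\<^sup>2 + (g2 \<tau>)\<^sup>2))" unfolding power_mult_distrib by (intro mult_left_mono ennreal_square_sum_le) auto
      finally show "(ennreal (jb \<tau> powr (1/2 + \<epsilon>)) * (\<integral>\<^sup>+\<sigma>. n \<sigma> * ennreal (norm (kT T \<tau> \<sigma>)) \<partial>lborel))\<^sup>2 \<le> A\<^sup>2 * (2 * ((g1 \<tau>)\<^sup>2 + (g2 \<tau>)\<^sup>2))" .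
    qed
    also have "\<dots> = A\<^sup>2 * (2 * ((\<integral>\<^sup>+\<tau>. (g1 \<tau>)\<^sup>2 \<partial>lborel) + (\<integral>\<^sup>+\<tau>. (g2 \<tau>)\<^sup>2 \<partial>lborel)))"
      by (subst nn_integral_cmult, measurable, subst nn_integral_cmult, measurable, subst nn_integral_add) auto
    also have "\<dots> \<le> A\<^sup>2 * (2 * ((ennreal (1 / T))\<^sup>2 * (P\<^sup>2 * F) + (ennreal (1 / T))\<^sup>2 * (Q * R * F)))"
      by (intro mult_left_mono add_mono I1 I2) auto
    also have "\<dots> = (A\<^sup>2 * (ennreal (1 / T))\<^sup>2) * ((2 * (P\<^sup>2 + Q * R)) * F)"
      by (simp add: distrib_left distrib_right ac_simps)
    also have "A\<^sup>2 * (ennreal (1 / T))\<^sup>2 = ennreal 40000 * ennreal (T powr (2 * \<epsilon>))"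
    proof -
      have "(200 * T powr (1 + \<epsilon>)) * (1 / T) = 200 * T powr \<epsilon>" using T by (simp add: powr_add)
      then have "A * ennreal (1 / T) = ennreal (200 * T powr \<epsilon>)" unfolding A_def using T by (subst ennreal_mult[symmetric]) auto
      then have "A\<^sup>2 * (ennreal (1 / T))\<^sup>2 = (ennreal (200 * T powr \<epsilon>))\<^sup>2" by (simp add: power_mult_distrib[symmetric])
      also have "\<dots> = ennreal ((200 * T powr \<epsilon>)\<^sup>2)" by (rule ennreal_power) simp
      also have "(200 * T powr \<epsilon>)\<^sup>2 = 40000 * T powr (2 * \<epsilon>)"
        using T by (simp add: power_mult_distrib powr_powr mult.commute flip: powr_numeral)
      also have "ennreal (40000 * T powr (2 * \<epsilon>)) = ennreal 40000 * ennreal (T powr (2 * \<epsilon>))" by (rule ennreal_mult) auto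
      finally show ?thesis .
    qed
    finally show "(\<integral>\<^sup>+\<tau>. (ennreal (jb \<tau> powr (1/2 + \<epsilon>)) * (\<integral>\<^sup>+\<sigma>. n \<sigma> * ennreal (norm (kT T \<tau> \<sigma>)) \<partial>lborel))\<^sup>2 \<partial>lborel)
     \<le> ennreal 40000 * (2 * (P\<^sup>2 + Q * R)) * ennreal (T powr (2 * \<epsilon>)) * (\<integral>\<^sup>+\<sigma>. (ennreal (jb \<sigma> powr (- (1/2) + 2 * \<epsilon>)) * n \<sigma>)\<^sup>2 \<partial>lborel)"
      unfolding F_def f_def by (simp only: mult.assoc mult.commute mult.left_commute)
  qed
qed

section \<open>Bourgain spaces and the Duhamel map\<close>

text \<open>\<open>e6\<close> is the demand of \<open>AB_big\<close> at regularity
  \<open>min s1 (- 1)\<close>, and \<open>e64\<close> that of the exponent 15/32 in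
  \<open>KT\<close>.\<close>

locale kp_params =
  fixes s1 s2 \<epsilon> :: real
  assumes s1: "- 9/8 < s1" and s2: "0 \<le> s2" and e0: "0 < \<epsilon>" and e6: "6 * \<epsilon> \<le> min s1 (- 1) + 9/8" and e64: "64 * \<epsilon> \<le> 1"
begin

text \<open>The squared norm with values in \<open>ennreal\<close>, meaningful for every function;
  finiteness is the membership condition.\<close>

definition nx :: "real \<Rightarrow> (freq \<Rightarrow> complex) \<Rightarrow> ennreal" where
  "nx b G = (\<integral>\<^sup>+z. ennreal ((xweight s1 s2 b z)\<^sup>2 * (cmod (G z))\<^sup>2) \<partial>lborel)"

definition nh :: "(real \<times> real \<Rightarrow> complex) \<Rightarrow> ennreal" where
  "nh f = (\<integral>\<^sup>+p. ennreal ((hweight s1 s2 p)\<^sup>2 * (cmod (f p))\<^sup>2) \<partial>lborel)"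

definition bb where "bb = 1/2 + \<epsilon>"
definition bp where "bp = - (1/2) + 2 * \<epsilon>"

lemma nx_alt: "nx b G = (\<integral>\<^sup>+z. (ennreal (xweight s1 s2 b z) * ennreal (cmod (G z)))\<^sup>2 \<partial>lborel)"
  unfolding nx_def using xweight_pos[of s1 s2 b]
  by (intro nn_integral_cong) (simp add: ennreal_mult[symmetric] ennreal_power power_mult_distrib less_imp_le)

lemma nx_add:
  assumes [measurable]: "G \<in> borel_measurable borel" "H \<in> borel_measurable borel"
  shows "nx b (\<lambda>z. G z + H z) \<le> 2 * (nx b G + nx b H)"
proof -
  have "nx b (\<lambda>z. G z + H z) \<le> (\<integral>\<^sup>+z. 2 * ((ennreal (xweight s1 s2 b z) * ennreal (cmod (G z)))\<^sup>2 + (ennreal (xweight s1 s2 b z) * ennreal (cmod (H z)))\<^sup>2) \<partial>lborel)"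
    unfolding nx_alt
  proof (rule nn_integral_mono)
    fix z
    have "ennreal (cmod (G z + H z)) \<le> ennreal (cmod (G z)) + ennreal (cmod (H z))"
      using norm_triangle_ineq[of "G z" "H z"] by (simp add: ennreal_plus[symmetric] del: ennreal_plus)
    then have "ennreal (xweight s1 s2 b z) * ennreal (cmod (G z + H z)) \<le> ennreal (xweight s1 s2 b z) * ennreal (cmod (G z)) + ennreal (xweight s1 s2 b z) * ennreal (cmod (H z))"
      unfolding distrib_left[symmetric] by (rule mult_left_mono) simp
    then have "(ennreal (xweight s1 s2 b z) * ennreal (cmod (G z + H z)))\<^sup>2 \<le> (ennreal (xweight s1 s2 b z) * ennreal (cmod (G z)) + ennreal (xweight s1 s2 b z) * ennreal (cmod (H z)))\<^sup>2"
      by (rule power_mono) simp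
    also note ennreal_square_sum_le
    finally show "(ennreal (xweight s1 s2 b z) * ennreal (cmod (G z + H z)))\<^sup>2 \<le> 2 * ((ennreal (xweight s1 s2 b z) * ennreal (cmod (G z)))\<^sup>2 + (ennreal (xweight s1 s2 b z) * ennreal (cmod (H z)))\<^sup>2)" .
  qed
  also have "\<dots> = 2 * (nx b G + nx b H)" unfolding nx_alt by (simp add: nn_integral_cmult nn_integral_add)
  finally show ?thesis .
qed

lemma nx_uminus: "nx b (\<lambda>z. - G z) = nx b G"
  unfolding nx_def by simp

lemma nx_diff:
  assumes "G \<in> borel_measurable borel" "H \<in> borel_measurable borel"
  shows "nx b (\<lambda>z. G z - H z) \<le> 2 * (nx b G + nx b H)"
  using nx_add[of G "\<lambda>z. - H z" b] assms by (simp add: nx_uminus)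

lemma nx_cong_AE: "AE z in lborel. G z = H z \<Longrightarrow> nx b G = nx b H"
  unfolding nx_def by (rule nn_integral_cong_AE) auto

lemma nx_zero_AE:
  assumes [measurable]: "G \<in> borel_measurable borel" and z: "nx b G = 0"
  shows "AE z in lborel. G z = 0"
proof -
  have "AE z in lborel. ennreal ((xweight s1 s2 b z)\<^sup>2 * (cmod (G z))\<^sup>2) = 0"
    using z unfolding nx_def by (subst (asm) nn_integral_0_iff_AE) auto
  then show ?thesis
  proof eventually_elim
    case (elim z)
    then have "(xweight s1 s2 b z)\<^sup>2 * (cmod (G z))\<^sup>2 \<le> 0" by (simp add: ennreal_eq_0_iff)
    then show ?case using xweight_pos[of s1 s2 b z] by (simp add: mult_le_0_iff)
  qed
qed

section \<open>The polarized nonlinearity and the cut-off Duhamel operator\<close>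

definition bil :: "(freq \<Rightarrow> complex) \<Rightarrow> (freq \<Rightarrow> complex) \<Rightarrow> freq \<Rightarrow> complex" where
  "bil G H z = (\<integral>w. G w * H (z - w) \<partial>lborel)"

definition Nl :: "(freq \<Rightarrow> complex) \<Rightarrow> (freq \<Rightarrow> complex) \<Rightarrow> freq \<Rightarrow> complex" where
  "Nl G H z = \<i> * complex_of_real (xi z) * bil G H z / complex_of_real ((2 * pi) ^ 3)"

text \<open>Majorant of \<open>bil\<close>; for measurable factors its finiteness is the absolute
  convergence required in \<open>duhamel_sol\<close>.\<close>

definition absbil :: "(freq \<Rightarrow> complex) \<Rightarrow> (freq \<Rightarrow> complex) \<Rightarrow> freq \<Rightarrow> ennreal" where
  "absbil G H z = (\<integral>\<^sup>+w. ennreal (cmod (G w)) * ennreal (cmod (H (z - w))) \<partial>lborel)"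

lemma nonlin_eq: "nonlin G = Nl G G"
  unfolding nonlin_def Nl_def bil_def by (rule ext) simp

lemma bil_measurable [measurable]:
  assumes [measurable]: "G \<in> borel_measurable borel" "H \<in> borel_measurable borel"
  shows "bil G H \<in> borel_measurable borel"
  unfolding bil_def[abs_def] by measurable

lemma Nl_measurable [measurable]:
  assumes [measurable]: "G \<in> borel_measurable borel" "H \<in> borel_measurable borel"
  shows "Nl G H \<in> borel_measurable borel"
  unfolding Nl_def[abs_def] by measurable

lemma absbil_measurable [measurable]:
  assumes [measurable]: "G \<in> borel_measurable borel" "H \<in> borel_measurable borel"
  shows "absbil G H \<in> borel_measurable borel"
  unfolding absbil_def[abs_def] by measurable

lemma integrable_bil_iff:
  assumes [measurable]: "G \<in> borel_measurable borel" "H \<in> borel_measurable borel"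
  shows "integrable lborel (\<lambda>w. G w * H (z - w)) \<longleftrightarrow> absbil G H z < \<top>"
  unfolding integrable_iff_bounded absbil_def by (simp add: norm_mult ennreal_mult)

lemma norm_bil_le:
  assumes [measurable]: "G \<in> borel_measurable borel" "H \<in> borel_measurable borel"
  shows "ennreal (cmod (bil G H z)) \<le> absbil G H z"
proof (cases "integrable lborel (\<lambda>w. G w * H (z - w))")
  case True
  have "ennreal (cmod (bil G H z)) \<le> (\<integral>\<^sup>+w. ennreal (cmod (G w * H (z - w))) \<partial>lborel)"
    unfolding bil_def by (rule integral_norm_bound_ennreal[OF True])
  then show ?thesis unfolding absbil_def by (simp add: norm_mult ennreal_mult)
qed (simp add: bil_def not_integrable_integral_eq)

lemma norm_Nl_le:
  assumes [measurable]: "G \<in> borel_measurable borel" "H \<in> borel_measurable borel"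
  shows "ennreal (cmod (Nl G H z)) \<le> ennreal \<bar>xi z\<bar> * absbil G H z"
proof -
  have p: "1 \<le> (2 * pi) ^ 3" using pi_ge_two by (intro one_le_power) linarith
  have "cmod (Nl G H z) = \<bar>xi z\<bar> * cmod (bil G H z) / (2 * pi) ^ 3"
    unfolding Nl_def norm_divide norm_mult norm_of_real using pi_gt_zero by simp
  also have "\<dots> \<le> \<bar>xi z\<bar> * cmod (bil G H z) / 1" by (intro divide_left_mono p) auto
  also have "\<dots> = \<bar>xi z\<bar> * cmod (bil G H z)" by simp
  finally have "ennreal (cmod (Nl G H z)) \<le> ennreal \<bar>xi z\<bar> * ennreal (cmod (bil G H z))"
    by (subst ennreal_mult[symmetric]) (auto intro: ennreal_leI)
  also have "\<dots> \<le> ennreal \<bar>xi z\<bar> * absbil G H z" by (intro mult_left_mono norm_bil_le) auto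
  finally show ?thesis .
qed

lemma absbil_estimate:
  obtains C where "C < \<top>" "\<And>G H. G \<in> borel_measurable borel \<Longrightarrow> H \<in> borel_measurable borel \<Longrightarrow>
    (\<integral>\<^sup>+z. (ennreal (xweight s1 s2 bp z) * (ennreal \<bar>xi z\<bar> * absbil G H z))\<^sup>2 \<partial>lborel) \<le> C * (nx bb G * nx bb H)"
proof -
  obtain C where C: "C < \<top>" "\<And>f g. f \<in> borel_measurable borel \<Longrightarrow> g \<in> borel_measurable borel \<Longrightarrow>
    (\<integral>\<^sup>+z. (ennreal (\<bar>xi z\<bar> * xweight s1 s2 (- (1/2) + 2 * \<epsilon>) z) * (\<integral>\<^sup>+w. f w * g (z - w) \<partial>lborel))\<^sup>2 \<partial>lborel)
    \<le> C * ((\<integral>\<^sup>+z. (ennreal (xweight s1 s2 (1/2 + \<epsilon>) z) * f z)\<^sup>2 \<partial>lborel) * (\<integral>\<^sup>+z. (ennreal (xweight s1 s2 (1/2 + \<epsilon>) z) * g z)\<^sup>2 \<partial>lborel))"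
    by (rule bilinear_estimate[OF s1 s2 e0 e6 e64]) blast
  show ?thesis
  proof (rule that[OF C(1)])
    fix G H :: "freq \<Rightarrow> complex"
    assume [measurable]: "G \<in> borel_measurable borel" "H \<in> borel_measurable borel"
    have eq: "ennreal (\<bar>xi z\<bar> * xweight s1 s2 (- (1/2) + 2 * \<epsilon>) z) * v = ennreal (xweight s1 s2 bp z) * (ennreal \<bar>xi z\<bar> * v)" for z v
      unfolding bp_def using xweight_pos[of s1 s2 "- (1/2) + 2 * \<epsilon>" z] by (subst ennreal_mult) (auto simp: ac_simps less_imp_le)
    show "(\<integral>\<^sup>+z. (ennreal (xweight s1 s2 bp z) * (ennreal \<bar>xi z\<bar> * absbil G H z))\<^sup>2 \<partial>lborel) \<le> C * (nx bb G * nx bb H)"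
      using C(2)[of "\<lambda>w. ennreal (cmod (G w))" "\<lambda>w. ennreal (cmod (H w))"]
      unfolding nx_alt absbil_def bb_def eq by simp
  qed
qed

text \<open>The bilinear bound controls only \<open>\<bar>xi z\<bar> * absbil G H z\<close>, but
  \<open>xi z = 0\<close> is a null set.\<close>

lemma absbil_finite_AE:
  assumes [measurable]: "G \<in> borel_measurable borel" "H \<in> borel_measurable borel" and f: "nx bb G < \<top>" "nx bb H < \<top>"
  shows "AE z in lborel. absbil G H z < \<top>"
proof -
  obtain C where C1: "C < \<top>" "\<And>G H. G \<in> borel_measurable borel \<Longrightarrow> H \<in> borel_measurable borel \<Longrightarrow>
    (\<integral>\<^sup>+z. (ennreal (xweight s1 s2 bp z) * (ennreal \<bar>xi z\<bar> * absbil G H z))\<^sup>2 \<partial>lborel) \<le> C * (nx bb G * nx bb H)"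
    by (rule absbil_estimate) blast
  note C = C1(1) C1(2)[OF assms(1,2)]
  have "C * (nx bb G * nx bb H) < \<top>" using C f by (simp add: ennreal_mult_less_top)
  then have "(\<integral>\<^sup>+z. (ennreal (xweight s1 s2 bp z) * (ennreal \<bar>xi z\<bar> * absbil G H z))\<^sup>2 \<partial>lborel) \<noteq> \<infinity>" using C(2) by auto
  then have "AE z in lborel. (ennreal (xweight s1 s2 bp z) * (ennreal \<bar>xi z\<bar> * absbil G H z))\<^sup>2 \<noteq> \<infinity>"
    by (rule nn_integral_PInf_AE[rotated]) measurable
  then show ?thesis using AE_xi_neq[of 0]
  proof eventually_elim
    case (elim z)
    show ?case
    proof (rule ccontr)
      assume "\<not> absbil G H z < \<top>"
      then have "absbil G H z = \<top>" by (simp add: less_top[symmetric])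
      then show False using elim xweight_pos[of s1 s2 bp z] by (simp add: ennreal_mult_top power2_eq_square ennreal_mult_eq_top_iff)
    qed
  qed
qed

text \<open>\<open>1 / (4 * pi)\<close> is the factor 1/2 of the equation times
  \<open>1 / (2 * pi)\<close> from the inverse transform. For each spatial frequency the operator
  integrates against \<open>kT\<close> in the modulation variable; it represents the Duhamel term
  only at times in \<open>[0,T]\<close>.\<close>

definition Duh :: "real \<Rightarrow> (freq \<Rightarrow> complex) \<Rightarrow> freq \<Rightarrow> complex" where
  "Duh T N z = - (1 / complex_of_real (4 * pi)) * (\<integral>\<rho>. N (fst z, \<rho>) * kT T (sg z) (\<rho> + phase (fst z)) \<partial>lborel)"

lemma Duh_measurable [measurable]:
  assumes [measurable]: "N \<in> borel_measurable borel"
  shows "Duh T N \<in> borel_measurable borel"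
  unfolding Duh_def[abs_def] by measurable

text \<open>With the modulation as variable the weight separates, so that operators acting in \<tau>
  alone reduce to one-dimensional estimates at fixed \<open>p\<close>.\<close>

lemma nn_integral_weighted:
  assumes [measurable]: "G \<in> borel_measurable borel"
  shows "nx b G = (\<integral>\<^sup>+p. (ennreal (hweight s1 s2 p))\<^sup>2 * (\<integral>\<^sup>+\<sigma>. (ennreal (jb \<sigma> powr b) * ennreal (cmod (G (p, \<sigma> - phase p))))\<^sup>2 \<partial>lborel) \<partial>lborel)"
proof -
  have hw: "0 \<le> hweight s1 s2 p" for p unfolding hweight_def by simp
  have "nx b G = (\<integral>\<^sup>+p. \<integral>\<^sup>+t. (ennreal (xweight s1 s2 b (p, t)) * ennreal (cmod (G (p, t))))\<^sup>2 \<partial>lborel \<partial>lborel)"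
    unfolding nx_alt by (rule nn_integral_lborel_pair) measurable
  also have "\<dots> = (\<integral>\<^sup>+p. \<integral>\<^sup>+\<sigma>. (ennreal (xweight s1 s2 b (p, - phase p + \<sigma>)) * ennreal (cmod (G (p, - phase p + \<sigma>))))\<^sup>2 \<partial>lborel \<partial>lborel)"
    by (intro nn_integral_cong nn_integral_lborel_translate[symmetric]) measurable
  also have "\<dots> = (\<integral>\<^sup>+p. \<integral>\<^sup>+\<sigma>. (ennreal (hweight s1 s2 p))\<^sup>2 * (ennreal (jb \<sigma> powr b) * ennreal (cmod (G (p, \<sigma> - phase p))))\<^sup>2 \<partial>lborel \<partial>lborel)"
    unfolding xweight_def using hw by (intro nn_integral_cong) (simp add: ennreal_mult power_mult_distrib mult.assoc)
  also have "\<dots> = (\<integral>\<^sup>+p. (ennreal (hweight s1 s2 p))\<^sup>2 * (\<integral>\<^sup>+\<sigma>. (ennreal (jb \<sigma> powr b) * ennreal (cmod (G (p, \<sigma> - phase p))))\<^sup>2 \<partial>lborel) \<partial>lborel)"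
    by (intro nn_integral_cong nn_integral_cmult) measurable
  finally show ?thesis .
qed

lemma norm_Duh_le:
  assumes [measurable]: "N \<in> borel_measurable borel"
  shows "ennreal (cmod (Duh T N (p, \<sigma> - phase p))) \<le> (\<integral>\<^sup>+\<rho>. ennreal (cmod (N (p, \<rho> - phase p))) * ennreal (norm (kT T \<sigma> \<rho>)) \<partial>lborel)"
proof -
  have sgz: "sg (p, \<sigma> - phase p) = \<sigma>" by (simp add: sg_def)
  have p4: "1 / (4 * pi) \<le> 1" using pi_ge_two by simp
  have "ennreal (cmod (\<integral>\<rho>. N (p, \<rho>) * kT T \<sigma> (\<rho> + phase p) \<partial>lborel)) \<le> (\<integral>\<^sup>+\<rho>. ennreal (cmod (N (p, \<rho>) * kT T \<sigma> (\<rho> + phase p))) \<partial>lborel)"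
  proof (cases "integrable lborel (\<lambda>\<rho>. N (p, \<rho>) * kT T \<sigma> (\<rho> + phase p))")
    case True then show ?thesis by (rule integral_norm_bound_ennreal)
  qed (simp add: not_integrable_integral_eq)
  also have "\<dots> = (\<integral>\<^sup>+\<rho>. ennreal (cmod (N (p, - phase p + \<rho>) * kT T \<sigma> (- phase p + \<rho> + phase p))) \<partial>lborel)"
    by (rule nn_integral_lborel_translate[symmetric, where f="\<lambda>\<rho>. ennreal (cmod (N (p, \<rho>) * kT T \<sigma> (\<rho> + phase p)))"]) measurable
  finally have 1: "ennreal (cmod (\<integral>\<rho>. N (p, \<rho>) * kT T \<sigma> (\<rho> + phase p) \<partial>lborel)) \<le> (\<integral>\<^sup>+\<rho>. ennreal (cmod (N (p, \<rho> - phase p))) * ennreal (norm (kT T \<sigma> \<rho>)) \<partial>lborel)"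
    by (simp add: norm_mult ennreal_mult)
  have "cmod (Duh T N (p, \<sigma> - phase p)) = (1 / (4 * pi)) * cmod (\<integral>\<rho>. N (p, \<rho>) * kT T \<sigma> (\<rho> + phase p) \<partial>lborel)"
    unfolding Duh_def sgz fst_conv norm_mult norm_minus_cancel norm_divide norm_of_real norm_one using pi_gt_zero by simp
  also have "\<dots> \<le> 1 * cmod (\<integral>\<rho>. N (p, \<rho>) * kT T \<sigma> (\<rho> + phase p) \<partial>lborel)" using p4 by (intro mult_right_mono) auto
  finally have "ennreal (cmod (Duh T N (p, \<sigma> - phase p))) \<le> ennreal (cmod (\<integral>\<rho>. N (p, \<rho>) * kT T \<sigma> (\<rho> + phase p) \<partial>lborel))" by (simp add: ennreal_leI)
  also note 1
  finally show ?thesis .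
qed

lemma Duh_estimate:
  obtains C where "C < \<top>" "\<And>T N. 0 < T \<Longrightarrow> T \<le> 1 \<Longrightarrow> N \<in> borel_measurable borel \<Longrightarrow>
    nx bb (Duh T N) \<le> C * ennreal (T powr (2 * \<epsilon>)) * nx bp N"
proof -
  obtain C where C: "C < \<top>" "\<And>T n. 0 < T \<Longrightarrow> T \<le> 1 \<Longrightarrow> n \<in> borel_measurable borel \<Longrightarrow>
    (\<integral>\<^sup>+\<tau>. (ennreal (jb \<tau> powr (1/2 + \<epsilon>)) * (\<integral>\<^sup>+\<sigma>. n \<sigma> * ennreal (norm (kT T \<tau> \<sigma>)) \<partial>lborel))\<^sup>2 \<partial>lborel)
     \<le> C * ennreal (T powr (2 * \<epsilon>)) * (\<integral>\<^sup>+\<sigma>. (ennreal (jb \<sigma> powr (- (1/2) + 2 * \<epsilon>)) * n \<sigma>)\<^sup>2 \<partial>lborel)"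
    by (rule duhamel_L2[OF e0 e64]) blast
  show ?thesis
  proof (rule that[OF C(1)])
    fix T :: real and N :: "freq \<Rightarrow> complex"
    assume T: "0 < T" "T \<le> 1" and [measurable]: "N \<in> borel_measurable borel"
    let ?D = "C * ennreal (T powr (2 * \<epsilon>))"
    have "nx bb (Duh T N) = (\<integral>\<^sup>+p. (ennreal (hweight s1 s2 p))\<^sup>2 * (\<integral>\<^sup>+\<sigma>. (ennreal (jb \<sigma> powr bb) * ennreal (cmod (Duh T N (p, \<sigma> - phase p))))\<^sup>2 \<partial>lborel) \<partial>lborel)"
      by (rule nn_integral_weighted) measurable
    also have "\<dots> \<le> (\<integral>\<^sup>+p. (ennreal (hweight s1 s2 p))\<^sup>2 * (?D * (\<integral>\<^sup>+\<sigma>. (ennreal (jb \<sigma> powr bp) * ennreal (cmod (N (p, \<sigma> - phase p))))\<^sup>2 \<partial>lborel)) \<partial>lborel)"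
    proof (intro nn_integral_mono mult_left_mono)
      fix p
      have "(\<integral>\<^sup>+\<sigma>. (ennreal (jb \<sigma> powr bb) * ennreal (cmod (Duh T N (p, \<sigma> - phase p))))\<^sup>2 \<partial>lborel)
        \<le> (\<integral>\<^sup>+\<sigma>. (ennreal (jb \<sigma> powr bb) * (\<integral>\<^sup>+\<rho>. ennreal (cmod (N (p, \<rho> - phase p))) * ennreal (norm (kT T \<sigma> \<rho>)) \<partial>lborel))\<^sup>2 \<partial>lborel)"
        by (intro nn_integral_mono power_mono mult_left_mono norm_Duh_le) auto
      also have "\<dots> \<le> ?D * (\<integral>\<^sup>+\<sigma>. (ennreal (jb \<sigma> powr bp) * ennreal (cmod (N (p, \<sigma> - phase p))))\<^sup>2 \<partial>lborel)"
        unfolding bb_def bp_def by (rule C(2)[OF T]) measurable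
      finally show "(\<integral>\<^sup>+\<sigma>. (ennreal (jb \<sigma> powr bb) * ennreal (cmod (Duh T N (p, \<sigma> - phase p))))\<^sup>2 \<partial>lborel)
        \<le> ?D * (\<integral>\<^sup>+\<sigma>. (ennreal (jb \<sigma> powr bp) * ennreal (cmod (N (p, \<sigma> - phase p))))\<^sup>2 \<partial>lborel)" .
    qed auto
    also have "\<dots> = (\<integral>\<^sup>+p. ?D * ((ennreal (hweight s1 s2 p))\<^sup>2 * (\<integral>\<^sup>+\<sigma>. (ennreal (jb \<sigma> powr bp) * ennreal (cmod (N (p, \<sigma> - phase p))))\<^sup>2 \<partial>lborel)) \<partial>lborel)"
      by (simp only: ac_simps)
    also have "\<dots> = ?D * nx bp N" by (subst nn_integral_weighted, measurable) (rule nn_integral_cmult, measurable)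
    finally show "nx bb (Duh T N) \<le> C * ennreal (T powr (2 * \<epsilon>)) * nx bp N" .
  qed
qed

lemma nx_Nl_estimate:
  obtains C where "C < \<top>" "\<And>V W. V \<in> borel_measurable borel \<Longrightarrow> W \<in> borel_measurable borel \<Longrightarrow>
    nx bp (Nl V W) \<le> C * (nx bb V * nx bb W)"
proof -
  obtain C where C: "C < \<top>" "\<And>G H. G \<in> borel_measurable borel \<Longrightarrow> H \<in> borel_measurable borel \<Longrightarrow>
    (\<integral>\<^sup>+z. (ennreal (xweight s1 s2 bp z) * (ennreal \<bar>xi z\<bar> * absbil G H z))\<^sup>2 \<partial>lborel) \<le> C * (nx bb G * nx bb H)"
    by (rule absbil_estimate) blast
  show ?thesis
  proof (rule that[OF C(1)])
    fix V W :: "freq \<Rightarrow> complex"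
    assume m: "V \<in> borel_measurable borel" "W \<in> borel_measurable borel"
    have "nx bp (Nl V W) \<le> (\<integral>\<^sup>+z. (ennreal (xweight s1 s2 bp z) * (ennreal \<bar>xi z\<bar> * absbil V W z))\<^sup>2 \<partial>lborel)"
      unfolding nx_alt by (intro nn_integral_mono power_mono mult_left_mono norm_Nl_le m) auto
    also note C(2)[OF m]
    finally show "nx bp (Nl V W) \<le> C * (nx bb V * nx bb W)" .
  qed
qed

lemma op_estimate:
  obtains K where "K < \<top>" "\<And>T V W. 0 < T \<Longrightarrow> T \<le> 1 \<Longrightarrow> V \<in> borel_measurable borel \<Longrightarrow> W \<in> borel_measurable borel \<Longrightarrow>
    nx bb (Duh T (Nl V W)) \<le> K * ennreal (T powr (2 * \<epsilon>)) * (nx bb V * nx bb W)"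
proof -
  obtain C where C: "C < \<top>" "\<And>T N. 0 < T \<Longrightarrow> T \<le> 1 \<Longrightarrow> N \<in> borel_measurable borel \<Longrightarrow>
    nx bb (Duh T N) \<le> C * ennreal (T powr (2 * \<epsilon>)) * nx bp N" by (rule Duh_estimate) blast
  obtain D where D: "D < \<top>" "\<And>V W. V \<in> borel_measurable borel \<Longrightarrow> W \<in> borel_measurable borel \<Longrightarrow>
    nx bp (Nl V W) \<le> D * (nx bb V * nx bb W)" by (rule nx_Nl_estimate) blast
  show ?thesis
  proof (rule that[of "C * D"])
    show "C * D < \<top>" using C D by (simp add: ennreal_mult_less_top)
    fix T :: real and V W :: "freq \<Rightarrow> complex"
    assume T: "0 < T" "T \<le> 1" and m [measurable]: "V \<in> borel_measurable borel" "W \<in> borel_measurable borel"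
    have "nx bb (Duh T (Nl V W)) \<le> C * ennreal (T powr (2 * \<epsilon>)) * nx bp (Nl V W)" by (rule C(2)[OF T]) measurable
    also have "\<dots> \<le> C * ennreal (T powr (2 * \<epsilon>)) * (D * (nx bb V * nx bb W))" by (intro mult_left_mono D m) auto
    finally show "nx bb (Duh T (Nl V W)) \<le> C * D * ennreal (T powr (2 * \<epsilon>)) * (nx bb V * nx bb W)" by (simp only: ac_simps)
  qed
qed

text \<open>Free evolution, cut off at time scale 1 and not \<open>T\<close>: the bound then does
  not depend on \<open>T\<close>, and the plateau still covers \<open>[0,T]\<close> for
  \<open>T \<le> 1\<close>.\<close>

definition Lin :: "(real \<times> real \<Rightarrow> complex) \<Rightarrow> freq \<Rightarrow> complex" where
  "Lin u z = u (fst z) * complex_of_real (cutT 1 (sg z))"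

lemma Lin_measurable [measurable]:
  assumes [measurable]: "u \<in> borel_measurable borel"
  shows "Lin u \<in> borel_measurable borel"
  unfolding Lin_def[abs_def] by measurable

lemma Lin_estimate:
  obtains C where "C < \<top>" "\<And>u. u \<in> borel_measurable borel \<Longrightarrow> nx bb (Lin u) \<le> C * nh u"
proof -
  define C where "C = ennreal 576 * jbint 2"
  show ?thesis
  proof (rule that[of C])
    show "C < \<top>" unfolding C_def using jbint_finite[of 2] by (simp add: ennreal_mult_less_top)
    fix u :: "real \<times> real \<Rightarrow> complex" assume [measurable]: "u \<in> borel_measurable borel"
    have hw: "0 \<le> hweight s1 s2 p" for p unfolding hweight_def by simp
    have "nx bb (Lin u) = (\<integral>\<^sup>+p. (ennreal (hweight s1 s2 p))\<^sup>2 * (\<integral>\<^sup>+\<sigma>. (ennreal (jb \<sigma> powr bb) * ennreal (cmod (Lin u (p, \<sigma> - phase p))))\<^sup>2 \<partial>lborel) \<partial>lborel)"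
      by (rule nn_integral_weighted) measurable
    also have "\<dots> \<le> (\<integral>\<^sup>+p. C * ennreal ((hweight s1 s2 p)\<^sup>2 * (cmod (u p))\<^sup>2) \<partial>lborel)"
    proof (rule nn_integral_mono)
      fix p
      have "(\<integral>\<^sup>+\<sigma>. (ennreal (jb \<sigma> powr bb) * ennreal (cmod (Lin u (p, \<sigma> - phase p))))\<^sup>2 \<partial>lborel) \<le> (\<integral>\<^sup>+\<sigma>. (ennreal (cmod (u p)))\<^sup>2 * (ennreal 576 * ennreal (jb \<sigma> powr - 2)) \<partial>lborel)"
      proof (rule nn_integral_mono)
        fix \<sigma> :: real
        have "cmod (Lin u (p, \<sigma> - phase p)) = cmod (u p) * \<bar>fcut \<sigma>\<bar>"
          unfolding Lin_def sg_def cutT_def by (simp add: norm_mult)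
        also have "\<dots> \<le> cmod (u p) * (24 * jb \<sigma> powr - 2)"
          using abs_cut_le[of \<sigma>] jb_pos[of \<sigma>] by (intro mult_left_mono) (auto simp: powr_minus field_simps)
        finally have "jb \<sigma> powr bb * cmod (Lin u (p, \<sigma> - phase p)) \<le> jb \<sigma> powr 1 * (cmod (u p) * (24 * jb \<sigma> powr - 2))"
          using e64 by (intro mult_mono jb_powr_expo_mono) (auto simp: bb_def)
        also have "\<dots> = cmod (u p) * (24 * (jb \<sigma> powr 1 * jb \<sigma> powr - 2))" by (simp only: ac_simps)
        also have "jb \<sigma> powr 1 * jb \<sigma> powr - 2 = jb \<sigma> powr - 1" unfolding powr_add[symmetric] by simp
        finally have "(jb \<sigma> powr bb * cmod (Lin u (p, \<sigma> - phase p)))\<^sup>2 \<le> (cmod (u p) * (24 * jb \<sigma> powr - 1))\<^sup>2"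
          by (intro power_mono) auto
        also have "\<dots> = (cmod (u p))\<^sup>2 * (576 * (jb \<sigma> powr - 1 * jb \<sigma> powr - 1))" by (simp add: power2_eq_square)
        also have "jb \<sigma> powr - 1 * jb \<sigma> powr - 1 = jb \<sigma> powr - 2" unfolding powr_add[symmetric] by simp
        finally have "ennreal ((jb \<sigma> powr bb * cmod (Lin u (p, \<sigma> - phase p)))\<^sup>2) \<le> ennreal ((cmod (u p))\<^sup>2 * (576 * jb \<sigma> powr - 2))" by (rule ennreal_leI)
        then show "(ennreal (jb \<sigma> powr bb) * ennreal (cmod (Lin u (p, \<sigma> - phase p))))\<^sup>2 \<le> (ennreal (cmod (u p)))\<^sup>2 * (ennreal 576 * ennreal (jb \<sigma> powr - 2))"
          by (simp add: ennreal_mult ennreal_power[symmetric])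
      qed
      also have "\<dots> = (ennreal (cmod (u p)))\<^sup>2 * C" unfolding C_def jbint_def by (simp add: nn_integral_cmult)
      finally have "(ennreal (hweight s1 s2 p))\<^sup>2 * (\<integral>\<^sup>+\<sigma>. (ennreal (jb \<sigma> powr bb) * ennreal (cmod (Lin u (p, \<sigma> - phase p))))\<^sup>2 \<partial>lborel)
        \<le> (ennreal (hweight s1 s2 p))\<^sup>2 * ((ennreal (cmod (u p)))\<^sup>2 * C)" by (rule mult_left_mono) simp
      also have "\<dots> = C * ennreal ((hweight s1 s2 p)\<^sup>2 * (cmod (u p))\<^sup>2)" using hw by (simp add: ennreal_mult ennreal_power ac_simps)
      finally show "(ennreal (hweight s1 s2 p))\<^sup>2 * (\<integral>\<^sup>+\<sigma>. (ennreal (jb \<sigma> powr bb) * ennreal (cmod (Lin u (p, \<sigma> - phase p))))\<^sup>2 \<partial>lborel)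
        \<le> C * ennreal ((hweight s1 s2 p)\<^sup>2 * (cmod (u p))\<^sup>2)" .
    qed
    also have "\<dots> = C * nh u" unfolding nh_def by (rule nn_integral_cmult) measurable
    finally show "nx bb (Lin u) \<le> C * nh u" .
  qed
qed

end

section \<open>Restriction to fixed times\<close>

lemma hweight_pos: "0 < hweight s1 s2 p"
proof -
  have "0 < jb u powr q" for u q using jb_pos[of u] by simp
  then show ?thesis unfolding hweight_def by (intro mult_pos_pos)
qed

lemma tker_measurable [measurable (raw)]:
  assumes [measurable]: "f \<in> borel_measurable M"
  shows "(\<lambda>x. tker t (f x)) \<in> borel_measurable M"
  unfolding tker_def by measurable

lemma norm_tker_le: "norm (tker t \<sigma>) \<le> (\<bar>t\<bar> + 2) * jb \<sigma> powr - 1"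
proof -
  have "norm (tker t \<sigma>) * jb \<sigma> \<le> \<bar>t\<bar> + 2"
  proof (cases "\<sigma> = 0")
    case True then show ?thesis by (simp add: tker_def jb_def)
  next
    case False
    have n: "norm (tker t \<sigma>) = cmod (exp (\<i> * complex_of_real (t * \<sigma>)) - 1) / \<bar>\<sigma>\<bar>"
      using False unfolding tker_def by (simp add: norm_divide norm_mult)
    have "cmod (exp (\<i> * complex_of_real (t * \<sigma>)) - 1) \<le> \<bar>t * \<sigma>\<bar>"
      using iexp_approx1[of "t * \<sigma>" 0] by simp
    then have 1: "norm (tker t \<sigma>) \<le> \<bar>t\<bar>" unfolding n using False by (simp add: divide_le_eq abs_mult)
    have "cmod (exp (\<i> * complex_of_real (t * \<sigma>)) - 1) \<le> cmod (exp (\<i> * complex_of_real (t * \<sigma>))) + cmod 1" by (rule norm_triangle_ineq4)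
    then have "norm (tker t \<sigma>) * \<bar>\<sigma>\<bar> \<le> 2" unfolding n using False by simp
    then show ?thesis using 1 unfolding jb_def by (simp add: distrib_left)
  qed
  then show ?thesis using jb_pos[of \<sigma>] by (simp add: powr_minus field_simps)
qed

lemma AE_lborel_fst:
  fixes P :: "'a::euclidean_space \<Rightarrow> bool"
  assumes "AE x in lborel. P x"
  shows "AE z in (lborel :: ('a \<times> 'b::euclidean_space) measure). P (fst z)"
proof -
  obtain N where N: "{x \<in> space lborel. \<not> P x} \<subseteq> N" "N \<in> null_sets lborel" using assms by (auto elim!: AE_E simp: null_sets_def)
  have "N \<times> (UNIV :: 'b set) \<in> null_sets (lborel \<Otimes>\<^sub>M lborel)"
    using N(2) lborel.emeasure_pair_measure_Times[of N lborel "UNIV :: 'b set"] by (auto simp: null_sets_def)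
  then show ?thesis unfolding lborel_prod using N(1) by (intro AE_I'[of "N \<times> UNIV"]) auto
qed

lemma AE_lborel_pair:
  fixes P :: "'a::euclidean_space \<times> 'b::euclidean_space \<Rightarrow> bool"
  assumes "AE z in lborel. P z"
  shows "AE x in lborel. AE y in lborel. P (x, y)"
  using assms unfolding lborel_prod[symmetric] by (rule lborel_pair.AE_pair)

lemma AE_lborel_reflect:
  fixes P :: "'a::euclidean_space \<Rightarrow> bool"
  assumes "AE x in lborel. P x"
  shows "AE x in lborel. P (c - x)"
proof -
  have d: "distr lborel borel (\<lambda>x::'a. c - x) = lborel"
  proof -
    have "distr lborel borel (\<lambda>x::'a. c - x) = distr (distr lborel borel uminus) borel ((+) c)"
      by (subst distr_distr) (auto simp: comp_def)
    then show ?thesis unfolding lborel_distr_uminus_euclidean lborel_distr_plus .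
  qed
  obtain N where N: "{x \<in> space lborel. \<not> P x} \<subseteq> N" "N \<in> null_sets lborel" using assms by (auto elim!: AE_E simp: null_sets_def)
  then have "AE x in distr lborel borel (\<lambda>x::'a. c - x). x \<notin> N" unfolding d by (simp add: AE_not_in)
  then have "AE x in lborel. c - x \<notin> N" using N(2) by (subst (asm) AE_distr_iff) (auto simp: null_sets_def)
  then show ?thesis by eventually_elim (use N in auto)
qed

context kp_params
begin

text \<open>\<open>q = 0\<close> controls the inverse transform in time at fixed \<open>p\<close>;
  \<open>q = 1\<close> controls the Duhamel integral, whose kernel \<open>tker\<close> decays like
  the inverse of the modulation.\<close>

definition slice :: "real \<Rightarrow> (freq \<Rightarrow> ennreal) \<Rightarrow> real \<times> real \<Rightarrow> ennreal" where
  "slice q f p = (\<integral>\<^sup>+t. f (p, t) * ennreal (jb (t + phase p) powr - q) \<partial>lborel)"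

lemma slice_measurable [measurable]:
  assumes [measurable]: "f \<in> borel_measurable borel"
  shows "slice q f \<in> borel_measurable borel"
  unfolding slice_def[abs_def] by measurable

text \<open>Cauchy-Schwarz in \<open>t\<close> against
  \<open>jb (t + phase p) powr - (b + q)\<close>, useful when \<open>b + q > 1/2\<close>. The
  applications with \<open>bb\<close> and \<open>q = 0\<close>, and with \<open>bp\<close> and
  \<open>q = 1\<close>, exceed 1/2 by \<epsilon> and \<open>2 * \<epsilon>\<close>.\<close>

lemma slice_estimate:
  assumes [measurable]: "f \<in> borel_measurable borel"
  shows "(\<integral>\<^sup>+p. (ennreal (hweight s1 s2 p) * slice q f p)\<^sup>2 \<partial>lborel) \<le>
    jbint (2 * (b + q)) * (\<integral>\<^sup>+z. (ennreal (xweight s1 s2 b z) * f z)\<^sup>2 \<partial>lborel)"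
proof -
  have hw: "0 \<le> hweight s1 s2 p" for p unfolding hweight_def by simp
  have "(ennreal (hweight s1 s2 p) * slice q f p)\<^sup>2 \<le> jbint (2 * (b + q)) * (\<integral>\<^sup>+t. (ennreal (xweight s1 s2 b (p, t)) * f (p, t))\<^sup>2 \<partial>lborel)" for p
  proof -
    have "ennreal (hweight s1 s2 p) * slice q f p = (\<integral>\<^sup>+t. ennreal (hweight s1 s2 p) * (f (p, t) * ennreal (jb (t + phase p) powr - q)) \<partial>lborel)"
      unfolding slice_def by (rule nn_integral_cmult[symmetric]) measurable
    also have "\<dots> = (\<integral>\<^sup>+t. ennreal (jb (t + phase p) powr - (b + q)) * (ennreal (xweight s1 s2 b (p, t)) * f (p, t)) \<partial>lborel)"
    proof (rule nn_integral_cong)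
      fix t
      have "jb (t + phase p) powr - q = jb (t + phase p) powr - (b + q) * jb (t + phase p) powr b" by (simp add: powr_add[symmetric])
      then have "ennreal (jb (t + phase p) powr - q) = ennreal (jb (t + phase p) powr - (b + q)) * ennreal (jb (t + phase p) powr b)"
        by (simp add: ennreal_mult)
      moreover have "ennreal (xweight s1 s2 b (p, t)) = ennreal (hweight s1 s2 p) * ennreal (jb (t + phase p) powr b)"
        unfolding xweight_def using hw by (simp add: ennreal_mult)
      ultimately show "ennreal (hweight s1 s2 p) * (f (p, t) * ennreal (jb (t + phase p) powr - q)) =
         ennreal (jb (t + phase p) powr - (b + q)) * (ennreal (xweight s1 s2 b (p, t)) * f (p, t))" by (simp only: ac_simps)
    qed
    finally have "(ennreal (hweight s1 s2 p) * slice q f p)\<^sup>2 \<le> (\<integral>\<^sup>+t. (ennreal (jb (t + phase p) powr - (b + q)))\<^sup>2 \<partial>lborel) * (\<integral>\<^sup>+t. (ennreal (xweight s1 s2 b (p, t)) * f (p, t))\<^sup>2 \<partial>lborel)"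
      by (simp only:) (rule Cauchy_Schwarz_nn_integral, measurable)
    also have "(\<integral>\<^sup>+t. (ennreal (jb (t + phase p) powr - (b + q)))\<^sup>2 \<partial>lborel) = (\<integral>\<^sup>+t. ennreal (jb (t + phase p) powr - (2 * (b + q))) \<partial>lborel)"
      by (simp add: power2_eq_square ennreal_mult[symmetric] powr_add[symmetric] algebra_simps)
    also have "\<dots> = jbint (2 * (b + q))" by (rule nn_integral_jb_translate')
    finally show ?thesis .
  qed
  then have "(\<integral>\<^sup>+p. (ennreal (hweight s1 s2 p) * slice q f p)\<^sup>2 \<partial>lborel) \<le>
    (\<integral>\<^sup>+p. jbint (2 * (b + q)) * (\<integral>\<^sup>+t. (ennreal (xweight s1 s2 b (p, t)) * f (p, t))\<^sup>2 \<partial>lborel) \<partial>lborel)" by (rule nn_integral_mono)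
  also have "\<dots> = jbint (2 * (b + q)) * (\<integral>\<^sup>+p. \<integral>\<^sup>+t. (ennreal (xweight s1 s2 b (p, t)) * f (p, t))\<^sup>2 \<partial>lborel \<partial>lborel)"
    by (rule nn_integral_cmult) measurable
  also have "(\<integral>\<^sup>+p. \<integral>\<^sup>+t. (ennreal (xweight s1 s2 b (p, t)) * f (p, t))\<^sup>2 \<partial>lborel \<partial>lborel) = (\<integral>\<^sup>+z. (ennreal (xweight s1 s2 b z) * f z)\<^sup>2 \<partial>lborel)"
    by (rule nn_integral_lborel_pair[symmetric]) measurable
  finally show ?thesis .
qed

lemma slice_finite_AE:
  assumes [measurable]: "f \<in> borel_measurable borel" and fin: "(\<integral>\<^sup>+z. (ennreal (xweight s1 s2 b z) * f z)\<^sup>2 \<partial>lborel) < \<top>" and q: "b + q > 1/2"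
  shows "AE p in lborel. slice q f p < \<top>"
proof -
  have "(\<integral>\<^sup>+p. (ennreal (hweight s1 s2 p) * slice q f p)\<^sup>2 \<partial>lborel) < \<top>"
    by (rule le_less_trans[OF slice_estimate[of f q b]]) (use fin jbint_finite[of "2 * (b + q)"] q in \<open>auto simp: ennreal_mult_less_top\<close>)
  then have "AE p in lborel. (ennreal (hweight s1 s2 p) * slice q f p)\<^sup>2 \<noteq> \<infinity>"
    by (intro nn_integral_PInf_AE) auto
  then show ?thesis
  proof eventually_elim
    case (elim p)
    show ?case
    proof (rule ccontr)
      assume "\<not> slice q f p < \<top>"
      then have "slice q f p = \<top>" by (simp add: less_top[symmetric])
      then show False using elim hweight_pos[of s1 s2 p] by (simp add: ennreal_mult_top power2_eq_square ennreal_mult_eq_top_iff)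
    qed
  qed
qed

lemma slice_norm_finite_AE:
  assumes [measurable]: "G \<in> borel_measurable borel" and "nx b G < \<top>" "b + q > 1/2"
  shows "AE p in lborel. slice q (\<lambda>z. ennreal (cmod (G z))) p < \<top>"
  using assms unfolding nx_alt by (intro slice_finite_AE) auto

lemma integrable_slice:
  assumes [measurable]: "G \<in> borel_measurable borel" and "slice 0 (\<lambda>z. ennreal (cmod (G z))) p < \<top>"
  shows "integrable lborel (\<lambda>t. G (p, t))"
proof (rule integrableI_bounded)
  have "jb x \<noteq> 0" for x using jb_pos[of x] by simp
  then show "(\<integral>\<^sup>+t. ennreal (norm (G (p, t))) \<partial>lborel) < \<infinity>" using assms(2) unfolding slice_def by simp
qed measurable

lemma integrable_slice_AE:
  assumes [measurable]: "G \<in> borel_measurable borel" and "nx bb G < \<top>"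
  shows "AE p in lborel. integrable lborel (\<lambda>t. G (p, t))"
proof -
  have "AE p in lborel. slice 0 (\<lambda>z. ennreal (cmod (G z))) p < \<top>"
    by (rule slice_norm_finite_AE[OF _ assms(2)]) (use e0 in \<open>auto simp: bb_def\<close>)
  then show ?thesis by eventually_elim (rule integrable_slice, auto)
qed

lemma integrable_tker:
  assumes [measurable]: "N \<in> borel_measurable borel" and f: "slice 1 (\<lambda>z. ennreal (cmod (N z))) p < \<top>"
  shows "integrable lborel (\<lambda>\<tau>. N (p, \<tau>) * tker t (\<tau> + phase p))"
proof (rule integrableI_bounded)
  have "(\<integral>\<^sup>+\<tau>. ennreal (norm (N (p, \<tau>) * tker t (\<tau> + phase p))) \<partial>lborel) \<le>
    (\<integral>\<^sup>+\<tau>. ennreal (\<bar>t\<bar> + 2) * (ennreal (cmod (N (p, \<tau>))) * ennreal (jb (\<tau> + phase p) powr - 1)) \<partial>lborel)"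
  proof (rule nn_integral_mono)
    fix \<tau>
    have "norm (N (p, \<tau>) * tker t (\<tau> + phase p)) \<le> cmod (N (p, \<tau>)) * ((\<bar>t\<bar> + 2) * jb (\<tau> + phase p) powr - 1)"
      unfolding norm_mult by (intro mult_left_mono norm_tker_le) auto
    then have "ennreal (norm (N (p, \<tau>) * tker t (\<tau> + phase p))) \<le> ennreal (cmod (N (p, \<tau>)) * ((\<bar>t\<bar> + 2) * jb (\<tau> + phase p) powr - 1))" by (rule ennreal_leI)
    also have "\<dots> = ennreal (\<bar>t\<bar> + 2) * (ennreal (cmod (N (p, \<tau>))) * ennreal (jb (\<tau> + phase p) powr - 1))"
      by (subst ennreal_mult, simp, simp, subst ennreal_mult, simp, simp) (simp only: ac_simps)
    finally show "ennreal (norm (N (p, \<tau>) * tker t (\<tau> + phase p))) \<le> ennreal (\<bar>t\<bar> + 2) * (ennreal (cmod (N (p, \<tau>))) * ennreal (jb (\<tau> + phase p) powr - 1))" .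
  qed
  also have "\<dots> = ennreal (\<bar>t\<bar> + 2) * slice 1 (\<lambda>z. ennreal (cmod (N z))) p" unfolding slice_def by (rule nn_integral_cmult) measurable
  also have "\<dots> < \<infinity>" using f by (simp add: ennreal_mult_less_top)
  finally show "(\<integral>\<^sup>+\<tau>. ennreal (norm (N (p, \<tau>) * tker t (\<tau> + phase p))) \<partial>lborel) < \<infinity>" .
qed measurable

lemma slice_bp_AE:
  assumes [measurable]: "N \<in> borel_measurable borel" and "nx bp N < \<top>"
  shows "AE p in lborel. slice 1 (\<lambda>z. ennreal (cmod (N z))) p < \<top>"
  by (rule slice_norm_finite_AE[OF _ assms(2)]) (use e0 in \<open>auto simp: bp_def\<close>)

text \<open>Because \<open>bb > 1/2\<close>, the constant is finite: this is the embedding into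
  functions of time with values in the Sobolev space, uniform in \<open>t\<close>.\<close>

lemma nh_time_repr_le:
  assumes [measurable]: "G \<in> borel_measurable borel"
  shows "nh (\<lambda>p. time_repr G p t) \<le> jbint (2 * bb) * nx bb G"
proof -
  have "nh (\<lambda>p. time_repr G p t) \<le> (\<integral>\<^sup>+p. (ennreal (hweight s1 s2 p) * slice 0 (\<lambda>z. ennreal (cmod (G z))) p)\<^sup>2 \<partial>lborel)"
    unfolding nh_def
  proof (rule nn_integral_mono)
    fix p
    have nz: "jb x \<noteq> 0" for x using jb_pos[of x] by simp
    have "ennreal (cmod (\<integral>\<tau>. exp (\<i> * complex_of_real (t * \<tau>)) * G (p, \<tau>) \<partial>lborel)) \<le> (\<integral>\<^sup>+\<tau>. ennreal (cmod (exp (\<i> * complex_of_real (t * \<tau>)) * G (p, \<tau>))) \<partial>lborel)"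
    proof (cases "integrable lborel (\<lambda>\<tau>. exp (\<i> * complex_of_real (t * \<tau>)) * G (p, \<tau>))")
      case True then show ?thesis by (rule integral_norm_bound_ennreal)
    qed (simp add: not_integrable_integral_eq)
    also have "\<dots> = slice 0 (\<lambda>z. ennreal (cmod (G z))) p" unfolding slice_def using nz by (simp add: norm_mult)
    finally have 1: "ennreal (cmod (\<integral>\<tau>. exp (\<i> * complex_of_real (t * \<tau>)) * G (p, \<tau>) \<partial>lborel)) \<le> slice 0 (\<lambda>z. ennreal (cmod (G z))) p" .
    have "cmod (time_repr G p t) = cmod (\<integral>\<tau>. exp (\<i> * complex_of_real (t * \<tau>)) * G (p, \<tau>) \<partial>lborel) / (2 * pi)"
      unfolding time_repr_def norm_divide norm_of_real using pi_gt_zero by simp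
    also have "\<dots> \<le> cmod (\<integral>\<tau>. exp (\<i> * complex_of_real (t * \<tau>)) * G (p, \<tau>) \<partial>lborel) / 1" using pi_ge_two by (intro divide_left_mono) auto
    finally have "ennreal (cmod (time_repr G p t)) \<le> slice 0 (\<lambda>z. ennreal (cmod (G z))) p" using 1 by (simp add: order_trans[OF ennreal_leI])
    then have "(ennreal (hweight s1 s2 p) * ennreal (cmod (time_repr G p t)))\<^sup>2 \<le> (ennreal (hweight s1 s2 p) * slice 0 (\<lambda>z. ennreal (cmod (G z))) p)\<^sup>2"
      by (intro power_mono mult_left_mono) auto
    then show "ennreal ((hweight s1 s2 p)\<^sup>2 * (cmod (time_repr G p t))\<^sup>2) \<le> (ennreal (hweight s1 s2 p) * slice 0 (\<lambda>z. ennreal (cmod (G z))) p)\<^sup>2"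
      using hweight_pos[of s1 s2 p] by (simp add: ennreal_mult[symmetric] ennreal_power power_mult_distrib less_imp_le)
  qed
  also have "\<dots> \<le> jbint (2 * (bb + 0)) * (\<integral>\<^sup>+z. (ennreal (xweight s1 s2 bb z) * ennreal (cmod (G z)))\<^sup>2 \<partial>lborel)"
    by (rule slice_estimate) measurable
  finally show ?thesis unfolding nx_alt by simp
qed

lemma time_repr_measurable [measurable]:
  assumes [measurable]: "G \<in> borel_measurable borel"
  shows "(\<lambda>p. time_repr G p t) \<in> borel_measurable borel"
  unfolding time_repr_def by measurable

lemma nh_zero_AE:
  assumes [measurable]: "f \<in> borel_measurable borel" and z: "nh f = 0"
  shows "AE p in lborel. f p = 0"
proof -
  have "AE p in lborel. ennreal ((hweight s1 s2 p)\<^sup>2 * (cmod (f p))\<^sup>2) = 0"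
    using z unfolding nh_def by (subst (asm) nn_integral_0_iff_AE) auto
  then show ?thesis
  proof eventually_elim
    case (elim p)
    then have "(hweight s1 s2 p)\<^sup>2 * (cmod (f p))\<^sup>2 \<le> 0" by (simp add: ennreal_eq_0_iff)
    then show ?case using hweight_pos[of s1 s2 p] by (simp add: mult_le_0_iff)
  qed
qed

lemma time_repr_Lin:
  assumes t: "\<bar>t\<bar> \<le> 1"
  shows "time_repr (Lin u) p t = exp (- \<i> * complex_of_real (t * phase p)) * u p"
proof -
  have "(\<integral>\<tau>. exp (\<i> * complex_of_real (t * \<tau>)) * Lin u (p, \<tau>) \<partial>lborel) =
    (\<integral>\<tau>. u p * (exp (\<i> * complex_of_real (t * \<tau>)) * complex_of_real (cutT 1 (\<tau> - (- phase p)))) \<partial>lborel)"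
    unfolding Lin_def sg_def by (simp add: ac_simps)
  also have "\<dots> = u p * (\<integral>\<tau>. exp (\<i> * complex_of_real (t * \<tau>)) * complex_of_real (cutT 1 (\<tau> - (- phase p))) \<partial>lborel)"
    by (rule integral_mult_right_zero)
  also have "\<dots> = u p * (exp (\<i> * complex_of_real (t * - phase p)) * complex_of_real (2 * pi))"
    using integral_exp_cutT[of 1 t "- phase p"] t by simp
  finally show ?thesis unfolding time_repr_def using pi_gt_zero by simp
qed

text \<open>One factor \<open>T\<close> is given up, using \<open>T \<le> 1\<close>, for decay in
  \<sigma> itself instead of \<open>T * \<sigma>\<close>.\<close>

lemma norm_kT_le_jb:
  assumes T: "0 < T" "T \<le> 1"
  shows "norm (kT T \<tau> \<sigma>) \<le> (200 * T) * (jb (T * (\<tau> - \<sigma>)) powr - 2 + jb (T * (\<tau> - 0)) powr - 2) * jb \<sigma> powr - 1"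
proof -
  have "T * jb \<sigma> \<le> jb (T * \<sigma>)" using T by (simp add: jb_def abs_mult algebra_simps)
  then have 1: "1 / jb (T * \<sigma>) \<le> (1 / T) * jb \<sigma> powr - 1" using T jb_pos[of \<sigma>] jb_pos[of "T * \<sigma>"] by (simp add: powr_minus field_simps)
  have sq: "1 / (jb y)\<^sup>2 = jb y powr - 2" for y :: real using jb_pos[of y] by (simp add: powr_minus field_simps)
  have "norm (kT T \<tau> \<sigma>) \<le> 200 * T\<^sup>2 * ((jb (T * (\<tau> - \<sigma>)) powr - 2 + jb (T * \<tau>) powr - 2) * (1 / jb (T * \<sigma>)))"
    using norm_kT_le[OF T(1), of \<tau> \<sigma>] unfolding sq by simp
  also have "\<dots> \<le> 200 * T\<^sup>2 * ((jb (T * (\<tau> - \<sigma>)) powr - 2 + jb (T * \<tau>) powr - 2) * ((1 / T) * jb \<sigma> powr - 1))"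
    by (intro mult_left_mono 1) auto
  also have "\<dots> = (200 * (T\<^sup>2 * (1 / T))) * (jb (T * (\<tau> - \<sigma>)) powr - 2 + jb (T * (\<tau> - 0)) powr - 2) * jb \<sigma> powr - 1" by (simp only: diff_zero ac_simps)
  also have "T\<^sup>2 * (1 / T) = T" using T by (simp add: power2_eq_square)
  finally show ?thesis .
qed

lemma norm_kT_le_const:
  assumes T: "0 < T" "T \<le> 1"
  shows "norm (kT T \<tau> \<sigma>) \<le> 400 * jb \<sigma> powr - 1"
proof -
  have "norm (kT T \<tau> \<sigma>) \<le> (200 * T) * (jb (T * (\<tau> - \<sigma>)) powr - 2 + jb (T * (\<tau> - 0)) powr - 2) * jb \<sigma> powr - 1"
    by (rule norm_kT_le_jb[OF T])
  also have "\<dots> \<le> (200 * 1) * (1 + 1) * jb \<sigma> powr - 1"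
    using T jb_powr_le_1[of "-2"] by (intro mult_right_mono mult_mono add_mono) auto
  finally show ?thesis by simp
qed

lemma integrable_kT_slice:
  assumes [measurable]: "N \<in> borel_measurable borel" and f: "slice 1 (\<lambda>z. ennreal (cmod (N z))) p < \<top>" and T: "0 < T" "T \<le> 1"
  shows "integrable lborel (\<lambda>\<rho>. N (p, \<rho>) * kT T \<sigma> (\<rho> + phase p))"
proof (rule integrableI_bounded)
  have "(\<integral>\<^sup>+\<rho>. ennreal (norm (N (p, \<rho>) * kT T \<sigma> (\<rho> + phase p))) \<partial>lborel) \<le>
    (\<integral>\<^sup>+\<rho>. ennreal 400 * (ennreal (cmod (N (p, \<rho>))) * ennreal (jb (\<rho> + phase p) powr - 1)) \<partial>lborel)"
  proof (rule nn_integral_mono)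
    fix \<rho>
    have "norm (N (p, \<rho>) * kT T \<sigma> (\<rho> + phase p)) \<le> cmod (N (p, \<rho>)) * (400 * jb (\<rho> + phase p) powr - 1)"
      unfolding norm_mult by (intro mult_left_mono norm_kT_le_const T) auto
    then have "ennreal (norm (N (p, \<rho>) * kT T \<sigma> (\<rho> + phase p))) \<le> ennreal (cmod (N (p, \<rho>)) * (400 * jb (\<rho> + phase p) powr - 1))" by (rule ennreal_leI)
    also have "\<dots> = ennreal 400 * (ennreal (cmod (N (p, \<rho>))) * ennreal (jb (\<rho> + phase p) powr - 1))"
      by (subst ennreal_mult, simp, simp, subst ennreal_mult, simp, simp) (simp only: ac_simps)
    finally show "ennreal (norm (N (p, \<rho>) * kT T \<sigma> (\<rho> + phase p))) \<le> ennreal 400 * (ennreal (cmod (N (p, \<rho>))) * ennreal (jb (\<rho> + phase p) powr - 1))" .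
  qed
  also have "\<dots> = ennreal 400 * slice 1 (\<lambda>z. ennreal (cmod (N z))) p" unfolding slice_def by (rule nn_integral_cmult) measurable
  also have "\<dots> < \<infinity>" using f by (simp add: ennreal_mult_less_top)
  finally show "(\<integral>\<^sup>+\<rho>. ennreal (norm (N (p, \<rho>) * kT T \<sigma> (\<rho> + phase p))) \<partial>lborel) < \<infinity>" .
qed measurable

text \<open>Fubini moves the inverse transform onto \<open>kT\<close>, where
  \<open>integral_exp_kT\<close> produces \<open>tker\<close>; the range
  \<open>0 \<le> t \<le> T\<close> is where the cut-off equals 1. Finiteness of the slice with
  \<open>q = 1\<close> gives absolute convergence.\<close>

lemma time_repr_Duh:
  assumes [measurable]: "N \<in> borel_measurable borel" and f: "slice 1 (\<lambda>z. ennreal (cmod (N z))) p < \<top>"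
    and T: "0 < T" "T \<le> 1" and t: "0 \<le> t" "t \<le> T"
  shows "time_repr (Duh T N) p t = exp (- \<i> * complex_of_real (t * phase p)) *
     (- (1/2) * (\<integral>\<rho>. N (p, \<rho>) * tker t (\<rho> + phase p) \<partial>lborel) / complex_of_real (2 * pi))"
proof -
  let ?e = "\<lambda>\<tau>. exp (\<i> * complex_of_real (t * \<tau>))"
  let ?f = "\<lambda>\<rho> \<tau>. ?e \<tau> * (N (p, \<rho>) * kT T (\<tau> + phase p) (\<rho> + phase p))"
  have int: "integrable (lborel \<Otimes>\<^sub>M lborel) (\<lambda>(\<rho>, \<tau>). ?f \<rho> \<tau>)"
  proof (rule integrableI_bounded)
    have "(\<integral>\<^sup>+x. ennreal (norm (case x of (\<rho>, \<tau>) \<Rightarrow> ?f \<rho> \<tau>)) \<partial>(lborel \<Otimes>\<^sub>M lborel)) =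
      (\<integral>\<^sup>+\<rho>. \<integral>\<^sup>+\<tau>. ennreal (norm (?f \<rho> \<tau>)) \<partial>lborel \<partial>lborel)"
      by (subst lborel.nn_integral_fst[symmetric]) (auto simp: split_beta)
    also have "\<dots> \<le> (\<integral>\<^sup>+\<rho>. ennreal (cmod (N (p, \<rho>))) * ennreal (jb (\<rho> + phase p) powr - 1) * (ennreal (200 * T) * (ennreal (1 / T) * jbint 2 + ennreal (1 / T) * jbint 2)) \<partial>lborel)"
    proof (rule nn_integral_mono)
      fix \<rho>
      define \<sigma> where "\<sigma> = \<rho> + phase p"
      have "(\<integral>\<^sup>+\<tau>. ennreal (norm (?f \<rho> \<tau>)) \<partial>lborel) = (\<integral>\<^sup>+\<tau>. ennreal (cmod (N (p, \<rho>))) * ennreal (norm (kT T (phase p + \<tau>) \<sigma>)) \<partial>lborel)"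
        unfolding \<sigma>_def by (simp add: norm_mult ennreal_mult add.commute)
      also have "\<dots> = ennreal (cmod (N (p, \<rho>))) * (\<integral>\<^sup>+\<tau>. ennreal (norm (kT T (phase p + \<tau>) \<sigma>)) \<partial>lborel)"
        by (rule nn_integral_cmult) measurable
      also have "(\<integral>\<^sup>+\<tau>. ennreal (norm (kT T (phase p + \<tau>) \<sigma>)) \<partial>lborel) = (\<integral>\<^sup>+\<tau>. ennreal (norm (kT T \<tau> \<sigma>)) \<partial>lborel)"
        by (rule nn_integral_lborel_translate[where f="\<lambda>\<tau>. ennreal (norm (kT T \<tau> \<sigma>))"]) measurable
      also have "\<dots> \<le> (\<integral>\<^sup>+\<tau>. ennreal (jb \<sigma> powr - 1) * (ennreal (200 * T) * (ennreal (jb (T * (\<tau> - \<sigma>)) powr - 2) + ennreal (jb (T * (\<tau> - 0)) powr - 2))) \<partial>lborel)"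
      proof (rule nn_integral_mono)
        fix \<tau>
        have "ennreal (norm (kT T \<tau> \<sigma>)) \<le> ennreal ((200 * T) * (jb (T * (\<tau> - \<sigma>)) powr - 2 + jb (T * (\<tau> - 0)) powr - 2) * jb \<sigma> powr - 1)"
          by (intro ennreal_leI norm_kT_le_jb T)
        also have "\<dots> = ennreal (jb \<sigma> powr - 1) * (ennreal (200 * T) * (ennreal (jb (T * (\<tau> - \<sigma>)) powr - 2) + ennreal (jb (T * (\<tau> - 0)) powr - 2)))"
          using T by (subst ennreal_mult, simp, simp, subst ennreal_mult, simp, simp, subst ennreal_plus, simp, simp) (simp only: ac_simps)
        finally show "ennreal (norm (kT T \<tau> \<sigma>)) \<le> ennreal (jb \<sigma> powr - 1) * (ennreal (200 * T) * (ennreal (jb (T * (\<tau> - \<sigma>)) powr - 2) + ennreal (jb (T * (\<tau> - 0)) powr - 2)))" .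
      qed
      also have "\<dots> = ennreal (jb \<sigma> powr - 1) * (ennreal (200 * T) * ((\<integral>\<^sup>+\<tau>. ennreal (jb (T * (\<tau> - \<sigma>)) powr - 2) \<partial>lborel) + (\<integral>\<^sup>+\<tau>. ennreal (jb (T * (\<tau> - 0)) powr - 2) \<partial>lborel)))"
        by (subst nn_integral_cmult, measurable, subst nn_integral_cmult, measurable, subst nn_integral_add) auto
      also have "\<dots> = ennreal (jb \<sigma> powr - 1) * (ennreal (200 * T) * (ennreal (1 / T) * jbint 2 + ennreal (1 / T) * jbint 2))"
        unfolding nn_integral_jb_scale[OF T(1)] ..
      finally show "(\<integral>\<^sup>+\<tau>. ennreal (norm (?f \<rho> \<tau>)) \<partial>lborel) \<le> ennreal (cmod (N (p, \<rho>))) * ennreal (jb (\<rho> + phase p) powr - 1) * (ennreal (200 * T) * (ennreal (1 / T) * jbint 2 + ennreal (1 / T) * jbint 2))"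
        unfolding \<sigma>_def by (simp add: mult.assoc mult_left_mono)
    qed
    also have "\<dots> = slice 1 (\<lambda>z. ennreal (cmod (N z))) p * (ennreal (200 * T) * (ennreal (1 / T) * jbint 2 + ennreal (1 / T) * jbint 2))"
      unfolding slice_def by (rule nn_integral_multc) measurable
    also have "\<dots> < \<infinity>" using f jbint_finite[of 2] by (simp add: ennreal_mult_less_top)
    finally show "(\<integral>\<^sup>+x. ennreal (norm (case x of (\<rho>, \<tau>) \<Rightarrow> ?f \<rho> \<tau>)) \<partial>(lborel \<Otimes>\<^sub>M lborel)) < \<infinity>" .
  qed measurable
  have fr: "(\<integral>\<rho>. ?f \<rho> \<tau> \<partial>lborel) = ?e \<tau> * (\<integral>\<rho>. N (p, \<rho>) * kT T (\<tau> + phase p) (\<rho> + phase p) \<partial>lborel)" for \<tau>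
    by (rule integral_mult_right_zero)
  have "(\<integral>\<tau>. ?e \<tau> * Duh T N (p, \<tau>) \<partial>lborel) = (\<integral>\<tau>. - (1 / complex_of_real (4 * pi)) * (\<integral>\<rho>. ?f \<rho> \<tau> \<partial>lborel) \<partial>lborel)"
    unfolding fr by (intro Bochner_Integration.integral_cong refl) (simp add: Duh_def sg_def)
  also have "\<dots> = - (1 / complex_of_real (4 * pi)) * (\<integral>\<tau>. \<integral>\<rho>. ?f \<rho> \<tau> \<partial>lborel \<partial>lborel)" by (rule integral_mult_right_zero)
  also have "(\<integral>\<tau>. \<integral>\<rho>. ?f \<rho> \<tau> \<partial>lborel \<partial>lborel) = (\<integral>\<rho>. \<integral>\<tau>. ?f \<rho> \<tau> \<partial>lborel \<partial>lborel)"
    by (rule lborel_pair.Fubini_integral[OF int])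
  also have "\<dots> = (\<integral>\<rho>. (exp (- \<i> * complex_of_real (t * phase p)) * complex_of_real (2 * pi)) * (N (p, \<rho>) * tker t (\<rho> + phase p)) \<partial>lborel)"
  proof (rule integral_cong_AE)
    have "AE \<rho> in lborel. \<rho> \<noteq> - phase p" by (rule AE_lborel_singleton)
    then show "AE \<rho> in lborel. (\<integral>\<tau>. ?f \<rho> \<tau> \<partial>lborel) = (exp (- \<i> * complex_of_real (t * phase p)) * complex_of_real (2 * pi)) * (N (p, \<rho>) * tker t (\<rho> + phase p))"
    proof eventually_elim
      case (elim \<rho>)
      define \<sigma> where "\<sigma> = \<rho> + phase p"
      have s0: "\<sigma> \<noteq> 0" using elim by (auto simp: \<sigma>_def add_eq_0_iff2)
      have "(\<integral>\<tau>. ?f \<rho> \<tau> \<partial>lborel) = (\<integral>\<tau>. N (p, \<rho>) * (?e \<tau> * kT T (\<tau> + phase p) \<sigma>) \<partial>lborel)" unfolding \<sigma>_def by (simp add: ac_simps)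
      also have "\<dots> = N (p, \<rho>) * (\<integral>\<tau>. ?e \<tau> * kT T (\<tau> + phase p) \<sigma> \<partial>lborel)" by (rule integral_mult_right_zero)
      \<comment> \<open>Translating \<tau> by the phase produces the free propagator.\<close>
      also have "(\<integral>\<tau>. ?e \<tau> * kT T (\<tau> + phase p) \<sigma> \<partial>lborel) = (\<integral>\<tau>. exp (- \<i> * complex_of_real (t * phase p)) * (?e \<tau> * kT T \<tau> \<sigma>) \<partial>lborel)"
      proof -
        have "(\<integral>\<tau>. ?e \<tau> * kT T (\<tau> + phase p) \<sigma> \<partial>lborel) = \<bar>1\<bar> *\<^sub>R (\<integral>\<tau>. ?e (- phase p + 1 * \<tau>) * kT T (- phase p + 1 * \<tau> + phase p) \<sigma> \<partial>lborel)"
          by (rule lborel_integral_real_affine) simp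
        also have "\<dots> = (\<integral>\<tau>. exp (- \<i> * complex_of_real (t * phase p)) * (?e \<tau> * kT T \<tau> \<sigma>) \<partial>lborel)"
        proof -
          have "?e (- phase p + 1 * \<tau>) = exp (- \<i> * complex_of_real (t * phase p)) * ?e \<tau>" for \<tau>
            unfolding exp_add[symmetric] by (simp add: algebra_simps)
          then show ?thesis by (simp add: mult.assoc)
        qed
        finally show ?thesis .
      qed
      also have "\<dots> = exp (- \<i> * complex_of_real (t * phase p)) * (\<integral>\<tau>. ?e \<tau> * kT T \<tau> \<sigma> \<partial>lborel)" by (rule integral_mult_right_zero)
      also have "\<dots> = exp (- \<i> * complex_of_real (t * phase p)) * (complex_of_real (2 * pi) * tker t \<sigma>)"
        unfolding integral_exp_kT[OF T(1) t s0] ..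
      finally show ?case unfolding \<sigma>_def by (simp only: ac_simps)
    qed
  qed measurable
  also have "\<dots> = (exp (- \<i> * complex_of_real (t * phase p)) * complex_of_real (2 * pi)) * (\<integral>\<rho>. N (p, \<rho>) * tker t (\<rho> + phase p) \<partial>lborel)"
    by (rule integral_mult_right_zero)
  finally show ?thesis unfolding time_repr_def using pi_gt_zero by simp
qed

end

section \<open>Localization in time and uniqueness\<close>

lemma integrable_lborel_pairI:
  fixes f :: "'a::euclidean_space \<times> 'b::euclidean_space \<Rightarrow> complex"
  assumes [measurable]: "f \<in> borel_measurable borel" and "(\<integral>\<^sup>+x. \<integral>\<^sup>+y. ennreal (norm (f (x, y))) \<partial>lborel \<partial>lborel) < \<top>"
  shows "integrable lborel f"
  by (rule integrableI_bounded) (use assms(2) in \<open>auto simp: nn_integral_lborel_pair\<close>)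

lemma integral_lborel_pair:
  fixes f :: "'a::euclidean_space \<times> 'b::euclidean_space \<Rightarrow> complex"
  assumes "integrable lborel f"
  shows "(\<integral>z. f z \<partial>lborel) = (\<integral>x. \<integral>y. f (x, y) \<partial>lborel \<partial>lborel)"
    and "(\<integral>z. f z \<partial>lborel) = (\<integral>y. \<integral>x. f (x, y) \<partial>lborel \<partial>lborel)"
proof -
  have i: "integrable (lborel \<Otimes>\<^sub>M lborel) f" using assms unfolding lborel_prod .
  show 1: "(\<integral>z. f z \<partial>lborel) = (\<integral>x. \<integral>y. f (x, y) \<partial>lborel \<partial>lborel)"
    using lborel_pair.integral_fst'[OF i] unfolding lborel_prod by simp
  have "integrable (lborel \<Otimes>\<^sub>M lborel) (\<lambda>(x, y). f (x, y))" using i by simp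
  from lborel_pair.Fubini_integral[OF this] 1
  show "(\<integral>z. f z \<partial>lborel) = (\<integral>y. \<integral>x. f (x, y) \<partial>lborel \<partial>lborel)" by simp
qed

lemma integral_lborel_reflect:
  fixes f :: "'a::euclidean_space \<Rightarrow> complex"
  assumes [measurable]: "f \<in> borel_measurable borel"
  shows "(\<integral>x. f (c - x) \<partial>lborel) = (\<integral>x. f x \<partial>lborel)"
proof -
  have d: "distr lborel borel (\<lambda>x::'a. c - x) = lborel"
  proof -
    have "distr lborel borel (\<lambda>x::'a. c - x) = distr (distr lborel borel uminus) borel ((+) c)"
      by (subst distr_distr) (auto simp: comp_def)
    then show ?thesis unfolding lborel_distr_uminus_euclidean lborel_distr_plus .
  qed
  have "(\<integral>x. f x \<partial>lborel) = (\<integral>x. f x \<partial>(distr lborel borel (\<lambda>x::'a. c - x)))" unfolding d ..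
  also have "\<dots> = (\<integral>x. f (c - x) \<partial>lborel)" by (rule integral_distr) auto
  finally show ?thesis ..
qed

text \<open>As a superposition of exponentials over \<open>[0,t]\<close> the kernel shows that the
  Duhamel term uses only those times.\<close>

lemma tker_eq_integral:
  assumes t: "0 \<le> t"
  shows "tker t \<sigma> = (\<integral>t'. indicator {0..t} t' *\<^sub>R exp (\<i> * complex_of_real (t' * \<sigma>)) \<partial>lborel)"
proof (cases "\<sigma> = 0")
  case True
  have "(\<integral>t'. indicator {0..t} t' *\<^sub>R (1::complex) \<partial>lborel) = complex_of_real t - complex_of_real 0"
    by (rule integral_FTC_Icc[OF t]) (auto intro!: derivative_eq_intros simp: has_vector_derivative_def scaleR_conv_of_real fun_eq_iff)
  then show ?thesis using True by (simp add: tker_def)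
next
  case False
  have "(\<integral>t'. indicator {0..t} t' *\<^sub>R exp (\<i> * complex_of_real (t' * \<sigma>)) \<partial>lborel) =
    exp (\<i> * complex_of_real (t * \<sigma>)) / (\<i> * complex_of_real \<sigma>) - exp (\<i> * complex_of_real (0 * \<sigma>)) / (\<i> * complex_of_real \<sigma>)"
  proof (rule integral_FTC_Icc[OF t])
    fix x
    have "((\<lambda>z. exp (\<i> * (z * complex_of_real \<sigma>)) / (\<i> * complex_of_real \<sigma>)) has_field_derivative exp (\<i> * (complex_of_real x * complex_of_real \<sigma>))) (at (complex_of_real x))"
    proof -
      have "- (\<i> * (e * \<i>)) = e" for e by (simp add: complex_eq_iff)
      then show ?thesis using False by (auto intro!: derivative_eq_intros)
    qed
    from has_vector_derivative_real_field[OF this]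
    show "((\<lambda>t'. exp (\<i> * complex_of_real (t' * \<sigma>)) / (\<i> * complex_of_real \<sigma>)) has_vector_derivative exp (\<i> * complex_of_real (x * \<sigma>))) (at x within {0..t})"
      by simp
    show "continuous_on {0..t} (\<lambda>t'. exp (\<i> * complex_of_real (t' * \<sigma>)))" by (intro continuous_intros)
  qed
  then show ?thesis using False by (simp add: tker_def diff_divide_distrib)
qed

context kp_params
begin

text \<open>The Duhamel term on \<open>[0,t]\<close> depends only on the restriction of the factors to \<open>[0,t]\<close>. The product is
  not absolutely convergent at fixed time, so the identity is proved after truncating the frequency
  region and then removing the truncation by dominated convergence in space-time frequency.\<close>
lemma localization:
  assumes [measurable]: "V \<in> borel_measurable borel" "W \<in> borel_measurable borel"
    and fin: "nx bb V < \<top>" "nx bb W < \<top>"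
    and van: "\<And>t. t \<in> {0..\<delta>} \<Longrightarrow> AE p in lborel. time_repr W p t = 0" and t: "t \<in> {0..\<delta>}"
  shows "AE p in lborel. (\<integral>\<rho>. Nl V W (p, \<rho>) * tker t (\<rho> + phase p) \<partial>lborel) = 0"
proof -
  let ?A = "\<lambda>z. ennreal \<bar>xi z\<bar> * absbil V W z"
  obtain C where C1: "C < \<top>" "\<And>G H. G \<in> borel_measurable borel \<Longrightarrow> H \<in> borel_measurable borel \<Longrightarrow>
    (\<integral>\<^sup>+z. (ennreal (xweight s1 s2 bp z) * (ennreal \<bar>xi z\<bar> * absbil G H z))\<^sup>2 \<partial>lborel) \<le> C * (nx bb G * nx bb H)"
    by (rule absbil_estimate) blast
  have "(\<integral>\<^sup>+z. (ennreal (xweight s1 s2 bp z) * ?A z)\<^sup>2 \<partial>lborel) \<le> C * (nx bb V * nx bb W)" by (rule C1(2)) measurable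
  also have "\<dots> < \<top>" using C1(1) fin by (simp add: ennreal_mult_less_top)
  finally have "AE p in lborel. slice 1 ?A p < \<top>"
    by (intro slice_finite_AE) (use e0 in \<open>auto simp: bp_def\<close>)
  then show ?thesis
  proof eventually_elim
    case (elim p)
    show ?case
    proof (cases "fst p = 0")
      case True
      then show ?thesis by (simp add: Nl_def)
    next
      case False
      define \<phi> where "\<phi> = phase p"
      \<comment> \<open>The Duhamel integrand in all variables at fixed \<open>p\<close>. It is
        absolutely integrable: \<open>tker\<close> supplies the modulation decay of
        \<open>slice 1\<close>, and the missing factor \<open>\<bar>fst p\<bar>\<close> is a nonzero
        constant.\<close>
      define g :: "real \<times> freq \<Rightarrow> complex" where "g x = V (snd x) * W ((p, fst x) - snd x) * tker t (fst x + \<phi>)" for x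
      have [measurable]: "g \<in> borel_measurable borel" unfolding g_def[abs_def] by measurable
      have gi: "integrable lborel g"
      proof (rule integrable_lborel_pairI)
        have "(\<integral>\<^sup>+\<rho>. \<integral>\<^sup>+w. ennreal (norm (g (\<rho>, w))) \<partial>lborel \<partial>lborel) = (\<integral>\<^sup>+\<rho>. absbil V W (p, \<rho>) * ennreal (norm (tker t (\<rho> + \<phi>))) \<partial>lborel)"
          unfolding absbil_def by (subst nn_integral_multc[symmetric]) (auto simp: g_def norm_mult ennreal_mult)
        also have "\<dots> \<le> (\<integral>\<^sup>+\<rho>. ennreal ((\<bar>t\<bar> + 2) / \<bar>fst p\<bar>) * (?A (p, \<rho>) * ennreal (jb (\<rho> + phase p) powr - 1)) \<partial>lborel)"
        proof (rule nn_integral_mono)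
          fix \<rho>
          have "ennreal (norm (tker t (\<rho> + \<phi>))) \<le> ennreal ((\<bar>t\<bar> + 2) / \<bar>fst p\<bar> * (\<bar>fst p\<bar> * jb (\<rho> + phase p) powr - 1))"
            using norm_tker_le[of t "\<rho> + \<phi>"] False unfolding \<phi>_def by (intro ennreal_leI) simp
          also have "\<dots> = ennreal ((\<bar>t\<bar> + 2) / \<bar>fst p\<bar>) * (ennreal \<bar>fst p\<bar> * ennreal (jb (\<rho> + phase p) powr - 1))"
            by (subst ennreal_mult, simp, simp, subst ennreal_mult, simp, simp) (rule refl)
          finally have "absbil V W (p, \<rho>) * ennreal (norm (tker t (\<rho> + \<phi>))) \<le> absbil V W (p, \<rho>) * (ennreal ((\<bar>t\<bar> + 2) / \<bar>fst p\<bar>) * (ennreal \<bar>fst p\<bar> * ennreal (jb (\<rho> + phase p) powr - 1)))"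
            by (rule mult_left_mono) simp
          then show "absbil V W (p, \<rho>) * ennreal (norm (tker t (\<rho> + \<phi>))) \<le> ennreal ((\<bar>t\<bar> + 2) / \<bar>fst p\<bar>) * (?A (p, \<rho>) * ennreal (jb (\<rho> + phase p) powr - 1))"
            by (simp only: fst_conv ac_simps)
        qed
        also have "\<dots> = ennreal ((\<bar>t\<bar> + 2) / \<bar>fst p\<bar>) * slice 1 ?A p" unfolding slice_def by (rule nn_integral_cmult) measurable
        also have "\<dots> < \<top>" using elim by (simp add: ennreal_mult_less_top)
        finally show "(\<integral>\<^sup>+\<rho>. \<integral>\<^sup>+w. ennreal (norm (g (\<rho>, w))) \<partial>lborel \<partial>lborel) < \<top>" .
      qed measurable
      define hw where "hw = hweight s1 s2"
      have [measurable]: "hw \<in> borel_measurable borel" unfolding hw_def by measurable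
      have hwp: "0 < hw q" for q unfolding hw_def by (rule hweight_pos)
      \<comment> \<open>On \<open>S n\<close> both weights are at least \<open>1 / n\<close>. The
        slices of \<open>V\<close> and \<open>W\<close>, known only to be square integrable with
        weight, are square integrable there without it, so the truncated convolution at
        \<open>p\<close> converges absolutely.\<close>
      define S :: "nat \<Rightarrow> freq set" where "S n = {w. 1 \<le> real n * hw (fst w) \<and> 1 \<le> real n * hw (p - fst w)}" for n
      have Sm [measurable]: "S n \<in> sets borel" for n unfolding S_def by measurable
      define h :: "nat \<Rightarrow> real \<times> freq \<Rightarrow> complex" where "h n x = indicator (S n) (snd x) *\<^sub>R (V (snd x) * W ((p, fst x) - snd x))" for n x
      have [measurable]: "h n \<in> borel_measurable borel" for n unfolding h_def[abs_def] by measurable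
      have hi: "integrable lborel (h n)" for n
      proof (rule integrable_lborel_pairI)
        define u v where "u = slice 0 (\<lambda>z. ennreal (cmod (V z)))" and "v = slice 0 (\<lambda>z. ennreal (cmod (W z)))"
        have [measurable]: "u \<in> borel_measurable borel" "v \<in> borel_measurable borel" unfolding u_def v_def by measurable
        have nz: "jb x \<noteq> 0" for x using jb_pos[of x] by simp
        define In :: "real \<times> real \<Rightarrow> ennreal" where "In q = (if 1 \<le> real n * hw q \<and> 1 \<le> real n * hw (p - q) then 1 else 0)" for q
        have [measurable]: "In \<in> borel_measurable borel" unfolding In_def[abs_def] by measurable
        have "(\<integral>\<^sup>+\<rho>. \<integral>\<^sup>+w. ennreal (norm (h n (\<rho>, w))) \<partial>lborel \<partial>lborel) = (\<integral>\<^sup>+w. \<integral>\<^sup>+\<rho>. ennreal (norm (h n (\<rho>, w))) \<partial>lborel \<partial>lborel)"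
          by (rule nn_integral_lborel_swap) measurable
        also have "\<dots> = (\<integral>\<^sup>+w. In (fst w) * ennreal (cmod (V w)) * v (p - fst w) \<partial>lborel)"
        proof (rule nn_integral_cong)
          fix w :: freq
          have "(\<integral>\<^sup>+\<rho>. ennreal (norm (h n (\<rho>, w))) \<partial>lborel) = (\<integral>\<^sup>+\<rho>. (In (fst w) * ennreal (cmod (V w))) * (\<lambda>\<rho>. ennreal (cmod (W (p - fst w, \<rho>)))) (- snd w + \<rho>) \<partial>lborel)"
            by (intro nn_integral_cong) (cases w, auto simp: h_def S_def In_def norm_mult ennreal_mult split: split_indicator)
          also have "\<dots> = (In (fst w) * ennreal (cmod (V w))) * (\<integral>\<^sup>+\<rho>. (\<lambda>\<rho>. ennreal (cmod (W (p - fst w, \<rho>)))) (- snd w + \<rho>) \<partial>lborel)"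
            by (rule nn_integral_cmult) measurable
          also have "(\<integral>\<^sup>+\<rho>. (\<lambda>\<rho>. ennreal (cmod (W (p - fst w, \<rho>)))) (- snd w + \<rho>) \<partial>lborel) = (\<integral>\<^sup>+\<rho>. ennreal (cmod (W (p - fst w, \<rho>))) \<partial>lborel)"
            by (rule nn_integral_lborel_translate) measurable
          also have "\<dots> = v (p - fst w)" unfolding v_def slice_def using nz by simp
          finally show "(\<integral>\<^sup>+\<rho>. ennreal (norm (h n (\<rho>, w))) \<partial>lborel) = In (fst w) * ennreal (cmod (V w)) * v (p - fst w)" .
        qed
        also have "\<dots> = (\<integral>\<^sup>+q. \<integral>\<^sup>+\<tau>. (In q * v (p - q)) * ennreal (cmod (V (q, \<tau>))) \<partial>lborel \<partial>lborel)"
          by (subst nn_integral_lborel_pair) (auto simp: ac_simps)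
        also have "\<dots> = (\<integral>\<^sup>+q. In q * v (p - q) * u q \<partial>lborel)"
          unfolding u_def slice_def using nz by (simp add: nn_integral_cmult)
        also have "\<dots> \<le> (\<integral>\<^sup>+q. ennreal ((real n)\<^sup>2) * ((ennreal (hw q) * u q) * (ennreal (hw (p - q)) * v (p - q))) \<partial>lborel)"
        proof (rule nn_integral_mono)
          fix q
          have "In q \<le> ennreal ((real n)\<^sup>2 * (hw q * hw (p - q)))"
          proof (cases "1 \<le> real n * hw q \<and> 1 \<le> real n * hw (p - q)")
            case True
            then have "1 * 1 \<le> (real n * hw q) * (real n * hw (p - q))" by (intro mult_mono) auto
            then show ?thesis using True unfolding In_def by (simp add: power2_eq_square ac_simps)
          qed (auto simp: In_def)
          also have "\<dots> = ennreal ((real n)\<^sup>2) * (ennreal (hw q) * ennreal (hw (p - q)))" using hwp by (simp add: ennreal_mult less_imp_le)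
          finally have "In q * v (p - q) * u q \<le> ennreal ((real n)\<^sup>2) * (ennreal (hw q) * ennreal (hw (p - q))) * v (p - q) * u q"
            by (intro mult_right_mono) auto
          then show "In q * v (p - q) * u q \<le> ennreal ((real n)\<^sup>2) * ((ennreal (hw q) * u q) * (ennreal (hw (p - q)) * v (p - q)))" by (simp only: ac_simps)
        qed
        also have "\<dots> = ennreal ((real n)\<^sup>2) * (\<integral>\<^sup>+q. (ennreal (hw q) * u q) * (ennreal (hw (p - q)) * v (p - q)) \<partial>lborel)"
          by (rule nn_integral_cmult) measurable
        also have "\<dots> < \<top>"
        proof -
          have fu: "(\<integral>\<^sup>+q. (ennreal (hw q) * u q)\<^sup>2 \<partial>lborel) < \<top>"
            unfolding hw_def u_def by (rule le_less_trans[OF slice_estimate[of _ 0 bb]])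
              (use fin(1) jbint_finite[of "2 * (bb + 0)"] e0 in \<open>auto simp: nx_alt bb_def ennreal_mult_less_top\<close>)
          have fv: "(\<integral>\<^sup>+q. (ennreal (hw q) * v q)\<^sup>2 \<partial>lborel) < \<top>"
            unfolding hw_def v_def by (rule le_less_trans[OF slice_estimate[of _ 0 bb]])
              (use fin(2) jbint_finite[of "2 * (bb + 0)"] e0 in \<open>auto simp: nx_alt bb_def ennreal_mult_less_top\<close>)
          have "(\<integral>\<^sup>+q. (ennreal (hw q) * u q) * (ennreal (hw (p - q)) * v (p - q)) \<partial>lborel)\<^sup>2 \<le>
             (\<integral>\<^sup>+q. (ennreal (hw q) * u q)\<^sup>2 \<partial>lborel) * (\<integral>\<^sup>+q. (ennreal (hw (p - q)) * v (p - q))\<^sup>2 \<partial>lborel)"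
            by (rule Cauchy_Schwarz_nn_integral) measurable
          also have "(\<integral>\<^sup>+q. (ennreal (hw (p - q)) * v (p - q))\<^sup>2 \<partial>lborel) = (\<integral>\<^sup>+q. (ennreal (hw q) * v q)\<^sup>2 \<partial>lborel)"
            by (rule nn_integral_lborel_reflect[where f="\<lambda>q. (ennreal (hw q) * v q)\<^sup>2"]) measurable
          finally have "(\<integral>\<^sup>+q. (ennreal (hw q) * u q) * (ennreal (hw (p - q)) * v (p - q)) \<partial>lborel)\<^sup>2 < \<top>"
            using fu fv by (auto simp: ennreal_mult_less_top elim!: le_less_trans)
          then show ?thesis by (simp add: ennreal_mult_less_top power_less_top_ennreal)
        qed
        finally show "(\<integral>\<^sup>+\<rho>. \<integral>\<^sup>+w. ennreal (norm (h n (\<rho>, w))) \<partial>lborel \<partial>lborel) < \<top>" .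
      qed measurable
      \<comment> \<open>At a fixed time the inner integral in \<rho> is, up to a factor, the time
        representation of \<open>W\<close> at \<open>p - fst w\<close>, which vanishes for almost
        every \<open>w\<close>.\<close>
      have Z: "(\<integral>x. h n x * exp (\<i> * complex_of_real (t' * fst x)) \<partial>lborel) = 0" if t': "t' \<in> {0..\<delta>}" for n t'
      proof -
        have i: "integrable lborel (\<lambda>x. h n x * exp (\<i> * complex_of_real (t' * fst x)))"
          by (rule Bochner_Integration.integrable_bound[OF hi[of n]]) (auto simp: norm_mult)
        have "AE q in lborel. time_repr W (p - q) t' = 0" using AE_lborel_reflect[OF van[OF t'], of p] .
        then have "AE w in (lborel :: freq measure). time_repr W (p - fst w) t' = 0" by (rule AE_lborel_fst)
        then have "AE w in lborel. (\<integral>\<rho>. h n (\<rho>, w) * exp (\<i> * complex_of_real (t' * \<rho>)) \<partial>lborel) = 0"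
        proof eventually_elim
          case (elim w)
          define K where "K = indicator (S n) w *\<^sub>R V w"
          have "(\<integral>\<rho>. h n (\<rho>, w) * exp (\<i> * complex_of_real (t' * \<rho>)) \<partial>lborel) =
            (\<integral>\<rho>. K * (W (p - fst w, \<rho> - snd w) * exp (\<i> * complex_of_real (t' * \<rho>))) \<partial>lborel)"
            by (intro Bochner_Integration.integral_cong refl) (cases w, simp add: h_def K_def)
          also have "\<dots> = K * (\<integral>\<rho>. W (p - fst w, \<rho> - snd w) * exp (\<i> * complex_of_real (t' * \<rho>)) \<partial>lborel)" by (rule integral_mult_right_zero)
          also have "(\<integral>\<rho>. W (p - fst w, \<rho> - snd w) * exp (\<i> * complex_of_real (t' * \<rho>)) \<partial>lborel) =
             \<bar>1\<bar> *\<^sub>R (\<integral>\<rho>. W (p - fst w, snd w + 1 * \<rho> - snd w) * exp (\<i> * complex_of_real (t' * (snd w + 1 * \<rho>))) \<partial>lborel)"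
            by (rule lborel_integral_real_affine) simp
          also have "\<dots> = (\<integral>\<rho>. exp (\<i> * complex_of_real (t' * snd w)) * (exp (\<i> * complex_of_real (t' * \<rho>)) * W (p - fst w, \<rho>)) \<partial>lborel)"
          proof -
            have "exp (\<i> * complex_of_real (t' * (snd w + 1 * \<rho>))) = exp (\<i> * complex_of_real (t' * snd w)) * exp (\<i> * complex_of_real (t' * \<rho>))" for \<rho>
              unfolding exp_add[symmetric] by (simp add: algebra_simps)
            then show ?thesis by (simp add: ac_simps)
          qed
          also have "\<dots> = exp (\<i> * complex_of_real (t' * snd w)) * (\<integral>\<rho>. exp (\<i> * complex_of_real (t' * \<rho>)) * W (p - fst w, \<rho>) \<partial>lborel)" by (rule integral_mult_right_zero)
          also have "(\<integral>\<rho>. exp (\<i> * complex_of_real (t' * \<rho>)) * W (p - fst w, \<rho>) \<partial>lborel) = 0"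
            using elim pi_gt_zero unfolding time_repr_def by simp
          finally show ?case by simp
        qed
        then have "(\<integral>w. \<integral>\<rho>. h n (\<rho>, w) * exp (\<i> * complex_of_real (t' * \<rho>)) \<partial>lborel \<partial>lborel) = 0"
          by (rule integral_eq_zero_AE)
        then show ?thesis using integral_lborel_pair(2)[OF i] by simp
      qed
      \<comment> \<open>\<open>tker\<close> is replaced by its integral over times in
        \<open>[0,t]\<close>, and Fubini reduces the claim to \<open>Z\<close>. This step relies on
        \<open>h n\<close> being integrable without the decay of \<open>tker\<close>.\<close>
      have B: "(\<integral>x. h n x * tker t (fst x + \<phi>) \<partial>lborel) = 0" for n
      proof -
        define k :: "(real \<times> freq) \<times> real \<Rightarrow> complex" where
          "k y = h n (fst y) * (indicator {0..t} (snd y) *\<^sub>R exp (\<i> * complex_of_real (snd y * (fst (fst y) + \<phi>))))" for y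
        have [measurable]: "k \<in> borel_measurable borel" unfolding k_def[abs_def] by measurable
        have ki: "integrable lborel k"
        proof (rule integrable_lborel_pairI)
          have "(\<integral>\<^sup>+x. \<integral>\<^sup>+t'. ennreal (norm (k (x, t'))) \<partial>lborel \<partial>lborel) = (\<integral>\<^sup>+x. \<integral>\<^sup>+t'. ennreal (norm (h n x)) * indicator {0..t} t' \<partial>lborel \<partial>lborel)"
            by (intro nn_integral_cong) (auto simp: k_def norm_mult split: split_indicator)
          also have "\<dots> = (\<integral>\<^sup>+x. ennreal (norm (h n x)) * ennreal t \<partial>lborel)" using t by (simp add: nn_integral_cmult)
          also have "\<dots> = (\<integral>\<^sup>+x. ennreal (norm (h n x)) \<partial>lborel) * ennreal t" by (rule nn_integral_multc) measurable
          also have "\<dots> < \<top>" using hi[of n] unfolding integrable_iff_bounded by (simp add: ennreal_mult_less_top)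
          finally show "(\<integral>\<^sup>+x. \<integral>\<^sup>+t'. ennreal (norm (k (x, t'))) \<partial>lborel \<partial>lborel) < \<top>" .
        qed measurable
        have "(\<integral>x. h n x * tker t (fst x + \<phi>) \<partial>lborel) = (\<integral>x. \<integral>t'. k (x, t') \<partial>lborel \<partial>lborel)"
        proof (rule Bochner_Integration.integral_cong[OF refl])
          fix x
          have "(\<integral>t'. k (x, t') \<partial>lborel) = h n x * (\<integral>t'. indicator {0..t} t' *\<^sub>R exp (\<i> * complex_of_real (t' * (fst x + \<phi>))) \<partial>lborel)"
            unfolding k_def fst_conv snd_conv by (rule integral_mult_right_zero)
          also have "\<dots> = h n x * tker t (fst x + \<phi>)" using t tker_eq_integral[of t "fst x + \<phi>"] by simp
          finally show "h n x * tker t (fst x + \<phi>) = (\<integral>t'. k (x, t') \<partial>lborel)" ..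
        qed
        also have "\<dots> = (\<integral>t'. \<integral>x. k (x, t') \<partial>lborel \<partial>lborel)" using integral_lborel_pair[OF ki] by simp
        also have "\<dots> = (\<integral>t'. 0 \<partial>(lborel :: real measure))"
        proof (rule Bochner_Integration.integral_cong[OF refl])
          fix t' :: real
          show "(\<integral>x. k (x, t') \<partial>lborel) = 0"
          proof (cases "t' \<in> {0..t}")
            case True
            have E: "exp (\<i> * complex_of_real (t' * (r + \<phi>))) = exp (\<i> * complex_of_real (t' * \<phi>)) * exp (\<i> * complex_of_real (t' * r))" for r
              unfolding exp_add[symmetric] by (simp add: algebra_simps)
            have "k (x, t') = exp (\<i> * complex_of_real (t' * \<phi>)) * (h n x * exp (\<i> * complex_of_real (t' * fst x)))" for x
              using True unfolding k_def fst_conv snd_conv E by simp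
            then have "(\<integral>x. k (x, t') \<partial>lborel) = (\<integral>x. exp (\<i> * complex_of_real (t' * \<phi>)) * (h n x * exp (\<i> * complex_of_real (t' * fst x))) \<partial>lborel)"
              by simp
            also have "\<dots> = exp (\<i> * complex_of_real (t' * \<phi>)) * (\<integral>x. h n x * exp (\<i> * complex_of_real (t' * fst x)) \<partial>lborel)" by (rule integral_mult_right_zero)
            finally show ?thesis using Z[of t' n] True t by simp
          qed (simp add: k_def)
        qed
        finally show ?thesis by simp
      qed
      \<comment> \<open>The weights are positive everywhere, so each point lies in
        \<open>S n\<close> for all large \<open>n\<close>; \<open>g\<close> itself is the
        majorant.\<close>
      have "(\<lambda>n. \<integral>x. h n x * tker t (fst x + \<phi>) \<partial>lborel) \<longlonglongrightarrow> (\<integral>x. g x \<partial>lborel)"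
      proof (rule integral_dominated_convergence[where w="\<lambda>x. norm (g x)"])
        show "integrable lborel (\<lambda>x. norm (g x))" using gi by simp
        show "AE x in lborel. norm (h n x * tker t (fst x + \<phi>)) \<le> norm (g x)" for n
          by (intro AE_I2) (auto simp: h_def g_def norm_mult split: split_indicator)
        show "AE x in lborel. (\<lambda>n. h n x * tker t (fst x + \<phi>)) \<longlonglongrightarrow> g x"
        proof (rule AE_I2)
          fix x :: "real \<times> freq"
          define m where "m = min (hw (fst (snd x))) (hw (p - fst (snd x)))"
          have "m > 0" using hwp by (simp add: m_def)
          then obtain N where N: "1 / m < real N" using reals_Archimedean2 by blast
          have ev: "h n x * tker t (fst x + \<phi>) = g x" if "n \<ge> N" for n
          proof -
            have "1 \<le> real n * m" using N that \<open>m > 0\<close> by (simp add: field_simps) (smt (verit) mult_left_mono of_nat_le_iff)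
            then have "1 \<le> real n * hw (fst (snd x))" "1 \<le> real n * hw (p - fst (snd x))"
              unfolding m_def by (smt (verit) mult_left_mono of_nat_0_le_iff)+
            then have "snd x \<in> S n" by (simp add: S_def)
            then show ?thesis by (simp add: h_def g_def)
          qed
          show "(\<lambda>n. h n x * tker t (fst x + \<phi>)) \<longlonglongrightarrow> g x"
            by (rule tendsto_eventually) (use ev in \<open>auto simp: eventually_sequentially\<close>)
        qed
      qed measurable
      then have g0: "(\<integral>x. g x \<partial>lborel) = 0" unfolding B by (simp add: LIMSEQ_const_iff)
      have "(\<integral>\<rho>. bil V W (p, \<rho>) * tker t (\<rho> + \<phi>) \<partial>lborel) = (\<integral>\<rho>. \<integral>w. g (\<rho>, w) \<partial>lborel \<partial>lborel)"
        unfolding bil_def g_def by simp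
      also have "\<dots> = 0" using integral_lborel_pair(1)[OF gi] g0 by simp
      finally have b0: "(\<integral>\<rho>. bil V W (p, \<rho>) * tker t (\<rho> + \<phi>) \<partial>lborel) = 0" .
      have "(\<integral>\<rho>. Nl V W (p, \<rho>) * tker t (\<rho> + phase p) \<partial>lborel) =
        (\<integral>\<rho>. (\<i> * complex_of_real (fst p) / complex_of_real ((2 * pi) ^ 3)) * (bil V W (p, \<rho>) * tker t (\<rho> + \<phi>)) \<partial>lborel)"
        unfolding Nl_def \<phi>_def by (intro Bochner_Integration.integral_cong refl) simp
      also have "\<dots> = (\<i> * complex_of_real (fst p) / complex_of_real ((2 * pi) ^ 3)) * (\<integral>\<rho>. bil V W (p, \<rho>) * tker t (\<rho> + \<phi>) \<partial>lborel)"
        by (rule integral_mult_right_zero)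
      finally show ?thesis using b0 by simp
    qed
  qed
qed

end

section \<open>The linear equation for the difference of two solutions\<close>

lemma ennreal_le_geometric_imp_zero:
  fixes x c :: ennreal
  assumes "\<And>n. x \<le> ennreal ((1/4) ^ n) * c" and c: "c < \<top>"
  shows "x = 0"
proof -
  have "(\<lambda>n. (1/4::real) ^ n) \<longlonglongrightarrow> 0" by (rule LIMSEQ_power_zero) simp
  from tendsto_ennrealI[OF this] have "(\<lambda>n. ennreal ((1/4) ^ n) * c) \<longlonglongrightarrow> ennreal 0 * c"
    by (rule tendsto_mult_ennreal[OF _ tendsto_const]) (use c in auto)
  then have "(\<lambda>n. ennreal ((1/4) ^ n) * c) \<longlonglongrightarrow> 0" by simp
  then have "x \<le> 0" by (rule LIMSEQ_le_const) (use assms in auto)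
  then show ?thesis by simp
qed

text \<open>Splits the time integral at \<open>t0\<close>, which allows the equation to be restarted
  there.\<close>

lemma tker_add: "tker (t + t0) \<sigma> = tker t0 \<sigma> + exp (\<i> * complex_of_real (t0 * \<sigma>)) * tker t \<sigma>"
proof (cases "\<sigma> = 0")
  case False
  have "exp (\<i> * complex_of_real ((t + t0) * \<sigma>)) = exp (\<i> * complex_of_real (t0 * \<sigma>)) * exp (\<i> * complex_of_real (t * \<sigma>))"
    unfolding exp_add[symmetric] by (simp add: algebra_simps)
  then show ?thesis using False by (simp add: tker_def field_simps)
qed (simp add: tker_def)

lemma tker_zero: "tker 0 \<sigma> = 0"
  by (simp add: tker_def)

context kp_params
begin

lemma small_time:
  assumes A: "A < \<top>" and c: "0 < c"
  obtains \<delta> where "0 < \<delta>" "\<delta> \<le> 1" "\<And>d. 0 < d \<Longrightarrow> d \<le> \<delta> \<Longrightarrow> A * ennreal (d powr (2 * \<epsilon>)) \<le> ennreal c"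
proof -
  obtain a where a: "0 \<le> a" "A = ennreal a" using A by (cases A) auto
  define q where "q = c / (a + 1)"
  have q: "0 < q" using a c by (simp add: q_def)
  show ?thesis
  proof (rule that[of "min 1 (q powr (1 / (2 * \<epsilon>)))"])
    fix d assume d: "0 < d" "d \<le> min 1 (q powr (1 / (2 * \<epsilon>)))"
    have "d powr (2 * \<epsilon>) \<le> (q powr (1 / (2 * \<epsilon>))) powr (2 * \<epsilon>)" using d e0 by (intro powr_mono2) auto
    also have "\<dots> = q" using q e0 by (simp add: powr_powr)
    finally have "a * d powr (2 * \<epsilon>) \<le> a * q" using a by (intro mult_left_mono)
    also have "\<dots> \<le> c" using a c by (simp add: q_def field_simps)
    finally show "A * ennreal (d powr (2 * \<epsilon>)) \<le> ennreal c" using a by (simp add: ennreal_mult[symmetric] ennreal_leI)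
  qed (use q in auto)
qed

lemma bil_commute:
  assumes [measurable]: "G \<in> borel_measurable borel" "H \<in> borel_measurable borel"
  shows "bil G H z = bil H G z"
  unfolding bil_def using integral_lborel_reflect[of "\<lambda>w. H w * G (z - w)" z] by (simp add: mult.commute)

lemma Nl_diff_right_AE:
  assumes [measurable]: "V \<in> borel_measurable borel" "W1 \<in> borel_measurable borel" "W2 \<in> borel_measurable borel"
    and f: "nx bb V < \<top>" "nx bb W1 < \<top>" "nx bb W2 < \<top>"
  shows "AE z in lborel. Nl V (\<lambda>z. W1 z - W2 z) z = Nl V W1 z - Nl V W2 z"
proof -
  have "AE z in lborel. absbil V W1 z < \<top>" by (rule absbil_finite_AE) (use f in auto)
  moreover have "AE z in lborel. absbil V W2 z < \<top>" by (rule absbil_finite_AE) (use f in auto)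
  ultimately show ?thesis
  proof eventually_elim
    case (elim z)
    then have "integrable lborel (\<lambda>w. V w * W1 (z - w))" "integrable lborel (\<lambda>w. V w * W2 (z - w))"
      by (simp_all add: integrable_bil_iff)
    then have "bil V (\<lambda>z. W1 z - W2 z) z = bil V W1 z - bil V W2 z"
      unfolding bil_def by (simp add: right_diff_distrib)
    then show ?case by (simp add: Nl_def right_diff_distrib diff_divide_distrib)
  qed
qed

text \<open>The cross terms cancel by \<open>bil_commute\<close>. Expanding the product requires all
  four convolutions to converge absolutely, hence only almost every \<open>z\<close>.\<close>

lemma Nl_square_diff_AE:
  assumes [measurable]: "G \<in> borel_measurable borel" "H \<in> borel_measurable borel"
    and f: "nx bb G < \<top>" "nx bb H < \<top>"
  shows "AE z in lborel. Nl (\<lambda>z. G z + H z) (\<lambda>z. G z - H z) z = Nl G G z - Nl H H z"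
proof -
  have "AE z in lborel. absbil G G z < \<top>" by (rule absbil_finite_AE) (use f in auto)
  moreover have "AE z in lborel. absbil G H z < \<top>" by (rule absbil_finite_AE) (use f in auto)
  moreover have "AE z in lborel. absbil H G z < \<top>" by (rule absbil_finite_AE) (use f in auto)
  moreover have "AE z in lborel. absbil H H z < \<top>" by (rule absbil_finite_AE) (use f in auto)
  ultimately show ?thesis
  proof eventually_elim
    case (elim z)
    then have i: "integrable lborel (\<lambda>w. G w * G (z - w))" "integrable lborel (\<lambda>w. G w * H (z - w))"
       "integrable lborel (\<lambda>w. H w * G (z - w))" "integrable lborel (\<lambda>w. H w * H (z - w))"
      by (simp_all add: integrable_bil_iff)
    have "bil (\<lambda>z. G z + H z) (\<lambda>z. G z - H z) z =
      (\<integral>w. (G w * G (z - w) - G w * H (z - w)) + (H w * G (z - w) - H w * H (z - w)) \<partial>lborel)"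
      unfolding bil_def by (intro Bochner_Integration.integral_cong) (auto simp: algebra_simps)
    also have "\<dots> = bil G G z - bil G H z + (bil H G z - bil H H z)"
      using i unfolding bil_def by simp
    finally have "bil (\<lambda>z. G z + H z) (\<lambda>z. G z - H z) z = bil G G z - bil H H z"
      using bil_commute[of G H z] by simp
    then show ?case by (simp add: Nl_def right_diff_distrib diff_divide_distrib)
  qed
qed

lemma nx_Nl_finite:
  assumes "V \<in> borel_measurable borel" "W \<in> borel_measurable borel" "nx bb V < \<top>" "nx bb W < \<top>"
  shows "nx bp (Nl V W) < \<top>"
proof -
  obtain C where C: "C < \<top>" "\<And>V W. V \<in> borel_measurable borel \<Longrightarrow> W \<in> borel_measurable borel \<Longrightarrow>
    nx bp (Nl V W) \<le> C * (nx bb V * nx bb W)" by (rule nx_Nl_estimate) blast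
  show ?thesis by (rule le_less_trans[OF C(2)]) (use assms C(1) in \<open>auto simp: ennreal_mult_less_top\<close>)
qed

definition Jt :: "(freq \<Rightarrow> complex) \<Rightarrow> real \<times> real \<Rightarrow> real \<Rightarrow> complex" where
  "Jt N p t = (\<integral>\<rho>. N (p, \<rho>) * tker t (\<rho> + phase p) \<partial>lborel)"

lemma Jt_cong_AE:
  assumes [measurable]: "N \<in> borel_measurable borel" "M \<in> borel_measurable borel" and e: "AE z in lborel. N z = M z"
  shows "AE p in lborel. Jt N p t = Jt M p t"
  using AE_lborel_pair[OF e]
proof eventually_elim
  case (elim p)
  have [measurable]: "(\<lambda>\<rho>. N (p, \<rho>)) \<in> borel_measurable borel" "(\<lambda>\<rho>. M (p, \<rho>)) \<in> borel_measurable borel" by measurable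
  show ?case unfolding Jt_def by (rule integral_cong_AE) (use elim in auto)
qed

lemma Jt_diff_AE:
  assumes [measurable]: "N \<in> borel_measurable borel" "M \<in> borel_measurable borel" and f: "nx bp N < \<top>" "nx bp M < \<top>"
  shows "AE p in lborel. Jt (\<lambda>z. N z - M z) p t = Jt N p t - Jt M p t"
proof -
  have "AE p in lborel. slice 1 (\<lambda>z. ennreal (cmod (N z))) p < \<top>" by (rule slice_bp_AE) (use f in auto)
  moreover have "AE p in lborel. slice 1 (\<lambda>z. ennreal (cmod (M z))) p < \<top>" by (rule slice_bp_AE) (use f in auto)
  ultimately show ?thesis
  proof eventually_elim
    case (elim p)
    show ?case unfolding Jt_def left_diff_distrib
      by (rule Bochner_Integration.integral_diff) (use elim in \<open>auto intro!: integrable_tker\<close>)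
  qed
qed

lemma Duh_cong_AE:
  assumes [measurable]: "N \<in> borel_measurable borel" "M \<in> borel_measurable borel" and e: "AE z in lborel. N z = M z"
  shows "AE z in lborel. Duh T N z = Duh T M z"
  using AE_lborel_fst[OF AE_lborel_pair[OF e], where 'b=real]
proof eventually_elim
  case (elim z)
  have [measurable]: "(\<lambda>\<rho>. N (fst z, \<rho>)) \<in> borel_measurable borel" "(\<lambda>\<rho>. M (fst z, \<rho>)) \<in> borel_measurable borel" by measurable
  have "(\<integral>\<rho>. N (fst z, \<rho>) * kT T (sg z) (\<rho> + phase (fst z)) \<partial>lborel) = (\<integral>\<rho>. M (fst z, \<rho>) * kT T (sg z) (\<rho> + phase (fst z)) \<partial>lborel)"
    by (rule integral_cong_AE) (use elim in auto)
  then show ?case by (simp add: Duh_def)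
qed

lemma Duh_diff_AE:
  assumes [measurable]: "N \<in> borel_measurable borel" "M \<in> borel_measurable borel" and f: "nx bp N < \<top>" "nx bp M < \<top>"
    and T: "0 < T" "T \<le> 1"
  shows "AE z in lborel. Duh T (\<lambda>z. N z - M z) z = Duh T N z - Duh T M z"
proof -
  have "AE p in lborel. slice 1 (\<lambda>z. ennreal (cmod (N z))) p < \<top>" by (rule slice_bp_AE) (use f in auto)
  then have "AE z in (lborel :: freq measure). slice 1 (\<lambda>z. ennreal (cmod (N z))) (fst z) < \<top>" by (rule AE_lborel_fst)
  moreover have "AE p in lborel. slice 1 (\<lambda>z. ennreal (cmod (M z))) p < \<top>" by (rule slice_bp_AE) (use f in auto)
  then have "AE z in (lborel :: freq measure). slice 1 (\<lambda>z. ennreal (cmod (M z))) (fst z) < \<top>" by (rule AE_lborel_fst)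
  ultimately show ?thesis
  proof eventually_elim
    case (elim z)
    have "(\<integral>\<rho>. (N (fst z, \<rho>) - M (fst z, \<rho>)) * kT T (sg z) (\<rho> + phase (fst z)) \<partial>lborel) =
      (\<integral>\<rho>. N (fst z, \<rho>) * kT T (sg z) (\<rho> + phase (fst z)) \<partial>lborel) - (\<integral>\<rho>. M (fst z, \<rho>) * kT T (sg z) (\<rho> + phase (fst z)) \<partial>lborel)"
      unfolding left_diff_distrib
      by (rule Bochner_Integration.integral_diff) (use elim T in \<open>auto intro!: integrable_kT_slice\<close>)
    then show ?case by (simp only: Duh_def right_diff_distrib)
  qed
qed

lemma time_repr_cong_AE:
  assumes [measurable]: "G \<in> borel_measurable borel" "H \<in> borel_measurable borel" and e: "AE z in lborel. G z = H z"
  shows "AE p in lborel. time_repr G p t = time_repr H p t"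
  using AE_lborel_pair[OF e]
proof eventually_elim
  case (elim p)
  have [measurable]: "(\<lambda>\<rho>. G (p, \<rho>)) \<in> borel_measurable borel" "(\<lambda>\<rho>. H (p, \<rho>)) \<in> borel_measurable borel" by measurable
  have "(\<integral>\<tau>. exp (\<i> * complex_of_real (t * \<tau>)) * G (p, \<tau>) \<partial>lborel) = (\<integral>\<tau>. exp (\<i> * complex_of_real (t * \<tau>)) * H (p, \<tau>) \<partial>lborel)"
    by (rule integral_cong_AE) (use elim in auto)
  then show ?case unfolding time_repr_def by simp
qed

lemma time_repr_lincomb_AE:
  assumes [measurable]: "G \<in> borel_measurable borel" "H \<in> borel_measurable borel" and f: "nx bb G < \<top>" "nx bb H < \<top>"
  shows "AE p in lborel. time_repr (\<lambda>z. G z - H z) p t = time_repr G p t - time_repr H p t"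
    and "AE p in lborel. time_repr (\<lambda>z. G z + H z) p t = time_repr G p t + time_repr H p t"
proof -
  have i: "integrable lborel (\<lambda>\<tau>. exp (\<i> * complex_of_real (t * \<tau>)) * F (p, \<tau>))"
    if "integrable lborel (\<lambda>\<tau>. F (p, \<tau>))" for F :: "freq \<Rightarrow> complex" and p
    by (rule integrable_exp_mult[OF that])
  have "AE p in lborel. integrable lborel (\<lambda>t. G (p, t))" by (rule integrable_slice_AE) (use f in auto)
  moreover have "AE p in lborel. integrable lborel (\<lambda>t. H (p, t))" by (rule integrable_slice_AE) (use f in auto)
  ultimately have ae: "AE p in lborel. integrable lborel (\<lambda>t. G (p, t)) \<and> integrable lborel (\<lambda>t. H (p, t))" by eventually_elim simp
  show "AE p in lborel. time_repr (\<lambda>z. G z - H z) p t = time_repr G p t - time_repr H p t"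
    using ae
  proof eventually_elim
    case (elim p)
    show ?case unfolding time_repr_def right_diff_distrib
      by (subst Bochner_Integration.integral_diff) (use elim in \<open>auto intro!: i simp: diff_divide_distrib simp del: of_real_mult\<close>)
  qed
  show "AE p in lborel. time_repr (\<lambda>z. G z + H z) p t = time_repr G p t + time_repr H p t"
    using ae
  proof eventually_elim
    case (elim p)
    show ?case unfolding time_repr_def distrib_left
      by (subst Bochner_Integration.integral_add) (use elim in \<open>auto intro!: i simp: add_divide_distrib simp del: of_real_mult\<close>)
  qed
qed

text \<open>Fourier side of \<open>- 1/2\<close> times the integral over \<open>[0,t]\<close> of the
  free propagator applied to the forcing \<open>N\<close>.\<close>

definition Ds :: "(freq \<Rightarrow> complex) \<Rightarrow> real \<times> real \<Rightarrow> real \<Rightarrow> complex" where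
  "Ds N p t = exp (- \<i> * complex_of_real (t * phase p)) * (- (1/2) * Jt N p t / complex_of_real (2 * pi))"

lemma time_repr_Duh_AE:
  assumes [measurable]: "N \<in> borel_measurable borel" and f: "nx bp N < \<top>"
    and T: "0 < T" "T \<le> 1" and t: "t \<in> {0..T}"
  shows "AE p in lborel. time_repr (Duh T N) p t = Ds N p t"
  using slice_bp_AE[OF assms(1,2)]
  by eventually_elim (use T t in \<open>simp add: time_repr_Duh Ds_def Jt_def\<close>)

lemma uniq_local:
  assumes K: "\<And>W. W \<in> borel_measurable borel \<Longrightarrow> nx bb (Duh \<delta> (Nl V W)) \<le> ennreal (1/4) * nx bb W"
    and \<delta>: "0 < \<delta>" "\<delta> \<le> 1"
    and [measurable]: "V \<in> borel_measurable borel" "W \<in> borel_measurable borel"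
    and fin: "nx bb V < \<top>" "nx bb W < \<top>"
    and eq: "\<And>t. t \<in> {0..\<delta>} \<Longrightarrow> AE p in lborel. time_repr W p t = Ds (Nl V W) p t"
    and t: "t \<in> {0..\<delta>}"
  shows "AE p in lborel. time_repr W p t = 0"
proof -
  define X where "X n = ((\<lambda>Y. Duh \<delta> (Nl V Y)) ^^ n) W" for n
  have XS: "X (Suc n) = Duh \<delta> (Nl V (X n))" for n by (simp add: X_def)
  have Xm[measurable]: "X n \<in> borel_measurable borel" for n
  proof (induction n)
    case 0 then show ?case by (simp add: X_def)
  next
    case (Suc n) from this[measurable] show ?case unfolding XS by measurable
  qed
  have Xn: "nx bb (X n) \<le> ennreal ((1/4) ^ n) * nx bb W" for n
  proof (induction n)
    case 0 then show ?case by (simp add: X_def)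
  next
    case (Suc n)
    have "nx bb (X (Suc n)) \<le> ennreal (1/4) * nx bb (X n)" unfolding XS by (rule K) measurable
    also have "\<dots> \<le> ennreal (1/4) * (ennreal ((1/4) ^ n) * nx bb W)" by (rule mult_left_mono[OF Suc]) simp
    also have "\<dots> = ennreal ((1/4) ^ Suc n) * nx bb W" by (simp only: mult.assoc[symmetric] power_Suc) (subst ennreal_mult, auto)
    finally show ?case .
  qed
  have Xf: "nx bb (X n) < \<top>" for n by (rule le_less_trans[OF Xn]) (use fin in \<open>simp add: ennreal_mult_less_top\<close>)
  \<comment> \<open>The iterate and \<open>W\<close> agree on \<open>[0,\<delta>]\<close>; by
    \<open>localization\<close>, so do the Duhamel terms formed with them, and the one formed with
    \<open>W\<close> is \<open>W\<close> there.\<close>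
  have Xe: "\<forall>t\<in>{0..\<delta>}. AE p in lborel. time_repr (X n) p t = time_repr W p t" for n
  proof (induction n)
    case 0 then show ?case by (simp add: X_def)
  next
    case (Suc n)
    let ?D = "\<lambda>z. X n z - W z"
    have Df: "nx bb ?D < \<top>"
      by (rule le_less_trans[OF nx_diff]) (use Xf[of n] fin in \<open>auto simp: ennreal_mult_less_top\<close>)
    have van: "AE p in lborel. time_repr ?D p s = 0" if s: "s \<in> {0..\<delta>}" for s
    proof -
      have "AE p in lborel. time_repr ?D p s = time_repr (X n) p s - time_repr W p s"
        by (rule time_repr_lincomb_AE(1)) (use Xf[of n] fin in auto)
      with Suc.IH[rule_format, OF s] show ?thesis by eventually_elim simp
    qed
    show ?case
    proof
      fix s assume s: "s \<in> {0..\<delta>}"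
      have "AE p in lborel. Jt (Nl V ?D) p s = 0" unfolding Jt_def by (rule localization[OF _ _ fin(1) Df van s]) auto
      moreover have "AE p in lborel. Jt (Nl V ?D) p s = Jt (\<lambda>z. Nl V (X n) z - Nl V W z) p s"
        by (rule Jt_cong_AE) (use Nl_diff_right_AE[of V "X n" W] Xf[of n] fin in auto)
      moreover have "AE p in lborel. Jt (\<lambda>z. Nl V (X n) z - Nl V W z) p s = Jt (Nl V (X n)) p s - Jt (Nl V W) p s"
        by (rule Jt_diff_AE) (use Xf[of n] fin in \<open>auto intro!: nx_Nl_finite\<close>)
      moreover have "AE p in lborel. time_repr (X (Suc n)) p s = Ds (Nl V (X n)) p s" unfolding XS
        by (rule time_repr_Duh_AE) (use Xf[of n] fin \<delta> s in \<open>auto intro!: nx_Nl_finite\<close>)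
      ultimately show "AE p in lborel. time_repr (X (Suc n)) p s = time_repr W p s"
        using eq[OF s] by eventually_elim (simp add: Ds_def)
    qed
  qed
  have "nh (\<lambda>p. time_repr W p t) = 0"
  proof (rule ennreal_le_geometric_imp_zero)
    fix n
    have "nh (\<lambda>p. time_repr W p t) = nh (\<lambda>p. time_repr (X n) p t)"
      unfolding nh_def by (rule nn_integral_cong_AE) (use Xe[of n, rule_format, OF t] in \<open>eventually_elim, simp\<close>)
    also have "\<dots> \<le> jbint (2 * bb) * nx bb (X n)" by (rule nh_time_repr_le) measurable
    also have "\<dots> \<le> jbint (2 * bb) * (ennreal ((1/4) ^ n) * nx bb W)" by (rule mult_left_mono[OF Xn]) simp
    also have "\<dots> = ennreal ((1/4) ^ n) * (jbint (2 * bb) * nx bb W)" by (simp only: ac_simps)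
    finally show "nh (\<lambda>p. time_repr W p t) \<le> ennreal ((1/4) ^ n) * (jbint (2 * bb) * nx bb W)" .
  qed (use fin jbint_finite[of "2 * bb"] e0 in \<open>auto simp: ennreal_mult_less_top bb_def\<close>)
  then show ?thesis by (rule nh_zero_AE[rotated]) measurable
qed

text \<open>Translation of time by \<open>t0\<close>. The factor is a character, so it passes
  through convolutions and leaves all norms unchanged.\<close>

definition tr :: "real \<Rightarrow> (freq \<Rightarrow> complex) \<Rightarrow> freq \<Rightarrow> complex" where
  "tr t0 G z = exp (\<i> * complex_of_real (t0 * snd z)) * G z"

lemma tr_measurable [measurable]:
  assumes [measurable]: "G \<in> borel_measurable borel"
  shows "tr t0 G \<in> borel_measurable borel"
  unfolding tr_def[abs_def] by measurable

lemma nx_tr: "nx b (tr t0 G) = nx b G"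
  unfolding nx_def tr_def by (simp add: norm_mult)

lemma time_repr_tr: "time_repr (tr t0 G) p t = time_repr G p (t + t0)"
proof -
  have "exp (\<i> * complex_of_real (t * \<tau>)) * tr t0 G (p, \<tau>) = exp (\<i> * complex_of_real ((t + t0) * \<tau>)) * G (p, \<tau>)" for \<tau>
    unfolding tr_def mult.assoc[symmetric] exp_add[symmetric] by (simp add: algebra_simps)
  then show ?thesis unfolding time_repr_def by simp
qed

lemma Nl_tr: "Nl (tr t0 V) (tr t0 W) z = exp (\<i> * complex_of_real (t0 * snd z)) * Nl V W z"
proof -
  have "tr t0 V w * tr t0 W (z - w) = exp (\<i> * complex_of_real (t0 * snd z)) * (V w * W (z - w))" for w
  proof -
    have "exp (\<i> * complex_of_real (t0 * snd w)) * exp (\<i> * complex_of_real (t0 * snd (z - w))) = exp (\<i> * complex_of_real (t0 * snd z))"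
      unfolding exp_add[symmetric] by (simp add: algebra_simps)
    then show ?thesis unfolding tr_def by (simp only: ac_simps)
  qed
  then have "bil (tr t0 V) (tr t0 W) z = exp (\<i> * complex_of_real (t0 * snd z)) * bil V W z" unfolding bil_def by simp
  then show ?thesis by (simp add: Nl_def)
qed

text \<open>The step \<delta> depends on \<open>V\<close> only through \<open>nx bb V\<close>, which
  \<open>tr\<close> preserves, so one step length serves every starting time and finitely many steps
  reach \<open>T\<close>.\<close>

lemma uniq_global:
  assumes [measurable]: "V \<in> borel_measurable borel" "W \<in> borel_measurable borel"
    and fin: "nx bb V < \<top>" "nx bb W < \<top>"
    and eq: "\<And>t. t \<in> {0..T} \<Longrightarrow> AE p in lborel. time_repr W p t = Ds (Nl V W) p t"
    and t: "t \<in> {0..T}"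
  shows "AE p in lborel. time_repr W p t = 0"
proof -
  obtain K where K: "K < \<top>" "\<And>T V W. 0 < T \<Longrightarrow> T \<le> 1 \<Longrightarrow> V \<in> borel_measurable borel \<Longrightarrow> W \<in> borel_measurable borel \<Longrightarrow>
    nx bb (Duh T (Nl V W)) \<le> K * ennreal (T powr (2 * \<epsilon>)) * (nx bb V * nx bb W)" by (rule op_estimate) blast
  have "K * nx bb V < \<top>" using K(1) fin by (simp add: ennreal_mult_less_top)
  then obtain \<delta> where \<delta>: "0 < \<delta>" "\<delta> \<le> 1" "\<And>d. 0 < d \<Longrightarrow> d \<le> \<delta> \<Longrightarrow> K * nx bb V * ennreal (d powr (2 * \<epsilon>)) \<le> ennreal (1/4)"
    by (rule small_time[of _ "1/4"]) auto
  have step: "nx bb (Duh d (Nl (tr s V) Y)) \<le> ennreal (1/4) * nx bb Y" if "0 < d" "d \<le> \<delta>" "Y \<in> borel_measurable borel" for d s Y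
  proof -
    have "nx bb (Duh d (Nl (tr s V) Y)) \<le> K * ennreal (d powr (2 * \<epsilon>)) * (nx bb (tr s V) * nx bb Y)"
      by (rule K(2)) (use that \<delta> in auto)
    also have "\<dots> = K * nx bb V * ennreal (d powr (2 * \<epsilon>)) * nx bb Y" by (simp only: nx_tr ac_simps)
    also have "\<dots> \<le> ennreal (1/4) * nx bb Y" by (rule mult_right_mono[OF \<delta>(3)]) (use that in auto)
    finally show ?thesis .
  qed
  have "\<forall>t\<in>{0..min T (real n * \<delta>)}. AE p in lborel. time_repr W p t = 0" for n
  proof (induction n)
    case 0
    show ?case
    proof
      fix t assume "t \<in> {0..min T (real 0 * \<delta>)}"
      then have t: "t = 0" "t \<in> {0..T}" by auto
      show "AE p in lborel. time_repr W p t = 0" using eq[OF t(2)] by eventually_elim (simp add: t Ds_def Jt_def tker_zero)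
    qed
  next
    case (Suc n)
    define s where "s = real n * \<delta>"
    have s0: "0 \<le> s" using \<delta> by (simp add: s_def)
    show ?case
    proof (cases "s < T")
      case False
      then have "min T (real (Suc n) * \<delta>) = min T (real n * \<delta>)" using \<delta> by (simp add: s_def algebra_simps)
      then show ?thesis using Suc.IH by simp
    next
      case True
      define d where "d = min \<delta> (T - s)"
      have d: "0 < d" "d \<le> \<delta>" "s + d \<le> T" using True \<delta> by (auto simp: d_def)
      \<comment> \<open>Since \<open>W\<close> vanishes at time \<open>s\<close>, so does the
        Duhamel integral up to \<open>s\<close>; by \<open>tker_add\<close> the translated functions
        then satisfy the same equation with zero data.\<close>
      have J0: "AE p in lborel. Jt (Nl V W) p s = 0"
      proof -
        have "AE p in lborel. time_repr W p s = 0" using Suc.IH True s0 by (auto simp: s_def)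
        moreover have "AE p in lborel. time_repr W p s = Ds (Nl V W) p s" using True s0 by (intro eq) auto
        ultimately show ?thesis by eventually_elim (simp add: Ds_def)
      qed
      have slf: "AE p in lborel. slice 1 (\<lambda>z. ennreal (cmod (Nl V W z))) p < \<top>"
        by (rule slice_bp_AE) (use fin in \<open>auto intro!: nx_Nl_finite\<close>)
      have new: "AE p in lborel. time_repr W p (r + s) = 0" if r: "r \<in> {0..d}" for r
      proof -
        have "AE p in lborel. time_repr (tr s W) p r = 0"
        proof (rule uniq_local[OF step[OF d(1,2)] d(1) _ _ _ _ _ _ r])
          fix r' assume r': "r' \<in> {0..d}"
          have "r' + s \<in> {0..T}" using r' s0 d by auto
          from eq[OF this] J0 slf show "AE p in lborel. time_repr (tr s W) p r' = Ds (Nl (tr s V) (tr s W)) p r'"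
          proof eventually_elim
            case (elim p)
            have i: "integrable lborel (\<lambda>\<tau>. Nl V W (p, \<tau>) * tker t (\<tau> + phase p))" for t
              by (rule integrable_tker) (use elim(3) in auto)
            have pt: "Nl V W (p, \<rho>) * tker (r' + s) (\<rho> + phase p) = Nl V W (p, \<rho>) * tker s (\<rho> + phase p) +
               exp (\<i> * complex_of_real (s * phase p)) * (Nl (tr s V) (tr s W) (p, \<rho>) * tker r' (\<rho> + phase p))" for \<rho>
            proof -
              have "exp (\<i> * complex_of_real (s * (\<rho> + phase p))) = exp (\<i> * complex_of_real (s * phase p)) * exp (\<i> * complex_of_real (s * \<rho>))"
                unfolding exp_add[symmetric] by (simp add: algebra_simps)
              then show ?thesis unfolding tker_add[of r' s] Nl_tr by (simp only: snd_conv distrib_left ac_simps)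
            qed
            have "Jt (Nl V W) p (r' + s) - Jt (Nl V W) p s =
              (\<integral>\<rho>. Nl V W (p, \<rho>) * tker (r' + s) (\<rho> + phase p) - Nl V W (p, \<rho>) * tker s (\<rho> + phase p) \<partial>lborel)"
              unfolding Jt_def by (rule Bochner_Integration.integral_diff[symmetric]) (rule i)+
            also have "\<dots> = (\<integral>\<rho>. exp (\<i> * complex_of_real (s * phase p)) * (Nl (tr s V) (tr s W) (p, \<rho>) * tker r' (\<rho> + phase p)) \<partial>lborel)"
              unfolding pt by simp
            also have "\<dots> = exp (\<i> * complex_of_real (s * phase p)) * Jt (Nl (tr s V) (tr s W)) p r'"
              unfolding Jt_def by (rule integral_mult_right_zero)
            finally have J: "Jt (Nl V W) p (r' + s) = exp (\<i> * complex_of_real (s * phase p)) * Jt (Nl (tr s V) (tr s W)) p r'"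
              using elim(2) by simp
            have E: "exp (- \<i> * complex_of_real ((r' + s) * phase p)) * (- (1/2) * (exp (\<i> * complex_of_real (s * phase p)) * c) / complex_of_real (2 * pi)) =
              exp (- \<i> * complex_of_real (r' * phase p)) * (- (1/2) * c / complex_of_real (2 * pi))" for c
            proof -
              have "exp (- \<i> * complex_of_real ((r' + s) * phase p)) * exp (\<i> * complex_of_real (s * phase p)) = exp (- \<i> * complex_of_real (r' * phase p))"
                unfolding exp_add[symmetric] by (simp add: algebra_simps)
              then show ?thesis by (simp add: divide_simps)
            qed
            show ?case unfolding time_repr_tr elim(1) Ds_def J by (rule E)
          qed
        qed (use \<delta> d fin in \<open>auto simp: nx_tr\<close>)
        then show ?thesis by (simp add: time_repr_tr)
      qed
      show ?thesis
      proof
        fix t assume t: "t \<in> {0..min T (real (Suc n) * \<delta>)}"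
        show "AE p in lborel. time_repr W p t = 0"
        proof (cases "t \<le> s")
          case True
          then show ?thesis using Suc.IH t by (auto simp: s_def)
        next
          case False
          have "t \<le> s + \<delta>" using t by (simp add: s_def algebra_simps)
          then have "t - s \<in> {0..d}" using False t by (auto simp: d_def)
          from new[OF this] show ?thesis by simp
        qed
      qed
    qed
  qed
  moreover obtain n where "T < real n * \<delta>" using reals_Archimedean3[OF \<delta>(1)] by blast
  ultimately show ?thesis using t by (metis less_imp_le min.absorb1)
qed

end

section \<open>Picard iteration\<close>

context kp_params
begin

text \<open>A geometrically summable series in the X-norm converges almost everywhere, because
  \<open>P = \<Sum>n. 4^n * (norm (d n))^2\<close> is finite almost everywhere and dominates the tails.\<close>
lemma X_series:
  assumes dm[measurable]: "\<And>n. d n \<in> borel_measurable borel"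
    and dn: "\<And>n. nx b (d n) \<le> ennreal ((1/16) ^ n * r)" and r: "0 \<le> r"
  obtains G where "G \<in> borel_measurable borel" "\<And>n. nx b (\<lambda>z. G z - (\<Sum>k<n. d k z)) \<le> ennreal ((1/4) ^ n * (8 * r))"
proof -
  define w where "w z = (xweight s1 s2 b z)\<^sup>2" for z
  have [measurable]: "w \<in> borel_measurable borel" unfolding w_def[abs_def] by measurable
  have w0: "0 < w z" for z unfolding w_def using xweight_pos[of s1 s2 b z] by simp
  define P where "P z = (\<Sum>n. ennreal (4 ^ n * (cmod (d n z))\<^sup>2))" for z
  have [measurable]: "P \<in> borel_measurable borel" unfolding P_def[abs_def] by measurable
  \<comment> \<open>The weights \<open>4 ^ n\<close> against \<open>(1/16) ^ n\<close> leave a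
    geometric series of ratio 1/4, with sum \<open>4/3 * r\<close>.\<close>
  have IP: "(\<integral>\<^sup>+z. ennreal (w z) * P z \<partial>lborel) \<le> ennreal (2 * r)"
  proof -
    have "(\<integral>\<^sup>+z. ennreal (w z) * P z \<partial>lborel) = (\<integral>\<^sup>+z. (\<Sum>n. ennreal (w z) * ennreal (4 ^ n * (cmod (d n z))\<^sup>2)) \<partial>lborel)"
      unfolding P_def by simp
    also have "\<dots> = (\<Sum>n. \<integral>\<^sup>+z. ennreal (w z) * ennreal (4 ^ n * (cmod (d n z))\<^sup>2) \<partial>lborel)" by (rule nn_integral_suminf) measurable
    also have "\<dots> = (\<Sum>n. ennreal (4 ^ n) * nx b (d n))"
    proof (rule suminf_cong)
      fix n
      have "(\<integral>\<^sup>+z. ennreal (w z) * ennreal (4 ^ n * (cmod (d n z))\<^sup>2) \<partial>lborel) = (\<integral>\<^sup>+z. ennreal (4 ^ n) * ennreal (w z * (cmod (d n z))\<^sup>2) \<partial>lborel)"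
        using w0 by (intro nn_integral_cong) (simp add: ennreal_mult[symmetric] less_imp_le mult.left_commute)
      also have "\<dots> = ennreal (4 ^ n) * nx b (d n)" unfolding nx_def w_def by (rule nn_integral_cmult) measurable
      finally show "(\<integral>\<^sup>+z. ennreal (w z) * ennreal (4 ^ n * (cmod (d n z))\<^sup>2) \<partial>lborel) = ennreal (4 ^ n) * nx b (d n)" .
    qed
    also have "\<dots> \<le> (\<Sum>n. ennreal (r * (1/4) ^ n))"
    proof (intro suminf_le allI)
      fix n
      have "ennreal (4 ^ n) * nx b (d n) \<le> ennreal (4 ^ n) * ennreal ((1/16) ^ n * r)" by (rule mult_left_mono[OF dn]) simp
      also have "\<dots> = ennreal (r * (1/4) ^ n)" using r by (simp add: ennreal_mult[symmetric] power_mult_distrib[symmetric] mult.assoc[symmetric])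
      finally show "ennreal (4 ^ n) * nx b (d n) \<le> ennreal (r * (1/4) ^ n)" .
    qed auto
    also have "\<dots> = ennreal (\<Sum>n. r * (1/4) ^ n)"
      by (rule suminf_ennreal2) (use r in \<open>auto intro!: summable_mult summable_geometric\<close>)
    also have "(\<Sum>n. r * (1/4::real) ^ n) = r * (4/3)" by (simp add: suminf_mult suminf_geometric summable_geometric)
    also have "ennreal (r * (4/3)) \<le> ennreal (2 * r)" using r by (intro ennreal_leI) simp
    finally show ?thesis .
  qed
  have "AE z in lborel. ennreal (w z) * P z \<noteq> \<infinity>"
    by (rule nn_integral_PInf_AE) (use IP in \<open>auto simp: top_unique\<close>)
  then have fin: "AE z in lborel. P z < \<top>"
    by eventually_elim (use w0 in \<open>auto simp: less_top[symmetric] ennreal_mult_eq_top_iff ennreal_eq_0_iff not_le\<close>)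
  define G where "G z = (\<Sum>k. d k z)" for z
  have [measurable]: "G \<in> borel_measurable borel" unfolding G_def[abs_def] by measurable
  show ?thesis
  proof (rule that)
    fix n
    \<comment> \<open>Each term of \<open>P\<close> gives
      \<open>cmod (d k z) \<le> sqrt (P z) * (1/2) ^ k\<close>, so the tail from \<open>n\<close> is
      at most \<open>2 * sqrt (P z) * (1/2) ^ n\<close>. Its square, combined with the bound
      \<open>2 * r\<close> of \<open>IP\<close>, yields the constant 8.\<close>
    have pt: "AE z in lborel. ennreal (w z * (cmod (G z - (\<Sum>k<n. d k z)))\<^sup>2) \<le> ennreal (4 * (1/4) ^ n) * (ennreal (w z) * P z)"
      using fin
    proof eventually_elim
      case (elim z)
      obtain q where q: "0 \<le> q" "P z = ennreal q" using elim by (cases "P z") auto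
      have dk: "cmod (d k z) \<le> sqrt q * (1/2) ^ k" for k
      proof -
        have "(\<Sum>n\<in>{k}. ennreal (4 ^ n * (cmod (d n z))\<^sup>2)) \<le> P z"
          unfolding P_def by (rule sum_le_suminf) auto
        then have "ennreal (4 ^ k * (cmod (d k z))\<^sup>2) \<le> ennreal q" unfolding q(2) by (simp only: sum.insert finite.emptyI empty_iff sum.empty add_0_right not_False_eq_True)
        then have "4 ^ k * (cmod (d k z))\<^sup>2 \<le> q" using q(1) by (simp add: ennreal_le_iff)
        then have "sqrt (4 ^ k * (cmod (d k z))\<^sup>2) \<le> sqrt q" by simp
        moreover have "sqrt (4 ^ k) = (2::real) ^ k" using real_sqrt_power[of 4 k] by simp
        ultimately have "2 ^ k * cmod (d k z) \<le> sqrt q" by (simp add: real_sqrt_mult)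
        then show ?thesis by (simp add: field_simps)
      qed
      have gs: "summable (\<lambda>k. sqrt q * (1/2::real) ^ k)" by (intro summable_mult summable_geometric) simp
      have s: "summable (\<lambda>k. d k z)" by (rule summable_comparison_test'[OF gs]) (use dk in auto)
      have "cmod (G z - (\<Sum>k<n. d k z)) = cmod (\<Sum>k. d (k + n) z)"
        unfolding G_def using suminf_minus_initial_segment[OF s, of n] by simp
      also have "\<dots> \<le> (\<Sum>k. sqrt q * (1/2) ^ n * (1/2) ^ k)"
      proof (rule norm_suminf_le)
        show "cmod (d (k + n) z) \<le> sqrt q * (1/2) ^ n * (1/2) ^ k" for k using dk[of "k + n"] by (simp add: power_add ac_simps)
        show "summable (\<lambda>k. sqrt q * (1/2) ^ n * (1/2::real) ^ k)" by (intro summable_mult summable_geometric) simp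
      qed
      also have "\<dots> = 2 * sqrt q * (1/2) ^ n" by (simp add: suminf_mult suminf_geometric summable_geometric)
      finally have "(cmod (G z - (\<Sum>k<n. d k z)))\<^sup>2 \<le> (2 * sqrt q * (1/2) ^ n)\<^sup>2" by (rule power_mono) simp
      also have "\<dots> = 4 * (1/4) ^ n * q"
      proof -
        have "((1/2::real) ^ n)\<^sup>2 = (1/4) ^ n" unfolding power2_eq_square power_mult_distrib[symmetric] by simp
        then show ?thesis using q(1) by (simp add: power_mult_distrib)
      qed
      finally have "w z * (cmod (G z - (\<Sum>k<n. d k z)))\<^sup>2 \<le> w z * (4 * (1/4) ^ n * q)" using w0[of z] by (intro mult_left_mono) auto
      then have "ennreal (w z * (cmod (G z - (\<Sum>k<n. d k z)))\<^sup>2) \<le> ennreal (4 * (1/4) ^ n * (w z * q))" by (intro ennreal_leI) (simp add: ac_simps)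
      also have "\<dots> = ennreal (4 * (1/4) ^ n) * (ennreal (w z) * P z)" using q w0[of z] by (simp add: ennreal_mult less_imp_le)
      finally show ?case .
    qed
    have "nx b (\<lambda>z. G z - (\<Sum>k<n. d k z)) \<le> (\<integral>\<^sup>+z. ennreal (4 * (1/4) ^ n) * (ennreal (w z) * P z) \<partial>lborel)"
      unfolding nx_def w_def[symmetric] by (rule nn_integral_mono_AE[OF pt])
    also have "\<dots> = ennreal (4 * (1/4) ^ n) * (\<integral>\<^sup>+z. ennreal (w z) * P z \<partial>lborel)" by (rule nn_integral_cmult) measurable
    also have "\<dots> \<le> ennreal (4 * (1/4) ^ n) * ennreal (2 * r)" by (rule mult_left_mono[OF IP]) simp
    also have "\<dots> = ennreal ((1/4) ^ n * (8 * r))" using r by (subst ennreal_mult[symmetric]) (auto simp: ac_simps)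
    finally show "nx b (\<lambda>z. G z - (\<Sum>k<n. d k z)) \<le> ennreal ((1/4) ^ n * (8 * r))" .
  qed measurable
qed

definition Phi :: "real \<Rightarrow> (real \<times> real \<Rightarrow> complex) \<Rightarrow> (freq \<Rightarrow> complex) \<Rightarrow> freq \<Rightarrow> complex" where
  "Phi T u G z = Lin u z + Duh T (Nl G G) z"

lemma Phi_measurable [measurable]:
  assumes [measurable]: "u \<in> borel_measurable borel" "G \<in> borel_measurable borel"
  shows "Phi T u G \<in> borel_measurable borel"
  unfolding Phi_def[abs_def] by measurable

text \<open>The difference of squares is a product whose first factor \<open>G + H\<close> has
  \<open>nx\<close> at most \<open>32 * r\<close>, by the triangle inequality with factor 2. Hence
  the bound 1/1024 on \<open>A * r\<close> gives the rate 1/32.\<close>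

lemma Phi_diff:
  assumes T: "0 < T" "T \<le> 1"
    and A: "\<And>V W. V \<in> borel_measurable borel \<Longrightarrow> W \<in> borel_measurable borel \<Longrightarrow> nx bb (Duh T (Nl V W)) \<le> A * (nx bb V * nx bb W)"
    and AR: "A * ennreal r \<le> ennreal (1/1024)" and r: "0 \<le> r"
    and [measurable]: "G \<in> borel_measurable borel" "H \<in> borel_measurable borel"
    and G: "nx bb G \<le> ennreal (8 * r)" "nx bb H \<le> ennreal (8 * r)"
  shows "nx bb (\<lambda>z. Duh T (Nl G G) z - Duh T (Nl H H) z) \<le> ennreal (1/32) * nx bb (\<lambda>z. G z - H z)"
proof -
  have f: "nx bb G < \<top>" "nx bb H < \<top>" using G ennreal_less_top le_less_trans by blast+
  have "AE z in lborel. Duh T (\<lambda>z. Nl G G z - Nl H H z) z = Duh T (Nl G G) z - Duh T (Nl H H) z"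
    by (rule Duh_diff_AE) (use T f in \<open>auto intro!: nx_Nl_finite\<close>)
  moreover have "AE z in lborel. Duh T (Nl (\<lambda>z. G z + H z) (\<lambda>z. G z - H z)) z = Duh T (\<lambda>z. Nl G G z - Nl H H z) z"
    by (rule Duh_cong_AE) (use Nl_square_diff_AE[of G H] f in auto)
  ultimately have "AE z in lborel. Duh T (Nl G G) z - Duh T (Nl H H) z = Duh T (Nl (\<lambda>z. G z + H z) (\<lambda>z. G z - H z)) z"
    by eventually_elim simp
  then have "nx bb (\<lambda>z. Duh T (Nl G G) z - Duh T (Nl H H) z) = nx bb (Duh T (Nl (\<lambda>z. G z + H z) (\<lambda>z. G z - H z)))"
    by (rule nx_cong_AE)
  also have "\<dots> \<le> A * (nx bb (\<lambda>z. G z + H z) * nx bb (\<lambda>z. G z - H z))" by (rule A) measurable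
  also have "\<dots> \<le> A * (ennreal (32 * r) * nx bb (\<lambda>z. G z - H z))"
  proof (intro mult_left_mono mult_right_mono)
    have "nx bb (\<lambda>z. G z + H z) \<le> 2 * (nx bb G + nx bb H)" by (rule nx_add) measurable
    also have "\<dots> \<le> 2 * (ennreal (8 * r) + ennreal (8 * r))" by (intro mult_left_mono add_mono G) simp
    also have "\<dots> = ennreal 2 * ennreal (8 * r + 8 * r)" using r by (subst ennreal_plus) auto
    also have "\<dots> = ennreal (32 * r)" using r by (subst ennreal_mult[symmetric]) auto
    finally show "nx bb (\<lambda>z. G z + H z) \<le> ennreal (32 * r)" .
  qed auto
  also have "\<dots> = ennreal 32 * (A * ennreal r) * nx bb (\<lambda>z. G z - H z)"
    using r by (subst ennreal_mult) (auto simp only: ac_simps)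
  also have "\<dots> \<le> ennreal 32 * ennreal (1/1024) * nx bb (\<lambda>z. G z - H z)" by (intro mult_right_mono mult_left_mono AR) auto
  also have "ennreal 32 * ennreal (1/1024) = ennreal (1/32)" by (subst ennreal_mult[symmetric]) auto
  finally show ?thesis .
qed

text \<open>The iterates stay below \<open>r\<close> because \<open>2 * (1/4 + 1/1024) < 1\<close>.
  Their limit is known only to satisfy the bound \<open>8 * r\<close> of \<open>X_series\<close>,
  which is why \<open>Phi_diff\<close> works on that larger ball.\<close>

lemma picard:
  assumes T: "0 < T" "T \<le> 1"
    and A: "\<And>V W. V \<in> borel_measurable borel \<Longrightarrow> W \<in> borel_measurable borel \<Longrightarrow> nx bb (Duh T (Nl V W)) \<le> A * (nx bb V * nx bb W)"
    and AR: "A * ennreal r \<le> ennreal (1/1024)" and r: "0 \<le> r"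
    and [measurable]: "u \<in> borel_measurable borel" and L: "nx bb (Lin u) \<le> ennreal (r/4)"
  obtains G where "G \<in> borel_measurable borel" "nx bb G \<le> ennreal (8 * r)" "AE z in lborel. G z = Phi T u G z"
proof -
  define Y where "Y n = ((Phi T u) ^^ n) (\<lambda>_. 0)" for n
  have Y0: "Y 0 = (\<lambda>_. 0)" and YS: "Y (Suc n) = Phi T u (Y n)" for n by (simp_all add: Y_def)
  have Ym[measurable]: "Y n \<in> borel_measurable borel" for n
  proof (induction n)
    case 0 then show ?case by (simp add: Y0)
  next
    case (Suc n) from this[measurable] show ?case unfolding YS by measurable
  qed
  have Yn: "nx bb (Y n) \<le> ennreal r" for n
  proof (induction n)
    case 0 then show ?case by (simp add: Y0 nx_def)
  next
    case (Suc n)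
    have "nx bb (Y (Suc n)) \<le> 2 * (nx bb (Lin u) + nx bb (Duh T (Nl (Y n) (Y n))))"
      unfolding YS Phi_def[abs_def] by (rule nx_add) measurable
    also have "\<dots> \<le> 2 * (ennreal (r/4) + ennreal (r/1024))"
    proof (intro mult_left_mono add_mono L)
      have "nx bb (Duh T (Nl (Y n) (Y n))) \<le> A * (nx bb (Y n) * nx bb (Y n))" by (rule A) measurable
      also have "\<dots> \<le> A * (ennreal r * ennreal r)" by (intro mult_left_mono mult_mono Suc) auto
      also have "\<dots> = A * ennreal r * ennreal r" by (simp only: ac_simps)
      also have "\<dots> \<le> ennreal (1/1024) * ennreal r" by (rule mult_right_mono[OF AR]) simp
      also have "\<dots> = ennreal (r/1024)" using r by (subst ennreal_mult[symmetric]) auto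
      finally show "nx bb (Duh T (Nl (Y n) (Y n))) \<le> ennreal (r/1024)" .
    qed auto
    also have "\<dots> = ennreal 2 * ennreal (r/4 + r/1024)" using r by (subst ennreal_plus) auto
    also have "\<dots> = ennreal (2 * (r/4 + r/1024))" using r by (subst ennreal_mult[symmetric]) auto
    also have "\<dots> \<le> ennreal r" using r by (intro ennreal_leI) simp
    finally show ?case .
  qed
  have Yn8: "nx bb (Y n) \<le> ennreal (8 * r)" for n by (rule order_trans[OF Yn ennreal_leI]) (use r in simp)
  define d where "d n z = Y (Suc n) z - Y n z" for n z
  have dm[measurable]: "d n \<in> borel_measurable borel" for n unfolding d_def[abs_def] by measurable
  have dn: "nx bb (d n) \<le> ennreal ((1/16) ^ n * r)" for n
  proof (induction n)
    case 0
    have "d 0 = Y 1" by (simp add: d_def Y0 fun_eq_iff)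
    then show ?case using Yn[of 1] by simp
  next
    case (Suc n)
    have "d (Suc n) = (\<lambda>z. Duh T (Nl (Y (Suc n)) (Y (Suc n))) z - Duh T (Nl (Y n) (Y n)) z)"
      unfolding d_def[abs_def] YS[of "Suc n"] fun_eq_iff Phi_def[of T u "Y (Suc n)"] by (simp add: YS[of n] Phi_def[of T u "Y n"])
    then have "nx bb (d (Suc n)) \<le> ennreal (1/32) * nx bb (\<lambda>z. Y (Suc n) z - Y n z)"
      by (simp only:) (rule Phi_diff[OF T A AR r _ _ Yn8 Yn8], auto)
    also have "\<dots> \<le> ennreal (1/32) * ennreal ((1/16) ^ n * r)" using Suc unfolding d_def by (intro mult_left_mono) auto
    also have "\<dots> = ennreal (1/32 * ((1/16) ^ n * r))" using r by (subst ennreal_mult[symmetric]) auto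
    also have "\<dots> \<le> ennreal ((1/16) ^ Suc n * r)" using r by (intro ennreal_leI) (simp add: field_simps)
    finally show ?case .
  qed
  obtain G where [measurable]: "G \<in> borel_measurable borel" and Gn: "\<And>n. nx bb (\<lambda>z. G z - (\<Sum>k<n. d k z)) \<le> ennreal ((1/4) ^ n * (8 * r))"
    by (rule X_series[OF dm dn r]) blast
  have sd: "(\<Sum>k<n. d k z) = Y n z" for n z
    by (induction n) (simp_all add: d_def Y0)
  have Gn': "nx bb (\<lambda>z. G z - Y n z) \<le> ennreal ((1/4) ^ n) * ennreal (8 * r)" for n
    using Gn[of n] r unfolding sd by (subst ennreal_mult[symmetric]) auto
  have G8: "nx bb G \<le> ennreal (8 * r)" using Gn[of 0] by simp
  \<comment> \<open>Both \<open>G\<close> and its image are compared with \<open>Y (Suc n)\<close>;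
    the defect is a fixed multiple of \<open>(1/4) ^ n\<close> for every \<open>n\<close>.\<close>
  have "nx bb (\<lambda>z. G z - Phi T u G z) = 0"
  proof (rule ennreal_le_geometric_imp_zero)
    fix n
    have "nx bb (\<lambda>z. G z - Phi T u G z) = nx bb (\<lambda>z. (G z - Y (Suc n) z) - (Duh T (Nl G G) z - Duh T (Nl (Y n) (Y n)) z))"
      by (rule arg_cong[where f="nx bb"]) (simp add: fun_eq_iff YS[of n] Phi_def[of T u])
    also have "\<dots> \<le> 2 * (nx bb (\<lambda>z. G z - Y (Suc n) z) + nx bb (\<lambda>z. Duh T (Nl G G) z - Duh T (Nl (Y n) (Y n)) z))"
      by (rule nx_diff) measurable
    also have "\<dots> \<le> 2 * (ennreal ((1/4) ^ n) * ennreal (8 * r) + ennreal ((1/4) ^ n) * ennreal (8 * r))"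
    proof (intro mult_left_mono add_mono)
      show "nx bb (\<lambda>z. G z - Y (Suc n) z) \<le> ennreal ((1/4) ^ n) * ennreal (8 * r)"
        by (rule order_trans[OF Gn' mult_right_mono[OF ennreal_leI]]) auto
      have "nx bb (\<lambda>z. Duh T (Nl G G) z - Duh T (Nl (Y n) (Y n)) z) \<le> ennreal (1/32) * nx bb (\<lambda>z. G z - Y n z)"
        by (rule Phi_diff[OF T A AR r _ _ G8 Yn8]) auto
      also have "\<dots> \<le> 1 * nx bb (\<lambda>z. G z - Y n z)" by (intro mult_right_mono) auto
      finally show "nx bb (\<lambda>z. Duh T (Nl G G) z - Duh T (Nl (Y n) (Y n)) z) \<le> ennreal ((1/4) ^ n) * ennreal (8 * r)"
        using Gn'[of n] by simp
    qed auto
    also have "\<dots> = ennreal ((1/4) ^ n) * (2 * (ennreal (8 * r) + ennreal (8 * r)))"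
      by (simp only: distrib_left mult.left_commute)
    finally show "nx bb (\<lambda>z. G z - Phi T u G z) \<le> ennreal ((1/4) ^ n) * (2 * (ennreal (8 * r) + ennreal (8 * r)))" .
  next
    have "ennreal (8 * r) + ennreal (8 * r) < \<top>" by simp
    then show "2 * (ennreal (8 * r) + ennreal (8 * r)) < \<top>" by (intro ennreal_mult_less_top[THEN iffD2]) simp
  qed
  then have "AE z in lborel. G z - Phi T u G z = 0" by (rule nx_zero_AE[rotated]) measurable
  then have "AE z in lborel. G z = Phi T u G z" by eventually_elim simp
  with \<open>G \<in> borel_measurable borel\<close> G8 show ?thesis by (rule that)
qed

end

section \<open>Existence, uniqueness and continuous dependence\<close>

context kp_params
begin

lemma inX_iff: "inX s1 s2 b G \<longleftrightarrow> G \<in> borel_measurable borel \<and> nx b G < \<top>"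
proof -
  have "integrable lborel (\<lambda>z. (xweight s1 s2 b z)\<^sup>2 * (cmod (G z))\<^sup>2) \<longleftrightarrow> nx b G < \<top>" if [measurable]: "G \<in> borel_measurable borel"
    unfolding integrable_iff_bounded nx_def by (simp add: abs_mult)
  then show ?thesis unfolding inX_def by auto
qed

lemma nx_eq_xnorm:
  assumes "inX s1 s2 b G"
  shows "nx b G = ennreal ((xnorm s1 s2 b G)\<^sup>2)"
proof -
  have "nx b G = ennreal (\<integral>z. (xweight s1 s2 b z)\<^sup>2 * (cmod (G z))\<^sup>2 \<partial>lborel)"
    unfolding nx_def by (rule nn_integral_eq_integral) (use assms in \<open>auto simp: inX_def\<close>)
  then show ?thesis unfolding xnorm_def by simp
qed

lemma nh_eq_hnorm:
  assumes "inH s1 s2 u"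
  shows "nh u = ennreal ((hnorm s1 s2 u)\<^sup>2)"
proof -
  have "nh u = ennreal (\<integral>z. (hweight s1 s2 z)\<^sup>2 * (cmod (u z))\<^sup>2 \<partial>lborel)"
    unfolding nh_def by (rule nn_integral_eq_integral) (use assms in \<open>auto simp: inH_def\<close>)
  then show ?thesis unfolding hnorm_def by simp
qed

lemma hnorm_nonneg: "0 \<le> hnorm s1 s2 u"
  unfolding hnorm_def by simp

lemma xnorm_nonneg: "0 \<le> xnorm s1 s2 b u"
  unfolding xnorm_def by simp

lemma nh_add:
  assumes [measurable]: "u \<in> borel_measurable borel" "v \<in> borel_measurable borel"
  shows "nh (\<lambda>p. u p + v p) \<le> 2 * (nh u + nh v)"
proof -
  have "nh (\<lambda>p. u p + v p) \<le> (\<integral>\<^sup>+p. 2 * (ennreal ((hweight s1 s2 p)\<^sup>2 * (cmod (u p))\<^sup>2) + ennreal ((hweight s1 s2 p)\<^sup>2 * (cmod (v p))\<^sup>2)) \<partial>lborel)"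
    unfolding nh_def
  proof (rule nn_integral_mono)
    fix p
    have "(cmod (u p + v p))\<^sup>2 \<le> (cmod (u p) + cmod (v p))\<^sup>2" by (rule power_mono[OF norm_triangle_ineq]) simp
    also have "\<dots> \<le> 2 * ((cmod (u p))\<^sup>2 + (cmod (v p))\<^sup>2)" using sum_squares_bound[of "cmod (u p)" "cmod (v p)"] by (simp add: power2_sum)
    finally have "(hweight s1 s2 p)\<^sup>2 * (cmod (u p + v p))\<^sup>2 \<le> (hweight s1 s2 p)\<^sup>2 * (2 * ((cmod (u p))\<^sup>2 + (cmod (v p))\<^sup>2))"
      by (rule mult_left_mono) simp
    then have "ennreal ((hweight s1 s2 p)\<^sup>2 * (cmod (u p + v p))\<^sup>2) \<le> ennreal (2 * ((hweight s1 s2 p)\<^sup>2 * (cmod (u p))\<^sup>2 + (hweight s1 s2 p)\<^sup>2 * (cmod (v p))\<^sup>2))"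
      by (intro ennreal_leI) (simp add: algebra_simps)
    also have "\<dots> = ennreal 2 * (ennreal ((hweight s1 s2 p)\<^sup>2 * (cmod (u p))\<^sup>2) + ennreal ((hweight s1 s2 p)\<^sup>2 * (cmod (v p))\<^sup>2))"
      by (subst ennreal_mult, simp, simp, subst ennreal_plus) auto
    finally show "ennreal ((hweight s1 s2 p)\<^sup>2 * (cmod (u p + v p))\<^sup>2) \<le> 2 * (ennreal ((hweight s1 s2 p)\<^sup>2 * (cmod (u p))\<^sup>2) + ennreal ((hweight s1 s2 p)\<^sup>2 * (cmod (v p))\<^sup>2))"
      by simp
  qed
  also have "\<dots> = 2 * (nh u + nh v)"
    unfolding nh_def by (subst nn_integral_cmult, measurable) (subst nn_integral_add, auto)
  finally show ?thesis .
qed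

text \<open>At times in \<open>[0,T]\<close> the cut-offs in \<open>Lin\<close> and
  \<open>Duh\<close> equal 1, so the fixed point equation in frequency space becomes the integral
  equation there.\<close>

lemma fixpoint_duhamel_sol:
  assumes T: "0 < T" "T \<le> 1" and [measurable]: "u \<in> borel_measurable borel" "G \<in> borel_measurable borel"
    and f: "nx bb G < \<top>" "nx bb (Lin u) < \<top>" and e: "AE z in lborel. G z = Phi T u G z"
    and D: "nx bb (Duh T (Nl G G)) < \<top>"
  shows "duhamel_sol s1 s2 bb T u G"
  unfolding duhamel_sol_def nonlin_eq
proof (intro conjI ballI)
  show "inX s1 s2 bb G" using f by (simp add: inX_iff)
  show "AE z in lborel. integrable lborel (\<lambda>w. G w * G (z - w))"
    using absbil_finite_AE[of G G] f by (simp add: integrable_bil_iff)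
  fix t assume t: "t \<in> {0..T}"
  have N: "nx bp (Nl G G) < \<top>" by (rule nx_Nl_finite) (use f in auto)
  have "AE p in lborel. slice 1 (\<lambda>z. ennreal (cmod (Nl G G z))) p < \<top>" by (rule slice_bp_AE) (use N in auto)
  moreover have "AE p in lborel. time_repr G p t = time_repr (Phi T u G) p t" by (rule time_repr_cong_AE) (use e in auto)
  moreover have "AE p in lborel. time_repr (Phi T u G) p t = time_repr (Lin u) p t + time_repr (Duh T (Nl G G)) p t"
    unfolding Phi_def[abs_def] by (rule time_repr_lincomb_AE(2)) (use f D in auto)
  moreover have "AE p in lborel. time_repr (Duh T (Nl G G)) p t = Ds (Nl G G) p t"
    by (rule time_repr_Duh_AE) (use N T t in auto)
  ultimately show "AE p in lborel. integrable lborel (\<lambda>\<tau>. Nl G G (p, \<tau>) * tker t (\<tau> + phase p)) \<and>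
        time_repr G p t = exp (- \<i> * complex_of_real (t * phase p)) *
          (u p - (1/2) * integral\<^sup>L lborel (\<lambda>\<tau>. Nl G G (p, \<tau>) * tker t (\<tau> + phase p)) / complex_of_real (2 * pi))"
  proof eventually_elim
    case (elim p)
    have "time_repr (Lin u) p t = exp (- \<i> * complex_of_real (t * phase p)) * u p"
      by (rule time_repr_Lin) (use t T in auto)
    then have "time_repr G p t = exp (- \<i> * complex_of_real (t * phase p)) * u p + Ds (Nl G G) p t" using elim by simp
    also have "\<dots> = exp (- \<i> * complex_of_real (t * phase p)) *
          (u p - (1/2) * integral\<^sup>L lborel (\<lambda>\<tau>. Nl G G (p, \<tau>) * tker t (\<tau> + phase p)) / complex_of_real (2 * pi))"
      unfolding Ds_def Jt_def by (simp add: right_diff_distrib)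
    finally show ?case using integrable_tker[OF _ elim(1)] by simp
  qed
qed

text \<open>For \<open>V = G + H\<close> and \<open>W = G - H\<close> the data cancel and the
  quadratic terms combine to \<open>Nl V W\<close>, the situation of \<open>uniq_global\<close>.
  Neither solution has to come from the iteration.\<close>

lemma duhamel_sol_unique:
  assumes G: "duhamel_sol s1 s2 bb T u G" and H: "duhamel_sol s1 s2 bb T u H"
  shows "same_on T G H"
  unfolding same_on_def
proof
  fix t assume t: "t \<in> {0..T}"
  have m[measurable]: "G \<in> borel_measurable borel" "H \<in> borel_measurable borel" and f: "nx bb G < \<top>" "nx bb H < \<top>"
    using G H by (simp_all add: duhamel_sol_def inX_iff)
  let ?V = "\<lambda>z. G z + H z" and ?W = "\<lambda>z. G z - H z"
  have fV: "nx bb ?V < \<top>" by (rule le_less_trans[OF nx_add]) (use f in \<open>auto simp: ennreal_mult_less_top\<close>)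
  have fW: "nx bb ?W < \<top>" by (rule le_less_trans[OF nx_diff]) (use f in \<open>auto simp: ennreal_mult_less_top\<close>)
  have "AE p in lborel. time_repr ?W p t = 0"
  proof (rule uniq_global[of ?V ?W T, OF _ _ fV fW _ t])
    fix s assume s: "s \<in> {0..T}"
    have "AE p in lborel. time_repr G p s = exp (- \<i> * complex_of_real (s * phase p)) * (u p - (1/2) * Jt (Nl G G) p s / complex_of_real (2 * pi))"
      using G s unfolding duhamel_sol_def nonlin_eq Jt_def[symmetric] by auto
    moreover have "AE p in lborel. time_repr H p s = exp (- \<i> * complex_of_real (s * phase p)) * (u p - (1/2) * Jt (Nl H H) p s / complex_of_real (2 * pi))"
      using H s unfolding duhamel_sol_def nonlin_eq Jt_def[symmetric] by auto
    moreover have "AE p in lborel. time_repr ?W p s = time_repr G p s - time_repr H p s"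
      by (rule time_repr_lincomb_AE(1)) (use f in auto)
    moreover have "AE p in lborel. Jt (Nl ?V ?W) p s = Jt (\<lambda>z. Nl G G z - Nl H H z) p s"
      by (rule Jt_cong_AE) (use Nl_square_diff_AE[of G H] f in auto)
    moreover have "AE p in lborel. Jt (\<lambda>z. Nl G G z - Nl H H z) p s = Jt (Nl G G) p s - Jt (Nl H H) p s"
      by (rule Jt_diff_AE) (use f in \<open>auto intro!: nx_Nl_finite\<close>)
    ultimately show "AE p in lborel. time_repr ?W p s = Ds (Nl ?V ?W) p s"
    proof eventually_elim
      case (elim p)
      have E: "e * (v - (1/2) * a / c) - e * (v - (1/2) * b / c) = e * (- (1/2) * (a - b) / c)" for e v a b c :: complex
        by (simp add: algebra_simps diff_divide_distrib)
      show ?case unfolding elim(3) elim(1) elim(2) Ds_def elim(4) elim(5) by (rule E)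
    qed
  qed measurable
  moreover have "AE p in lborel. time_repr ?W p t = time_repr G p t - time_repr H p t"
    by (rule time_repr_lincomb_AE(1)) (use f in auto)
  ultimately show "AE p in lborel. time_repr G p t = time_repr H p t" by eventually_elim simp
qed

lemma restr_norm_le:
  assumes "inX s1 s2 b K" "same_on T K G"
  shows "restr_norm s1 s2 b T G \<le> xnorm s1 s2 b K"
  unfolding restr_norm_def
  by (rule cInf_lower) (use assms in \<open>auto intro!: bdd_belowI[of _ 0] xnorm_nonneg\<close>)

lemma well_posed:
  "\<exists>Tf :: real \<Rightarrow> real. (\<forall>r. Tf r > 0) \<and>
      (\<forall>u0. admissible s1 s2 u0 \<longrightarrow>
        (let T = Tf (hnorm s1 s2 u0) in
          (\<exists>G. duhamel_sol s1 s2 bb T u0 G) \<and>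
          (\<forall>G1 G2. duhamel_sol s1 s2 bb T u0 G1 \<and> duhamel_sol s1 s2 bb T u0 G2
              \<longrightarrow> same_on T G1 G2) \<and>
          (\<forall>G. duhamel_sol s1 s2 bb T u0 G \<longrightarrow>
             (\<forall>e>0. \<exists>\<delta>>0. \<forall>v0. admissible s1 s2 v0 \<and> hnorm s1 s2 (\<lambda>p. v0 p - u0 p) < \<delta>
                \<longrightarrow> (\<exists>H. duhamel_sol s1 s2 bb T v0 H \<and>
                         restr_norm s1 s2 bb T (\<lambda>z. G z - H z) < e)))))"
proof -
  obtain K where K: "K < \<top>" "\<And>T V W. 0 < T \<Longrightarrow> T \<le> 1 \<Longrightarrow> V \<in> borel_measurable borel \<Longrightarrow> W \<in> borel_measurable borel \<Longrightarrow>
    nx bb (Duh T (Nl V W)) \<le> K * ennreal (T powr (2 * \<epsilon>)) * (nx bb V * nx bb W)" by (rule op_estimate) blast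
  obtain C where C: "C < \<top>" "\<And>u. u \<in> borel_measurable borel \<Longrightarrow> nx bb (Lin u) \<le> C * nh u" by (rule Lin_estimate) blast
  obtain c where c: "0 \<le> c" "C = ennreal c" using C(1) by (cases C) auto
  \<comment> \<open>Room for neighbouring data: if \<open>v0\<close> is within distance 1 of data of
    norm \<open>r\<close>, then \<open>nh v0 \<le> 2 * r\<^sup>2 + 2\<close>, so one time serves all
    of them. The factor 4 matches the bound on \<open>Lin\<close> in \<open>picard\<close>.\<close>
  define R where "R r = 4 * c * (2 * r\<^sup>2 + 2)" for r :: real
  have R0: "0 \<le> R r" for r using c by (simp add: R_def)
  have "\<exists>T. 0 < T \<and> T \<le> 1 \<and> K * ennreal (R r) * ennreal (T powr (2 * \<epsilon>)) \<le> ennreal (1/1024)" for r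
  proof -
    have "K * ennreal (R r) < \<top>" using K(1) by (simp add: ennreal_mult_less_top)
    then obtain \<delta> where "0 < \<delta>" "\<delta> \<le> 1" "\<And>d. 0 < d \<Longrightarrow> d \<le> \<delta> \<Longrightarrow> K * ennreal (R r) * ennreal (d powr (2 * \<epsilon>)) \<le> ennreal (1/1024)"
      by (rule small_time[of _ "1/1024"]) auto
    then show ?thesis by blast
  qed
  then obtain Tf where Tf: "\<And>r. 0 < Tf r" "\<And>r. Tf r \<le> 1" "\<And>r. K * ennreal (R r) * ennreal (Tf r powr (2 * \<epsilon>)) \<le> ennreal (1/1024)"
    by metis
  show ?thesis
  proof (intro exI[of _ Tf] conjI allI impI, rule Tf(1))
    fix u0 assume u0: "admissible s1 s2 u0"
    define r where "r = hnorm s1 s2 u0"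
    define T where "T = Tf r"
    define A where "A = K * ennreal (T powr (2 * \<epsilon>))"
    have T: "0 < T" "T \<le> 1" using Tf by (auto simp: T_def)
    have uH: "inH s1 s2 u0" using u0 by (simp add: admissible_def)
    have um[measurable]: "u0 \<in> borel_measurable borel" using uH by (simp add: inH_def)
    have A: "nx bb (Duh T (Nl V W)) \<le> A * (nx bb V * nx bb W)" if "V \<in> borel_measurable borel" "W \<in> borel_measurable borel" for V W
      unfolding A_def by (rule K(2)[OF T that])
    have AR: "A * ennreal (R r) \<le> ennreal (1/1024)" using Tf(3)[of r] unfolding A_def T_def by (simp only: ac_simps)
    have Af: "A < \<top>" unfolding A_def using K(1) by (simp add: ennreal_mult_less_top)
    have ex: "\<exists>G. G \<in> borel_measurable borel \<and> nx bb G \<le> ennreal (8 * R r) \<and> (AE z in lborel. G z = Phi T v G z) \<and> duhamel_sol s1 s2 bb T v G"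
      if vm'[measurable]: "v \<in> borel_measurable borel" and v: "nh v \<le> ennreal (2 * r\<^sup>2 + 2)" for v
    proof -
      have "nx bb (Lin v) \<le> C * nh v" by (rule C(2)) measurable
      also have "\<dots> \<le> ennreal c * ennreal (2 * r\<^sup>2 + 2)" unfolding c(2) by (rule mult_left_mono[OF v]) simp
      also have "\<dots> = ennreal (R r / 4)" using c by (subst ennreal_mult[symmetric]) (auto simp: R_def)
      finally have L: "nx bb (Lin v) \<le> ennreal (R r / 4)" .
      obtain G where G: "G \<in> borel_measurable borel" "nx bb G \<le> ennreal (8 * R r)" "AE z in lborel. G z = Phi T v G z"
        by (rule picard[OF T A AR R0 vm' L]) auto
      have f: "nx bb G < \<top>" "nx bb (Lin v) < \<top>" using G(2) L ennreal_less_top le_less_trans by blast+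
      have "nx bb (Duh T (Nl G G)) < \<top>" by (rule le_less_trans[OF A[OF G(1) G(1)]]) (use Af f in \<open>simp add: ennreal_mult_less_top\<close>)
      from fixpoint_duhamel_sol[OF T vm' G(1) f G(3) this] G show ?thesis by blast
    qed
    have nu: "nh u0 = ennreal (r\<^sup>2)" unfolding r_def by (rule nh_eq_hnorm[OF uH])
    obtain G0 where G0m[measurable]: "G0 \<in> borel_measurable borel" and G0: "nx bb G0 \<le> ennreal (8 * R r)" "AE z in lborel. G0 z = Phi T u0 G0 z" "duhamel_sol s1 s2 bb T u0 G0"
    proof -
      have "nh u0 \<le> ennreal (2 * r\<^sup>2 + 2)" unfolding nu by (rule ennreal_leI) (simp add: add_increasing2)
      from ex[OF um this] show ?thesis using that by blast
    qed
    have dep: "\<exists>\<delta>>0. \<forall>v0. admissible s1 s2 v0 \<and> hnorm s1 s2 (\<lambda>p. v0 p - u0 p) < \<delta>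
                \<longrightarrow> (\<exists>H. duhamel_sol s1 s2 bb T v0 H \<and> restr_norm s1 s2 bb T (\<lambda>z. G z - H z) < e)"
      if G: "duhamel_sol s1 s2 bb T u0 G" and e: "0 < e" for G e
    proof -
      \<comment> \<open>\<open>x \<le> 2 * (x/32 + c * y)\<close> implies
        \<open>x \<le> 4 * (c * y)\<close>; adding 1 to \<open>c\<close> keeps \<open>q\<close>
        positive when \<open>c = 0\<close>.\<close>
      define q where "q = 4 * (c + 1)"
      have q: "0 < q" using c by (simp add: q_def)
      show ?thesis
      proof (rule exI[of _ "min 1 (e / sqrt q)"], intro conjI allI impI)
        show "0 < min 1 (e / sqrt q)" using e q by simp
        fix v0 assume "admissible s1 s2 v0 \<and> hnorm s1 s2 (\<lambda>p. v0 p - u0 p) < min 1 (e / sqrt q)"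
        then have vH: "inH s1 s2 v0" and hd: "hnorm s1 s2 (\<lambda>p. v0 p - u0 p) < 1" "hnorm s1 s2 (\<lambda>p. v0 p - u0 p) < e / sqrt q"
          by (auto simp: admissible_def)
        have vm[measurable]: "v0 \<in> borel_measurable borel" using vH by (simp add: inH_def)
        define y where "y = (hnorm s1 s2 (\<lambda>p. v0 p - u0 p))\<^sup>2"
        have y0: "0 \<le> y" by (simp add: y_def)
        have y1: "y \<le> 1" unfolding y_def using hd(1) hnorm_nonneg by (intro power_le_one) auto
        have ye: "q * y < e\<^sup>2"
        proof -
          have "y < (e / sqrt q)\<^sup>2" unfolding y_def by (rule power_strict_mono[OF hd(2)]) (auto simp: hnorm_nonneg)
          also have "\<dots> = e\<^sup>2 / q" using q by (simp add: power_divide)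
          finally show ?thesis using q by (simp add: field_simps)
        qed
        have ndf: "nh (\<lambda>p. v0 p - u0 p) < \<top>"
        proof -
          have "nh (\<lambda>p. v0 p + (- u0 p)) \<le> 2 * (nh v0 + nh (\<lambda>p. - u0 p))" by (rule nh_add) measurable
          also have "\<dots> < \<top>" using nh_eq_hnorm[OF vH] nu by (simp add: nh_def ennreal_mult_less_top)
          finally show ?thesis by simp
        qed
        have dH: "inH s1 s2 (\<lambda>p. v0 p - u0 p)"
          using ndf unfolding inH_def integrable_iff_bounded nh_def by (simp add: abs_mult)
        have nd: "nh (\<lambda>p. v0 p - u0 p) = ennreal y" unfolding y_def by (rule nh_eq_hnorm[OF dH])
        have "nh v0 = nh (\<lambda>p. u0 p + (v0 p - u0 p))" by simp
        also have "\<dots> \<le> 2 * (nh u0 + nh (\<lambda>p. v0 p - u0 p))" by (rule nh_add) measurable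
        also have "\<dots> = ennreal 2 * ennreal (r\<^sup>2 + y)" unfolding nu nd using y0 by (subst ennreal_plus) auto
        also have "\<dots> = ennreal (2 * (r\<^sup>2 + y))" using y0 by (subst ennreal_mult[symmetric]) auto
        also have "\<dots> \<le> ennreal (2 * r\<^sup>2 + 2)" using y1 by (intro ennreal_leI) simp
        finally obtain H where Hm[measurable]: "H \<in> borel_measurable borel" and H: "nx bb H \<le> ennreal (8 * R r)" "AE z in lborel. H z = Phi T v0 H z" "duhamel_sol s1 s2 bb T v0 H"
          using ex[OF vm] by auto
        let ?D = "\<lambda>z. G0 z - H z"
        have f: "nx bb G0 < \<top>" "nx bb H < \<top>" using G0(1) H(1) ennreal_less_top le_less_trans by blast+
        have Df: "nx bb ?D < \<top>" by (rule le_less_trans[OF nx_diff]) (use f in \<open>auto simp: ennreal_mult_less_top\<close>)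
        then have DX: "inX s1 s2 bb ?D" by (simp add: inX_iff)
        define x where "x = (xnorm s1 s2 bb ?D)\<^sup>2"
        have nD: "nx bb ?D = ennreal x" unfolding x_def by (rule nx_eq_xnorm[OF DX])
        have x0: "0 \<le> x" by (simp add: x_def)
        have "AE z in lborel. ?D z = (Duh T (Nl G0 G0) z - Duh T (Nl H H) z) - Lin (\<lambda>p. v0 p - u0 p) z"
          using G0(2) H(2)
        proof eventually_elim
          case (elim z)
          have "Lin (\<lambda>p. v0 p - u0 p) z = Lin v0 z - Lin u0 z" by (simp add: Lin_def left_diff_distrib)
          moreover have "G0 z - H z = Phi T u0 G0 z - Phi T v0 H z" using elim by simp
          ultimately show ?case by (simp add: Phi_def)
        qed
        then have "nx bb ?D = nx bb (\<lambda>z. (Duh T (Nl G0 G0) z - Duh T (Nl H H) z) - Lin (\<lambda>p. v0 p - u0 p) z)" by (rule nx_cong_AE)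
        also have "\<dots> \<le> 2 * (nx bb (\<lambda>z. Duh T (Nl G0 G0) z - Duh T (Nl H H) z) + nx bb (Lin (\<lambda>p. v0 p - u0 p)))"
          by (rule nx_diff) measurable
        also have "\<dots> \<le> 2 * (ennreal (x/32) + ennreal (c * y))"
        proof (intro mult_left_mono add_mono)
          have "nx bb (\<lambda>z. Duh T (Nl G0 G0) z - Duh T (Nl H H) z) \<le> ennreal (1/32) * nx bb ?D"
            by (rule Phi_diff[OF T A AR R0 G0m Hm G0(1) H(1)])
          also have "\<dots> = ennreal (x/32)" unfolding nD using x0 by (subst ennreal_mult[symmetric]) auto
          finally show "nx bb (\<lambda>z. Duh T (Nl G0 G0) z - Duh T (Nl H H) z) \<le> ennreal (x/32)" .
          have "nx bb (Lin (\<lambda>p. v0 p - u0 p)) \<le> C * nh (\<lambda>p. v0 p - u0 p)" by (rule C(2)) measurable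
          also have "\<dots> = ennreal (c * y)" unfolding nd c(2) using c y0 by (simp add: ennreal_mult)
          finally show "nx bb (Lin (\<lambda>p. v0 p - u0 p)) \<le> ennreal (c * y)" .
        qed auto
        also have "\<dots> = ennreal 2 * ennreal (x/32 + c * y)" using x0 c y0 by (subst ennreal_plus) auto
        also have "\<dots> = ennreal (2 * (x/32 + c * y))" using x0 c y0 by (subst ennreal_mult[symmetric]) auto
        finally have "x \<le> 2 * (x/32 + c * y)" unfolding nD by (rule ennreal_le_iff[THEN iffD1, rotated]) (use x0 c y0 in simp)
        moreover have "4 * (c * y) \<le> q * y" using y0 unfolding q_def by (simp add: algebra_simps)
        moreover have "0 \<le> c * y" using c y0 by simp
        moreover have "x \<le> 2 * (x/32 + a) \<Longrightarrow> 4 * a \<le> m \<Longrightarrow> 0 \<le> a \<Longrightarrow> x \<le> m" for a m :: real by (simp add: field_simps)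
        ultimately have "x \<le> q * y" by blast
        then have "x < e\<^sup>2" using ye by simp
        then have xe: "xnorm s1 s2 bb ?D < e" unfolding x_def using e by (metis power2_less_imp_less less_imp_le)
        \<comment> \<open>\<open>G\<close> need not be the fixed point \<open>G0\<close>, but by
          uniqueness they agree on \<open>[0,T]\<close>, so \<open>G0 - H\<close> is one of the
          extensions over which \<open>restr_norm\<close> takes the infimum.\<close>
        have "same_on T ?D (\<lambda>z. G z - H z)"
          unfolding same_on_def
        proof
          fix t assume t: "t \<in> {0..T}"
          have Gm[measurable]: "G \<in> borel_measurable borel" and fG: "nx bb G < \<top>" using G by (simp_all add: duhamel_sol_def inX_iff)
          have "AE p in lborel. time_repr ?D p t = time_repr G0 p t - time_repr H p t"
            by (rule time_repr_lincomb_AE(1)) (use f in auto)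
          moreover have "AE p in lborel. time_repr (\<lambda>z. G z - H z) p t = time_repr G p t - time_repr H p t"
            by (rule time_repr_lincomb_AE(1)) (use f fG in auto)
          moreover have "AE p in lborel. time_repr G0 p t = time_repr G p t"
            using duhamel_sol_unique[OF G0(3) G] t by (auto simp: same_on_def)
          ultimately show "AE p in lborel. time_repr ?D p t = time_repr (\<lambda>z. G z - H z) p t" by eventually_elim simp
        qed
        from restr_norm_le[OF DX this] xe have "restr_norm s1 s2 bb T (\<lambda>z. G z - H z) < e" by simp
        with H(3) show "\<exists>H. duhamel_sol s1 s2 bb T v0 H \<and> restr_norm s1 s2 bb T (\<lambda>z. G z - H z) < e" by blast
      qed
    qed
    show "let T = Tf (hnorm s1 s2 u0) in
          (\<exists>G. duhamel_sol s1 s2 bb T u0 G) \<and>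
          (\<forall>G1 G2. duhamel_sol s1 s2 bb T u0 G1 \<and> duhamel_sol s1 s2 bb T u0 G2 \<longrightarrow> same_on T G1 G2) \<and>
          (\<forall>G. duhamel_sol s1 s2 bb T u0 G \<longrightarrow>
             (\<forall>e>0. \<exists>\<delta>>0. \<forall>v0. admissible s1 s2 v0 \<and> hnorm s1 s2 (\<lambda>p. v0 p - u0 p) < \<delta>
                \<longrightarrow> (\<exists>H. duhamel_sol s1 s2 bb T v0 H \<and> restr_norm s1 s2 bb T (\<lambda>z. G z - H z) < e)))"
      unfolding Let_def r_def[symmetric] T_def[symmetric]
      using G0(3) duhamel_sol_unique dep by blast
  qed
qed

end

theorem theorem1p1:
  fixes s1 s2 :: real
  assumes "s1 > - 9 / 8" and "s2 \<ge> 0"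
  shows "\<exists>\<epsilon>0>0. \<forall>\<epsilon>. 0 < \<epsilon> \<and> \<epsilon> < \<epsilon>0 \<longrightarrow>
    (\<exists>Tf :: real \<Rightarrow> real. (\<forall>r. Tf r > 0) \<and>
      (\<forall>u0. admissible s1 s2 u0 \<longrightarrow>
        (let T = Tf (hnorm s1 s2 u0); b = 1/2 + \<epsilon> in
          (\<exists>G. duhamel_sol s1 s2 b T u0 G) \<and>
          (\<forall>G1 G2. duhamel_sol s1 s2 b T u0 G1 \<and> duhamel_sol s1 s2 b T u0 G2
              \<longrightarrow> same_on T G1 G2) \<and>
          (\<forall>G. duhamel_sol s1 s2 b T u0 G \<longrightarrow>
             (\<forall>e>0. \<exists>\<delta>>0. \<forall>v0. admissible s1 s2 v0 \<and> hnorm s1 s2 (\<lambda>p. v0 p - u0 p) < \<delta>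
                \<longrightarrow> (\<exists>H. duhamel_sol s1 s2 b T v0 H \<and>
                         restr_norm s1 s2 b T (\<lambda>z. G z - H z) < e))))))"
\<comment> \<open>The first bound is a sixth of the distance from the regularity to
  \<open>- 9/8\<close>, where regularities above \<open>- 1\<close> count as \<open>- 1\<close>; the
  second is \<open>e64\<close>.\<close>
proof (intro exI[of _ "min ((min s1 (- 1) + 9/8) / 6) (1/64)"] conjI allI impI)
  show "0 < min ((min s1 (- 1) + 9/8) / 6) (1/64)" using assms by auto
  fix \<epsilon> :: real assume "0 < \<epsilon> \<and> \<epsilon> < min ((min s1 (- 1) + 9/8) / 6) (1/64)"
  then interpret kp_params s1 s2 \<epsilon> using assms by unfold_locales auto
  show "\<exists>Tf :: real \<Rightarrow> real. (\<forall>r. Tf r > 0) \<and>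
      (\<forall>u0. admissible s1 s2 u0 \<longrightarrow>
        (let T = Tf (hnorm s1 s2 u0); b = 1/2 + \<epsilon> in
          (\<exists>G. duhamel_sol s1 s2 b T u0 G) \<and>
          (\<forall>G1 G2. duhamel_sol s1 s2 b T u0 G1 \<and> duhamel_sol s1 s2 b T u0 G2
              \<longrightarrow> same_on T G1 G2) \<and>
          (\<forall>G. duhamel_sol s1 s2 b T u0 G \<longrightarrow>
             (\<forall>e>0. \<exists>\<delta>>0. \<forall>v0. admissible s1 s2 v0 \<and> hnorm s1 s2 (\<lambda>p. v0 p - u0 p) < \<delta>
                \<longrightarrow> (\<exists>H. duhamel_sol s1 s2 b T v0 H \<and>
                         restr_norm s1 s2 b T (\<lambda>z. G z - H z) < e)))))"
    using well_posed unfolding Let_def bb_def .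
qed

end
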